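(* Let $(\mathcal C,\circ,I,\bullet,J)$ be a $\bullet$-braided duoidal category. Assume that $\mathcal C$ has, and $\bullet$ preserves, binary intersections. Let $\pi:A\to H$ and $\sigma:H\to A$ be morphisms in $\mathrm{Bimon}(\mathcal C,\circ,\bullet)$ with $\pi\sigma=\mathrm{Id}_H$, where the unit $u_H:I\to H$ is a monomorphism in $\mathcal C$ and $A$ is cocommutative. Then $\pi$ has a kernel $(K,k:K\to A)$, namely the pullback $$\begin{array}{ccc}K&\xrightarrow{\ k\ }&A\\ {\scriptstyle\varepsilon^\circ_K}\downarrow&&\downarrow{\scriptstyle\pi}\\ I&\xrightarrow{\ u_H\ }&H\end{array}$$ in $\mathrm{Bimon}(\mathcal C,\circ,\bullet)$, in the category of cocommutative bimonoids $\mathrm{Bimon}_{\mathrm{coc}}(\mathcal C,\circ,\bullet)$ and in the category $\mathrm{Comon}(\mathcal C^\bullet)$ of comonoids in $(\mathcal C,\bullet,J)$. Assume further that there is a reversion on $(\mathcal C,\circ,I,\bullet,J)$. - If $H$ is a Hopf monoid, then $\varphi:=m_A(k\circ\sigma):K\circ H\to A$ is an isomorphism in $\mathcal C$. - If $A$ is a Hopf monoid, then so is $K$, and $K$ turns out to be the kernel of $\pi$ in the category $\mathrm{Hopf}_{\mathrm{coc}}(\mathcal C,\circ,\bullet)$ of cocommutative Hopf monoids.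
   Context: Conventions: composition is juxtaposition (right to left), an object also denotes its identity morphism, associativity constraints are suppressed. Duoidal category $(\mathcal C,\circ,I,\bullet,J)$: a category with monoidal structures $(\mathcal C,\circ,I)$, $(\mathcal C,\bullet,J)$ (left/right unit constraints $l^\circ,r^\circ$, resp. $l^\bullet,r^\bullet$), a natural transformation $\zeta_{A,B,C,D}:(A\bullet B)\circ(C\bullet D)\to(A\circ C)\bullet(B\circ D)$ and morphisms $\Delta_I:I\to I\bullet I$, $m_J:J\circ J\to J$, $\varepsilon_I=u_J:I\to J$ such that $(J,m_J,u_J)$ is a monoid in $(\mathcal C,\circ,I)$, $(I,\Delta_I,\varepsilon_I)$ is a comonoid in $(\mathcal C,\bullet,J)$, and $\zeta_{A,B,C\circ E,D\circ F}((A\bullet B)\circ\zeta_{C,D,E,F})=\zeta_{A\circ C,B\circ D,E,F}(\zeta_{A,B,C,D}\circ(E\bullet F))$, $((A\circ D)\bullet\zeta_{B,C,E,F})\zeta_{A,B\bullet C,D,E\bullet F}=(\zeta_{A,B,D,E}\bullet(C\circ F))\zeta_{A\bullet B,C,D\bullet E,F}$, $(l^\circ_A\bullet l^\circ_B)\zeta_{I,I,A,B}(\Delta_I\circ(A\bullet B))=l^\circ_{A\bullet B}$, $(r^\circ_A\bullet r^\circ_B)\zeta_{A,B,I,I}((A\bullet B)\circ\Delta_I)=r^\circ_{A\bullet B}$, $l^\bullet_{A\circ B}(m_J\bullet(A\circ B))\zeta_{J,A,J,B}=l^\bullet_A\circ l^\bullet_B$, $r^\bullet_{A\circ B}((A\circ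 B)\bullet m_J)\zeta_{A,J,B,J}=r^\bullet_A\circ r^\bullet_B$. It is $\bullet$-braided if $(\mathcal C,\bullet,J)$ has a braiding, here denoted $\sigma_{X,Y}:X\bullet Y\to Y\bullet X$, with $\sigma_{A\circ C,B\circ D}\zeta_{A,B,C,D}=\zeta_{B,A,D,C}(\sigma_{A,B}\circ\sigma_{C,D})$ and $\sigma_{I,I}\Delta_I=\Delta_I$. A binary intersection is a pullback of two monomorphisms with common codomain; "$\bullet$ preserves binary intersections" means all functors $X\bullet(-)$ and $(-)\bullet X$ do. Bimonoid: $(H,m_H,u_H,\Delta_H,\varepsilon_H)$ with $(H,m_H,u_H)$ a monoid in $(\mathcal C,\circ,I)$, $(H,\Delta_H,\varepsilon_H)$ a comonoid in $(\mathcal C,\bullet,J)$ and $\Delta_Hm_H=(m_H\bullet m_H)\zeta_{H,H,H,H}(\Delta_H\circ\Delta_H)$, $\varepsilon_Hm_H=m_J(\varepsilon_H\circ\varepsilon_H)$, $\Delta_Hu_H=(u_H\bullet u_H)\Delta_I$, $\varepsilon_Hu_H=\varepsilon_I$; morphisms are morphisms of monoids and comonoids. $H$ is cocommutative if $\sigma_{H,H}\Delta_H=\Delta_H$. $\mathrm{Bimon}_{\mathrm{coc}}$ and $\mathrm{Hopf}_{\mathrm{coc}}$ are full subcategories of $\mathrm{Bimon}(\mathcal C,\circ,\bullet)$. The initial object of $\mathrm{Bimon}(\mathcal C,\circ,\bullet)$ is $I$ (with initial morphisms the units $u_H$), and the kernel of a morphism is its pullback along the initial morphism. Reversion: a functor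 $(-)^-:\mathcal C\to\mathcal C$ with lax monoidal structures $(\phi^\circ_{X,Y}:X^-\circ Y^-\to(Y\circ X)^-,\ \phi^\circ_0:I\to I^-)$ from $(\mathcal C,\circ^{\mathrm{rev}})$ to $(\mathcal C,\circ)$ and $(\phi^\bullet_{X,Y}:X^-\bullet Y^-\to(Y\bullet X)^-,\ \phi^\bullet_0:J\to J^-)$ from $(\mathcal C,\bullet^{\mathrm{rev}})$ to $(\mathcal C,\bullet)$ ($\mathrm{rev}$ = reversed tensor product), forming a double lax monoidal functor $(\mathcal C,\circ^{\mathrm{rev}},\bullet^{\mathrm{rev}})\to(\mathcal C,\circ,\bullet)$, i.e. $\phi^\bullet_{C\circ A,D\circ B}(\phi^\circ_{A,C}\bullet\phi^\circ_{B,D})\zeta_{A^-,B^-,C^-,D^-}=(\zeta_{D,C,B,A})^-\phi^\circ_{B\bullet A,D\bullet C}(\phi^\bullet_{A,B}\circ\phi^\bullet_{C,D})$, $\phi^\bullet_{I,I}(\phi^\circ_0\bullet\phi^\circ_0)\Delta_I=(\Delta_I)^-\phi^\circ_0$, $(m_J)^-\phi^\circ_{J,J}(\phi^\bullet_0\circ\phi^\bullet_0)=\phi^\bullet_0m_J$, $\phi^\bullet_0\varepsilon_I=(\varepsilon_I)^-\phi^\circ_0$; together with natural transformations $\gamma_{X,Y,Z,T}:((X\bullet Y^-)\circ Z)\bullet T\to X\circ(Z\bullet(Y\circ T))$, $\delta_{X,Y,Z,T}:X\bullet(Y\circ(Z^-\bullet T))\to((X\circ Z)\bullet Y)\circ T$,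 $\widetilde\gamma_{X,Y,Z,T}:X^-\bullet((Y\bullet Z)\circ T)\to Z\circ((X\circ Y)^-\bullet T)$, $\widetilde\delta_{X,Y,Z,T}:(X\circ(Y\bullet Z))\bullet T^-\to(X\bullet(Z\circ T)^-)\circ Y$. Put $\psi_{X,Y}=\gamma_{J,X,I,Y}(((l^\bullet_{X^-})^{-1}\circ I)\bullet Y)((r^\circ_{X^-})^{-1}\bullet Y):X^-\bullet Y\to J\circ(I\bullet(X\circ Y))$, $\varphi_{X,Y}=\delta_{X,I,Y,J}(X\bullet(I\circ(r^\bullet_{Y^-})^{-1}))(X\bullet(l^\circ_{Y^-})^{-1}):X\bullet Y^-\to((X\circ Y)\bullet I)\circ J$, $\widetilde\psi_{X,Y}=l^\circ_{(X\circ Y)^-}(I\circ r^\bullet_{(X\circ Y)^-})\widetilde\gamma_{X,Y,I,J}:X^-\bullet((Y\bullet I)\circ J)\to(X\circ Y)^-$, $\widetilde\varphi_{X,Y}=r^\circ_{(X\circ Y)^-}(l^\bullet_{(X\circ Y)^-}\circ I)\widetilde\delta_{J,I,X,Y}:(J\circ(I\bullet X))\bullet Y^-\to(X\circ Y)^-$. Axioms, for all objects ($\Delta_J:J\to J\bullet J$ is the inverse unit constraint): (R1) $\gamma_{X,Y,Z\circ U,T\circ V}\zeta_{(X\bullet Y^-)\circ Z,T,U,V}=(X\circ\zeta_{Z,Y\circ T,U,V})(\gamma_{X,Y,Z,T}\circ(U\bullet V))$. (R2) $((X\circ T)\bullet\gamma_{Y,Z,U,V})(\zeta_{X,Y\bullet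 Z^-,T,U}\bullet V)=\zeta_{X,Y,T,U\bullet(Z\circ V)}\gamma_{X\bullet Y,Z,T\bullet U,V}$. (R3) $\delta_{X\circ Z,Y\circ T,U,V}\zeta_{X,Y,Z,T\circ(U^-\bullet V)}=(\zeta_{X,Y,Z\circ U,T}\circ V)((X\bullet Y)\circ\delta_{Z,T,U,V})$. (R4) $(\delta_{X,Y,T,U}\bullet(Z\circ V))(X\bullet\zeta_{Y,Z,T^-\bullet U,V})=\zeta_{(X\circ T)\bullet Y,Z,U,V}\delta_{X,Y\bullet Z,T,U\bullet V}$. (R5) $\delta_{X,Y,T,U\bullet(Z\circ V)}(X\bullet\gamma_{Y,Z,T^-\bullet U,V})=\gamma_{(X\circ T)\bullet Y,Z,U,V}(\delta_{X,Y\bullet Z^-,T,U}\bullet V)$. (R6) $l^\circ_{I\bullet I}(I\circ(I\bullet l^\circ_I))\gamma_{I,I,I,I}(((I\bullet\phi^\circ_0)\Delta_I\circ I)\bullet I)=l^\circ_I\bullet I$. (R7) $r^\circ_{I\bullet I}((r^\circ_I\bullet I)\circ I)\delta_{I,I,I,I}(I\bullet(I\circ(\phi^\circ_0\bullet I)\Delta_I))=I\bullet r^\circ_I$. (R8) $\gamma_{X\circ Z,Y,J\circ J,U}((\delta_{X,Y^-,Z,J}\circ J)\bullet U)(((X\bullet(Y^-\circ(r^\bullet_{Z^-})^{-1}))\circ J)\bullet U)=(X\circ Z\circ\zeta_{J,Y,J,U})(X\circ Z\circ(l^\bullet_Y)^{-1}\circ(l^\bullet_U)^{-1})(X\circ l^\bullet_{Z\circ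 Y\circ U})\gamma_{X,Z\circ Y,J,U}(((X\bullet\phi^\circ_{Y,Z})\circ J)\bullet U)$. (R9) $\delta_{X,J\circ J,Z,Y\circ U}(X\bullet(J\circ\gamma_{J,Y,Z^-,U}))(X\bullet(J\circ(((l^\bullet_{Y^-})^{-1}\circ Z^-)\bullet U)))=(\zeta_{X,J,Z,J}\circ Y\circ U)((r^\bullet_X)^{-1}\circ(r^\bullet_Z)^{-1}\circ Y\circ U)(r^\bullet_{X\circ Z\circ Y}\circ U)\delta_{X,J,Z\circ Y,U}(X\bullet(J\circ(\phi^\circ_{Y,Z}\bullet U)))$. (R10) $\widetilde\varphi_{X\circ Y,Z}(\psi_{X,Y}\bullet Z^-)=\widetilde\psi_{X,Y\circ Z}(X^-\bullet\varphi_{Y,Z})$. (R11) $(r^\circ_X)^-l^\circ_{(X\circ I)^-}(I\circ r^\bullet_{(X\circ I)^-})\widetilde\gamma_{X,I,I,J}(X^-\bullet(\Delta_I\circ J))=r^\bullet_{X^-}(X^-\bullet l^\circ_J)$. (R12) $(l^\circ_X)^-r^\circ_{(I\circ X)^-}(l^\bullet_{(I\circ X)^-}\circ I)\widetilde\delta_{J,I,I,X}((J\circ\Delta_I)\bullet X^-)=l^\bullet_{X^-}(r^\circ_J\bullet X^-)$. (R13) $\gamma_{X,Y,T\bullet(Z\circ U),V}(\gamma_{X\bullet Y^-,Z,T,U}\bullet V)=(X\circ(T\bullet\zeta_{Z,Y,U,V}))\gamma_{X,Z\bullet Y,T,U\bullet V}(((X\bullet\phi^\bullet_{Y,Z})\circ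 T)\bullet U\bullet V)$. (R14) $\delta_{X,(Y\circ T)\bullet Z,U,V}(X\bullet\delta_{Y,Z,T,U^-\bullet V})=((\zeta_{X,Y,U,T}\bullet Z)\circ V)\delta_{X\bullet Y,Z,U\bullet T,V}(X\bullet Y\bullet(Z\circ(\phi^\bullet_{T,U}\bullet V)))$. (R15) $(X\circ\gamma_{Z,T,U,Y\circ V})\gamma_{X,Y,(Z\bullet T^-)\circ U,V}=\gamma_{X\circ Z,T\circ Y,U,V}((((X\circ Z)\bullet\phi^\circ_{Y,T})\circ U)\bullet V)((\zeta_{X,Y^-,Z,T^-}\circ U)\bullet V)$. (R16) $(\delta_{X\circ U,Y,Z,T}\circ V)\delta_{X,Y\circ(Z^-\bullet T),U,V}=\delta_{X,Y,U\circ Z,T\circ V}(X\bullet(Y\circ(\phi^\circ_{Z,U}\bullet(T\circ V))))(X\bullet(Y\circ\zeta_{Z^-,T,U^-,V}))$. (R17) $r^\circ_J(J\circ r^\bullet_I)(J\circ(I\bullet m_J))\gamma_{J,J,I,J}(((J\bullet\phi^\bullet_0)\Delta_J\circ I)\bullet J)=r^\bullet_J(r^\circ_J\bullet J)$. (R18) $l^\circ_J(l^\bullet_I\circ J)((m_J\bullet I)\circ J)\delta_{J,I,J,J}(J\bullet(I\circ(\phi^\bullet_0\bullet J)\Delta_J))=l^\bullet_J(J\bullet l^\circ_J)$. Hopf monoid: a bimonoid $H$ with an antipode, i.e. a morphism $\Sigma_H:H\to H^-$ in $\mathcal C$ such that $((m_H\bullet I)\circ J)\varphi_{H,H}(H\bullet\Sigma_H)\Delta_H=((u_H\bullet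 I)\circ J)(\Delta_I\circ J)(l^\circ_J)^{-1}\varepsilon_H$ and $(J\circ(I\bullet m_H))\psi_{H,H}(\Sigma_H\bullet H)\Delta_H=(J\circ(I\bullet u_H))(J\circ\Delta_I)(r^\circ_J)^{-1}\varepsilon_H$. *)

theory Defs
  imports Main
begin

text \<open>
  Categories are one-sorted: objects are the identity arrows (the arrows that equal their own
  domain), so an object denotes its identity morphism, and the same binary operation gives a tensor
  product on objects and on arrows. Associativity constraints are not suppressed: every
  coherence axiom below carries the associators that its typing requires.
\<close>

record 'a cat =
  Arr :: "'a set"
  Dom :: "'a \<Rightarrow> 'a"
  Cod :: "'a \<Rightarrow> 'a"
  Comp :: "'a \<Rightarrow> 'a \<Rightarrow> 'a"

definition Obj :: "('a, 'b) cat_scheme \<Rightarrow> 'a set" where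
  "Obj C = {X \<in> Arr C. Dom C X = X}"

definition Hom :: "('a, 'b) cat_scheme \<Rightarrow> 'a \<Rightarrow> 'a \<Rightarrow> 'a set" where
  "Hom C X Y = {f \<in> Arr C. Dom C f = X \<and> Cod C f = Y}"

locale category =
  fixes C :: "('a, 'b) cat_scheme"
  assumes Dom_Obj: "f \<in> Arr C \<Longrightarrow> Dom C f \<in> Obj C"
    and Cod_Obj: "f \<in> Arr C \<Longrightarrow> Cod C f \<in> Obj C"
    and Cod_of_Obj: "X \<in> Obj C \<Longrightarrow> Cod C X = X"
    and Comp_Hom: "f \<in> Hom C X Y \<Longrightarrow> g \<in> Hom C Y Z \<Longrightarrow> Comp C g f \<in> Hom C X Z"
    and Comp_Dom: "f \<in> Arr C \<Longrightarrow> Comp C f (Dom C f) = f"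
    and Comp_Cod: "f \<in> Arr C \<Longrightarrow> Comp C (Cod C f) f = f"
    and Comp_assoc: "f \<in> Hom C X Y \<Longrightarrow> g \<in> Hom C Y Z \<Longrightarrow> h \<in> Hom C Z W \<Longrightarrow>
      Comp C h (Comp C g f) = Comp C (Comp C h g) f"

definition inverse_of :: "('a, 'b) cat_scheme \<Rightarrow> 'a \<Rightarrow> 'a \<Rightarrow> bool" where
  "inverse_of C f g \<longleftrightarrow> g \<in> Hom C (Cod C f) (Dom C f) \<and>
     Comp C g f = Dom C f \<and> Comp C f g = Cod C f"

definition is_iso :: "('a, 'b) cat_scheme \<Rightarrow> 'a \<Rightarrow> bool" where
  "is_iso C f \<longleftrightarrow> f \<in> Arr C \<and> (\<exists>g. inverse_of C f g)"

definition Inv :: "('a, 'b) cat_scheme \<Rightarrow> 'a \<Rightarrow> 'a" where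
  "Inv C f = (THE g. inverse_of C f g)"

definition monic :: "('a, 'b) cat_scheme \<Rightarrow> 'a \<Rightarrow> bool" where
  "monic C f \<longleftrightarrow> f \<in> Arr C \<and>
     (\<forall>X. \<forall>g \<in> Hom C X (Dom C f). \<forall>h \<in> Hom C X (Dom C f). Comp C f g = Comp C f h \<longrightarrow> g = h)"

text \<open>\<open>is_pullback C p q f g\<close>: the legs \<open>p\<close> and \<open>q\<close> form a pullback of the cospan \<open>(f, g)\<close>,
  with \<open>f\<close> after \<open>p\<close> equal to \<open>g\<close> after \<open>q\<close>.\<close>

definition is_pullback :: "('a, 'b) cat_scheme \<Rightarrow> 'a \<Rightarrow> 'a \<Rightarrow> 'a \<Rightarrow> 'a \<Rightarrow> bool" where
  "is_pullback C p q f g \<longleftrightarrow>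
     f \<in> Arr C \<and> g \<in> Arr C \<and> Cod C f = Cod C g \<and>
     p \<in> Hom C (Dom C p) (Dom C f) \<and> q \<in> Hom C (Dom C p) (Dom C g) \<and> Comp C f p = Comp C g q \<and>
     (\<forall>X. \<forall>p' \<in> Hom C X (Dom C f). \<forall>q' \<in> Hom C X (Dom C g). Comp C f p' = Comp C g q' \<longrightarrow>
        (\<exists>!h. h \<in> Hom C X (Dom C p) \<and> Comp C p h = p' \<and> Comp C q h = q'))"

definition is_initial :: "('a, 'b) cat_scheme \<Rightarrow> 'a \<Rightarrow> bool" where
  "is_initial C Z \<longleftrightarrow> Z \<in> Obj C \<and> (\<forall>X \<in> Obj C. \<exists>!f. f \<in> Hom C Z X)"

definition is_kernel :: "('a, 'b) cat_scheme \<Rightarrow> 'a \<Rightarrow> 'a \<Rightarrow> bool" where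
  "is_kernel C f k \<longleftrightarrow>
     (\<exists>Z i e. is_initial C Z \<and> i \<in> Hom C Z (Cod C f) \<and> is_pullback C k e f i)"

definition has_binary_intersections :: "('a, 'b) cat_scheme \<Rightarrow> bool" where
  "has_binary_intersections C \<longleftrightarrow>
     (\<forall>f g. monic C f \<and> monic C g \<and> Cod C f = Cod C g \<longrightarrow> (\<exists>p q. is_pullback C p q f g))"

definition preserves_binary_intersections :: "('a, 'b) cat_scheme \<Rightarrow> ('a \<Rightarrow> 'a) \<Rightarrow> bool" where
  "preserves_binary_intersections C F \<longleftrightarrow>
     (\<forall>f g p q. monic C f \<and> monic C g \<and> is_pullback C p q f g \<longrightarrow>
        is_pullback C (F p) (F q) (F f) (F g))"

definition full_subcat :: "'x cat \<Rightarrow> 'x set \<Rightarrow> 'x cat" where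
  "full_subcat C S = C\<lparr>Arr := {f \<in> Arr C. Dom C f \<in> S \<and> Cod C f \<in> S}\<rparr>"

text \<open>A category of structures over \<open>C\<close>: \<open>U X\<close> is the object of \<open>C\<close> underlying the structure \<open>X\<close>,
  and an arrow \<open>(X, f, Y)\<close> is a morphism \<open>f\<close> of \<open>C\<close> tagged with its source and target structures.\<close>

definition structure_cat ::
  "('a, 'b) cat_scheme \<Rightarrow> ('x \<Rightarrow> 'a) \<Rightarrow> ('x \<times> 'a \<times> 'x) set \<Rightarrow> ('x \<times> 'a \<times> 'x) cat" where
  "structure_cat C U M =
     \<lparr> Arr = M,
       Dom = \<lambda>(X, f, Y). (X, U X, X),
       Cod = \<lambda>(X, f, Y). (Y, U Y, Y),
       Comp = \<lambda>(Y', g, Z) (X, f, Y). (X, Comp C g f, Z) \<rparr>"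

definition is_endofunctor :: "('a, 'b) cat_scheme \<Rightarrow> ('a \<Rightarrow> 'a) \<Rightarrow> bool" where
  "is_endofunctor C F \<longleftrightarrow>
     (\<forall>f \<in> Arr C. F f \<in> Hom C (F (Dom C f)) (F (Cod C f))) \<and>
     (\<forall>f \<in> Arr C. \<forall>g \<in> Arr C. Dom C g = Cod C f \<longrightarrow> F (Comp C g f) = Comp C (F g) (F f))"

text \<open>\<open>assoc T X Y Z\<close> goes from \<open>(X \<otimes> Y) \<otimes> Z\<close> to \<open>X \<otimes> (Y \<otimes> Z)\<close>.\<close>

record 'a tensor =
  ten :: "'a \<Rightarrow> 'a \<Rightarrow> 'a"
  unit_ob :: 'a
  assoc :: "'a \<Rightarrow> 'a \<Rightarrow> 'a \<Rightarrow> 'a"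
  lunit :: "'a \<Rightarrow> 'a"
  runit :: "'a \<Rightarrow> 'a"

locale monoidal_category = category C
  for C :: "('a, 'b) cat_scheme" +
  fixes T :: "'a tensor"
  assumes unit_Obj: "unit_ob T \<in> Obj C"
    and ten_Hom: "f \<in> Hom C X X' \<Longrightarrow> g \<in> Hom C Y Y' \<Longrightarrow> ten T f g \<in> Hom C (ten T X Y) (ten T X' Y')"
    and interchange: "f \<in> Hom C X X' \<Longrightarrow> f' \<in> Hom C X' X'' \<Longrightarrow> g \<in> Hom C Y Y' \<Longrightarrow> g' \<in> Hom C Y' Y'' \<Longrightarrow>
      ten T (Comp C f' f) (Comp C g' g) = Comp C (ten T f' g') (ten T f g)"
    and assoc_Hom: "{X, Y, Z} \<subseteq> Obj C \<Longrightarrow>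
      assoc T X Y Z \<in> Hom C (ten T (ten T X Y) Z) (ten T X (ten T Y Z))"
    and assoc_iso: "{X, Y, Z} \<subseteq> Obj C \<Longrightarrow> is_iso C (assoc T X Y Z)"
    and assoc_natural: "f \<in> Hom C X X' \<Longrightarrow> g \<in> Hom C Y Y' \<Longrightarrow> h \<in> Hom C Z Z' \<Longrightarrow>
      Comp C (assoc T X' Y' Z') (ten T (ten T f g) h) =
      Comp C (ten T f (ten T g h)) (assoc T X Y Z)"
    and lunit_Hom: "X \<in> Obj C \<Longrightarrow> lunit T X \<in> Hom C (ten T (unit_ob T) X) X"
    and lunit_iso: "X \<in> Obj C \<Longrightarrow> is_iso C (lunit T X)"
    and lunit_natural: "f \<in> Hom C X X' \<Longrightarrow>
      Comp C (lunit T X') (ten T (unit_ob T) f) = Comp C f (lunit T X)"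
    and runit_Hom: "X \<in> Obj C \<Longrightarrow> runit T X \<in> Hom C (ten T X (unit_ob T)) X"
    and runit_iso: "X \<in> Obj C \<Longrightarrow> is_iso C (runit T X)"
    and runit_natural: "f \<in> Hom C X X' \<Longrightarrow>
      Comp C (runit T X') (ten T f (unit_ob T)) = Comp C f (runit T X)"
    and pentagon: "{X, Y, Z, W} \<subseteq> Obj C \<Longrightarrow>
      Comp C (assoc T X Y (ten T Z W)) (assoc T (ten T X Y) Z W) =
      Comp C (ten T X (assoc T Y Z W)) (Comp C (assoc T X (ten T Y Z) W) (ten T (assoc T X Y Z) W))"
    and triangle: "{X, Y} \<subseteq> Obj C \<Longrightarrow>
      Comp C (ten T X (lunit T Y)) (assoc T X (unit_ob T) Y) = ten T (runit T X) Y"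

definition rev_tensor :: "('a, 'b) cat_scheme \<Rightarrow> 'a tensor \<Rightarrow> 'a tensor" where
  "rev_tensor C T =
     \<lparr> ten = \<lambda>X Y. ten T Y X,
       unit_ob = unit_ob T,
       assoc = \<lambda>X Y Z. Inv C (assoc T Z Y X),
       lunit = runit T,
       runit = lunit T \<rparr>"

definition lax_monoidal ::
  "('a, 'b) cat_scheme \<Rightarrow> 'a tensor \<Rightarrow> 'a tensor \<Rightarrow> ('a \<Rightarrow> 'a) \<Rightarrow> ('a \<Rightarrow> 'a \<Rightarrow> 'a) \<Rightarrow> 'a \<Rightarrow> bool" where
  "lax_monoidal C S T F \<phi> \<phi>0 \<longleftrightarrow>
     is_endofunctor C F \<and>
     (\<forall>X \<in> Obj C. \<forall>Y \<in> Obj C. \<phi> X Y \<in> Hom C (ten T (F X) (F Y)) (F (ten S X Y))) \<and>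
     (\<forall>X X' Y Y'. \<forall>f \<in> Hom C X X'. \<forall>g \<in> Hom C Y Y'.
        Comp C (\<phi> X' Y') (ten T (F f) (F g)) = Comp C (F (ten S f g)) (\<phi> X Y)) \<and>
     \<phi>0 \<in> Hom C (unit_ob T) (F (unit_ob S)) \<and>
     (\<forall>X \<in> Obj C. \<forall>Y \<in> Obj C. \<forall>Z \<in> Obj C.
        Comp C (F (assoc S X Y Z)) (Comp C (\<phi> (ten S X Y) Z) (ten T (\<phi> X Y) (F Z))) =
        Comp C (\<phi> X (ten S Y Z)) (Comp C (ten T (F X) (\<phi> Y Z)) (assoc T (F X) (F Y) (F Z)))) \<and>
     (\<forall>X \<in> Obj C.
        Comp C (F (lunit S X)) (Comp C (\<phi> (unit_ob S) X) (ten T \<phi>0 (F X))) = lunit T (F X) \<and>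
        Comp C (F (runit S X)) (Comp C (\<phi> X (unit_ob S)) (ten T (F X) \<phi>0)) = runit T (F X))"

definition is_braiding :: "('a, 'b) cat_scheme \<Rightarrow> 'a tensor \<Rightarrow> ('a \<Rightarrow> 'a \<Rightarrow> 'a) \<Rightarrow> bool" where
  "is_braiding C T s \<longleftrightarrow>
     (\<forall>X \<in> Obj C. \<forall>Y \<in> Obj C. s X Y \<in> Hom C (ten T X Y) (ten T Y X) \<and> is_iso C (s X Y)) \<and>
     (\<forall>X X' Y Y'. \<forall>f \<in> Hom C X X'. \<forall>g \<in> Hom C Y Y'.
        Comp C (s X' Y') (ten T f g) = Comp C (ten T g f) (s X Y)) \<and>
     (\<forall>X \<in> Obj C. \<forall>Y \<in> Obj C. \<forall>Z \<in> Obj C.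
        Comp C (assoc T Y Z X) (Comp C (s X (ten T Y Z)) (assoc T X Y Z)) =
        Comp C (ten T Y (s X Z)) (Comp C (assoc T Y X Z) (ten T (s X Y) Z)) \<and>
        Comp C (Inv C (assoc T Z X Y)) (Comp C (s (ten T X Y) Z) (Inv C (assoc T X Y Z))) =
        Comp C (ten T (s X Z) Y) (Comp C (Inv C (assoc T X Z Y)) (ten T X (s Y Z))))"

definition is_monoid :: "('a, 'b) cat_scheme \<Rightarrow> 'a tensor \<Rightarrow> 'a \<Rightarrow> 'a \<Rightarrow> 'a \<Rightarrow> bool" where
  "is_monoid C T X m u \<longleftrightarrow>
     X \<in> Obj C \<and> m \<in> Hom C (ten T X X) X \<and> u \<in> Hom C (unit_ob T) X \<and>
     Comp C m (ten T m X) = Comp C m (Comp C (ten T X m) (assoc T X X X)) \<and>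
     Comp C m (ten T u X) = lunit T X \<and>
     Comp C m (ten T X u) = runit T X"

definition is_comonoid :: "('a, 'b) cat_scheme \<Rightarrow> 'a tensor \<Rightarrow> 'a \<Rightarrow> 'a \<Rightarrow> 'a \<Rightarrow> bool" where
  "is_comonoid C T X d e \<longleftrightarrow>
     X \<in> Obj C \<and> d \<in> Hom C X (ten T X X) \<and> e \<in> Hom C X (unit_ob T) \<and>
     Comp C (assoc T X X X) (Comp C (ten T d X) d) = Comp C (ten T X d) d \<and>
     Comp C (lunit T X) (Comp C (ten T e X) d) = X \<and>
     Comp C (runit T X) (Comp C (ten T X e) d) = X"

text \<open>\<open>eps_I\<close> is both the counit of the comonoid \<open>I\<close> and the unit of the monoid \<open>J\<close>.\<close>

record 'a duoidal = "'a cat" +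
  circ :: "'a tensor"
  bull :: "'a tensor"
  zeta :: "'a \<Rightarrow> 'a \<Rightarrow> 'a \<Rightarrow> 'a \<Rightarrow> 'a"
  Delta_I :: 'a
  m_J :: 'a
  eps_I :: 'a

locale duoidal_syntax =
  fixes D :: "('a, 'b) duoidal_scheme"
begin

abbreviation compD (infixr "\<cdot>" 60) where "g \<cdot> f \<equiv> Comp D g f"
abbreviation circD (infix "\<odot>" 75) where "f \<odot> g \<equiv> ten (circ D) f g"
abbreviation bullD (infix "\<bullet>" 75) where "f \<bullet> g \<equiv> ten (bull D) f g"
abbreviation I where "I \<equiv> unit_ob (circ D)"
abbreviation J where "J \<equiv> unit_ob (bull D)"
abbreviation a\<^sub>c where "a\<^sub>c \<equiv> assoc (circ D)"
abbreviation a\<^sub>b where "a\<^sub>b \<equiv> assoc (bull D)"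
abbreviation l\<^sub>c where "l\<^sub>c \<equiv> lunit (circ D)"
abbreviation r\<^sub>c where "r\<^sub>c \<equiv> runit (circ D)"
abbreviation l\<^sub>b where "l\<^sub>b \<equiv> lunit (bull D)"
abbreviation r\<^sub>b where "r\<^sub>b \<equiv> runit (bull D)"
abbreviation \<zeta> where "\<zeta> \<equiv> zeta D"
abbreviation \<Delta>\<^sub>I where "\<Delta>\<^sub>I \<equiv> Delta_I D"
abbreviation m\<^sub>J where "m\<^sub>J \<equiv> m_J D"
abbreviation \<epsilon>\<^sub>I where "\<epsilon>\<^sub>I \<equiv> eps_I D"
abbreviation inv where "inv \<equiv> Inv D"

end

locale duoidal_category =
  duoidal_syntax D + circ: monoidal_category D "circ D" + bull: monoidal_category D "bull D"
  for D :: "('a, 'b) duoidal_scheme" +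
  assumes zeta_Hom: "{A, B, C, E} \<subseteq> Obj D \<Longrightarrow>
      \<zeta> A B C E \<in> Hom D ((A \<bullet> B) \<odot> (C \<bullet> E)) ((A \<odot> C) \<bullet> (B \<odot> E))"
    and zeta_natural:
      "f \<in> Hom D A A' \<Longrightarrow> g \<in> Hom D B B' \<Longrightarrow> h \<in> Hom D C C' \<Longrightarrow> k \<in> Hom D E E' \<Longrightarrow>
      \<zeta> A' B' C' E' \<cdot> ((f \<bullet> g) \<odot> (h \<bullet> k)) = ((f \<odot> h) \<bullet> (g \<odot> k)) \<cdot> \<zeta> A B C E"
    and J_monoid: "is_monoid D (circ D) J m\<^sub>J \<epsilon>\<^sub>I"
    and I_comonoid: "is_comonoid D (bull D) I \<Delta>\<^sub>I \<epsilon>\<^sub>I"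
    and zeta_assoc_circ: "{A, B, C, E, F, G} \<subseteq> Obj D \<Longrightarrow>
      \<zeta> A B (C \<odot> F) (E \<odot> G) \<cdot> ((A \<bullet> B) \<odot> \<zeta> C E F G) \<cdot> a\<^sub>c (A \<bullet> B) (C \<bullet> E) (F \<bullet> G) =
      (a\<^sub>c A C F \<bullet> a\<^sub>c B E G) \<cdot> \<zeta> (A \<odot> C) (B \<odot> E) F G \<cdot> (\<zeta> A B C E \<odot> (F \<bullet> G))"
    and zeta_assoc_bull: "{A, B, C, E, F, G} \<subseteq> Obj D \<Longrightarrow>
      ((A \<odot> E) \<bullet> \<zeta> B C F G) \<cdot> \<zeta> A (B \<bullet> C) E (F \<bullet> G) \<cdot> (a\<^sub>b A B C \<odot> a\<^sub>b E F G) =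
      a\<^sub>b (A \<odot> E) (B \<odot> F) (C \<odot> G) \<cdot> (\<zeta> A B E F \<bullet> (C \<odot> G)) \<cdot> \<zeta> (A \<bullet> B) C (E \<bullet> F) G"
    and zeta_lunit_circ: "{A, B} \<subseteq> Obj D \<Longrightarrow>
      (l\<^sub>c A \<bullet> l\<^sub>c B) \<cdot> \<zeta> I I A B \<cdot> (\<Delta>\<^sub>I \<odot> (A \<bullet> B)) = l\<^sub>c (A \<bullet> B)"
    and zeta_runit_circ: "{A, B} \<subseteq> Obj D \<Longrightarrow>
      (r\<^sub>c A \<bullet> r\<^sub>c B) \<cdot> \<zeta> A B I I \<cdot> ((A \<bullet> B) \<odot> \<Delta>\<^sub>I) = r\<^sub>c (A \<bullet> B)"
    and zeta_lunit_bull: "{A, B} \<subseteq> Obj D \<Longrightarrow>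
      l\<^sub>b (A \<odot> B) \<cdot> (m\<^sub>J \<bullet> (A \<odot> B)) \<cdot> \<zeta> J A J B = l\<^sub>b A \<odot> l\<^sub>b B"
    and zeta_runit_bull: "{A, B} \<subseteq> Obj D \<Longrightarrow>
      r\<^sub>b (A \<odot> B) \<cdot> ((A \<odot> B) \<bullet> m\<^sub>J) \<cdot> \<zeta> A J B J = r\<^sub>b A \<odot> r\<^sub>b B"

record 'a braided_duoidal = "'a duoidal" +
  braid :: "'a \<Rightarrow> 'a \<Rightarrow> 'a"

locale bull_braided_duoidal_category = duoidal_category D
  for D :: "('a, 'b) braided_duoidal_scheme" +
  assumes braiding: "is_braiding D (bull D) (braid D)"
    and braid_zeta: "{A, B, C, E} \<subseteq> Obj D \<Longrightarrow>
      braid D (A \<odot> C) (B \<odot> E) \<cdot> \<zeta> A B C E = \<zeta> B A E C \<cdot> (braid D A B \<odot> braid D C E)"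
    and braid_Delta_I: "braid D I I \<cdot> \<Delta>\<^sub>I = \<Delta>\<^sub>I"

definition bull_preserves_binary_intersections :: "('a, 'b) duoidal_scheme \<Rightarrow> bool" where
  "bull_preserves_binary_intersections D \<longleftrightarrow>
     (\<forall>X \<in> Obj D. preserves_binary_intersections D (\<lambda>f. ten (bull D) X f) \<and>
                   preserves_binary_intersections D (\<lambda>f. ten (bull D) f X))"

record 'a comonoid =
  ob :: 'a
  comul :: 'a
  counit :: 'a

record 'a bimonoid = "'a comonoid" +
  mul :: 'a
  one :: 'a

context duoidal_syntax
begin

definition comonoid :: "('a, 'c) comonoid_scheme \<Rightarrow> bool" where
  "comonoid X \<longleftrightarrow> is_comonoid D (bull D) (ob X) (comul X) (counit X)"

definition comonoid_mor :: "('a, 'c) comonoid_scheme \<Rightarrow> ('a, 'c) comonoid_scheme \<Rightarrow> 'a \<Rightarrow> bool" where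
  "comonoid_mor X Y f \<longleftrightarrow>
     f \<in> Hom D (ob X) (ob Y) \<and>
     comul Y \<cdot> f = (f \<bullet> f) \<cdot> comul X \<and> counit Y \<cdot> f = counit X"

definition bimonoid :: "'a bimonoid \<Rightarrow> bool" where
  "bimonoid H \<longleftrightarrow>
     is_monoid D (circ D) (ob H) (mul H) (one H) \<and>
     comonoid H \<and>
     comul H \<cdot> mul H = (mul H \<bullet> mul H) \<cdot> \<zeta> (ob H) (ob H) (ob H) (ob H) \<cdot> (comul H \<odot> comul H) \<and>
     counit H \<cdot> mul H = m\<^sub>J \<cdot> (counit H \<odot> counit H) \<and>
     comul H \<cdot> one H = (one H \<bullet> one H) \<cdot> \<Delta>\<^sub>I \<and>
     counit H \<cdot> one H = \<epsilon>\<^sub>I"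

definition bimonoid_mor :: "'a bimonoid \<Rightarrow> 'a bimonoid \<Rightarrow> 'a \<Rightarrow> bool" where
  "bimonoid_mor X Y f \<longleftrightarrow>
     comonoid_mor X Y f \<and> f \<cdot> mul X = mul Y \<cdot> (f \<odot> f) \<and> f \<cdot> one X = one Y"

definition Comon :: "('a comonoid \<times> 'a \<times> 'a comonoid) cat" where
  "Comon = structure_cat D ob {(X, f, Y). comonoid X \<and> comonoid Y \<and> comonoid_mor X Y f}"

definition Bimon :: "('a bimonoid \<times> 'a \<times> 'a bimonoid) cat" where
  "Bimon = structure_cat D ob {(X, f, Y). bimonoid X \<and> bimonoid Y \<and> bimonoid_mor X Y f}"

definition unit_bimonoid :: "'a bimonoid" where
  "unit_bimonoid = \<lparr> ob = I, comul = \<Delta>\<^sub>I, counit = \<epsilon>\<^sub>I, mul = l\<^sub>c I, one = I \<rparr>"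

end

definition cocommutative :: "('a, 'b) braided_duoidal_scheme \<Rightarrow> ('a, 'c) comonoid_scheme \<Rightarrow> bool" where
  "cocommutative D X \<longleftrightarrow> Comp D (braid D (ob X) (ob X)) (comul X) = comul X"

definition Bimon_coc ::
  "('a, 'b) braided_duoidal_scheme \<Rightarrow> ('a bimonoid \<times> 'a \<times> 'a bimonoid) cat" where
  "Bimon_coc D = full_subcat (duoidal_syntax.Bimon D)
     {(H, ob H, H) | H. duoidal_syntax.bimonoid D H \<and> cocommutative D H}"

record 'a reversion_data =
  rv :: "'a \<Rightarrow> 'a"
  phi_circ :: "'a \<Rightarrow> 'a \<Rightarrow> 'a"
  phi_circ0 :: 'a
  phi_bull :: "'a \<Rightarrow> 'a \<Rightarrow> 'a"
  phi_bull0 :: 'a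
  gam :: "'a \<Rightarrow> 'a \<Rightarrow> 'a \<Rightarrow> 'a \<Rightarrow> 'a"
  del :: "'a \<Rightarrow> 'a \<Rightarrow> 'a \<Rightarrow> 'a \<Rightarrow> 'a"
  gam_t :: "'a \<Rightarrow> 'a \<Rightarrow> 'a \<Rightarrow> 'a \<Rightarrow> 'a"
  del_t :: "'a \<Rightarrow> 'a \<Rightarrow> 'a \<Rightarrow> 'a \<Rightarrow> 'a"

locale reversion_syntax = duoidal_syntax D
  for D :: "('a, 'b) duoidal_scheme" +
  fixes R :: "'a reversion_data"
begin

abbreviation rvD ("_\<^sup>-" [1000] 1000) where "f\<^sup>- \<equiv> rv R f"
abbreviation \<phi>\<^sub>c where "\<phi>\<^sub>c \<equiv> phi_circ R"
abbreviation \<phi>\<^sub>c\<^sub>0 where "\<phi>\<^sub>c\<^sub>0 \<equiv> phi_circ0 R"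
abbreviation \<phi>\<^sub>b where "\<phi>\<^sub>b \<equiv> phi_bull R"
abbreviation \<phi>\<^sub>b\<^sub>0 where "\<phi>\<^sub>b\<^sub>0 \<equiv> phi_bull0 R"
abbreviation \<gamma> where "\<gamma> \<equiv> gam R"
abbreviation \<delta> where "\<delta> \<equiv> del R"
abbreviation \<gamma>\<^sub>t where "\<gamma>\<^sub>t \<equiv> gam_t R"
abbreviation \<delta>\<^sub>t where "\<delta>\<^sub>t \<equiv> del_t R"

definition \<psi> :: "'a \<Rightarrow> 'a \<Rightarrow> 'a" where
  "\<psi> X Y = \<gamma> J X I Y \<cdot> ((inv (l\<^sub>b (X\<^sup>-)) \<odot> I) \<bullet> Y) \<cdot> (inv (r\<^sub>c (X\<^sup>-)) \<bullet> Y)"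

definition \<phi> :: "'a \<Rightarrow> 'a \<Rightarrow> 'a" where
  "\<phi> X Y = \<delta> X I Y J \<cdot> (X \<bullet> (I \<odot> inv (r\<^sub>b (Y\<^sup>-)))) \<cdot> (X \<bullet> inv (l\<^sub>c (Y\<^sup>-)))"

definition \<psi>\<^sub>t :: "'a \<Rightarrow> 'a \<Rightarrow> 'a" where
  "\<psi>\<^sub>t X Y = l\<^sub>c ((X \<odot> Y)\<^sup>-) \<cdot> (I \<odot> r\<^sub>b ((X \<odot> Y)\<^sup>-)) \<cdot> \<gamma>\<^sub>t X Y I J"

definition \<phi>\<^sub>t :: "'a \<Rightarrow> 'a \<Rightarrow> 'a" where
  "\<phi>\<^sub>t X Y = r\<^sub>c ((X \<odot> Y)\<^sup>-) \<cdot> (l\<^sub>b ((X \<odot> Y)\<^sup>-) \<odot> I) \<cdot> \<delta>\<^sub>t J I X Y"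

text \<open>The inverse unit constraint; in any monoidal category the left and right unit constraints of
  the unit object agree.\<close>

definition \<Delta>\<^sub>J :: 'a where
  "\<Delta>\<^sub>J = inv (l\<^sub>b J)"

definition is_antipode :: "'a bimonoid \<Rightarrow> 'a \<Rightarrow> bool" where
  "is_antipode H S \<longleftrightarrow>
     S \<in> Hom D (ob H) ((ob H)\<^sup>-) \<and>
     ((mul H \<bullet> I) \<odot> J) \<cdot> \<phi> (ob H) (ob H) \<cdot> (ob H \<bullet> S) \<cdot> comul H =
       ((one H \<bullet> I) \<odot> J) \<cdot> (\<Delta>\<^sub>I \<odot> J) \<cdot> inv (l\<^sub>c J) \<cdot> counit H \<and>
     (J \<odot> (I \<bullet> mul H)) \<cdot> \<psi> (ob H) (ob H) \<cdot> (S \<bullet> ob H) \<cdot> comul H =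
       (J \<odot> (I \<bullet> one H)) \<cdot> (J \<odot> \<Delta>\<^sub>I) \<cdot> inv (r\<^sub>c J) \<cdot> counit H"

definition hopf_monoid :: "'a bimonoid \<Rightarrow> bool" where
  "hopf_monoid H \<longleftrightarrow> bimonoid H \<and> (\<exists>S. is_antipode H S)"

end

locale reversion = reversion_syntax D R + duoidal_category D
  for D :: "('a, 'b) duoidal_scheme" and R :: "'a reversion_data" +
  assumes lax_circ: "lax_monoidal D (rev_tensor D (circ D)) (circ D) (rv R) \<phi>\<^sub>c \<phi>\<^sub>c\<^sub>0"
    and lax_bull: "lax_monoidal D (rev_tensor D (bull D)) (bull D) (rv R) \<phi>\<^sub>b \<phi>\<^sub>b\<^sub>0"
    and double_lax_zeta: "{A, B, C, E} \<subseteq> Obj D \<Longrightarrow>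
      \<phi>\<^sub>b (C \<odot> A) (E \<odot> B) \<cdot> (\<phi>\<^sub>c A C \<bullet> \<phi>\<^sub>c B E) \<cdot> \<zeta> (A\<^sup>-) (B\<^sup>-) (C\<^sup>-) (E\<^sup>-) =
      (\<zeta> E C B A)\<^sup>- \<cdot> \<phi>\<^sub>c (B \<bullet> A) (E \<bullet> C) \<cdot> (\<phi>\<^sub>b A B \<odot> \<phi>\<^sub>b C E)"
    and double_lax_Delta_I: "\<phi>\<^sub>b I I \<cdot> (\<phi>\<^sub>c\<^sub>0 \<bullet> \<phi>\<^sub>c\<^sub>0) \<cdot> \<Delta>\<^sub>I = \<Delta>\<^sub>I\<^sup>- \<cdot> \<phi>\<^sub>c\<^sub>0"
    and double_lax_m_J: "m\<^sub>J\<^sup>- \<cdot> \<phi>\<^sub>c J J \<cdot> (\<phi>\<^sub>b\<^sub>0 \<odot> \<phi>\<^sub>b\<^sub>0) = \<phi>\<^sub>b\<^sub>0 \<cdot> m\<^sub>J"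
    and double_lax_eps_I: "\<phi>\<^sub>b\<^sub>0 \<cdot> \<epsilon>\<^sub>I = \<epsilon>\<^sub>I\<^sup>- \<cdot> \<phi>\<^sub>c\<^sub>0"
    and gamma_Hom: "{X, Y, Z, T} \<subseteq> Obj D \<Longrightarrow>
      \<gamma> X Y Z T \<in> Hom D (((X \<bullet> Y\<^sup>-) \<odot> Z) \<bullet> T) (X \<odot> (Z \<bullet> (Y \<odot> T)))"
    and gamma_natural:
      "f \<in> Hom D X X' \<Longrightarrow> g \<in> Hom D Y Y' \<Longrightarrow> h \<in> Hom D Z Z' \<Longrightarrow> k \<in> Hom D T T' \<Longrightarrow>
      \<gamma> X' Y' Z' T' \<cdot> (((f \<bullet> g\<^sup>-) \<odot> h) \<bullet> k) = (f \<odot> (h \<bullet> (g \<odot> k))) \<cdot> \<gamma> X Y Z T"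
    and delta_Hom: "{X, Y, Z, T} \<subseteq> Obj D \<Longrightarrow>
      \<delta> X Y Z T \<in> Hom D (X \<bullet> (Y \<odot> (Z\<^sup>- \<bullet> T))) (((X \<odot> Z) \<bullet> Y) \<odot> T)"
    and delta_natural:
      "f \<in> Hom D X X' \<Longrightarrow> g \<in> Hom D Y Y' \<Longrightarrow> h \<in> Hom D Z Z' \<Longrightarrow> k \<in> Hom D T T' \<Longrightarrow>
      \<delta> X' Y' Z' T' \<cdot> (f \<bullet> (g \<odot> (h\<^sup>- \<bullet> k))) = (((f \<odot> h) \<bullet> g) \<odot> k) \<cdot> \<delta> X Y Z T"
    and gamma_t_Hom: "{X, Y, Z, T} \<subseteq> Obj D \<Longrightarrow>
      \<gamma>\<^sub>t X Y Z T \<in> Hom D (X\<^sup>- \<bullet> ((Y \<bullet> Z) \<odot> T)) (Z \<odot> ((X \<odot> Y)\<^sup>- \<bullet> T))"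
    and gamma_t_natural:
      "f \<in> Hom D X X' \<Longrightarrow> g \<in> Hom D Y Y' \<Longrightarrow> h \<in> Hom D Z Z' \<Longrightarrow> k \<in> Hom D T T' \<Longrightarrow>
      \<gamma>\<^sub>t X' Y' Z' T' \<cdot> (f\<^sup>- \<bullet> ((g \<bullet> h) \<odot> k)) = (h \<odot> ((f \<odot> g)\<^sup>- \<bullet> k)) \<cdot> \<gamma>\<^sub>t X Y Z T"
    and delta_t_Hom: "{X, Y, Z, T} \<subseteq> Obj D \<Longrightarrow>
      \<delta>\<^sub>t X Y Z T \<in> Hom D ((X \<odot> (Y \<bullet> Z)) \<bullet> T\<^sup>-) ((X \<bullet> (Z \<odot> T)\<^sup>-) \<odot> Y)"
    and delta_t_natural:
      "f \<in> Hom D X X' \<Longrightarrow> g \<in> Hom D Y Y' \<Longrightarrow> h \<in> Hom D Z Z' \<Longrightarrow> k \<in> Hom D T T' \<Longrightarrow>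
      \<delta>\<^sub>t X' Y' Z' T' \<cdot> ((f \<odot> (g \<bullet> h)) \<bullet> k\<^sup>-) = ((f \<bullet> (h \<odot> k)\<^sup>-) \<odot> g) \<cdot> \<delta>\<^sub>t X Y Z T"
    and R1: "{X, Y, Z, T, U, V} \<subseteq> Obj D \<Longrightarrow>
      \<gamma> X Y (Z \<odot> U) (T \<odot> V) \<cdot> (a\<^sub>c (X \<bullet> Y\<^sup>-) Z U \<bullet> (T \<odot> V)) \<cdot> \<zeta> ((X \<bullet> Y\<^sup>-) \<odot> Z) T U V =
      (X \<odot> ((Z \<odot> U) \<bullet> a\<^sub>c Y T V)) \<cdot> (X \<odot> \<zeta> Z (Y \<odot> T) U V) \<cdot> a\<^sub>c X (Z \<bullet> (Y \<odot> T)) (U \<bullet> V) \<cdot>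
        (\<gamma> X Y Z T \<odot> (U \<bullet> V))"
    and R2: "{X, Y, Z, T, U, V} \<subseteq> Obj D \<Longrightarrow>
      ((X \<odot> T) \<bullet> \<gamma> Y Z U V) \<cdot> a\<^sub>b (X \<odot> T) ((Y \<bullet> Z\<^sup>-) \<odot> U) V \<cdot> (\<zeta> X (Y \<bullet> Z\<^sup>-) T U \<bullet> V) \<cdot>
        ((a\<^sub>b X Y (Z\<^sup>-) \<odot> (T \<bullet> U)) \<bullet> V) =
      \<zeta> X Y T (U \<bullet> (Z \<odot> V)) \<cdot> ((X \<bullet> Y) \<odot> a\<^sub>b T U (Z \<odot> V)) \<cdot> \<gamma> (X \<bullet> Y) Z (T \<bullet> U) V"
    and R3: "{X, Y, Z, T, U, V} \<subseteq> Obj D \<Longrightarrow>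
      ((a\<^sub>c X Z U \<bullet> (Y \<odot> T)) \<odot> V) \<cdot> \<delta> (X \<odot> Z) (Y \<odot> T) U V \<cdot>
        ((X \<odot> Z) \<bullet> inv (a\<^sub>c Y T (U\<^sup>- \<bullet> V))) \<cdot> \<zeta> X Y Z (T \<odot> (U\<^sup>- \<bullet> V)) =
      (\<zeta> X Y (Z \<odot> U) T \<odot> V) \<cdot> inv (a\<^sub>c (X \<bullet> Y) ((Z \<odot> U) \<bullet> T) V) \<cdot> ((X \<bullet> Y) \<odot> \<delta> Z T U V)"
    and R4: "{X, Y, Z, T, U, V} \<subseteq> Obj D \<Longrightarrow>
      (\<delta> X Y T U \<bullet> (Z \<odot> V)) \<cdot> inv (a\<^sub>b X (Y \<odot> (T\<^sup>- \<bullet> U)) (Z \<odot> V)) \<cdot> (X \<bullet> \<zeta> Y Z (T\<^sup>- \<bullet> U) V) \<cdot>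
        (X \<bullet> ((Y \<bullet> Z) \<odot> inv (a\<^sub>b (T\<^sup>-) U V))) =
      \<zeta> ((X \<odot> T) \<bullet> Y) Z U V \<cdot> (inv (a\<^sub>b (X \<odot> T) Y Z) \<odot> (U \<bullet> V)) \<cdot> \<delta> X (Y \<bullet> Z) T (U \<bullet> V)"
    and R5: "{X, Y, Z, T, U, V} \<subseteq> Obj D \<Longrightarrow>
      \<delta> X Y T (U \<bullet> (Z \<odot> V)) \<cdot> (X \<bullet> (Y \<odot> a\<^sub>b (T\<^sup>-) U (Z \<odot> V))) \<cdot> (X \<bullet> \<gamma> Y Z (T\<^sup>- \<bullet> U) V) \<cdot>
        a\<^sub>b X ((Y \<bullet> Z\<^sup>-) \<odot> (T\<^sup>- \<bullet> U)) V =
      \<gamma> ((X \<odot> T) \<bullet> Y) Z U V \<cdot> ((inv (a\<^sub>b (X \<odot> T) Y (Z\<^sup>-)) \<odot> U) \<bullet> V) \<cdot> (\<delta> X (Y \<bullet> Z\<^sup>-) T U \<bullet> V)"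
    and R6:
      "l\<^sub>c (I \<bullet> I) \<cdot> (I \<odot> (I \<bullet> l\<^sub>c I)) \<cdot> \<gamma> I I I I \<cdot> ((((I \<bullet> \<phi>\<^sub>c\<^sub>0) \<cdot> \<Delta>\<^sub>I) \<odot> I) \<bullet> I) = l\<^sub>c I \<bullet> I"
    and R7:
      "r\<^sub>c (I \<bullet> I) \<cdot> ((r\<^sub>c I \<bullet> I) \<odot> I) \<cdot> \<delta> I I I I \<cdot> (I \<bullet> (I \<odot> ((\<phi>\<^sub>c\<^sub>0 \<bullet> I) \<cdot> \<Delta>\<^sub>I))) = I \<bullet> r\<^sub>c I"
    and R8: "{X, Y, Z, U} \<subseteq> Obj D \<Longrightarrow>
      \<gamma> (X \<odot> Z) Y (J \<odot> J) U \<cdot> (a\<^sub>c ((X \<odot> Z) \<bullet> Y\<^sup>-) J J \<bullet> U) \<cdot> ((\<delta> X (Y\<^sup>-) Z J \<odot> J) \<bullet> U) \<cdot>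
        (((X \<bullet> (Y\<^sup>- \<odot> inv (r\<^sub>b (Z\<^sup>-)))) \<odot> J) \<bullet> U) =
      ((X \<odot> Z) \<odot> \<zeta> J Y J U) \<cdot> ((X \<odot> Z) \<odot> (inv (l\<^sub>b Y) \<odot> inv (l\<^sub>b U))) \<cdot>
        inv (a\<^sub>c X Z (Y \<odot> U)) \<cdot> (X \<odot> a\<^sub>c Z Y U) \<cdot>
        (X \<odot> l\<^sub>b ((Z \<odot> Y) \<odot> U)) \<cdot> \<gamma> X (Z \<odot> Y) J U \<cdot> (((X \<bullet> \<phi>\<^sub>c Y Z) \<odot> J) \<bullet> U)"
    and R9: "{X, Y, Z, U} \<subseteq> Obj D \<Longrightarrow>
      \<delta> X (J \<odot> J) Z (Y \<odot> U) \<cdot> (X \<bullet> inv (a\<^sub>c J J (Z\<^sup>- \<bullet> (Y \<odot> U)))) \<cdot>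
        (X \<bullet> (J \<odot> \<gamma> J Y (Z\<^sup>-) U)) \<cdot> (X \<bullet> (J \<odot> ((inv (l\<^sub>b (Y\<^sup>-)) \<odot> Z\<^sup>-) \<bullet> U))) =
      (\<zeta> X J Z J \<odot> (Y \<odot> U)) \<cdot> ((inv (r\<^sub>b X) \<odot> inv (r\<^sub>b Z)) \<odot> (Y \<odot> U)) \<cdot>
        a\<^sub>c (X \<odot> Z) Y U \<cdot> (inv (a\<^sub>c X Z Y) \<odot> U) \<cdot>
        (r\<^sub>b (X \<odot> (Z \<odot> Y)) \<odot> U) \<cdot> \<delta> X J (Z \<odot> Y) U \<cdot> (X \<bullet> (J \<odot> (\<phi>\<^sub>c Y Z \<bullet> U)))"
    and R10: "{X, Y, Z} \<subseteq> Obj D \<Longrightarrow>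
      (a\<^sub>c X Y Z)\<^sup>- \<cdot> \<phi>\<^sub>t (X \<odot> Y) Z \<cdot> (\<psi> X Y \<bullet> Z\<^sup>-) =
      \<psi>\<^sub>t X (Y \<odot> Z) \<cdot> (X\<^sup>- \<bullet> \<phi> Y Z) \<cdot> a\<^sub>b (X\<^sup>-) Y (Z\<^sup>-)"
    and R11: "X \<in> Obj D \<Longrightarrow>
      (r\<^sub>c X)\<^sup>- \<cdot> l\<^sub>c ((X \<odot> I)\<^sup>-) \<cdot> (I \<odot> r\<^sub>b ((X \<odot> I)\<^sup>-)) \<cdot> \<gamma>\<^sub>t X I I J \<cdot> (X\<^sup>- \<bullet> (\<Delta>\<^sub>I \<odot> J)) =
      r\<^sub>b (X\<^sup>-) \<cdot> (X\<^sup>- \<bullet> l\<^sub>c J)"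
    and R12: "X \<in> Obj D \<Longrightarrow>
      (l\<^sub>c X)\<^sup>- \<cdot> r\<^sub>c ((I \<odot> X)\<^sup>-) \<cdot> (l\<^sub>b ((I \<odot> X)\<^sup>-) \<odot> I) \<cdot> \<delta>\<^sub>t J I I X \<cdot> ((J \<odot> \<Delta>\<^sub>I) \<bullet> X\<^sup>-) =
      l\<^sub>b (X\<^sup>-) \<cdot> (r\<^sub>c J \<bullet> X\<^sup>-)"
    and R13: "{X, Y, Z, T, U, V} \<subseteq> Obj D \<Longrightarrow>
      (X \<odot> a\<^sub>b T (Z \<odot> U) (Y \<odot> V)) \<cdot> \<gamma> X Y (T \<bullet> (Z \<odot> U)) V \<cdot> (\<gamma> (X \<bullet> Y\<^sup>-) Z T U \<bullet> V) =
      (X \<odot> (T \<bullet> \<zeta> Z Y U V)) \<cdot> \<gamma> X (Z \<bullet> Y) T (U \<bullet> V) \<cdot> (((X \<bullet> \<phi>\<^sub>b Y Z) \<odot> T) \<bullet> (U \<bullet> V)) \<cdot>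
        ((a\<^sub>b X (Y\<^sup>-) (Z\<^sup>-) \<odot> T) \<bullet> (U \<bullet> V)) \<cdot> a\<^sub>b (((X \<bullet> Y\<^sup>-) \<bullet> Z\<^sup>-) \<odot> T) U V"
    and R14: "{X, Y, Z, T, U, V} \<subseteq> Obj D \<Longrightarrow>
      \<delta> X ((Y \<odot> T) \<bullet> Z) U V \<cdot> (X \<bullet> \<delta> Y Z T (U\<^sup>- \<bullet> V)) =
      (a\<^sub>b (X \<odot> U) (Y \<odot> T) Z \<odot> V) \<cdot> ((\<zeta> X Y U T \<bullet> Z) \<odot> V) \<cdot> \<delta> (X \<bullet> Y) Z (U \<bullet> T) V \<cdot>
        ((X \<bullet> Y) \<bullet> (Z \<odot> (\<phi>\<^sub>b T U \<bullet> V))) \<cdot> ((X \<bullet> Y) \<bullet> (Z \<odot> inv (a\<^sub>b (T\<^sup>-) (U\<^sup>-) V))) \<cdot>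
        inv (a\<^sub>b X Y (Z \<odot> (T\<^sup>- \<bullet> (U\<^sup>- \<bullet> V))))"
    and R15: "{X, Y, Z, T, U, V} \<subseteq> Obj D \<Longrightarrow>
      (X \<odot> \<gamma> Z T U (Y \<odot> V)) \<cdot> \<gamma> X Y ((Z \<bullet> T\<^sup>-) \<odot> U) V \<cdot> (a\<^sub>c (X \<bullet> Y\<^sup>-) (Z \<bullet> T\<^sup>-) U \<bullet> V) =
      a\<^sub>c X Z (U \<bullet> (T \<odot> (Y \<odot> V))) \<cdot> ((X \<odot> Z) \<odot> (U \<bullet> a\<^sub>c T Y V)) \<cdot> \<gamma> (X \<odot> Z) (T \<odot> Y) U V \<cdot>
        ((((X \<odot> Z) \<bullet> \<phi>\<^sub>c Y T) \<odot> U) \<bullet> V) \<cdot> ((\<zeta> X (Y\<^sup>-) Z (T\<^sup>-) \<odot> U) \<bullet> V)"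
    and R16: "{X, Y, Z, T, U, V} \<subseteq> Obj D \<Longrightarrow>
      ((a\<^sub>c X U Z \<bullet> Y) \<odot> (T \<odot> V)) \<cdot> a\<^sub>c (((X \<odot> U) \<odot> Z) \<bullet> Y) T V \<cdot>
        (\<delta> (X \<odot> U) Y Z T \<odot> V) \<cdot> \<delta> X (Y \<odot> (Z\<^sup>- \<bullet> T)) U V =
      \<delta> X Y (U \<odot> Z) (T \<odot> V) \<cdot> (X \<bullet> (Y \<odot> (\<phi>\<^sub>c Z U \<bullet> (T \<odot> V)))) \<cdot>
        (X \<bullet> (Y \<odot> \<zeta> (Z\<^sup>-) T (U\<^sup>-) V)) \<cdot> (X \<bullet> a\<^sub>c Y (Z\<^sup>- \<bullet> T) (U\<^sup>- \<bullet> V))"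
    and R17:
      "r\<^sub>c J \<cdot> (J \<odot> r\<^sub>b I) \<cdot> (J \<odot> (I \<bullet> m\<^sub>J)) \<cdot> \<gamma> J J I J \<cdot> ((((J \<bullet> \<phi>\<^sub>b\<^sub>0) \<cdot> \<Delta>\<^sub>J) \<odot> I) \<bullet> J) =
      r\<^sub>b J \<cdot> (r\<^sub>c J \<bullet> J)"
    and R18:
      "l\<^sub>c J \<cdot> (l\<^sub>b I \<odot> J) \<cdot> ((m\<^sub>J \<bullet> I) \<odot> J) \<cdot> \<delta> J I J J \<cdot> (J \<bullet> (I \<odot> ((\<phi>\<^sub>b\<^sub>0 \<bullet> J) \<cdot> \<Delta>\<^sub>J))) =
      l\<^sub>b J \<cdot> (J \<bullet> l\<^sub>c J)"

definition Hopf_coc ::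
  "('a, 'b) braided_duoidal_scheme \<Rightarrow> 'a reversion_data \<Rightarrow>
     ('a bimonoid \<times> 'a \<times> 'a bimonoid) cat" where
  "Hopf_coc D R = full_subcat (duoidal_syntax.Bimon D)
     {(H, ob H, H) | H. reversion_syntax.hopf_monoid D R H \<and> cocommutative D H}"

end

theory Submission
  imports Defs
begin

text \<open>
  Put \<open>\<theta> = (A \<bullet> \<pi>) \<Delta>\<close> on \<open>A\<close>. The kernel \<open>K\<close> is the intersection of the monomorphisms \<open>\<theta>\<close> and
  \<open>A \<bullet> u\<close>, where \<open>u\<close> is the unit of \<open>H\<close>. Cocommutativity of \<open>A\<close> makes the comultiplication restrict
  to \<open>K\<close>, and the remaining structure restricts because every comonoid morphism \<open>f\<close> into \<open>A\<close> for which
  \<open>\<pi> f\<close> factors through \<open>u\<close> lands in \<open>K\<close>.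

  For a right \<open>H\<close>-module \<open>N\<close> and a left \<open>H\<close>-comodule \<open>W\<close> there is a canonical Galois map from
  \<open>(N \<bullet> I) \<odot> W\<close> to \<open>N \<bullet> W\<close>, and the axioms on \<open>\<gamma>\<close> and \<open>\<delta>\<close> make it invertible as soon as \<open>H\<close> has an
  antipode. Its inverse allows one to write the classical projection \<open>a \<mapsto> a\<^sub>1 \<sigma>(S(\<pi>(a\<^sub>2)))\<close>, which lands in
  \<open>K\<close> and gives a \<open>K\<close>-linear retraction \<open>\<rho>\<close> of the morphism from \<open>K\<close> to \<open>A \<bullet> I\<close>. The inverse of
  \<open>m (k \<odot> \<sigma>)\<close> and a right antipode of \<open>K\<close> are built from \<open>\<rho>\<close>. Reversing both tensor products exchanges
  \<open>\<gamma>\<close> with \<open>\<delta>\<close> and right with left antipodes, so \<open>K\<close> also has a left antipode; by (R10)--(R12) a left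
  and a right antipode of the same bimonoid agree.
\<close>

section \<open>Monoidal categories\<close>

text \<open>\<open>I\<close> and \<open>J\<close> are different units, so a morphism from
  \<open>N\<close> to \<open>N \<bullet> I\<close> need not exist, while
  \<open>\<epsilon>\<^sub>I\<close> gives one from \<open>N \<bullet> I\<close> to \<open>N\<close>.
  The interchange \<open>\<zeta>\<close> lets \<open>H\<close> act on \<open>N\<close> when the left
  factor is a \<open>\<bullet>\<close>-product; this is why the Galois maps start at
  \<open>(N \<bullet> I) \<odot> W\<close> and why \<open>K\<close> becomes a retract of
  \<open>A \<bullet> I\<close> rather than of \<open>A\<close>. Coinvariance of the classical
  projection is usually read off from the antipode reversing products and coproducts. Here it comes
  from the Galois maps: their inverses are natural for \<open>H\<close>-linear morphisms, and the
  coaction of \<open>A\<close> is one, so a cotensor condition is carried into coinvariants without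
  computing with \<open>S\<close>. A reversion is a functor that need not preserve monomorphisms, so
  the antipode of \<open>A\<close> restricted to \<open>K\<close> cannot simply be factored through
  the reversed \<open>k\<close>. Applying the functor to the retraction replaces that factorisation;
  the price is that the retraction has to be known to be \<open>K\<close>-linear.\<close>

definition composable :: "('a, 'b) cat_scheme \<Rightarrow> 'a \<Rightarrow> 'a \<Rightarrow> bool" where
  "composable C g f \<longleftrightarrow> f \<in> Arr C \<and> g \<in> Arr C \<and> Dom C g = Cod C f"

context category
begin

lemma Obj_Arr [simp]: "X \<in> Obj C \<Longrightarrow> X \<in> Arr C"
  and Dom_Obj_eq [simp]: "X \<in> Obj C \<Longrightarrow> Dom C X = X"
  and Cod_Obj_eq [simp]: "X \<in> Obj C \<Longrightarrow> Cod C X = X"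
  by (auto simp: Obj_def Cod_of_Obj)

lemmas Dom_Obj' [simp] = Dom_Obj
lemmas Cod_Obj' [simp] = Cod_Obj

text \<open>The guards restrict this rule to factors that are not themselves composites; composites are
  decomposed by \<open>composable_comp\<close>, so that each factor of a long composite is checked only once.\<close>

lemma composableI [simp]: "NO_MATCH (Comp x y u) f \<Longrightarrow> NO_MATCH (Comp x' y' u') g \<Longrightarrow> f \<in> Arr C \<Longrightarrow> g \<in> Arr C \<Longrightarrow> Dom C g = Cod C f \<Longrightarrow> composable C g f"
  by (simp add: composable_def)

lemma Arr_comp [simp]: "composable C g f \<Longrightarrow> Comp C g f \<in> Arr C"
  and Dom_comp [simp]: "composable C g f \<Longrightarrow> Dom C (Comp C g f) = Dom C f"
  and Cod_comp [simp]: "composable C g f \<Longrightarrow> Cod C (Comp C g f) = Cod C g"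
  using Comp_Hom[of f "Dom C f" "Cod C f" g "Cod C g"] by (simp_all add: Hom_def composable_def)

lemma composable_comp [simp]:
  "composable C g h \<Longrightarrow> composable C h f \<Longrightarrow> composable C g (Comp C h f)"
  "composable C g h \<Longrightarrow> composable C h f \<Longrightarrow> composable C (Comp C g h) f"
  using Arr_comp Dom_comp Cod_comp by (simp_all add: composable_def)

text \<open>Composites are normalised to right-nested form. Together with the rule that fuses tensor
  products, this makes a bare \<open>simp\<close> in the later calculations mean equality up to
  associativity of composition and functoriality of both tensors; the named equation of each step
  carries the content.\<close>

lemma comp_assoc [simp]:
  assumes "composable C g f" "composable C h g"
  shows "Comp C (Comp C h g) f = Comp C h (Comp C g f)"
  by (rule Comp_assoc[symmetric]) (use assms in \<open>auto simp: Hom_def composable_def\<close>)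

lemma comp_Obj_right [simp]: "X \<in> Obj C \<Longrightarrow> f \<in> Arr C \<Longrightarrow> Dom C f = X \<Longrightarrow> Comp C f X = f"
  using Comp_Dom by blast

lemma comp_Obj_left [simp]: "X \<in> Obj C \<Longrightarrow> f \<in> Arr C \<Longrightarrow> Cod C f = X \<Longrightarrow> Comp C X f = f"
  using Comp_Cod by blast

lemma inverse_of_unique:
  assumes "f \<in> Arr C" "inverse_of C f g" "inverse_of C f h"
  shows "g = h"
proof -
  have "g \<in> Arr C" "Dom C g = Cod C f" "Cod C g = Dom C f" "Comp C g f = Dom C f"
    "h \<in> Arr C" "Dom C h = Cod C f" "Cod C h = Dom C f" "Comp C f h = Cod C f"
    using assms by (auto simp: inverse_of_def Hom_def)
  then have "g = Comp C g (Comp C f h)" using assms(1) by simp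
  also have "\<dots> = Comp C (Comp C g f) h"
    using assms(1) \<open>g \<in> Arr C\<close> \<open>h \<in> Arr C\<close> \<open>Dom C g = Cod C f\<close> \<open>Cod C h = Dom C f\<close>
    by (subst comp_assoc) auto
  also have "\<dots> = h" using \<open>Comp C g f = _\<close> \<open>h \<in> Arr C\<close> \<open>Cod C h = Dom C f\<close> assms(1) by simp
  finally show ?thesis .
qed

lemma Inv_eqI: "f \<in> Arr C \<Longrightarrow> inverse_of C f g \<Longrightarrow> Inv C f = g"
  unfolding Inv_def using inverse_of_unique by blast

lemma inverse_of_Inv: "is_iso C f \<Longrightarrow> inverse_of C f (Inv C f)"
  using Inv_eqI by (auto simp: is_iso_def)

lemma Inv_Arr: "is_iso C f \<Longrightarrow> Inv C f \<in> Arr C"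
  and Dom_Inv: "is_iso C f \<Longrightarrow> Dom C (Inv C f) = Cod C f"
  and Cod_Inv: "is_iso C f \<Longrightarrow> Cod C (Inv C f) = Dom C f"
  and comp_Inv_left: "is_iso C f \<Longrightarrow> Comp C (Inv C f) f = Dom C f"
  and comp_Inv_right: "is_iso C f \<Longrightarrow> Comp C f (Inv C f) = Cod C f"
  using inverse_of_Inv by (auto simp: inverse_of_def Hom_def)

lemma comp_Inv_left': "is_iso C f \<Longrightarrow> h \<in> Arr C \<Longrightarrow> Cod C h = Dom C f \<Longrightarrow> Comp C (Inv C f) (Comp C f h) = h"
  and comp_Inv_right': "is_iso C f \<Longrightarrow> h \<in> Arr C \<Longrightarrow> Cod C h = Cod C f \<Longrightarrow> Comp C f (Comp C (Inv C f) h) = h"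
proof -
  assume f: "is_iso C f" and h: "h \<in> Arr C"
  have fA: "f \<in> Arr C" using f by (simp add: is_iso_def)
  show "Cod C h = Dom C f \<Longrightarrow> Comp C (Inv C f) (Comp C f h) = h"
    using f h fA by (subst comp_assoc[symmetric]) (auto simp: Inv_Arr Dom_Inv Cod_Inv comp_Inv_left)
  show "Cod C h = Cod C f \<Longrightarrow> Comp C f (Comp C (Inv C f) h) = h"
    using f h fA by (subst comp_assoc[symmetric]) (auto simp: Inv_Arr Dom_Inv Cod_Inv comp_Inv_right)
qed

lemma isoI:
  assumes "f \<in> Hom C X Y" "g \<in> Hom C Y X" "Comp C g f = X" "Comp C f g = Y"
  shows "is_iso C f" "Inv C f = g"
proof -
  have "inverse_of C f g" "f \<in> Arr C" using assms by (auto simp: inverse_of_def Hom_def)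
  then show "is_iso C f" "Inv C f = g" by (auto simp: is_iso_def Inv_eqI)
qed

lemma is_iso_Inv: "is_iso C f \<Longrightarrow> is_iso C (Inv C f)"
  and Inv_Inv: "is_iso C f \<Longrightarrow> Inv C (Inv C f) = f"
proof -
  assume f: "is_iso C f"
  then have fA: "f \<in> Arr C" by (simp add: is_iso_def)
  have 1: "Inv C f \<in> Hom C (Cod C f) (Dom C f)" "f \<in> Hom C (Dom C f) (Cod C f)"
    using f fA by (auto simp: Hom_def Inv_Arr Dom_Inv Cod_Inv)
  show "is_iso C (Inv C f)" "Inv C (Inv C f) = f"
    using isoI[OF 1] f by (auto simp: comp_Inv_left comp_Inv_right)
qed

lemma iso_cancel_left:
  assumes "is_iso C f" "g \<in> Arr C" "h \<in> Arr C" "Cod C g = Dom C f" "Cod C h = Dom C f"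
    "Comp C f g = Comp C f h"
  shows "g = h"
  using assms comp_Inv_left' by metis

lemma iso_cancel_right:
  assumes f: "is_iso C f" and "g \<in> Arr C" "h \<in> Arr C" "Dom C g = Cod C f" "Dom C h = Cod C f"
    "Comp C g f = Comp C h f"
  shows "g = h"
proof -
  have fA: "f \<in> Arr C" using f by (simp add: is_iso_def)
  note i = Inv_Arr[OF f] Dom_Inv[OF f] Cod_Inv[OF f]
  have "Comp C g (Comp C f (Inv C f)) = Comp C (Comp C g f) (Inv C f)"
    by (rule comp_assoc[symmetric]) (use assms fA i in simp_all)
  also have "\<dots> = Comp C h (Comp C f (Inv C f))"
    unfolding assms(6) by (rule comp_assoc) (use assms fA i in simp_all)
  finally have "Comp C g (Comp C f (Inv C f)) = Comp C h (Comp C f (Inv C f))" .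
  then show ?thesis using assms fA by (simp add: comp_Inv_right)
qed

lemma monicD:
  "monic C f \<Longrightarrow> g \<in> Arr C \<Longrightarrow> h \<in> Arr C \<Longrightarrow> Cod C g = Dom C f \<Longrightarrow> Dom C h = Dom C g \<Longrightarrow>
   Cod C h = Dom C f \<Longrightarrow> Comp C f g = Comp C f h \<Longrightarrow> g = h"
  by (auto simp: monic_def Hom_def)

end

context monoidal_category
begin

lemma ten_Arr [simp]: "f \<in> Arr C \<Longrightarrow> g \<in> Arr C \<Longrightarrow> ten T f g \<in> Arr C"
  and Dom_ten [simp]: "f \<in> Arr C \<Longrightarrow> g \<in> Arr C \<Longrightarrow> Dom C (ten T f g) = ten T (Dom C f) (Dom C g)"
  and Cod_ten [simp]: "f \<in> Arr C \<Longrightarrow> g \<in> Arr C \<Longrightarrow> Cod C (ten T f g) = ten T (Cod C f) (Cod C g)"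
  using ten_Hom[of f "Dom C f" "Cod C f" g "Dom C g" "Cod C g"] by (auto simp: Hom_def)

lemma ten_Obj [simp]: "X \<in> Obj C \<Longrightarrow> Y \<in> Obj C \<Longrightarrow> ten T X Y \<in> Obj C"
  by (subst Obj_def) simp

lemma unit_Obj' [simp]: "unit_ob T \<in> Obj C"
  by (rule unit_Obj)

lemma composable_ten [simp]:
  "composable C f' f \<Longrightarrow> composable C g' g \<Longrightarrow> composable C (ten T f' g') (ten T f g)"
  by (simp add: composable_def)

lemma ten_comp [simp]:
  assumes "composable C f' f" "composable C g' g"
  shows "Comp C (ten T f' g') (ten T f g) = ten T (Comp C f' f) (Comp C g' g)"
  by (rule interchange[symmetric]) (use assms in \<open>auto simp: Hom_def composable_def\<close>)

text \<open>The fusing rule with a tail \<open>h\<close>: in right-nested form the two tensor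
  products are rarely the whole composite.\<close>

lemma ten_comp' [simp]:
  assumes "composable C f' f" "composable C g' g" "composable C (ten T f g) h"
  shows "Comp C (ten T f' g') (Comp C (ten T f g) h) = Comp C (ten T (Comp C f' f) (Comp C g' g)) h"
  by (subst comp_assoc[symmetric]) (use assms in auto)

lemma assoc_simps [simp]:
  assumes "X \<in> Obj C" "Y \<in> Obj C" "Z \<in> Obj C"
  shows "is_iso C (assoc T X Y Z)" "assoc T X Y Z \<in> Arr C"
    "Dom C (assoc T X Y Z) = ten T (ten T X Y) Z" "Cod C (assoc T X Y Z) = ten T X (ten T Y Z)"
  using assms assoc_Hom[of X Y Z] assoc_iso[of X Y Z] by (auto simp: Hom_def)

lemma unitor_simps [simp]:
  assumes "X \<in> Obj C"
  shows "is_iso C (lunit T X)" "lunit T X \<in> Arr C"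
    "Dom C (lunit T X) = ten T (unit_ob T) X" "Cod C (lunit T X) = X"
    "is_iso C (runit T X)" "runit T X \<in> Arr C"
    "Dom C (runit T X) = ten T X (unit_ob T)" "Cod C (runit T X) = X"
  using assms lunit_Hom[of X] lunit_iso[of X] runit_Hom[of X] runit_iso[of X] by (auto simp: Hom_def)

end

lemmas (in category) Inv_simps [simp] =
  Inv_Arr Dom_Inv Cod_Inv comp_Inv_left comp_Inv_right comp_Inv_left' comp_Inv_right' Inv_Inv is_iso_Inv

context monoidal_category
begin

lemma ten_iso [simp]:
  assumes "is_iso C f" "is_iso C g"
  shows "is_iso C (ten T f g)" "Inv C (ten T f g) = ten T (Inv C f) (Inv C g)"
proof -
  have "f \<in> Arr C" "g \<in> Arr C" using assms by (auto simp: is_iso_def)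
  then have 1: "ten T f g \<in> Hom C (ten T (Dom C f) (Dom C g)) (ten T (Cod C f) (Cod C g))"
     "ten T (Inv C f) (Inv C g) \<in> Hom C (ten T (Cod C f) (Cod C g)) (ten T (Dom C f) (Dom C g))"
    using assms by (auto simp: Hom_def)
  show "is_iso C (ten T f g)" "Inv C (ten T f g) = ten T (Inv C f) (Inv C g)"
    using isoI[OF 1] assms \<open>f \<in> Arr C\<close> \<open>g \<in> Arr C\<close> by auto
qed

lemma is_iso_Obj [simp]: "X \<in> Obj C \<Longrightarrow> is_iso C X" "X \<in> Obj C \<Longrightarrow> Inv C X = X"
  using isoI[of X X X X] by (auto simp: Hom_def)

lemma assoc_nat:
  assumes "f \<in> Arr C" "g \<in> Arr C" "h \<in> Arr C" "Cod C f = X" "Cod C g = Y" "Cod C h = Z"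
  shows "Comp C (assoc T X Y Z) (ten T (ten T f g) h) =
    Comp C (ten T f (ten T g h)) (assoc T (Dom C f) (Dom C g) (Dom C h))"
  using assms assoc_natural[of f "Dom C f" X g "Dom C g" Y h "Dom C h" Z] by (auto simp: Hom_def)

lemma lunit_nat:
  assumes "f \<in> Arr C" "Cod C f = X"
  shows "Comp C (lunit T X) (ten T (unit_ob T) f) = Comp C f (lunit T (Dom C f))"
  using assms lunit_natural[of f "Dom C f" X] by (auto simp: Hom_def)

lemma runit_nat:
  assumes "f \<in> Arr C" "Cod C f = X"
  shows "Comp C (runit T X) (ten T f (unit_ob T)) = Comp C f (runit T (Dom C f))"
  using assms runit_natural[of f "Dom C f" X] by (auto simp: Hom_def)

end

context category
begin

text \<open>Source of the naturality of every inverse coherence constraint: a naturality square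
  stays commutative when its two invertible sides are turned around.\<close>

lemma Inv_square:
  assumes "is_iso C a" "is_iso C b" "p \<in> Arr C" "q \<in> Arr C" "Cod C p = Dom C a" "Dom C p = Dom C b"
    "Dom C q = Cod C b" "Cod C q = Cod C a" "Comp C a p = Comp C q b"
  shows "Comp C p (Inv C b) = Comp C (Inv C a) q"
proof -
  have A: "a \<in> Arr C" "b \<in> Arr C" using assms(1,2) by (auto simp: is_iso_def)
  have "Comp C p (Inv C b) = Comp C (Inv C a) (Comp C (Comp C a p) (Inv C b))"
    using assms(1-8) A by simp
  also have "\<dots> = Comp C (Inv C a) q"
    unfolding assms(9) using assms(1-8) A by simp
  finally show ?thesis .
qed

end

context monoidal_category
begin

lemma Inv_assoc_nat:
  assumes "f \<in> Arr C" "g \<in> Arr C" "h \<in> Arr C" "Cod C f = X" "Cod C g = Y" "Cod C h = Z"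
  shows "Comp C (Inv C (assoc T X Y Z)) (ten T f (ten T g h)) =
    Comp C (ten T (ten T f g) h) (Inv C (assoc T (Dom C f) (Dom C g) (Dom C h)))"
  by (rule Inv_square[symmetric]) (use assms in \<open>auto simp: assoc_nat\<close>)

lemma Inv_lunit_nat:
  assumes "f \<in> Arr C" "Cod C f = X"
  shows "Comp C (ten T (unit_ob T) f) (Inv C (lunit T (Dom C f))) = Comp C (Inv C (lunit T X)) f"
  by (rule Inv_square) (use assms in \<open>auto simp: lunit_nat\<close>)

lemma Inv_runit_nat:
  assumes "f \<in> Arr C" "Cod C f = X"
  shows "Comp C (ten T f (unit_ob T)) (Inv C (runit T (Dom C f))) = Comp C (Inv C (runit T X)) f"
  by (rule Inv_square) (use assms in \<open>auto simp: runit_nat\<close>)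

text \<open>Tensoring with the unit is isomorphic to the identity functor by \<open>lunit\<close>,
  hence faithful. Equations between unit constraints are proved after tensoring, where the pentagon
  applies.\<close>

lemma unit_ten_cancel:
  assumes "f \<in> Arr C" "g \<in> Arr C" "Dom C f = Dom C g" "Cod C f = Cod C g"
    "ten T (unit_ob T) f = ten T (unit_ob T) g"
  shows "f = g"
proof (rule iso_cancel_right[of "lunit T (Dom C f)"])
  show "Comp C f (lunit T (Dom C f)) = Comp C g (lunit T (Dom C f))"
    using lunit_nat[of f "Cod C f"] lunit_nat[of g "Cod C g"] assms by simp
qed (use assms in auto)

lemma ten_unit_cancel:
  assumes "f \<in> Arr C" "g \<in> Arr C" "Dom C f = Dom C g" "Cod C f = Cod C g"
    "ten T f (unit_ob T) = ten T g (unit_ob T)"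
  shows "f = g"
proof (rule iso_cancel_right[of "runit T (Dom C f)"])
  show "Comp C f (runit T (Dom C f)) = Comp C g (runit T (Dom C f))"
    using runit_nat[of f "Cod C f"] runit_nat[of g "Cod C g"] assms by simp
qed (use assms in auto)

lemma triangle':
  "X \<in> Obj C \<Longrightarrow> Y \<in> Obj C \<Longrightarrow> Comp C (ten T X (lunit T Y)) (assoc T X (unit_ob T) Y) = ten T (runit T X) Y"
  by (simp add: triangle)

text \<open>Kelly's argument: after tensoring with the unit on the left and precomposing with
  invertible associators, the claim is the pentagon for the unit, the unit, \<open>X\<close> and
  \<open>Y\<close>, combined with two instances of the triangle and naturality of the
  associator.\<close>

lemma lunit_ten:
  assumes [simp]: "X \<in> Obj C" "Y \<in> Obj C"
  shows "Comp C (lunit T (ten T X Y)) (assoc T (unit_ob T) X Y) = ten T (lunit T X) Y"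
proof (rule unit_ten_cancel)
  let ?I = "unit_ob T"
  let ?x = "Comp C (assoc T ?I (ten T ?I X) Y) (ten T (assoc T ?I ?I X) Y)"
  show "ten T ?I (Comp C (lunit T (ten T X Y)) (assoc T ?I X Y)) = ten T ?I (ten T (lunit T X) Y)"
  proof (rule iso_cancel_right[of ?x])
    show "is_iso C ?x"
      by (rule isoI(1)[of _ "ten T (ten T (ten T ?I ?I) X) Y" "ten T ?I (ten T (ten T ?I X) Y)"
          "Comp C (ten T (Inv C (assoc T ?I ?I X)) Y) (Inv C (assoc T ?I (ten T ?I X) Y))"])
        (simp_all add: Hom_def)
    have "Comp C (ten T ?I (Comp C (lunit T (ten T X Y)) (assoc T ?I X Y))) ?x =
      Comp C (ten T ?I (lunit T (ten T X Y))) (Comp C (ten T ?I (assoc T ?I X Y)) ?x)"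
      by simp
    also have "\<dots> = Comp C (ten T ?I (lunit T (ten T X Y)))
        (Comp C (assoc T ?I ?I (ten T X Y)) (assoc T (ten T ?I ?I) X Y))"
      using pentagon[of ?I ?I X Y] by simp
    also have "\<dots> = Comp C (ten T (runit T ?I) (ten T X Y)) (assoc T (ten T ?I ?I) X Y)"
      by (subst comp_assoc[symmetric]) (simp_all add: triangle')
    also have "\<dots> = Comp C (assoc T ?I X Y) (ten T (ten T (runit T ?I) X) Y)"
      by (simp add: assoc_nat)
    also have "\<dots> = Comp C (assoc T ?I X Y) (Comp C (ten T (ten T ?I (lunit T X)) Y) (ten T (assoc T ?I ?I X) Y))"
      by (simp add: triangle')
    also have "\<dots> = Comp C (Comp C (assoc T ?I X Y) (ten T (ten T ?I (lunit T X)) Y)) (ten T (assoc T ?I ?I X) Y)"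
      by (rule comp_assoc[symmetric]) simp_all
    also have "\<dots> = Comp C (ten T ?I (ten T (lunit T X) Y)) ?x"
      by (simp add: assoc_nat)
    finally show "Comp C (ten T ?I (Comp C (lunit T (ten T X Y)) (assoc T ?I X Y))) ?x =
      Comp C (ten T ?I (ten T (lunit T X) Y)) ?x" .
  qed simp_all
qed simp_all

text \<open>The same argument with the unit tensored on the right: the pentagon for
  \<open>X\<close>, \<open>Y\<close> and two units, and the triangle at \<open>Y\<close> and at
  \<open>ten T X Y\<close>.\<close>

lemma runit_ten:
  assumes [simp]: "X \<in> Obj C" "Y \<in> Obj C"
  shows "Comp C (ten T X (runit T Y)) (assoc T X Y (unit_ob T)) = runit T (ten T X Y)"
proof (rule ten_unit_cancel)
  let ?I = "unit_ob T"
  let ?x = "Comp C (assoc T X (ten T Y ?I) ?I) (ten T (assoc T X Y ?I) ?I)"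
  show "ten T (Comp C (ten T X (runit T Y)) (assoc T X Y ?I)) ?I = ten T (runit T (ten T X Y)) ?I"
  proof (rule iso_cancel_left[of "assoc T X Y ?I"])
    have "Comp C (assoc T X Y ?I) (ten T (Comp C (ten T X (runit T Y)) (assoc T X Y ?I)) ?I) =
      Comp C (Comp C (assoc T X Y ?I) (ten T (ten T X (runit T Y)) ?I)) (ten T (assoc T X Y ?I) ?I)"
      by simp
    also have "\<dots> = Comp C (ten T X (ten T (runit T Y) ?I)) ?x"
      by (simp add: assoc_nat)
    also have "\<dots> = Comp C (ten T X (ten T Y (lunit T ?I))) (Comp C (ten T X (assoc T Y ?I ?I)) ?x)"
      by (simp add: triangle')
    also have "\<dots> = Comp C (ten T X (ten T Y (lunit T ?I))) (Comp C (assoc T X Y (ten T ?I ?I)) (assoc T (ten T X Y) ?I ?I))"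
      using pentagon[of X Y ?I ?I] by simp
    also have "\<dots> = Comp C (Comp C (ten T X (ten T Y (lunit T ?I))) (assoc T X Y (ten T ?I ?I))) (assoc T (ten T X Y) ?I ?I)"
      by (rule comp_assoc[symmetric]) simp_all
    also have "\<dots> = Comp C (Comp C (assoc T X Y ?I) (ten T (ten T X Y) (lunit T ?I))) (assoc T (ten T X Y) ?I ?I)"
      using assoc_nat[of X Y "lunit T ?I" X Y ?I] by simp
    also have "\<dots> = Comp C (assoc T X Y ?I) (ten T (runit T (ten T X Y)) ?I)"
      by (simp add: triangle')
    finally show "Comp C (assoc T X Y ?I) (ten T (Comp C (ten T X (runit T Y)) (assoc T X Y ?I)) ?I) =
      Comp C (assoc T X Y ?I) (ten T (runit T (ten T X Y)) ?I)" .
  qed simp_all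
qed simp_all

text \<open>Naturality of \<open>lunit\<close> at itself identifies its value at the square of the
  unit with the unit tensored by \<open>lunit\<close>. Then \<open>lunit_ten\<close> and the
  triangle express both sides of the claim, tensored with the unit, by the same composite.\<close>

lemma lunit_unit: "lunit T (unit_ob T) = runit T (unit_ob T)"
proof (rule ten_unit_cancel)
  let ?I = "unit_ob T"
  have "lunit T (ten T ?I ?I) = ten T ?I (lunit T ?I)"
    by (rule iso_cancel_left[of "lunit T ?I"]) (simp_all add: lunit_nat)
  then show "ten T (lunit T ?I) ?I = ten T (runit T ?I) ?I"
    using lunit_ten[of ?I ?I] triangle'[of ?I ?I] by simp
qed simp_all

end

section \<open>Rewriting inside composites, monomorphisms and pullbacks\<close>

context category
begin

text \<open>In right-nested form \<open>f\<close> and \<open>g\<close> are usually followed by a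
  further factor \<open>h\<close>, so an equation for the composite of \<open>f\<close> and
  \<open>g\<close> would not match. This rule and the next one supply the versions with a
  tail.\<close>

lemma comp_rewrite: "Comp C f g = w \<Longrightarrow> composable C f g \<Longrightarrow> composable C g h \<Longrightarrow> Comp C f (Comp C g h) = Comp C w h"
  by (erule subst) simp

lemma comp_rewrite2: "Comp C f (Comp C g k) = w \<Longrightarrow> composable C f g \<Longrightarrow> composable C g k \<Longrightarrow> composable C k h \<Longrightarrow>
    Comp C f (Comp C g (Comp C k h)) = Comp C w h"
  by (erule subst) simp

lemma iso_shift: "is_iso C f \<Longrightarrow> x \<in> Arr C \<Longrightarrow> Cod C x = Dom C f \<Longrightarrow> Comp C f x = y \<Longrightarrow> x = Comp C (Inv C f) y"
  by (erule subst) simp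

lemma monic_comp:
  assumes "monic C f" "monic C g" "Dom C f = Cod C g"
  shows "monic C (Comp C f g)"
proof -
  have A: "f \<in> Arr C" "g \<in> Arr C" using assms by (auto simp: monic_def)
  show ?thesis
    unfolding monic_def
  proof (intro conjI allI ballI impI)
    show "Comp C f g \<in> Arr C" using A assms(3) by simp
    fix X x y assume "x \<in> Hom C X (Dom C (Comp C f g))" "y \<in> Hom C X (Dom C (Comp C f g))"
      and eq: "Comp C (Comp C f g) x = Comp C (Comp C f g) y"
    then have xy: "x \<in> Arr C" "y \<in> Arr C" "Dom C x = X" "Dom C y = X" "Cod C x = Dom C g" "Cod C y = Dom C g"
      using A assms(3) by (auto simp: Hom_def)
    then have "Comp C f (Comp C g x) = Comp C f (Comp C g y)" using eq A assms(3) by simp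
    then have "Comp C g x = Comp C g y"
      by (rule monicD[OF assms(1), rotated -1]) (use A xy assms(3) in auto)
    then show "x = y" by (rule monicD[OF assms(2), rotated -1]) (use A xy in auto)
  qed
qed

lemma split_monic:
  assumes "f \<in> Arr C" "g \<in> Arr C" "Dom C g = Cod C f" "Comp C g f = Dom C f"
  shows "monic C f"
  unfolding monic_def
proof (intro conjI allI ballI impI)
  fix X x y assume "x \<in> Hom C X (Dom C f)" "y \<in> Hom C X (Dom C f)" and eq: "Comp C f x = Comp C f y"
  then have xy: "x \<in> Arr C" "y \<in> Arr C" "Cod C x = Dom C f" "Cod C y = Dom C f" by (auto simp: Hom_def)
  have "Comp C g (Comp C f x) = Comp C g (Comp C f y)" using eq by simp
  then show "x = y" using assms xy by (simp add: comp_rewrite[OF assms(4)])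
qed (use assms in simp)

text \<open>The self-intersection of a monomorphism has identities as legs, and conversely such a
  pullback forces monicity. A functor that preserves binary intersections therefore preserves
  monomorphisms, which is how \<open>X \<bullet> -\<close> and \<open>- \<bullet> X\<close> are seen
  to do so.\<close>

lemma monic_pullback_self:
  assumes "monic C f"
  shows "is_pullback C (Dom C f) (Dom C f) f f"
proof -
  have f: "f \<in> Arr C" using assms by (simp add: monic_def)
  show ?thesis
    unfolding is_pullback_def
  proof (intro conjI allI ballI impI)
    fix X p q assume pq: "p \<in> Hom C X (Dom C f)" "q \<in> Hom C X (Dom C f)" "Comp C f p = Comp C f q"
    then have "p = q" using monicD[OF assms] by (auto simp: Hom_def)
    then show "\<exists>!h. h \<in> Hom C X (Dom C (Dom C f)) \<and> Comp C (Dom C f) h = p \<and> Comp C (Dom C f) h = q"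
    proof (intro ex1I[of _ p])
      have p: "p \<in> Arr C" "Dom C p = X" "Cod C p = Dom C f" using pq(1) by (auto simp: Hom_def)
      show "p \<in> Hom C X (Dom C (Dom C f)) \<and> Comp C (Dom C f) p = p \<and> Comp C (Dom C f) p = q"
        using p f \<open>p = q\<close>[symmetric] by (simp add: Hom_def)
      fix h assume "h \<in> Hom C X (Dom C (Dom C f)) \<and> Comp C (Dom C f) h = p \<and> Comp C (Dom C f) h = q"
      then show "h = p" using f comp_Obj_left[of "Dom C f" h] by (simp add: Hom_def)
    qed
  qed (use f in \<open>simp_all add: Hom_def\<close>)
qed

lemma pullback_self_monic:
  assumes "is_pullback C X X f f" "X \<in> Obj C"
  shows "monic C f"
proof -
  have f: "f \<in> Arr C" "Dom C f = X" using assms by (auto simp: is_pullback_def Hom_def)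
  show ?thesis
    unfolding monic_def
  proof (intro conjI allI ballI impI)
    fix Y x y assume xy: "x \<in> Hom C Y (Dom C f)" "y \<in> Hom C Y (Dom C f)" "Comp C f x = Comp C f y"
    then obtain h where "h \<in> Hom C Y X" "Comp C X h = x" "Comp C X h = y"
      using assms(1) Dom_Obj_eq[OF assms(2)] f(2) unfolding is_pullback_def by (metis (no_types))
    then show "x = y" by (elim subst) (rule refl)
  qed (use f in simp)
qed

lemma pullback_ex:
  assumes "is_pullback C p q f g" "x \<in> Arr C" "y \<in> Arr C" "Dom C x = Dom C y" "Cod C x = Dom C f" "Cod C y = Dom C g"
    "Comp C f x = Comp C g y"
  obtains h where "h \<in> Arr C" "Dom C h = Dom C x" "Cod C h = Dom C p" "Comp C p h = x" "Comp C q h = y"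
proof -
  have "x \<in> Hom C (Dom C x) (Dom C f)" "y \<in> Hom C (Dom C x) (Dom C g)"
    using assms by (auto simp: Hom_def)
  then obtain h where "h \<in> Hom C (Dom C x) (Dom C p)" "Comp C p h = x" "Comp C q h = y"
    using assms(1,7) unfolding is_pullback_def by metis
  then show ?thesis using that by (auto simp: Hom_def)
qed

lemma pullback_data:
  assumes "is_pullback C p q f g"
  shows "p \<in> Arr C" "q \<in> Arr C" "f \<in> Arr C" "g \<in> Arr C" "Cod C p = Dom C f" "Cod C q = Dom C g"
    "Dom C q = Dom C p" "Cod C f = Cod C g" "Comp C f p = Comp C g q" "Dom C p \<in> Obj C"
  using assms Dom_Obj by (auto simp: is_pullback_def Hom_def)

lemma pullback_monic:
  assumes P: "is_pullback C p q f g" and g: "monic C g"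
  shows "monic C p"
  unfolding monic_def
proof (intro conjI allI ballI impI)
  note pd [simp] = pullback_data(1-8,10)[OF P]
  show "p \<in> Arr C" by simp
  fix X x y assume "x \<in> Hom C X (Dom C p)" "y \<in> Hom C X (Dom C p)" and eq: "Comp C p x = Comp C p y"
  then have xy [simp]: "x \<in> Arr C" "y \<in> Arr C" "Dom C x = X" "Dom C y = X" "Cod C x = Dom C p" "Cod C y = Dom C p"
    by (auto simp: Hom_def)
  have e: "Comp C g (Comp C q z) = Comp C f (Comp C p z)" if "z \<in> Arr C" "Cod C z = Dom C p" for z
    using that by (simp add: comp_rewrite[OF pullback_data(9)[OF P]])
  have q: "Comp C q x = Comp C q y"
    by (rule monicD[OF g]) (simp_all add: e eq)
  have "Comp C p x \<in> Hom C X (Dom C f)" "Comp C q x \<in> Hom C X (Dom C g)" "Comp C f (Comp C p x) = Comp C g (Comp C q x)"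
    by (simp_all add: Hom_def e)
  then have "\<exists>!h. h \<in> Hom C X (Dom C p) \<and> Comp C p h = Comp C p x \<and> Comp C q h = Comp C q x"
    using P unfolding is_pullback_def by blast
  then show "x = y" using q eq \<open>x \<in> Hom C X _\<close> \<open>y \<in> Hom C X _\<close> by metis
qed

end

context monoidal_category
begin

lemma
  assumes [simp]: "X \<in> Obj C" "Y \<in> Obj C"
  shows triangle_inv: "Comp C (assoc T X (unit_ob T) Y) (ten T (Inv C (runit T X)) Y) = ten T X (Inv C (lunit T Y))"
    and triangle_inv': "Comp C (Inv C (assoc T X (unit_ob T) Y)) (ten T X (Inv C (lunit T Y))) = ten T (Inv C (runit T X)) Y"
    and inv_triangle: "Comp C (ten T (runit T X) Y) (Inv C (assoc T X (unit_ob T) Y)) = ten T X (lunit T Y)"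
proof -
  let ?a = "assoc T X (unit_ob T) Y"
  have "Comp C (ten T X (lunit T Y)) (Comp C ?a (ten T (Inv C (runit T X)) Y)) = ten T X Y"
    by (simp add: comp_rewrite[OF triangle'])
  then have "Comp C ?a (ten T (Inv C (runit T X)) Y) = Comp C (Inv C (ten T X (lunit T Y))) (ten T X Y)"
    by (intro iso_shift) simp_all
  then show 1: "Comp C ?a (ten T (Inv C (runit T X)) Y) = ten T X (Inv C (lunit T Y))" by simp
  show "Comp C (Inv C ?a) (ten T X (Inv C (lunit T Y))) = ten T (Inv C (runit T X)) Y"
    by (simp flip: 1)
  show "Comp C (ten T (runit T X) Y) (Inv C ?a) = ten T X (lunit T Y)"
    by (simp flip: triangle')
qed

lemma
  assumes [simp]: "X \<in> Obj C" "Y \<in> Obj C"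
  shows runit_ten_inv: "Comp C (assoc T X Y (unit_ob T)) (Inv C (runit T (ten T X Y))) = ten T X (Inv C (runit T Y))"
    and runit_ten_inv': "Comp C (Inv C (assoc T X Y (unit_ob T))) (ten T X (Inv C (runit T Y))) = Inv C (runit T (ten T X Y))"
    and inv_runit_ten: "Comp C (runit T (ten T X Y)) (Inv C (assoc T X Y (unit_ob T))) = ten T X (runit T Y)"
proof -
  let ?a = "assoc T X Y (unit_ob T)"
  have "Comp C (ten T X (runit T Y)) (Comp C ?a (Inv C (runit T (ten T X Y)))) = ten T X Y"
    by (simp add: comp_rewrite[OF runit_ten])
  then have "Comp C ?a (Inv C (runit T (ten T X Y))) = Comp C (Inv C (ten T X (runit T Y))) (ten T X Y)"
    by (intro iso_shift) simp_all
  then show 1: "Comp C ?a (Inv C (runit T (ten T X Y))) = ten T X (Inv C (runit T Y))" by simp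
  show "Comp C (Inv C ?a) (ten T X (Inv C (runit T Y))) = Inv C (runit T (ten T X Y))"
    by (simp flip: 1)
  show "Comp C (runit T (ten T X Y)) (Inv C ?a) = ten T X (runit T Y)"
    by (simp flip: runit_ten)
qed

end

section \<open>Duoidal categories\<close>

context duoidal_category
begin

lemma zeta_simps [simp]:
  assumes "A \<in> Obj D" "B \<in> Obj D" "C \<in> Obj D" "E \<in> Obj D"
  shows "\<zeta> A B C E \<in> Arr D" "Dom D (\<zeta> A B C E) = (A \<bullet> B) \<odot> (C \<bullet> E)"
    "Cod D (\<zeta> A B C E) = (A \<odot> C) \<bullet> (B \<odot> E)"
  using zeta_Hom[of A B C E] assms by (auto simp: Hom_def)

lemma zeta_nat:
  assumes "f \<in> Arr D" "g \<in> Arr D" "h \<in> Arr D" "k \<in> Arr D"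
    "Cod D f = A" "Cod D g = B" "Cod D h = C" "Cod D k = E"
  shows "\<zeta> A B C E \<cdot> ((f \<bullet> g) \<odot> (h \<bullet> k)) =
    ((f \<odot> h) \<bullet> (g \<odot> k)) \<cdot> \<zeta> (Dom D f) (Dom D g) (Dom D h) (Dom D k)"
  using assms zeta_natural[of f "Dom D f" A g "Dom D g" B h "Dom D h" C k "Dom D k" E] by (auto simp: Hom_def)

lemma unit_mor_simps [simp]:
  "\<Delta>\<^sub>I \<in> Arr D" "Dom D \<Delta>\<^sub>I = I" "Cod D \<Delta>\<^sub>I = I \<bullet> I"
  "m\<^sub>J \<in> Arr D" "Dom D m\<^sub>J = J \<odot> J" "Cod D m\<^sub>J = J"
  "\<epsilon>\<^sub>I \<in> Arr D" "Dom D \<epsilon>\<^sub>I = I" "Cod D \<epsilon>\<^sub>I = J"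
  using I_comonoid J_monoid unfolding is_comonoid_def is_monoid_def Hom_def by blast+

lemma Delta_I_coassoc: "a\<^sub>b I I I \<cdot> (\<Delta>\<^sub>I \<bullet> I) \<cdot> \<Delta>\<^sub>I = (I \<bullet> \<Delta>\<^sub>I) \<cdot> \<Delta>\<^sub>I"
  and Delta_I_counit_left: "l\<^sub>b I \<cdot> (\<epsilon>\<^sub>I \<bullet> I) \<cdot> \<Delta>\<^sub>I = I"
  and Delta_I_counit_right: "r\<^sub>b I \<cdot> (I \<bullet> \<epsilon>\<^sub>I) \<cdot> \<Delta>\<^sub>I = I"
  using I_comonoid unfolding is_comonoid_def by blast+

lemma m_J_unit_left: "m\<^sub>J \<cdot> (\<epsilon>\<^sub>I \<odot> J) = l\<^sub>c J" and m_J_unit_right: "m\<^sub>J \<cdot> (J \<odot> \<epsilon>\<^sub>I) = r\<^sub>c J"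
  using J_monoid unfolding is_monoid_def by blast+

lemma zeta_unit_left:
  "A \<in> Obj D \<Longrightarrow> B \<in> Obj D \<Longrightarrow> (l\<^sub>c A \<bullet> l\<^sub>c B) \<cdot> \<zeta> I I A B \<cdot> (\<Delta>\<^sub>I \<odot> (A \<bullet> B)) = l\<^sub>c (A \<bullet> B)"
  and zeta_unit_right:
  "A \<in> Obj D \<Longrightarrow> B \<in> Obj D \<Longrightarrow> (r\<^sub>c A \<bullet> r\<^sub>c B) \<cdot> \<zeta> A B I I \<cdot> ((A \<bullet> B) \<odot> \<Delta>\<^sub>I) = r\<^sub>c (A \<bullet> B)"
  and zeta_counit_left:
  "A \<in> Obj D \<Longrightarrow> B \<in> Obj D \<Longrightarrow> l\<^sub>b (A \<odot> B) \<cdot> (m\<^sub>J \<bullet> (A \<odot> B)) \<cdot> \<zeta> J A J B = l\<^sub>b A \<odot> l\<^sub>b B"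
  and zeta_counit_right:
  "A \<in> Obj D \<Longrightarrow> B \<in> Obj D \<Longrightarrow> r\<^sub>b (A \<odot> B) \<cdot> ((A \<odot> B) \<bullet> m\<^sub>J) \<cdot> \<zeta> A J B J = r\<^sub>b A \<odot> r\<^sub>b B"
  by (simp_all add: zeta_lunit_circ zeta_runit_circ zeta_lunit_bull zeta_runit_bull)

text \<open>The unit axioms solved for \<open>\<zeta>\<close>: a unit doubled by
  \<open>\<Delta>\<^sub>I\<close> and fed through \<open>\<zeta>\<close> is a pair of inverse unit
  constraints. In this form they remove an occurrence of \<open>\<zeta>\<close> from the middle of a
  composite.\<close>

lemma zeta_unit_left_inv:
  "A \<in> Obj D \<Longrightarrow> B \<in> Obj D \<Longrightarrow> \<zeta> I I A B \<cdot> (\<Delta>\<^sub>I \<odot> (A \<bullet> B)) \<cdot> inv (l\<^sub>c (A \<bullet> B)) = inv (l\<^sub>c A) \<bullet> inv (l\<^sub>c B)"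
  and zeta_unit_right_inv:
  "A \<in> Obj D \<Longrightarrow> B \<in> Obj D \<Longrightarrow> \<zeta> A B I I \<cdot> ((A \<bullet> B) \<odot> \<Delta>\<^sub>I) \<cdot> inv (r\<^sub>c (A \<bullet> B)) = inv (r\<^sub>c A) \<bullet> inv (r\<^sub>c B)"
proof -
  assume [simp]: "A \<in> Obj D" "B \<in> Obj D"
  have "(l\<^sub>c A \<bullet> l\<^sub>c B) \<cdot> \<zeta> I I A B \<cdot> (\<Delta>\<^sub>I \<odot> (A \<bullet> B)) \<cdot> inv (l\<^sub>c (A \<bullet> B)) = A \<bullet> B"
    by (simp add: circ.comp_rewrite2[OF zeta_unit_left])
  then have "\<zeta> I I A B \<cdot> (\<Delta>\<^sub>I \<odot> (A \<bullet> B)) \<cdot> inv (l\<^sub>c (A \<bullet> B)) = inv (l\<^sub>c A \<bullet> l\<^sub>c B) \<cdot> (A \<bullet> B)"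
    by (intro circ.iso_shift) simp_all
  then show "\<zeta> I I A B \<cdot> (\<Delta>\<^sub>I \<odot> (A \<bullet> B)) \<cdot> inv (l\<^sub>c (A \<bullet> B)) = inv (l\<^sub>c A) \<bullet> inv (l\<^sub>c B)"
    by simp
  have "(r\<^sub>c A \<bullet> r\<^sub>c B) \<cdot> \<zeta> A B I I \<cdot> ((A \<bullet> B) \<odot> \<Delta>\<^sub>I) \<cdot> inv (r\<^sub>c (A \<bullet> B)) = A \<bullet> B"
    by (simp add: circ.comp_rewrite2[OF zeta_unit_right])
  then have "\<zeta> A B I I \<cdot> ((A \<bullet> B) \<odot> \<Delta>\<^sub>I) \<cdot> inv (r\<^sub>c (A \<bullet> B)) = inv (r\<^sub>c A \<bullet> r\<^sub>c B) \<cdot> (A \<bullet> B)"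
    by (intro circ.iso_shift) simp_all
  then show "\<zeta> A B I I \<cdot> ((A \<bullet> B) \<odot> \<Delta>\<^sub>I) \<cdot> inv (r\<^sub>c (A \<bullet> B)) = inv (r\<^sub>c A) \<bullet> inv (r\<^sub>c B)"
    by simp
qed

lemma comonoid_simps [simp]:
  assumes "comonoid X"
  shows "ob X \<in> Obj D" "comul X \<in> Arr D" "Dom D (comul X) = ob X" "Cod D (comul X) = ob X \<bullet> ob X"
    "counit X \<in> Arr D" "Dom D (counit X) = ob X" "Cod D (counit X) = J"
  using assms unfolding comonoid_def is_comonoid_def Hom_def by blast+

lemma coassoc: "comonoid X \<Longrightarrow> a\<^sub>b (ob X) (ob X) (ob X) \<cdot> (comul X \<bullet> ob X) \<cdot> comul X = (ob X \<bullet> comul X) \<cdot> comul X"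
  and counit_left: "comonoid X \<Longrightarrow> l\<^sub>b (ob X) \<cdot> (counit X \<bullet> ob X) \<cdot> comul X = ob X"
  and counit_right: "comonoid X \<Longrightarrow> r\<^sub>b (ob X) \<cdot> (ob X \<bullet> counit X) \<cdot> comul X = ob X"
  unfolding comonoid_def is_comonoid_def by blast+

lemma comonoid_mor_simps:
  assumes "comonoid_mor X Y f"
  shows "f \<in> Arr D" "Dom D f = ob X" "Cod D f = ob Y"
  using assms unfolding comonoid_mor_def Hom_def by blast+

lemma comul_mor: "comonoid_mor X Y f \<Longrightarrow> comul Y \<cdot> f = (f \<bullet> f) \<cdot> comul X"
  and counit_mor: "comonoid_mor X Y f \<Longrightarrow> counit Y \<cdot> f = counit X"
  unfolding comonoid_mor_def by blast+

lemma bimonoid_comonoid [simp]: "bimonoid H \<Longrightarrow> comonoid H"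
  unfolding bimonoid_def by blast

lemma bimonoid_simps [simp]:
  assumes "bimonoid H"
  shows "mul H \<in> Arr D" "Dom D (mul H) = ob H \<odot> ob H" "Cod D (mul H) = ob H"
    "one H \<in> Arr D" "Dom D (one H) = I" "Cod D (one H) = ob H"
  using assms unfolding bimonoid_def is_monoid_def Hom_def by blast+

lemma mul_assoc: "bimonoid H \<Longrightarrow> mul H \<cdot> (mul H \<odot> ob H) = mul H \<cdot> (ob H \<odot> mul H) \<cdot> a\<^sub>c (ob H) (ob H) (ob H)"
  and mul_unit_left: "bimonoid H \<Longrightarrow> mul H \<cdot> (one H \<odot> ob H) = l\<^sub>c (ob H)"
  and mul_unit_right: "bimonoid H \<Longrightarrow> mul H \<cdot> (ob H \<odot> one H) = r\<^sub>c (ob H)"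
  and comul_mul: "bimonoid H \<Longrightarrow> comul H \<cdot> mul H =
    (mul H \<bullet> mul H) \<cdot> \<zeta> (ob H) (ob H) (ob H) (ob H) \<cdot> (comul H \<odot> comul H)"
  and counit_mul: "bimonoid H \<Longrightarrow> counit H \<cdot> mul H = m\<^sub>J \<cdot> (counit H \<odot> counit H)"
  and comul_one: "bimonoid H \<Longrightarrow> comul H \<cdot> one H = (one H \<bullet> one H) \<cdot> \<Delta>\<^sub>I"
  and counit_one: "bimonoid H \<Longrightarrow> counit H \<cdot> one H = \<epsilon>\<^sub>I"
  unfolding bimonoid_def is_monoid_def by blast+

lemma bimonoid_mor_comonoid_mor: "bimonoid_mor X Y f \<Longrightarrow> comonoid_mor X Y f"
  and mul_mor: "bimonoid_mor X Y f \<Longrightarrow> f \<cdot> mul X = mul Y \<cdot> (f \<odot> f)"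
  and one_mor: "bimonoid_mor X Y f \<Longrightarrow> f \<cdot> one X = one Y"
  unfolding bimonoid_mor_def by blast+

lemma ob_unit_bimonoid [simp]: "ob unit_bimonoid = I" "comul unit_bimonoid = \<Delta>\<^sub>I"
    "counit unit_bimonoid = \<epsilon>\<^sub>I" "mul unit_bimonoid = l\<^sub>c I" "one unit_bimonoid = I"
  by (simp_all add: unit_bimonoid_def)

lemma l_I_eq: "r\<^sub>c I = l\<^sub>c I" and l_J_eq: "r\<^sub>b J = l\<^sub>b J"
  using circ.lunit_unit bull.lunit_unit by simp_all

text \<open>Multiplicativity of \<open>\<Delta>\<^sub>I\<close> is the left unit axiom of
  \<open>\<zeta>\<close> at \<open>A = B = I\<close>, and that of \<open>\<epsilon>\<^sub>I\<close>
  is the left unit law of the monoid \<open>J\<close>, each combined with naturality of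
  \<open>l\<^sub>c\<close>.\<close>

lemma unit_bimonoid: "bimonoid unit_bimonoid"
proof -
  have "l\<^sub>c I \<cdot> (l\<^sub>c I \<odot> I) = l\<^sub>c I \<cdot> (I \<odot> l\<^sub>c I) \<cdot> a\<^sub>c I I I"
    by (simp add: circ.triangle' l_I_eq)
  moreover have "\<Delta>\<^sub>I \<cdot> l\<^sub>c I = (l\<^sub>c I \<bullet> l\<^sub>c I) \<cdot> \<zeta> I I I I \<cdot> (\<Delta>\<^sub>I \<odot> \<Delta>\<^sub>I)"
  proof -
    have "(l\<^sub>c I \<bullet> l\<^sub>c I) \<cdot> \<zeta> I I I I \<cdot> (\<Delta>\<^sub>I \<odot> \<Delta>\<^sub>I) =
      ((l\<^sub>c I \<bullet> l\<^sub>c I) \<cdot> \<zeta> I I I I \<cdot> (\<Delta>\<^sub>I \<odot> (I \<bullet> I))) \<cdot> (I \<odot> \<Delta>\<^sub>I)"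
      by simp
    also have "\<dots> = l\<^sub>c (I \<bullet> I) \<cdot> (I \<odot> \<Delta>\<^sub>I)"
      by (subst zeta_unit_left) simp_all
    also have "\<dots> = \<Delta>\<^sub>I \<cdot> l\<^sub>c I"
      by (simp add: circ.lunit_nat)
    finally show ?thesis ..
  qed
  moreover have "\<epsilon>\<^sub>I \<cdot> l\<^sub>c I = m\<^sub>J \<cdot> (\<epsilon>\<^sub>I \<odot> \<epsilon>\<^sub>I)"
  proof -
    have "m\<^sub>J \<cdot> (\<epsilon>\<^sub>I \<odot> \<epsilon>\<^sub>I) = (m\<^sub>J \<cdot> (\<epsilon>\<^sub>I \<odot> J)) \<cdot> (I \<odot> \<epsilon>\<^sub>I)" by simp
    also have "\<dots> = \<epsilon>\<^sub>I \<cdot> l\<^sub>c I" by (simp add: m_J_unit_left circ.lunit_nat)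
    finally show ?thesis ..
  qed
  ultimately show ?thesis
    using I_comonoid by (simp add: bimonoid_def is_monoid_def comonoid_def Hom_def l_I_eq)
qed

lemma unit_bimonoid_mor:
  assumes "bimonoid H"
  shows "bimonoid_mor unit_bimonoid H (one H)"
proof -
  have "mul H \<cdot> (one H \<odot> one H) = (mul H \<cdot> (one H \<odot> ob H)) \<cdot> (I \<odot> one H)"
    using assms by simp
  also have "\<dots> = one H \<cdot> l\<^sub>c I"
    using assms by (simp add: mul_unit_left circ.lunit_nat)
  finally show ?thesis
    using assms by (simp add: bimonoid_mor_def comonoid_mor_def Hom_def comul_one counit_one)
qed

end

section \<open>The kernel of a split morphism of bimonoids\<close>

text \<open>The assumption \<open>factor\<close> is the universal property of \<open>K\<close> as an intersection.\<close>

locale split_kernel = duoidal_category D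
  for D :: "('a, 'b) duoidal_scheme" +
  fixes s :: "'a \<Rightarrow> 'a \<Rightarrow> 'a" and A H K :: "'a bimonoid" and \<pi> \<sigma> k e :: 'a
  assumes s_Hom: "X \<in> Obj D \<Longrightarrow> Y \<in> Obj D \<Longrightarrow> s X Y \<in> Hom D (X \<bullet> Y) (Y \<bullet> X)"
    and s_natural: "f \<in> Hom D X X' \<Longrightarrow> g \<in> Hom D Y Y' \<Longrightarrow> s X' Y' \<cdot> (f \<bullet> g) = (g \<bullet> f) \<cdot> s X Y"
    and s_zeta: "{X, Y, Z, W} \<subseteq> Obj D \<Longrightarrow>
      s (X \<odot> Z) (Y \<odot> W) \<cdot> \<zeta> X Y Z W = \<zeta> Y X W Z \<cdot> (s X Y \<odot> s Z W)"
    and s_Delta_I: "s I I \<cdot> \<Delta>\<^sub>I = \<Delta>\<^sub>I"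
    and bimonoid_A [simp]: "bimonoid A" and bimonoid_H [simp]: "bimonoid H" and bimonoid_K [simp]: "bimonoid K"
    and pi_mor: "bimonoid_mor A H \<pi>" and sigma_mor: "bimonoid_mor H A \<sigma>"
    and k_mor: "bimonoid_mor K A k" and e_mor: "bimonoid_mor K unit_bimonoid e"
    and pi_sigma: "\<pi> \<cdot> \<sigma> = ob H" and pi_k: "\<pi> \<cdot> k = one H \<cdot> e" and k_monic: "monic D k"
    and kk_monic: "monic D (k \<bullet> k)" and one_monic: "monic D (one H)"
    and cocommutative_A: "s (ob A) (ob A) \<cdot> comul A = comul A"
    and cocommutative_K: "s (ob K) (ob K) \<cdot> comul K = comul K"
    and factor: "f \<in> Hom D X (ob A) \<Longrightarrow> t \<in> Hom D X (ob A \<bullet> I) \<Longrightarrow>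
      (ob A \<bullet> \<pi>) \<cdot> comul A \<cdot> f = (ob A \<bullet> one H) \<cdot> t \<Longrightarrow> \<exists>h \<in> Hom D X (ob K). k \<cdot> h = f"

section \<open>Construction of the kernel as an intersection\<close>

context bull_braided_duoidal_category
begin

lemma braid_simps [simp]:
  assumes "X \<in> Obj D" "Y \<in> Obj D"
  shows "braid D X Y \<in> Arr D" "Dom D (braid D X Y) = X \<bullet> Y" "Cod D (braid D X Y) = Y \<bullet> X"
  using braiding assms unfolding is_braiding_def Hom_def by blast+

lemma braid_nat:
  assumes "f \<in> Arr D" "g \<in> Arr D" "Cod D f = X" "Cod D g = Y"
  shows "braid D X Y \<cdot> (f \<bullet> g) = (g \<bullet> f) \<cdot> braid D (Dom D f) (Dom D g)"
  using braiding assms unfolding is_braiding_def Hom_def by blast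

lemma bull_monic:
  assumes P: "bull_preserves_binary_intersections D" and "monic D f" "X \<in> Obj D"
  shows "monic D (X \<bullet> f)" "monic D (f \<bullet> X)"
proof -
  have f: "f \<in> Arr D" using assms by (simp add: monic_def)
  have "is_pullback D (X \<bullet> Dom D f) (X \<bullet> Dom D f) (X \<bullet> f) (X \<bullet> f)"
    "is_pullback D (Dom D f \<bullet> X) (Dom D f \<bullet> X) (f \<bullet> X) (f \<bullet> X)"
    using P assms circ.monic_pullback_self[OF assms(2)]
    unfolding bull_preserves_binary_intersections_def preserves_binary_intersections_def by blast+
  then show "monic D (X \<bullet> f)" "monic D (f \<bullet> X)"
    using circ.pullback_self_monic f assms(3) by (metis bull.ten_Obj circ.Dom_Obj)+
qed

lemma bull_pullback:
  assumes P: "bull_preserves_binary_intersections D" and "monic D f" "monic D g" "X \<in> Obj D"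
    "is_pullback D p q f g"
  shows "is_pullback D (X \<bullet> p) (X \<bullet> q) (X \<bullet> f) (X \<bullet> g)"
    "is_pullback D (p \<bullet> X) (q \<bullet> X) (f \<bullet> X) (g \<bullet> X)"
  using assms unfolding bull_preserves_binary_intersections_def preserves_binary_intersections_def by blast+

text \<open>The comultiplication has to land in \<open>K \<bullet> K\<close>, whereas pullbacks are
  preserved in one variable at a time. So it is lifted twice: the right leg into
  \<open>A \<bullet> K\<close>, then, after the braiding has moved \<open>K\<close> to the left, the
  remaining leg into \<open>K \<bullet> K\<close>. The axioms for \<open>K\<close> are afterwards
  checked along monomorphisms built from \<open>k\<close> and from the unit of
  \<open>H\<close>.\<close>

lemma split_kernel_exists:
  assumes inter: "has_binary_intersections D" and pres: "bull_preserves_binary_intersections D"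
    and bA [simp]: "bimonoid A" and bH [simp]: "bimonoid H"
    and pi: "bimonoid_mor A H \<pi>" and sigma: "bimonoid_mor H A \<sigma>" and ps: "\<pi> \<cdot> \<sigma> = ob H"
    and u_monic: "monic D (one H)" and coc: "cocommutative D A"
  obtains K k e where "split_kernel D (braid D) A H K \<pi> \<sigma> k e"
proof -
  note cpi = bimonoid_mor_comonoid_mor[OF pi]
  note [simp] = comonoid_mor_simps[OF cpi]
  let ?A = "ob A" and ?u = "one H"
  define \<theta> where "\<theta> = (?A \<bullet> \<pi>) \<cdot> comul A"
  have \<theta> [simp]: "\<theta> \<in> Arr D" "Dom D \<theta> = ?A" "Cod D \<theta> = ?A \<bullet> ob H"
    unfolding \<theta>_def by simp_all
  \<comment> \<open>Deleting the \<open>H\<close>-leg by its counit recovers the argument, so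
    \<open>\<theta>\<close> is a split monomorphism.\<close>
  have "(r\<^sub>b ?A \<cdot> (?A \<bullet> counit H)) \<cdot> \<theta> = ?A"
    unfolding \<theta>_def by (simp add: counit_mor[OF cpi] counit_right)
  then have \<theta>_monic: "monic D \<theta>"
    by (intro circ.split_monic[of _ "r\<^sub>b ?A \<cdot> (?A \<bullet> counit H)"]) simp_all
  have Au_monic: "monic D (?A \<bullet> ?u)"
    by (rule bull_monic[OF pres u_monic]) simp
  obtain k p where pb: "is_pullback D k p \<theta> (?A \<bullet> ?u)"
    using inter \<theta>_monic Au_monic unfolding has_binary_intersections_def by fastforce
  define K where "K = Dom D k"
  note pd = circ.pullback_data[OF pb]
  have K [simp]: "K \<in> Obj D" using pd(10) K_def by simp
  have kp [simp]: "k \<in> Arr D" "p \<in> Arr D" "Dom D k = K" "Dom D p = K" "Cod D k = ?A" "Cod D p = ?A \<bullet> I"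
    using pd(1,2,5,6,7) by (simp_all add: K_def)
  have eq: "\<theta> \<cdot> k = (?A \<bullet> ?u) \<cdot> p" by (rule pd(9))
  have k_monic: "monic D k" by (rule circ.pullback_monic[OF pb Au_monic])
  note mono = bull_monic[OF pres]
  \<comment> \<open>\<open>\<theta>\<close> is a morphism of left \<open>A\<close>-comodules; this
    feeds the pullbacks obtained by tensoring on the left.\<close>
  have coassoc_\<theta>: "(?A \<bullet> \<theta>) \<cdot> comul A = a\<^sub>b ?A ?A (ob H) \<cdot> (comul A \<bullet> ob H) \<cdot> \<theta>"
  proof -
    have "(?A \<bullet> \<theta>) \<cdot> comul A = (?A \<bullet> (?A \<bullet> \<pi>)) \<cdot> (?A \<bullet> comul A) \<cdot> comul A"
      unfolding \<theta>_def by simp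
    also have "\<dots> = ((?A \<bullet> (?A \<bullet> \<pi>)) \<cdot> a\<^sub>b ?A ?A ?A) \<cdot> (comul A \<bullet> ?A) \<cdot> comul A"
      by (subst coassoc[symmetric]) simp_all
    also have "\<dots> = (a\<^sub>b ?A ?A (ob H) \<cdot> ((?A \<bullet> ?A) \<bullet> \<pi>)) \<cdot> (comul A \<bullet> ?A) \<cdot> comul A"
      by (subst bull.assoc_nat) simp_all
    also have "\<dots> = a\<^sub>b ?A ?A (ob H) \<cdot> (comul A \<bullet> ob H) \<cdot> \<theta>"
      unfolding \<theta>_def by simp
    finally show ?thesis .
  qed
  \<comment> \<open>The other coassociativity: \<open>\<theta>\<close> is a right coaction of
    \<open>H\<close> on \<open>A\<close>. It is what lets the second leg \<open>p\<close> of the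
    intersection lift along \<open>k \<bullet> I\<close>.\<close>
  have \<theta>_coassoc: "(\<theta> \<bullet> ob H) \<cdot> \<theta> = inv (a\<^sub>b ?A (ob H) (ob H)) \<cdot> (?A \<bullet> comul H) \<cdot> \<theta>"
  proof -
    have "a\<^sub>b ?A (ob H) (ob H) \<cdot> (\<theta> \<bullet> ob H) \<cdot> \<theta> =
      (a\<^sub>b ?A (ob H) (ob H) \<cdot> ((?A \<bullet> \<pi>) \<bullet> \<pi>)) \<cdot> (comul A \<bullet> ?A) \<cdot> comul A"
      unfolding \<theta>_def by simp
    also have "\<dots> = (?A \<bullet> (\<pi> \<bullet> \<pi>)) \<cdot> a\<^sub>b ?A ?A ?A \<cdot> (comul A \<bullet> ?A) \<cdot> comul A"
      by (simp add: bull.assoc_nat)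
    also have "\<dots> = (?A \<bullet> comul H) \<cdot> \<theta>"
      unfolding \<theta>_def by (simp add: coassoc comul_mor[OF cpi])
    finally show ?thesis
      by (intro circ.iso_shift) simp_all
  qed
  \<comment> \<open>Universal property after applying \<open>A \<bullet> -\<close>. The second leg
    of the cone is the comultiplication applied to the \<open>A\<close>-leg of \<open>p\<close>, as
    left colinearity of \<open>\<theta>\<close> suggests.\<close>
  obtain d1 where d1 [simp]: "d1 \<in> Arr D" "Dom D d1 = K" "Cod D d1 = ?A \<bullet> K"
    and d1_eq: "(?A \<bullet> k) \<cdot> d1 = comul A \<cdot> k"
  proof (rule circ.pullback_ex[OF bull_pullback(1)[OF pres \<theta>_monic Au_monic _ pb],
        of ?A "comul A \<cdot> k" "a\<^sub>b ?A ?A I \<cdot> (comul A \<bullet> I) \<cdot> p"])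
    have "(?A \<bullet> \<theta>) \<cdot> comul A \<cdot> k = a\<^sub>b ?A ?A (ob H) \<cdot> (comul A \<bullet> ob H) \<cdot> \<theta> \<cdot> k"
      by (simp add: circ.comp_rewrite[OF coassoc_\<theta>])
    also have "\<dots> = (a\<^sub>b ?A ?A (ob H) \<cdot> ((?A \<bullet> ?A) \<bullet> ?u)) \<cdot> (comul A \<bullet> I) \<cdot> p"
      by (simp add: eq)
    also have "\<dots> = (?A \<bullet> (?A \<bullet> ?u)) \<cdot> a\<^sub>b ?A ?A I \<cdot> (comul A \<bullet> I) \<cdot> p"
      by (subst bull.assoc_nat) simp_all
    finally show "(?A \<bullet> \<theta>) \<cdot> comul A \<cdot> k = (?A \<bullet> (?A \<bullet> ?u)) \<cdot> a\<^sub>b ?A ?A I \<cdot> (comul A \<bullet> I) \<cdot> p" .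
  qed simp_all
  \<comment> \<open>The braiding moves the lifted leg to the left; by cocommutativity of
    \<open>A\<close> the result still restricts the comultiplication.\<close>
  define d2 where "d2 = braid D ?A K \<cdot> d1"
  have d2 [simp]: "d2 \<in> Arr D" "Dom D d2 = K" "Cod D d2 = K \<bullet> ?A"
    unfolding d2_def by simp_all
  have d2_eq: "(k \<bullet> ?A) \<cdot> d2 = comul A \<cdot> k"
  proof -
    have "(k \<bullet> ?A) \<cdot> d2 = (braid D ?A ?A \<cdot> (?A \<bullet> k)) \<cdot> d1"
      unfolding d2_def by (subst braid_nat) simp_all
    also have "\<dots> = (braid D ?A ?A \<cdot> comul A) \<cdot> k" by (simp add: d1_eq)
    also have "\<dots> = comul A \<cdot> k" using coc by (simp add: cocommutative_def)
    finally show ?thesis .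
  qed
  \<comment> \<open>\<open>p\<close> itself takes values in \<open>K \<bullet> I\<close>. Its cone
    is tested after the monomorphism \<open>(A \<bullet> H) \<bullet> u\<close>, where
    \<open>(A \<bullet> u) \<cdot> p\<close> can be traded for
    \<open>\<theta> \<cdot> k\<close>.\<close>
  obtain p' where p' [simp]: "p' \<in> Arr D" "Dom D p' = K" "Cod D p' = K \<bullet> I"
    and p'_eq: "(k \<bullet> I) \<cdot> p' = p"
  proof (rule circ.pullback_ex[OF bull_pullback(2)[OF pres \<theta>_monic Au_monic _ pb],
        of I p "inv (a\<^sub>b ?A I I) \<cdot> (?A \<bullet> \<Delta>\<^sub>I) \<cdot> p"])
    show "(\<theta> \<bullet> I) \<cdot> p = ((?A \<bullet> ?u) \<bullet> I) \<cdot> inv (a\<^sub>b ?A I I) \<cdot> (?A \<bullet> \<Delta>\<^sub>I) \<cdot> p"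
    proof (rule circ.monicD[OF mono(1)[OF u_monic, of "?A \<bullet> ob H"], rotated -1])
      have "((?A \<bullet> ob H) \<bullet> ?u) \<cdot> (\<theta> \<bullet> I) \<cdot> p = ((\<theta> \<bullet> ob H) \<cdot> \<theta>) \<cdot> k"
        by (simp add: eq)
      also have "\<dots> = inv (a\<^sub>b ?A (ob H) (ob H)) \<cdot> (?A \<bullet> comul H) \<cdot> (?A \<bullet> ?u) \<cdot> p"
        by (simp add: \<theta>_coassoc eq)
      also have "\<dots> = (inv (a\<^sub>b ?A (ob H) (ob H)) \<cdot> (?A \<bullet> (?u \<bullet> ?u))) \<cdot> (?A \<bullet> \<Delta>\<^sub>I) \<cdot> p"
        by (simp add: comul_one)
      also have "\<dots> = ((?A \<bullet> ob H) \<bullet> ?u) \<cdot> ((?A \<bullet> ?u) \<bullet> I) \<cdot> inv (a\<^sub>b ?A I I) \<cdot> (?A \<bullet> \<Delta>\<^sub>I) \<cdot> p"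
        by (simp add: bull.Inv_assoc_nat)
      finally show "((?A \<bullet> ob H) \<bullet> ?u) \<cdot> (\<theta> \<bullet> I) \<cdot> p =
        ((?A \<bullet> ob H) \<bullet> ?u) \<cdot> ((?A \<bullet> ?u) \<bullet> I) \<cdot> inv (a\<^sub>b ?A I I) \<cdot> (?A \<bullet> \<Delta>\<^sub>I) \<cdot> p" .
    qed simp_all
  qed simp_all
  \<comment> \<open>The remaining leg of \<open>d2\<close> lifts by the pullback under
    \<open>K \<bullet> -\<close>. The cone is checked after the monomorphism
    \<open>k \<bullet> (A \<bullet> H)\<close>, where \<open>d2\<close> becomes the comultiplication
    of \<open>A\<close>.\<close>
  obtain dK where dK [simp]: "dK \<in> Arr D" "Dom D dK = K" "Cod D dK = K \<bullet> K"
    and dK_eq': "(K \<bullet> k) \<cdot> dK = d2"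
  proof (rule circ.pullback_ex[OF bull_pullback(1)[OF pres \<theta>_monic Au_monic _ pb],
        of K d2 "a\<^sub>b K ?A I \<cdot> (d2 \<bullet> I) \<cdot> p'"])
    show "(K \<bullet> \<theta>) \<cdot> d2 = (K \<bullet> (?A \<bullet> ?u)) \<cdot> a\<^sub>b K ?A I \<cdot> (d2 \<bullet> I) \<cdot> p'"
    proof (rule circ.monicD[OF mono(2)[OF k_monic, of "?A \<bullet> ob H"], rotated -1])
      have "(k \<bullet> (?A \<bullet> ob H)) \<cdot> (K \<bullet> \<theta>) \<cdot> d2 = (?A \<bullet> \<theta>) \<cdot> (k \<bullet> ?A) \<cdot> d2"
        by simp
      also have "\<dots> = ((?A \<bullet> \<theta>) \<cdot> comul A) \<cdot> k"
        by (simp only: d2_eq) simp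
      also have "\<dots> = a\<^sub>b ?A ?A (ob H) \<cdot> (comul A \<bullet> ob H) \<cdot> (?A \<bullet> ?u) \<cdot> p"
        by (simp add: coassoc_\<theta> eq)
      also have "\<dots> = (a\<^sub>b ?A ?A (ob H) \<cdot> ((?A \<bullet> ?A) \<bullet> ?u)) \<cdot> ((comul A \<cdot> k) \<bullet> I) \<cdot> p'"
        by (subst p'_eq[symmetric]) simp
      also have "\<dots> = (?A \<bullet> (?A \<bullet> ?u)) \<cdot> (a\<^sub>b ?A ?A I \<cdot> ((k \<bullet> ?A) \<bullet> I)) \<cdot> (d2 \<bullet> I) \<cdot> p'"
        by (subst bull.assoc_nat) (simp_all add: d2_eq)
      also have "\<dots> = (k \<bullet> (?A \<bullet> ob H)) \<cdot> (K \<bullet> (?A \<bullet> ?u)) \<cdot> a\<^sub>b K ?A I \<cdot> (d2 \<bullet> I) \<cdot> p'"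
        by (subst bull.assoc_nat) simp_all
      finally show "(k \<bullet> (?A \<bullet> ob H)) \<cdot> (K \<bullet> \<theta>) \<cdot> d2 =
        (k \<bullet> (?A \<bullet> ob H)) \<cdot> (K \<bullet> (?A \<bullet> ?u)) \<cdot> a\<^sub>b K ?A I \<cdot> (d2 \<bullet> I) \<cdot> p'" .
    qed simp_all
  qed simp_all
  have dK_eq: "(k \<bullet> k) \<cdot> dK = comul A \<cdot> k"
  proof -
    have "(k \<bullet> k) \<cdot> dK = (k \<bullet> ?A) \<cdot> (K \<bullet> k) \<cdot> dK" by simp
    also have "\<dots> = comul A \<cdot> k" by (simp only: dK_eq' d2_eq)
    finally show ?thesis .
  qed
  \<comment> \<open>Forgetting the \<open>A\<close>-leg of \<open>p\<close> by the counit gives the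
    second projection of the pullback square over \<open>u\<close>.\<close>
  define e where "e = l\<^sub>b I \<cdot> (counit A \<bullet> I) \<cdot> p"
  have e [simp]: "e \<in> Arr D" "Dom D e = K" "Cod D e = I"
    unfolding e_def by simp_all
  have ue: "\<pi> \<cdot> k = ?u \<cdot> e"
  proof -
    have "?u \<cdot> e = (?u \<cdot> l\<^sub>b I) \<cdot> (counit A \<bullet> I) \<cdot> p" unfolding e_def by simp
    also have "\<dots> = (l\<^sub>b (ob H) \<cdot> (J \<bullet> ?u)) \<cdot> (counit A \<bullet> I) \<cdot> p" by (subst bull.lunit_nat) simp_all
    also have "\<dots> = l\<^sub>b (ob H) \<cdot> (counit A \<bullet> ob H) \<cdot> (?A \<bullet> ?u) \<cdot> p" by simp
    also have "\<dots> = l\<^sub>b (ob H) \<cdot> (counit A \<bullet> ob H) \<cdot> \<theta> \<cdot> k" by (simp only: eq)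
    also have "\<dots> = (l\<^sub>b (ob H) \<cdot> (J \<bullet> \<pi>)) \<cdot> (counit A \<bullet> ?A) \<cdot> comul A \<cdot> k"
      unfolding \<theta>_def by simp
    also have "\<dots> = \<pi> \<cdot> (l\<^sub>b ?A \<cdot> (counit A \<bullet> ?A) \<cdot> comul A) \<cdot> k"
      by (subst bull.lunit_nat) simp_all
    also have "\<dots> = \<pi> \<cdot> k" by (simp add: counit_left)
    finally show ?thesis ..
  qed
  have kk_monic: "monic D (k \<bullet> k)"
  proof -
    have "monic D ((k \<bullet> ?A) \<cdot> (K \<bullet> k))"
      by (rule circ.monic_comp) (simp_all add: mono k_monic)
    then show ?thesis by simp
  qed
  have kkk_monic: "monic D (k \<bullet> (k \<bullet> k))"
  proof -
    have "monic D ((k \<bullet> (?A \<bullet> ?A)) \<cdot> (K \<bullet> (k \<bullet> k)))"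
      by (rule circ.monic_comp) (simp_all add: mono k_monic kk_monic)
    then show ?thesis by simp
  qed
  have uu_monic: "monic D (?u \<bullet> ?u)"
  proof -
    have "monic D ((?u \<bullet> ob H) \<cdot> (I \<bullet> ?u))"
      by (rule circ.monic_comp) (simp_all add: mono u_monic)
    then show ?thesis by simp
  qed
  define eK where "eK = counit A \<cdot> k"
  have eK [simp]: "eK \<in> Arr D" "Dom D eK = K" "Cod D eK = J"
    unfolding eK_def by simp_all
  have K_coassoc: "a\<^sub>b K K K \<cdot> (dK \<bullet> K) \<cdot> dK = (K \<bullet> dK) \<cdot> dK"
  proof (rule circ.monicD[OF kkk_monic, rotated -1])
    have "(k \<bullet> (k \<bullet> k)) \<cdot> a\<^sub>b K K K \<cdot> (dK \<bullet> K) \<cdot> dK = (a\<^sub>b ?A ?A ?A \<cdot> ((k \<bullet> k) \<bullet> k)) \<cdot> (dK \<bullet> K) \<cdot> dK"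
      by (subst bull.assoc_nat) simp_all
    also have "\<dots> = a\<^sub>b ?A ?A ?A \<cdot> (comul A \<bullet> ?A) \<cdot> (k \<bullet> k) \<cdot> dK"
      by (simp flip: dK_eq)
    also have "\<dots> = (?A \<bullet> comul A) \<cdot> (k \<bullet> k) \<cdot> dK"
      by (simp only: dK_eq) (simp add: circ.comp_rewrite2[OF coassoc])
    also have "\<dots> = (k \<bullet> (k \<bullet> k)) \<cdot> (K \<bullet> dK) \<cdot> dK"
      by (simp flip: dK_eq)
    finally show "(k \<bullet> (k \<bullet> k)) \<cdot> a\<^sub>b K K K \<cdot> (dK \<bullet> K) \<cdot> dK = (k \<bullet> (k \<bullet> k)) \<cdot> (K \<bullet> dK) \<cdot> dK" .
  qed simp_all
  have K_counit_left: "l\<^sub>b K \<cdot> (eK \<bullet> K) \<cdot> dK = K"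
  proof (rule circ.monicD[OF k_monic, rotated -1])
    have "k \<cdot> l\<^sub>b K \<cdot> (eK \<bullet> K) \<cdot> dK = (l\<^sub>b ?A \<cdot> (J \<bullet> k)) \<cdot> (eK \<bullet> K) \<cdot> dK"
      by (subst bull.lunit_nat) simp_all
    also have "\<dots> = l\<^sub>b ?A \<cdot> (counit A \<bullet> ?A) \<cdot> (k \<bullet> k) \<cdot> dK"
      by (simp add: eK_def)
    also have "\<dots> = k \<cdot> K"
      by (simp only: dK_eq) (simp add: circ.comp_rewrite2[OF counit_left])
    finally show "k \<cdot> l\<^sub>b K \<cdot> (eK \<bullet> K) \<cdot> dK = k \<cdot> K" .
  qed simp_all
  have K_counit_right: "r\<^sub>b K \<cdot> (K \<bullet> eK) \<cdot> dK = K"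
  proof (rule circ.monicD[OF k_monic, rotated -1])
    have "k \<cdot> r\<^sub>b K \<cdot> (K \<bullet> eK) \<cdot> dK = (r\<^sub>b ?A \<cdot> (k \<bullet> J)) \<cdot> (K \<bullet> eK) \<cdot> dK"
      by (subst bull.runit_nat) simp_all
    also have "\<dots> = r\<^sub>b ?A \<cdot> (?A \<bullet> counit A) \<cdot> (k \<bullet> k) \<cdot> dK"
      by (simp add: eK_def)
    also have "\<dots> = k \<cdot> K"
      by (simp only: dK_eq) (simp add: circ.comp_rewrite2[OF counit_right])
    finally show "k \<cdot> r\<^sub>b K \<cdot> (K \<bullet> eK) \<cdot> dK = k \<cdot> K" .
  qed simp_all
  have e_comul: "\<Delta>\<^sub>I \<cdot> e = (e \<bullet> e) \<cdot> dK"
  proof (rule circ.monicD[OF uu_monic, rotated -1])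
    have "(?u \<bullet> ?u) \<cdot> \<Delta>\<^sub>I \<cdot> e = comul H \<cdot> ?u \<cdot> e"
      by (simp add: circ.comp_rewrite[OF comul_one])
    also have "\<dots> = (\<pi> \<bullet> \<pi>) \<cdot> comul A \<cdot> k"
      by (simp flip: ue add: circ.comp_rewrite[OF comul_mor[OF cpi]])
    also have "\<dots> = (?u \<bullet> ?u) \<cdot> (e \<bullet> e) \<cdot> dK"
      by (simp add: ue flip: dK_eq)
    finally show "(?u \<bullet> ?u) \<cdot> \<Delta>\<^sub>I \<cdot> e = (?u \<bullet> ?u) \<cdot> (e \<bullet> e) \<cdot> dK" .
  qed simp_all
  have e_counit: "\<epsilon>\<^sub>I \<cdot> e = eK"
  proof -
    have "eK = counit H \<cdot> \<pi> \<cdot> k" unfolding eK_def by (simp add: circ.comp_rewrite[OF counit_mor[OF cpi]])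
    also have "\<dots> = \<epsilon>\<^sub>I \<cdot> e" by (simp add: ue circ.comp_rewrite[OF counit_one])
    finally show ?thesis ..
  qed
  have factor: "\<exists>h. h \<in> Arr D \<and> Dom D h = Dom D f \<and> Cod D h = K \<and> k \<cdot> h = f"
    if f: "f \<in> Arr D" "Cod D f = ?A" "t \<in> Arr D" "Dom D t = Dom D f" "Cod D t = ?A \<bullet> I"
      "\<theta> \<cdot> f = (?A \<bullet> ?u) \<cdot> t" for f t
    by (rule circ.pullback_ex[OF pb, of f t]) (use f in auto)
  \<comment> \<open>The factorisation criterion in the form used for the structure of
    \<open>K\<close>: a morphism \<open>d\<close> that makes \<open>f\<close> comultiplicative
    yields the witness \<open>(f \<bullet> g) \<cdot> d\<close>. It is applied with the
    comultiplication of \<open>K \<odot> K\<close> and with \<open>\<Delta>\<^sub>I\<close>.\<close>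
  have factor': "\<exists>h. h \<in> Arr D \<and> Dom D h = Dom D f \<and> Cod D h = K \<and> k \<cdot> h = f"
    if f [simp]: "f \<in> Arr D" "Cod D f = ?A" "g \<in> Arr D" "Dom D g = Dom D f" "Cod D g = I"
      "d \<in> Arr D" "Dom D d = Dom D f" "Cod D d = Dom D f \<bullet> Dom D f"
      and "comul A \<cdot> f = (f \<bullet> f) \<cdot> d" "\<pi> \<cdot> f = ?u \<cdot> g" for f g d
  proof (rule factor[of f "(f \<bullet> g) \<cdot> d"])
    show "\<theta> \<cdot> f = (?A \<bullet> ?u) \<cdot> (f \<bullet> g) \<cdot> d"
      unfolding \<theta>_def using that(9,10) by simp
  qed simp_all
  note mulmor = mul_mor[OF pi]
  have k_comul: "comul A \<cdot> mul A \<cdot> (k \<odot> k) = ((mul A \<cdot> (k \<odot> k)) \<bullet> (mul A \<cdot> (k \<odot> k))) \<cdot> \<zeta> K K K K \<cdot> (dK \<odot> dK)"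
  proof -
    have "comul A \<cdot> mul A \<cdot> (k \<odot> k) = (mul A \<bullet> mul A) \<cdot> \<zeta> ?A ?A ?A ?A \<cdot> ((comul A \<cdot> k) \<odot> (comul A \<cdot> k))"
      by (simp add: circ.comp_rewrite[OF comul_mul])
    also have "\<dots> = (mul A \<bullet> mul A) \<cdot> (\<zeta> ?A ?A ?A ?A \<cdot> ((k \<bullet> k) \<odot> (k \<bullet> k))) \<cdot> (dK \<odot> dK)"
      by (simp add: dK_eq)
    also have "\<dots> = ((mul A \<cdot> (k \<odot> k)) \<bullet> (mul A \<cdot> (k \<odot> k))) \<cdot> \<zeta> K K K K \<cdot> (dK \<odot> dK)"
      by (subst zeta_nat) simp_all
    finally show ?thesis .
  qed
  obtain mK where mK [simp]: "mK \<in> Arr D" "Dom D mK = K \<odot> K" "Cod D mK = K"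
    and mK_eq: "k \<cdot> mK = mul A \<cdot> (k \<odot> k)"
  proof -
    \<comment> \<open>The product of two elements over the unit lies over the unit, since
      \<open>one H\<close> is a morphism of monoids.\<close>
    have "\<pi> \<cdot> mul A \<cdot> (k \<odot> k) = mul H \<cdot> (one H \<odot> one H) \<cdot> (e \<odot> e)"
      by (simp add: circ.comp_rewrite[OF mulmor] ue)
    also have "\<dots> = one H \<cdot> l\<^sub>c I \<cdot> (e \<odot> e)"
      using mul_mor[OF unit_bimonoid_mor[OF bH]] by (simp add: circ.comp_rewrite)
    finally have "\<pi> \<cdot> mul A \<cdot> (k \<odot> k) = one H \<cdot> l\<^sub>c I \<cdot> (e \<odot> e)" .
    then show ?thesis
      using factor'[of "mul A \<cdot> (k \<odot> k)" "l\<^sub>c I \<cdot> (e \<odot> e)" "\<zeta> K K K K \<cdot> (dK \<odot> dK)"] that k_comul by auto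
  qed
  obtain uK where uK [simp]: "uK \<in> Arr D" "Dom D uK = I" "Cod D uK = K" and uK_eq: "k \<cdot> uK = one A"
    using factor'[of "one A" I \<Delta>\<^sub>I] by (auto simp: comul_one one_mor[OF pi])
  let ?K = "\<lparr>ob = K, comul = dK, counit = eK, mul = mK, one = uK\<rparr>"
  have ck: "comonoid_mor ?K A k"
    by (simp add: comonoid_mor_def Hom_def dK_eq eK_def)
  have com_K: "comonoid ?K"
    by (simp add: comonoid_def is_comonoid_def Hom_def K_coassoc K_counit_left K_counit_right)
  have m_assoc: "mK \<cdot> (mK \<odot> K) = mK \<cdot> (K \<odot> mK) \<cdot> a\<^sub>c K K K"
  proof (rule circ.monicD[OF k_monic, rotated -1])
    have "k \<cdot> mK \<cdot> (mK \<odot> K) = mul A \<cdot> (mul A \<odot> ?A) \<cdot> ((k \<odot> k) \<odot> k)"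
      by (simp add: circ.comp_rewrite[OF mK_eq] mK_eq)
    also have "\<dots> = mul A \<cdot> (?A \<odot> mul A) \<cdot> a\<^sub>c ?A ?A ?A \<cdot> ((k \<odot> k) \<odot> k)"
      by (subst circ.comp_rewrite[OF mul_assoc]) simp_all
    also have "\<dots> = mul A \<cdot> (?A \<odot> mul A) \<cdot> (k \<odot> (k \<odot> k)) \<cdot> a\<^sub>c K K K"
      by (subst circ.assoc_nat) simp_all
    also have "\<dots> = k \<cdot> mK \<cdot> (K \<odot> mK) \<cdot> a\<^sub>c K K K"
      by (simp add: circ.comp_rewrite[OF mK_eq] mK_eq)
    finally show "k \<cdot> mK \<cdot> (mK \<odot> K) = k \<cdot> mK \<cdot> (K \<odot> mK) \<cdot> a\<^sub>c K K K" .
  qed simp_all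
  have m_left: "mK \<cdot> (uK \<odot> K) = l\<^sub>c K"
  proof (rule circ.monicD[OF k_monic, rotated -1])
    have "k \<cdot> mK \<cdot> (uK \<odot> K) = mul A \<cdot> (one A \<odot> ?A) \<cdot> (I \<odot> k)"
      by (simp add: circ.comp_rewrite[OF mK_eq] uK_eq)
    also have "\<dots> = l\<^sub>c ?A \<cdot> (I \<odot> k)"
      by (rule circ.comp_rewrite[OF mul_unit_left]) simp_all
    also have "\<dots> = k \<cdot> l\<^sub>c K"
      by (subst circ.lunit_nat) simp_all
    finally show "k \<cdot> mK \<cdot> (uK \<odot> K) = k \<cdot> l\<^sub>c K" .
  qed simp_all
  have m_right: "mK \<cdot> (K \<odot> uK) = r\<^sub>c K"
  proof (rule circ.monicD[OF k_monic, rotated -1])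
    have "k \<cdot> mK \<cdot> (K \<odot> uK) = mul A \<cdot> (?A \<odot> one A) \<cdot> (k \<odot> I)"
      by (simp add: circ.comp_rewrite[OF mK_eq] uK_eq)
    also have "\<dots> = r\<^sub>c ?A \<cdot> (k \<odot> I)"
      by (rule circ.comp_rewrite[OF mul_unit_right]) simp_all
    also have "\<dots> = k \<cdot> r\<^sub>c K"
      by (subst circ.runit_nat) simp_all
    finally show "k \<cdot> mK \<cdot> (K \<odot> uK) = k \<cdot> r\<^sub>c K" .
  qed simp_all
  have m_comul: "dK \<cdot> mK = (mK \<bullet> mK) \<cdot> \<zeta> K K K K \<cdot> (dK \<odot> dK)"
  proof (rule circ.monicD[OF kk_monic, rotated -1])
    have "(k \<bullet> k) \<cdot> dK \<cdot> mK = comul A \<cdot> mul A \<cdot> (k \<odot> k)"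
      by (simp add: circ.comp_rewrite[OF dK_eq] mK_eq)
    also have "\<dots> = (k \<bullet> k) \<cdot> (mK \<bullet> mK) \<cdot> \<zeta> K K K K \<cdot> (dK \<odot> dK)"
      by (simp add: k_comul mK_eq)
    finally show "(k \<bullet> k) \<cdot> dK \<cdot> mK = (k \<bullet> k) \<cdot> (mK \<bullet> mK) \<cdot> \<zeta> K K K K \<cdot> (dK \<odot> dK)" .
  qed simp_all
  have m_counit: "eK \<cdot> mK = m\<^sub>J \<cdot> (eK \<odot> eK)"
    by (simp add: eK_def mK_eq circ.comp_rewrite[OF counit_mul])
  have u_comul: "dK \<cdot> uK = (uK \<bullet> uK) \<cdot> \<Delta>\<^sub>I"
  proof (rule circ.monicD[OF kk_monic, rotated -1])
    show "(k \<bullet> k) \<cdot> dK \<cdot> uK = (k \<bullet> k) \<cdot> (uK \<bullet> uK) \<cdot> \<Delta>\<^sub>I"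
      by (simp add: circ.comp_rewrite[OF dK_eq] uK_eq comul_one)
  qed simp_all
  have u_counit: "eK \<cdot> uK = \<epsilon>\<^sub>I"
    by (simp add: eK_def uK_eq counit_one)
  have bK: "bimonoid ?K"
    using com_K by (simp add: bimonoid_def is_monoid_def Hom_def m_assoc m_left m_right m_comul m_counit u_comul u_counit)
  have bk: "bimonoid_mor ?K A k"
    using ck by (simp add: bimonoid_mor_def mK_eq uK_eq)
  \<comment> \<open>As \<open>one H\<close> is a monomorphism, multiplicativity and unitality of
    \<open>e\<close> can be read off from those of \<open>\<pi> \<cdot> k\<close>.\<close>
  have "e \<cdot> mK = l\<^sub>c I \<cdot> (e \<odot> e)"
  proof (rule circ.monicD[OF u_monic, rotated -1])
    have "?u \<cdot> e \<cdot> mK = \<pi> \<cdot> k \<cdot> mK"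
      by (simp add: circ.comp_rewrite[OF ue])
    also have "\<dots> = mul H \<cdot> (?u \<odot> ?u) \<cdot> (e \<odot> e)"
      by (simp add: mK_eq circ.comp_rewrite[OF mulmor] ue)
    also have "\<dots> = one H \<cdot> l\<^sub>c I \<cdot> (e \<odot> e)"
      using mul_mor[OF unit_bimonoid_mor[OF bH]] by (simp add: circ.comp_rewrite)
    finally show "?u \<cdot> e \<cdot> mK = ?u \<cdot> l\<^sub>c I \<cdot> (e \<odot> e)" .
  qed simp_all
  moreover have "e \<cdot> uK = I"
  proof (rule circ.monicD[OF u_monic, rotated -1])
    have "?u \<cdot> e \<cdot> uK = \<pi> \<cdot> k \<cdot> uK"
      by (simp add: circ.comp_rewrite[OF ue])
    then show "?u \<cdot> e \<cdot> uK = ?u \<cdot> I" by (simp add: uK_eq one_mor[OF pi])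
  qed simp_all
  ultimately have be: "bimonoid_mor ?K unit_bimonoid e"
    by (simp add: bimonoid_mor_def comonoid_mor_def Hom_def e_comul e_counit)
  have cocK: "braid D K K \<cdot> dK = dK"
  proof (rule circ.monicD[OF kk_monic, rotated -1])
    have "(k \<bullet> k) \<cdot> braid D K K \<cdot> dK = (braid D ?A ?A \<cdot> (k \<bullet> k)) \<cdot> dK"
      by (subst braid_nat) simp_all
    also have "\<dots> = (braid D ?A ?A \<cdot> comul A) \<cdot> k" by (simp add: dK_eq)
    also have "\<dots> = (k \<bullet> k) \<cdot> dK" using coc by (simp add: cocommutative_def dK_eq)
    finally show "(k \<bullet> k) \<cdot> braid D K K \<cdot> dK = (k \<bullet> k) \<cdot> dK" .
  qed simp_all
  have "split_kernel D (braid D) A H ?K \<pi> \<sigma> k e"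
  proof unfold_locales
    fix f X t assume "f \<in> Hom D X (ob A)" "t \<in> Hom D X (ob A \<bullet> I)"
      "(ob A \<bullet> \<pi>) \<cdot> comul A \<cdot> f = (ob A \<bullet> one H) \<cdot> t"
    then show "\<exists>h\<in>Hom D X (ob ?K). k \<cdot> h = f"
      using factor[of f t] by (auto simp: Hom_def \<theta>_def)
  next
    fix X Y Z W assume "{X, Y, Z, W} \<subseteq> Obj D"
    then show "braid D (X \<odot> Z) (Y \<odot> W) \<cdot> \<zeta> X Y Z W = \<zeta> Y X W Z \<cdot> (braid D X Y \<odot> braid D Z W)"
      using braid_zeta by blast
  next
    show "braid D (ob ?K) (ob ?K) \<cdot> comul ?K = comul ?K" using cocK by simp
  qed (use pi sigma ps k_monic kk_monic u_monic coc bK bk be ue in \<open>auto simp: Hom_def braid_nat braid_Delta_I cocommutative_def\<close>)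
  then show ?thesis by (rule that)
qed

end

section \<open>Reversions\<close>

context reversion_syntax
begin

text \<open>The two antipode equations are separated because each of the two composites of the
  Galois maps uses one of them, and because reversing the tensor products exchanges them.\<close>

definition right_antipode :: "'a bimonoid \<Rightarrow> 'a \<Rightarrow> bool" where
  "right_antipode H S \<longleftrightarrow>
     S \<in> Hom D (ob H) ((ob H)\<^sup>-) \<and>
     ((mul H \<bullet> I) \<odot> J) \<cdot> \<phi> (ob H) (ob H) \<cdot> (ob H \<bullet> S) \<cdot> comul H =
       ((one H \<bullet> I) \<odot> J) \<cdot> (\<Delta>\<^sub>I \<odot> J) \<cdot> inv (l\<^sub>c J) \<cdot> counit H"

definition left_antipode :: "'a bimonoid \<Rightarrow> 'a \<Rightarrow> bool" where
  "left_antipode H S \<longleftrightarrow>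
     S \<in> Hom D (ob H) ((ob H)\<^sup>-) \<and>
     (J \<odot> (I \<bullet> mul H)) \<cdot> \<psi> (ob H) (ob H) \<cdot> (S \<bullet> ob H) \<cdot> comul H =
       (J \<odot> (I \<bullet> one H)) \<cdot> (J \<odot> \<Delta>\<^sub>I) \<cdot> inv (r\<^sub>c J) \<cdot> counit H"

lemma is_antipode_iff: "is_antipode H S \<longleftrightarrow> left_antipode H S \<and> right_antipode H S"
  unfolding is_antipode_def left_antipode_def right_antipode_def by blast

end

text \<open>A part of the structure of a reversion that is stable under reversing both tensor products:
  \<open>\<gamma>\<close> and \<open>\<delta>\<close> are exchanged.\<close>

locale semi_reversion = reversion_syntax D R + duoidal_category D
  for D :: "('a, 'b) duoidal_scheme" and R :: "'a reversion_data" +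
  assumes rv_endofunctor: "is_endofunctor D (rv R)"
    and phi_c0_Hom: "\<phi>\<^sub>c\<^sub>0 \<in> Hom D I (I\<^sup>-)"
    and phi_c_Hom: "X \<in> Obj D \<Longrightarrow> Y \<in> Obj D \<Longrightarrow> \<phi>\<^sub>c X Y \<in> Hom D (X\<^sup>- \<odot> Y\<^sup>-) ((Y \<odot> X)\<^sup>-)"
    and phi_b_Hom: "X \<in> Obj D \<Longrightarrow> Y \<in> Obj D \<Longrightarrow> \<phi>\<^sub>b X Y \<in> Hom D (X\<^sup>- \<bullet> Y\<^sup>-) ((Y \<bullet> X)\<^sup>-)"
    and phi_c_unit_left: "X \<in> Obj D \<Longrightarrow> (r\<^sub>c X)\<^sup>- \<cdot> \<phi>\<^sub>c I X \<cdot> (\<phi>\<^sub>c\<^sub>0 \<odot> X\<^sup>-) = l\<^sub>c (X\<^sup>-)"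
    and phi_c_unit_right: "X \<in> Obj D \<Longrightarrow> (l\<^sub>c X)\<^sup>- \<cdot> \<phi>\<^sub>c X I \<cdot> (X\<^sup>- \<odot> \<phi>\<^sub>c\<^sub>0) = r\<^sub>c (X\<^sup>-)"
    and gamma_Hom: "{X, Y, Z, T} \<subseteq> Obj D \<Longrightarrow>
      \<gamma> X Y Z T \<in> Hom D (((X \<bullet> Y\<^sup>-) \<odot> Z) \<bullet> T) (X \<odot> (Z \<bullet> (Y \<odot> T)))"
    and gamma_natural:
      "f \<in> Hom D X X' \<Longrightarrow> g \<in> Hom D Y Y' \<Longrightarrow> h \<in> Hom D Z Z' \<Longrightarrow> k \<in> Hom D T T' \<Longrightarrow>
      \<gamma> X' Y' Z' T' \<cdot> (((f \<bullet> g\<^sup>-) \<odot> h) \<bullet> k) = (f \<odot> (h \<bullet> (g \<odot> k))) \<cdot> \<gamma> X Y Z T"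
    and delta_Hom: "{X, Y, Z, T} \<subseteq> Obj D \<Longrightarrow>
      \<delta> X Y Z T \<in> Hom D (X \<bullet> (Y \<odot> (Z\<^sup>- \<bullet> T))) (((X \<odot> Z) \<bullet> Y) \<odot> T)"
    and delta_natural:
      "f \<in> Hom D X X' \<Longrightarrow> g \<in> Hom D Y Y' \<Longrightarrow> h \<in> Hom D Z Z' \<Longrightarrow> k \<in> Hom D T T' \<Longrightarrow>
      \<delta> X' Y' Z' T' \<cdot> (f \<bullet> (g \<odot> (h\<^sup>- \<bullet> k))) = (((f \<odot> h) \<bullet> g) \<odot> k) \<cdot> \<delta> X Y Z T"
    and R1: "{X, Y, Z, T, U, V} \<subseteq> Obj D \<Longrightarrow>
      \<gamma> X Y (Z \<odot> U) (T \<odot> V) \<cdot> (a\<^sub>c (X \<bullet> Y\<^sup>-) Z U \<bullet> (T \<odot> V)) \<cdot> \<zeta> ((X \<bullet> Y\<^sup>-) \<odot> Z) T U V =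
      (X \<odot> ((Z \<odot> U) \<bullet> a\<^sub>c Y T V)) \<cdot> (X \<odot> \<zeta> Z (Y \<odot> T) U V) \<cdot> a\<^sub>c X (Z \<bullet> (Y \<odot> T)) (U \<bullet> V) \<cdot>
        (\<gamma> X Y Z T \<odot> (U \<bullet> V))"
    and R2: "{X, Y, Z, T, U, V} \<subseteq> Obj D \<Longrightarrow>
      ((X \<odot> T) \<bullet> \<gamma> Y Z U V) \<cdot> a\<^sub>b (X \<odot> T) ((Y \<bullet> Z\<^sup>-) \<odot> U) V \<cdot> (\<zeta> X (Y \<bullet> Z\<^sup>-) T U \<bullet> V) \<cdot>
        ((a\<^sub>b X Y (Z\<^sup>-) \<odot> (T \<bullet> U)) \<bullet> V) =
      \<zeta> X Y T (U \<bullet> (Z \<odot> V)) \<cdot> ((X \<bullet> Y) \<odot> a\<^sub>b T U (Z \<odot> V)) \<cdot> \<gamma> (X \<bullet> Y) Z (T \<bullet> U) V"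
    and R3: "{X, Y, Z, T, U, V} \<subseteq> Obj D \<Longrightarrow>
      ((a\<^sub>c X Z U \<bullet> (Y \<odot> T)) \<odot> V) \<cdot> \<delta> (X \<odot> Z) (Y \<odot> T) U V \<cdot>
        ((X \<odot> Z) \<bullet> inv (a\<^sub>c Y T (U\<^sup>- \<bullet> V))) \<cdot> \<zeta> X Y Z (T \<odot> (U\<^sup>- \<bullet> V)) =
      (\<zeta> X Y (Z \<odot> U) T \<odot> V) \<cdot> inv (a\<^sub>c (X \<bullet> Y) ((Z \<odot> U) \<bullet> T) V) \<cdot> ((X \<bullet> Y) \<odot> \<delta> Z T U V)"
    and R4: "{X, Y, Z, T, U, V} \<subseteq> Obj D \<Longrightarrow>
      (\<delta> X Y T U \<bullet> (Z \<odot> V)) \<cdot> inv (a\<^sub>b X (Y \<odot> (T\<^sup>- \<bullet> U)) (Z \<odot> V)) \<cdot> (X \<bullet> \<zeta> Y Z (T\<^sup>- \<bullet> U) V) \<cdot>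
        (X \<bullet> ((Y \<bullet> Z) \<odot> inv (a\<^sub>b (T\<^sup>-) U V))) =
      \<zeta> ((X \<odot> T) \<bullet> Y) Z U V \<cdot> (inv (a\<^sub>b (X \<odot> T) Y Z) \<odot> (U \<bullet> V)) \<cdot> \<delta> X (Y \<bullet> Z) T (U \<bullet> V)"
    and R5: "{X, Y, Z, T, U, V} \<subseteq> Obj D \<Longrightarrow>
      \<delta> X Y T (U \<bullet> (Z \<odot> V)) \<cdot> (X \<bullet> (Y \<odot> a\<^sub>b (T\<^sup>-) U (Z \<odot> V))) \<cdot> (X \<bullet> \<gamma> Y Z (T\<^sup>- \<bullet> U) V) \<cdot>
        a\<^sub>b X ((Y \<bullet> Z\<^sup>-) \<odot> (T\<^sup>- \<bullet> U)) V =
      \<gamma> ((X \<odot> T) \<bullet> Y) Z U V \<cdot> ((inv (a\<^sub>b (X \<odot> T) Y (Z\<^sup>-)) \<odot> U) \<bullet> V) \<cdot> (\<delta> X (Y \<bullet> Z\<^sup>-) T U \<bullet> V)"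
    and R6:
      "l\<^sub>c (I \<bullet> I) \<cdot> (I \<odot> (I \<bullet> l\<^sub>c I)) \<cdot> \<gamma> I I I I \<cdot> ((((I \<bullet> \<phi>\<^sub>c\<^sub>0) \<cdot> \<Delta>\<^sub>I) \<odot> I) \<bullet> I) = l\<^sub>c I \<bullet> I"
    and R7:
      "r\<^sub>c (I \<bullet> I) \<cdot> ((r\<^sub>c I \<bullet> I) \<odot> I) \<cdot> \<delta> I I I I \<cdot> (I \<bullet> (I \<odot> ((\<phi>\<^sub>c\<^sub>0 \<bullet> I) \<cdot> \<Delta>\<^sub>I))) = I \<bullet> r\<^sub>c I"
    and R8: "{X, Y, Z, U} \<subseteq> Obj D \<Longrightarrow>
      \<gamma> (X \<odot> Z) Y (J \<odot> J) U \<cdot> (a\<^sub>c ((X \<odot> Z) \<bullet> Y\<^sup>-) J J \<bullet> U) \<cdot> ((\<delta> X (Y\<^sup>-) Z J \<odot> J) \<bullet> U) \<cdot>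
        (((X \<bullet> (Y\<^sup>- \<odot> inv (r\<^sub>b (Z\<^sup>-)))) \<odot> J) \<bullet> U) =
      ((X \<odot> Z) \<odot> \<zeta> J Y J U) \<cdot> ((X \<odot> Z) \<odot> (inv (l\<^sub>b Y) \<odot> inv (l\<^sub>b U))) \<cdot>
        inv (a\<^sub>c X Z (Y \<odot> U)) \<cdot> (X \<odot> a\<^sub>c Z Y U) \<cdot>
        (X \<odot> l\<^sub>b ((Z \<odot> Y) \<odot> U)) \<cdot> \<gamma> X (Z \<odot> Y) J U \<cdot> (((X \<bullet> \<phi>\<^sub>c Y Z) \<odot> J) \<bullet> U)"
    and R9: "{X, Y, Z, U} \<subseteq> Obj D \<Longrightarrow>
      \<delta> X (J \<odot> J) Z (Y \<odot> U) \<cdot> (X \<bullet> inv (a\<^sub>c J J (Z\<^sup>- \<bullet> (Y \<odot> U)))) \<cdot>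
        (X \<bullet> (J \<odot> \<gamma> J Y (Z\<^sup>-) U)) \<cdot> (X \<bullet> (J \<odot> ((inv (l\<^sub>b (Y\<^sup>-)) \<odot> Z\<^sup>-) \<bullet> U))) =
      (\<zeta> X J Z J \<odot> (Y \<odot> U)) \<cdot> ((inv (r\<^sub>b X) \<odot> inv (r\<^sub>b Z)) \<odot> (Y \<odot> U)) \<cdot>
        a\<^sub>c (X \<odot> Z) Y U \<cdot> (inv (a\<^sub>c X Z Y) \<odot> U) \<cdot>
        (r\<^sub>b (X \<odot> (Z \<odot> Y)) \<odot> U) \<cdot> \<delta> X J (Z \<odot> Y) U \<cdot> (X \<bullet> (J \<odot> (\<phi>\<^sub>c Y Z \<bullet> U)))"
    and R13: "{X, Y, Z, T, U, V} \<subseteq> Obj D \<Longrightarrow>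
      (X \<odot> a\<^sub>b T (Z \<odot> U) (Y \<odot> V)) \<cdot> \<gamma> X Y (T \<bullet> (Z \<odot> U)) V \<cdot> (\<gamma> (X \<bullet> Y\<^sup>-) Z T U \<bullet> V) =
      (X \<odot> (T \<bullet> \<zeta> Z Y U V)) \<cdot> \<gamma> X (Z \<bullet> Y) T (U \<bullet> V) \<cdot> (((X \<bullet> \<phi>\<^sub>b Y Z) \<odot> T) \<bullet> (U \<bullet> V)) \<cdot>
        ((a\<^sub>b X (Y\<^sup>-) (Z\<^sup>-) \<odot> T) \<bullet> (U \<bullet> V)) \<cdot> a\<^sub>b (((X \<bullet> Y\<^sup>-) \<bullet> Z\<^sup>-) \<odot> T) U V"
    and R14: "{X, Y, Z, T, U, V} \<subseteq> Obj D \<Longrightarrow>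
      \<delta> X ((Y \<odot> T) \<bullet> Z) U V \<cdot> (X \<bullet> \<delta> Y Z T (U\<^sup>- \<bullet> V)) =
      (a\<^sub>b (X \<odot> U) (Y \<odot> T) Z \<odot> V) \<cdot> ((\<zeta> X Y U T \<bullet> Z) \<odot> V) \<cdot> \<delta> (X \<bullet> Y) Z (U \<bullet> T) V \<cdot>
        ((X \<bullet> Y) \<bullet> (Z \<odot> (\<phi>\<^sub>b T U \<bullet> V))) \<cdot> ((X \<bullet> Y) \<bullet> (Z \<odot> inv (a\<^sub>b (T\<^sup>-) (U\<^sup>-) V))) \<cdot>
        inv (a\<^sub>b X Y (Z \<odot> (T\<^sup>- \<bullet> (U\<^sup>- \<bullet> V))))"

lemma (in reversion) semi_reversion: "semi_reversion D R"
proof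
  note lc = lax_circ[unfolded lax_monoidal_def rev_tensor_def, simplified]
  note lb = lax_bull[unfolded lax_monoidal_def rev_tensor_def, simplified]
  show "is_endofunctor D (rv R)" by (rule conjunct1[OF lc])
  show "\<phi>\<^sub>c\<^sub>0 \<in> Hom D I (I\<^sup>-)" using lc by (elim conjE)
  have "\<forall>X \<in> Obj D. \<forall>Y \<in> Obj D. \<phi>\<^sub>c X Y \<in> Hom D (X\<^sup>- \<odot> Y\<^sup>-) ((Y \<odot> X)\<^sup>-)"
    using lc by (elim conjE)
  then show "\<phi>\<^sub>c X Y \<in> Hom D (X\<^sup>- \<odot> Y\<^sup>-) ((Y \<odot> X)\<^sup>-)" if "X \<in> Obj D" "Y \<in> Obj D" for X Y
    using that by blast
  have "\<forall>X \<in> Obj D. \<forall>Y \<in> Obj D. \<phi>\<^sub>b X Y \<in> Hom D (X\<^sup>- \<bullet> Y\<^sup>-) ((Y \<bullet> X)\<^sup>-)"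
    using lb by (elim conjE)
  then show "\<phi>\<^sub>b X Y \<in> Hom D (X\<^sup>- \<bullet> Y\<^sup>-) ((Y \<bullet> X)\<^sup>-)" if "X \<in> Obj D" "Y \<in> Obj D" for X Y
    using that by blast
  have "\<forall>X \<in> Obj D. (r\<^sub>c X)\<^sup>- \<cdot> \<phi>\<^sub>c I X \<cdot> (\<phi>\<^sub>c\<^sub>0 \<odot> X\<^sup>-) = l\<^sub>c (X\<^sup>-) \<and>
    (l\<^sub>c X)\<^sup>- \<cdot> \<phi>\<^sub>c X I \<cdot> (X\<^sup>- \<odot> \<phi>\<^sub>c\<^sub>0) = r\<^sub>c (X\<^sup>-)"
    using lc by (elim conjE)
  then show "(r\<^sub>c X)\<^sup>- \<cdot> \<phi>\<^sub>c I X \<cdot> (\<phi>\<^sub>c\<^sub>0 \<odot> X\<^sup>-) = l\<^sub>c (X\<^sup>-)"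
    "(l\<^sub>c X)\<^sup>- \<cdot> \<phi>\<^sub>c X I \<cdot> (X\<^sup>- \<odot> \<phi>\<^sub>c\<^sub>0) = r\<^sub>c (X\<^sup>-)" if "X \<in> Obj D" for X
    using that by blast+
qed (fact gamma_Hom gamma_natural delta_Hom delta_natural R1 R2 R3 R4 R5 R6 R7 R8 R9 R13 R14)+

section \<open>Unit cases of \<open>\<gamma>\<close> and \<open>\<delta>\<close>, and the antipode
  equations with parameters\<close>

context semi_reversion
begin

lemma rv_simps [simp]:
  assumes "f \<in> Arr D"
  shows "f\<^sup>- \<in> Arr D" "Dom D (f\<^sup>-) = (Dom D f)\<^sup>-" "Cod D (f\<^sup>-) = (Cod D f)\<^sup>-"
  using rv_endofunctor assms unfolding is_endofunctor_def Hom_def by blast+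

lemma rv_Obj [simp]: "X \<in> Obj D \<Longrightarrow> X\<^sup>- \<in> Obj D"
  by (subst Obj_def) simp

lemma rv_comp [simp]: "f \<in> Arr D \<Longrightarrow> g \<in> Arr D \<Longrightarrow> Dom D g = Cod D f \<Longrightarrow> g\<^sup>- \<cdot> f\<^sup>- = (g \<cdot> f)\<^sup>-"
  using rv_endofunctor unfolding is_endofunctor_def by simp

lemma rv_comp' [simp]: "f \<in> Arr D \<Longrightarrow> g \<in> Arr D \<Longrightarrow> Dom D g = Cod D f \<Longrightarrow> h \<in> Arr D \<Longrightarrow> Cod D h = (Dom D f)\<^sup>- \<Longrightarrow>
    g\<^sup>- \<cdot> f\<^sup>- \<cdot> h = (g \<cdot> f)\<^sup>- \<cdot> h"
  by (simp add: circ.comp_rewrite[OF rv_comp])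

lemma phi_simps [simp]:
  "\<phi>\<^sub>c\<^sub>0 \<in> Arr D" "Dom D \<phi>\<^sub>c\<^sub>0 = I" "Cod D \<phi>\<^sub>c\<^sub>0 = I\<^sup>-"
  "X \<in> Obj D \<Longrightarrow> Y \<in> Obj D \<Longrightarrow> \<phi>\<^sub>c X Y \<in> Arr D"
  "X \<in> Obj D \<Longrightarrow> Y \<in> Obj D \<Longrightarrow> Dom D (\<phi>\<^sub>c X Y) = X\<^sup>- \<odot> Y\<^sup>-"
  "X \<in> Obj D \<Longrightarrow> Y \<in> Obj D \<Longrightarrow> Cod D (\<phi>\<^sub>c X Y) = (Y \<odot> X)\<^sup>-"
  "X \<in> Obj D \<Longrightarrow> Y \<in> Obj D \<Longrightarrow> \<phi>\<^sub>b X Y \<in> Arr D"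
  "X \<in> Obj D \<Longrightarrow> Y \<in> Obj D \<Longrightarrow> Dom D (\<phi>\<^sub>b X Y) = X\<^sup>- \<bullet> Y\<^sup>-"
  "X \<in> Obj D \<Longrightarrow> Y \<in> Obj D \<Longrightarrow> Cod D (\<phi>\<^sub>b X Y) = (Y \<bullet> X)\<^sup>-"
  using phi_c0_Hom phi_c_Hom[of X Y] phi_b_Hom[of X Y] unfolding Hom_def by blast+

lemma gamma_delta_simps [simp]:
  assumes "X \<in> Obj D" "Y \<in> Obj D" "Z \<in> Obj D" "T \<in> Obj D"
  shows "\<gamma> X Y Z T \<in> Arr D" "Dom D (\<gamma> X Y Z T) = ((X \<bullet> Y\<^sup>-) \<odot> Z) \<bullet> T"
    "Cod D (\<gamma> X Y Z T) = X \<odot> (Z \<bullet> (Y \<odot> T))"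
    "\<delta> X Y Z T \<in> Arr D" "Dom D (\<delta> X Y Z T) = X \<bullet> (Y \<odot> (Z\<^sup>- \<bullet> T))"
    "Cod D (\<delta> X Y Z T) = ((X \<odot> Z) \<bullet> Y) \<odot> T"
  using gamma_Hom[of X Y Z T] delta_Hom[of X Y Z T] assms unfolding Hom_def by blast+

lemma
  assumes "f \<in> Arr D" "g \<in> Arr D" "h \<in> Arr D" "k \<in> Arr D"
    "Cod D f = X" "Cod D g = Y" "Cod D h = Z" "Cod D k = T"
  shows gamma_nat: "\<gamma> X Y Z T \<cdot> (((f \<bullet> g\<^sup>-) \<odot> h) \<bullet> k) =
      (f \<odot> (h \<bullet> (g \<odot> k))) \<cdot> \<gamma> (Dom D f) (Dom D g) (Dom D h) (Dom D k)"
    and delta_nat: "\<delta> X Y Z T \<cdot> (f \<bullet> (g \<odot> (h\<^sup>- \<bullet> k))) =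
      (((f \<odot> h) \<bullet> g) \<odot> k) \<cdot> \<delta> (Dom D f) (Dom D g) (Dom D h) (Dom D k)"
  using assms gamma_natural[of f "Dom D f" X g "Dom D g" Y h "Dom D h" Z k "Dom D k" T]
    delta_natural[of f "Dom D f" X g "Dom D g" Y h "Dom D h" Z k "Dom D k" T] by (auto simp: Hom_def)

text \<open>\<open>\<Delta>\<^sub>I\<close> with \<open>\<phi>\<^sub>c\<^sub>0\<close> on its right
  leg, and for \<open>dl\<close> on its left leg. On such a half-reversed unit, \<open>R6\<close>
  and \<open>R7\<close> say that \<open>\<gamma>\<close> and \<open>\<delta>\<close> reduce to unit
  constraints.\<close>

definition dr where "dr = (I \<bullet> \<phi>\<^sub>c\<^sub>0) \<cdot> \<Delta>\<^sub>I"
definition dl where "dl = (\<phi>\<^sub>c\<^sub>0 \<bullet> I) \<cdot> \<Delta>\<^sub>I"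

lemma dr_dl_simps [simp]:
  "dr \<in> Arr D" "Dom D dr = I" "Cod D dr = I \<bullet> I\<^sup>-"
  "dl \<in> Arr D" "Dom D dl = I" "Cod D dl = I\<^sup>- \<bullet> I"
  by (simp_all add: dr_def dl_def)

text \<open>\<open>R6\<close> is the case \<open>U = V = I\<close>. \<open>R1\<close> describes how
  \<open>\<gamma>\<close> meets a further factor \<open>U \<bullet> V\<close>; evaluated at units
  and precomposed with \<open>dr\<close> and \<open>\<Delta>\<^sub>I\<close>, it carries
  \<open>R6\<close> to arbitrary \<open>U\<close> and \<open>V\<close>.\<close>

lemma gamma_unit:
  assumes [simp]: "U \<in> Obj D" "V \<in> Obj D"
  shows "\<gamma> I I U V \<cdot> ((dr \<odot> U) \<bullet> V) = (I \<odot> (U \<bullet> inv (l\<^sub>c V))) \<cdot> inv (l\<^sub>c (U \<bullet> V)) \<cdot> (l\<^sub>c U \<bullet> V)"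
proof -
  let ?g = "\<gamma> I I (I \<odot> U) (I \<odot> V)" and ?\<zeta> = "\<zeta> ((I \<bullet> I\<^sup>-) \<odot> I) I U V"
  let ?z = "(((inv (l\<^sub>c I) \<bullet> I) \<cdot> \<Delta>\<^sub>I) \<odot> (U \<bullet> V)) \<cdot> inv (l\<^sub>c (U \<bullet> V))"
  let ?d = "((dr \<odot> I) \<bullet> I) \<odot> (U \<bullet> V)"
  let ?y = "?d \<cdot> ?z"
  have R6': "\<gamma> I I I I \<cdot> ((dr \<odot> I) \<bullet> I) = (I \<odot> (I \<bullet> inv (l\<^sub>c I))) \<cdot> inv (l\<^sub>c (I \<bullet> I)) \<cdot> (l\<^sub>c I \<bullet> I)"
  proof -
    have "\<gamma> I I I I \<cdot> ((dr \<odot> I) \<bullet> I) = (I \<odot> (I \<bullet> inv (l\<^sub>c I))) \<cdot> inv (l\<^sub>c (I \<bullet> I)) \<cdot>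
      (l\<^sub>c (I \<bullet> I) \<cdot> (I \<odot> (I \<bullet> l\<^sub>c I)) \<cdot> \<gamma> I I I I \<cdot> ((dr \<odot> I) \<bullet> I))"
      by simp
    then show ?thesis using R6 by (simp add: dr_def)
  qed
  have a: "a\<^sub>c I I W \<cdot> (inv (l\<^sub>c I) \<odot> W) = I \<odot> inv (l\<^sub>c W)" if "W \<in> Obj D" for W
    using circ.triangle_inv[of I W] that by (simp add: l_I_eq)
  have z1: "\<zeta> (I \<odot> I) I U V \<cdot> ?z = ((inv (l\<^sub>c I) \<odot> U) \<bullet> (I \<odot> V)) \<cdot> (inv (l\<^sub>c U) \<bullet> inv (l\<^sub>c V))"
  proof -
    have "\<zeta> (I \<odot> I) I U V \<cdot> ?z = (\<zeta> (I \<odot> I) I U V \<cdot> ((inv (l\<^sub>c I) \<bullet> I) \<odot> (U \<bullet> V))) \<cdot> (\<Delta>\<^sub>I \<odot> (U \<bullet> V)) \<cdot> inv (l\<^sub>c (U \<bullet> V))"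
      by simp
    also have "\<dots> = ((inv (l\<^sub>c I) \<odot> U) \<bullet> (I \<odot> V)) \<cdot> \<zeta> I I U V \<cdot> (\<Delta>\<^sub>I \<odot> (U \<bullet> V)) \<cdot> inv (l\<^sub>c (U \<bullet> V))"
      by (subst zeta_nat) simp_all
    finally show ?thesis by (simp only: zeta_unit_left_inv assms)
  qed
  have z2: "\<zeta> I (I \<odot> I) U V \<cdot> (((I \<bullet> inv (l\<^sub>c I)) \<cdot> \<Delta>\<^sub>I) \<odot> (U \<bullet> V)) \<cdot> inv (l\<^sub>c (U \<bullet> V)) =
    ((I \<odot> U) \<bullet> (inv (l\<^sub>c I) \<odot> V)) \<cdot> (inv (l\<^sub>c U) \<bullet> inv (l\<^sub>c V))"
  proof -
    have "\<zeta> I (I \<odot> I) U V \<cdot> (((I \<bullet> inv (l\<^sub>c I)) \<cdot> \<Delta>\<^sub>I) \<odot> (U \<bullet> V)) \<cdot> inv (l\<^sub>c (U \<bullet> V)) =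
      (\<zeta> I (I \<odot> I) U V \<cdot> ((I \<bullet> inv (l\<^sub>c I)) \<odot> (U \<bullet> V))) \<cdot> (\<Delta>\<^sub>I \<odot> (U \<bullet> V)) \<cdot> inv (l\<^sub>c (U \<bullet> V))"
      by simp
    also have "\<dots> = ((I \<odot> U) \<bullet> (inv (l\<^sub>c I) \<odot> V)) \<cdot> \<zeta> I I U V \<cdot> (\<Delta>\<^sub>I \<odot> (U \<bullet> V)) \<cdot> inv (l\<^sub>c (U \<bullet> V))"
      by (subst zeta_nat) simp_all
    finally show ?thesis by (simp only: zeta_unit_left_inv assms)
  qed
  \<comment> \<open>Left side of \<open>R1\<close>: the unit axiom of \<open>\<zeta>\<close> leaves
    the \<open>\<gamma>\<close> of the claim, surrounded by unit constraints.\<close>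
  have L: "?g \<cdot> (a\<^sub>c (I \<bullet> I\<^sup>-) I U \<bullet> (I \<odot> V)) \<cdot> ?\<zeta> \<cdot> ?y =
      (I \<odot> (inv (l\<^sub>c U) \<bullet> (I \<odot> inv (l\<^sub>c V)))) \<cdot> \<gamma> I I U V \<cdot> ((dr \<odot> U) \<bullet> V) \<cdot> (inv (l\<^sub>c U) \<bullet> V)"
  proof -
    have "?g \<cdot> (a\<^sub>c (I \<bullet> I\<^sup>-) I U \<bullet> (I \<odot> V)) \<cdot> ?\<zeta> \<cdot> ?y = ?g \<cdot> (a\<^sub>c (I \<bullet> I\<^sup>-) I U \<bullet> (I \<odot> V)) \<cdot> (?\<zeta> \<cdot> ?d) \<cdot> ?z"
      by simp
    also have "\<dots> = ?g \<cdot> (a\<^sub>c (I \<bullet> I\<^sup>-) I U \<bullet> (I \<odot> V)) \<cdot> (((dr \<odot> I) \<odot> U) \<bullet> (I \<odot> V)) \<cdot> \<zeta> (I \<odot> I) I U V \<cdot> ?z"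
      by (subst zeta_nat) simp_all
    also have "\<dots> = ?g \<cdot> ((a\<^sub>c (I \<bullet> I\<^sup>-) I U \<cdot> ((dr \<odot> I) \<odot> U)) \<bullet> (I \<odot> V)) \<cdot>
        ((inv (l\<^sub>c I) \<odot> U) \<bullet> (I \<odot> V)) \<cdot> (inv (l\<^sub>c U) \<bullet> inv (l\<^sub>c V))"
      by (subst z1) simp
    also have "\<dots> = ?g \<cdot> (((dr \<odot> (I \<odot> U)) \<cdot> a\<^sub>c I I U \<cdot> (inv (l\<^sub>c I) \<odot> U) \<cdot> inv (l\<^sub>c U)) \<bullet> inv (l\<^sub>c V))"
      by (subst circ.assoc_nat) simp_all
    also have "\<dots> = ?g \<cdot> (((dr \<odot> (I \<odot> U)) \<cdot> (I \<odot> inv (l\<^sub>c U)) \<cdot> inv (l\<^sub>c U)) \<bullet> inv (l\<^sub>c V))"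
      by (simp add: circ.comp_rewrite[OF a])
    also have "\<dots> = (?g \<cdot> (((I \<bullet> I\<^sup>-) \<odot> inv (l\<^sub>c U)) \<bullet> inv (l\<^sub>c V))) \<cdot> ((dr \<odot> U) \<bullet> V) \<cdot> (inv (l\<^sub>c U) \<bullet> V)"
      by simp
    also have "\<dots> = ((I \<odot> (inv (l\<^sub>c U) \<bullet> (I \<odot> inv (l\<^sub>c V)))) \<cdot> \<gamma> I I U V) \<cdot> ((dr \<odot> U) \<bullet> V) \<cdot> (inv (l\<^sub>c U) \<bullet> V)"
      by (subst gamma_nat) simp_all
    finally show ?thesis by simp
  qed
  \<comment> \<open>Right side of \<open>R1\<close>: here \<open>\<gamma>\<close> occurs at the unit
    object, where \<open>R6'\<close> evaluates it.\<close>
  have R: "((\<gamma> I I I I) \<odot> (U \<bullet> V)) \<cdot> ?y = ((I \<odot> ((I \<bullet> inv (l\<^sub>c I)) \<cdot> \<Delta>\<^sub>I)) \<odot> (U \<bullet> V)) \<cdot>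
      (inv (l\<^sub>c I) \<odot> (U \<bullet> V)) \<cdot> inv (l\<^sub>c (U \<bullet> V))"
  proof -
    have "((\<gamma> I I I I) \<odot> (U \<bullet> V)) \<cdot> ?y = ((\<gamma> I I I I \<cdot> ((dr \<odot> I) \<bullet> I)) \<odot> (U \<bullet> V)) \<cdot> ?z"
      by simp
    also have "\<dots> = (((I \<odot> (I \<bullet> inv (l\<^sub>c I))) \<cdot> inv (l\<^sub>c (I \<bullet> I)) \<cdot> \<Delta>\<^sub>I) \<odot> (U \<bullet> V)) \<cdot> inv (l\<^sub>c (U \<bullet> V))"
      by (subst R6') simp
    also have "\<dots> = (((I \<odot> (I \<bullet> inv (l\<^sub>c I))) \<cdot> (I \<odot> \<Delta>\<^sub>I) \<cdot> inv (l\<^sub>c I)) \<odot> (U \<bullet> V)) \<cdot> inv (l\<^sub>c (U \<bullet> V))"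
      using circ.Inv_lunit_nat[of "\<Delta>\<^sub>I" "I \<bullet> I"] by simp
    finally show ?thesis by simp
  qed
  have "?g \<cdot> (a\<^sub>c (I \<bullet> I\<^sup>-) I U \<bullet> (I \<odot> V)) \<cdot> ?\<zeta> \<cdot> ?y =
    (?g \<cdot> (a\<^sub>c (I \<bullet> I\<^sup>-) I U \<bullet> (I \<odot> V)) \<cdot> ?\<zeta>) \<cdot> ?y" by simp
  also have "\<dots> = ((I \<odot> ((I \<odot> U) \<bullet> a\<^sub>c I I V)) \<cdot> (I \<odot> \<zeta> I (I \<odot> I) U V) \<cdot> a\<^sub>c I (I \<bullet> (I \<odot> I)) (U \<bullet> V) \<cdot>
        (\<gamma> I I I I \<odot> (U \<bullet> V))) \<cdot> ?y"
    by (subst R1) simp_all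
  also have "\<dots> = (I \<odot> ((I \<odot> U) \<bullet> a\<^sub>c I I V)) \<cdot> (I \<odot> \<zeta> I (I \<odot> I) U V) \<cdot> a\<^sub>c I (I \<bullet> (I \<odot> I)) (U \<bullet> V) \<cdot>
        (\<gamma> I I I I \<odot> (U \<bullet> V)) \<cdot> ?y"
    by simp
  also have "\<dots> = (I \<odot> ((I \<odot> U) \<bullet> a\<^sub>c I I V)) \<cdot> (I \<odot> \<zeta> I (I \<odot> I) U V) \<cdot>
      (a\<^sub>c I (I \<bullet> (I \<odot> I)) (U \<bullet> V) \<cdot> ((I \<odot> ((I \<bullet> inv (l\<^sub>c I)) \<cdot> \<Delta>\<^sub>I)) \<odot> (U \<bullet> V))) \<cdot>
      (inv (l\<^sub>c I) \<odot> (U \<bullet> V)) \<cdot> inv (l\<^sub>c (U \<bullet> V))"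
    by (subst R) simp
  also have "\<dots> = (I \<odot> ((I \<odot> U) \<bullet> a\<^sub>c I I V)) \<cdot> (I \<odot> \<zeta> I (I \<odot> I) U V) \<cdot>
      (I \<odot> (((I \<bullet> inv (l\<^sub>c I)) \<cdot> \<Delta>\<^sub>I) \<odot> (U \<bullet> V))) \<cdot> (a\<^sub>c I I (U \<bullet> V) \<cdot>
      (inv (l\<^sub>c I) \<odot> (U \<bullet> V))) \<cdot> inv (l\<^sub>c (U \<bullet> V))"
    by (subst circ.assoc_nat) simp_all
  also have "\<dots> = (I \<odot> (((I \<odot> U) \<bullet> a\<^sub>c I I V) \<cdot> \<zeta> I (I \<odot> I) U V \<cdot>
      (((I \<bullet> inv (l\<^sub>c I)) \<cdot> \<Delta>\<^sub>I) \<odot> (U \<bullet> V)) \<cdot> inv (l\<^sub>c (U \<bullet> V)))) \<cdot> inv (l\<^sub>c (U \<bullet> V))"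
    by (simp add: a)
  also have "\<dots> = (I \<odot> (inv (l\<^sub>c U) \<bullet> ((I \<odot> inv (l\<^sub>c V)) \<cdot> inv (l\<^sub>c V)))) \<cdot> inv (l\<^sub>c (U \<bullet> V))"
    by (subst z2) (simp add: circ.comp_rewrite[OF a])
  finally have "(I \<odot> (inv (l\<^sub>c U) \<bullet> (I \<odot> inv (l\<^sub>c V)))) \<cdot> \<gamma> I I U V \<cdot> ((dr \<odot> U) \<bullet> V) \<cdot> (inv (l\<^sub>c U) \<bullet> V) =
    (I \<odot> (inv (l\<^sub>c U) \<bullet> ((I \<odot> inv (l\<^sub>c V)) \<cdot> inv (l\<^sub>c V)))) \<cdot> inv (l\<^sub>c (U \<bullet> V))"
    unfolding L .
  \<comment> \<open>Both sides agree with the wanted ones up to invertible unit constraints, which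
    are cancelled at either end.\<close>
  then have "(I \<odot> (l\<^sub>c U \<bullet> (I \<odot> l\<^sub>c V))) \<cdot> ((I \<odot> (inv (l\<^sub>c U) \<bullet> (I \<odot> inv (l\<^sub>c V)))) \<cdot> \<gamma> I I U V \<cdot> ((dr \<odot> U) \<bullet> V) \<cdot> (inv (l\<^sub>c U) \<bullet> V)) \<cdot> (l\<^sub>c U \<bullet> V) =
    (I \<odot> (l\<^sub>c U \<bullet> (I \<odot> l\<^sub>c V))) \<cdot> ((I \<odot> (inv (l\<^sub>c U) \<bullet> ((I \<odot> inv (l\<^sub>c V)) \<cdot> inv (l\<^sub>c V)))) \<cdot> inv (l\<^sub>c (U \<bullet> V))) \<cdot> (l\<^sub>c U \<bullet> V)"
    by (rule arg_cong)
  then show ?thesis by simp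
qed

text \<open>The counterpart of \<open>gamma_unit\<close>, from \<open>R7\<close> and
  \<open>R3\<close> in place of \<open>R6\<close> and \<open>R1\<close>; here
  \<open>X \<bullet> Y\<close> is multiplied from the left.\<close>

lemma delta_unit:
  assumes [simp]: "X \<in> Obj D" "Y \<in> Obj D"
  shows "((r\<^sub>c X \<bullet> Y) \<odot> I) \<cdot> \<delta> X Y I I \<cdot> (X \<bullet> (Y \<odot> dl)) = inv (r\<^sub>c (X \<bullet> Y)) \<cdot> (X \<bullet> r\<^sub>c Y)"
proof -
  let ?g = "\<delta> (X \<odot> I) (Y \<odot> I) I I" and ?ii = "I\<^sup>- \<bullet> I"
  let ?\<zeta> = "\<zeta> X Y I (I \<odot> ?ii)"
  let ?z = "((X \<bullet> Y) \<odot> ((I \<bullet> inv (r\<^sub>c I)) \<cdot> \<Delta>\<^sub>I)) \<cdot> inv (r\<^sub>c (X \<bullet> Y))"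
  let ?d = "(X \<bullet> Y) \<odot> (I \<bullet> (I \<odot> dl))"
  have R7': "\<delta> I I I I \<cdot> (I \<bullet> (I \<odot> dl)) = ((inv (r\<^sub>c I) \<bullet> I) \<odot> I) \<cdot> inv (r\<^sub>c (I \<bullet> I)) \<cdot> (I \<bullet> r\<^sub>c I)"
  proof -
    have "\<delta> I I I I \<cdot> (I \<bullet> (I \<odot> dl)) = ((inv (r\<^sub>c I) \<bullet> I) \<odot> I) \<cdot> inv (r\<^sub>c (I \<bullet> I)) \<cdot>
      (r\<^sub>c (I \<bullet> I) \<cdot> ((r\<^sub>c I \<bullet> I) \<odot> I) \<cdot> \<delta> I I I I \<cdot> (I \<bullet> (I \<odot> dl)))"
      by simp
    then show ?thesis using R7 by (simp add: dl_def)
  qed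
  have a: "a\<^sub>c W I I \<cdot> (inv (r\<^sub>c W) \<odot> I) = W \<odot> inv (r\<^sub>c I)" if "W \<in> Obj D" for W
    using circ.triangle_inv[of W I] that by (simp add: l_I_eq)
  have a': "inv (a\<^sub>c W I I) \<cdot> (W \<odot> inv (r\<^sub>c I)) = inv (r\<^sub>c (W \<odot> I))" if "W \<in> Obj D" for W
    using circ.runit_ten_inv'[of W I] that by simp
  have z1: "\<zeta> X Y I (I \<odot> I) \<cdot> ?z = (inv (r\<^sub>c X) \<bullet> ((Y \<odot> inv (r\<^sub>c I)) \<cdot> inv (r\<^sub>c Y)))"
  proof -
    have "\<zeta> X Y I (I \<odot> I) \<cdot> ?z = (\<zeta> X Y I (I \<odot> I) \<cdot> ((X \<bullet> Y) \<odot> (I \<bullet> inv (r\<^sub>c I)))) \<cdot> ((X \<bullet> Y) \<odot> \<Delta>\<^sub>I) \<cdot> inv (r\<^sub>c (X \<bullet> Y))"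
      by simp
    also have "\<dots> = ((X \<odot> I) \<bullet> (Y \<odot> inv (r\<^sub>c I))) \<cdot> \<zeta> X Y I I \<cdot> ((X \<bullet> Y) \<odot> \<Delta>\<^sub>I) \<cdot> inv (r\<^sub>c (X \<bullet> Y))"
      by (subst zeta_nat) simp_all
    finally show ?thesis by (simp add: zeta_unit_right_inv)
  qed
  have z2: "\<zeta> X Y (I \<odot> I) I \<cdot> ((X \<bullet> Y) \<odot> ((inv (r\<^sub>c I) \<bullet> I) \<cdot> \<Delta>\<^sub>I)) \<cdot> inv (r\<^sub>c (X \<bullet> Y)) =
    ((X \<odot> inv (r\<^sub>c I)) \<cdot> inv (r\<^sub>c X)) \<bullet> inv (r\<^sub>c Y)"
  proof -
    have "\<zeta> X Y (I \<odot> I) I \<cdot> ((X \<bullet> Y) \<odot> ((inv (r\<^sub>c I) \<bullet> I) \<cdot> \<Delta>\<^sub>I)) \<cdot> inv (r\<^sub>c (X \<bullet> Y)) =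
      (\<zeta> X Y (I \<odot> I) I \<cdot> ((X \<bullet> Y) \<odot> (inv (r\<^sub>c I) \<bullet> I))) \<cdot> ((X \<bullet> Y) \<odot> \<Delta>\<^sub>I) \<cdot> inv (r\<^sub>c (X \<bullet> Y))"
      by simp
    also have "\<dots> = ((X \<odot> inv (r\<^sub>c I)) \<bullet> (Y \<odot> I)) \<cdot> \<zeta> X Y I I \<cdot> ((X \<bullet> Y) \<odot> \<Delta>\<^sub>I) \<cdot> inv (r\<^sub>c (X \<bullet> Y))"
      by (subst zeta_nat) simp_all
    finally show ?thesis by (simp add: zeta_unit_right_inv)
  qed
  let ?A = "(a\<^sub>c X I I \<bullet> (Y \<odot> I)) \<odot> I"
  have Y: "inv (a\<^sub>c Y I ?ii) \<cdot> (Y \<odot> (I \<odot> dl)) \<cdot> (Y \<odot> inv (r\<^sub>c I)) \<cdot> inv (r\<^sub>c Y) = (inv (r\<^sub>c Y) \<odot> ?ii) \<cdot> (Y \<odot> dl) \<cdot> inv (r\<^sub>c Y)"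
  proof -
    have "inv (a\<^sub>c Y I ?ii) \<cdot> (Y \<odot> (I \<odot> dl)) \<cdot> (Y \<odot> inv (r\<^sub>c I)) \<cdot> inv (r\<^sub>c Y) =
      (inv (a\<^sub>c Y I ?ii) \<cdot> (Y \<odot> (I \<odot> dl))) \<cdot> (Y \<odot> inv (r\<^sub>c I)) \<cdot> inv (r\<^sub>c Y)" by simp
    also have "\<dots> = ((Y \<odot> I) \<odot> dl) \<cdot> (inv (a\<^sub>c Y I I) \<cdot> (Y \<odot> inv (r\<^sub>c I))) \<cdot> inv (r\<^sub>c Y)"
      by (subst circ.Inv_assoc_nat) simp_all
    also have "\<dots> = ((Y \<odot> I) \<odot> dl) \<cdot> inv (r\<^sub>c (Y \<odot> I)) \<cdot> inv (r\<^sub>c Y)"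
      by (simp add: a')
    also have "\<dots> = ((Y \<odot> I) \<odot> dl) \<cdot> (inv (r\<^sub>c Y) \<odot> I) \<cdot> inv (r\<^sub>c Y)"
      using circ.Inv_runit_nat[of "inv (r\<^sub>c Y)" "Y \<odot> I"] by simp
    finally show ?thesis by simp
  qed
  have L: "?A \<cdot> ?g \<cdot> ((X \<odot> I) \<bullet> inv (a\<^sub>c Y I ?ii)) \<cdot> ?\<zeta> \<cdot> ?d \<cdot> ?z =
    ((((X \<odot> inv (r\<^sub>c I))) \<bullet> inv (r\<^sub>c Y)) \<odot> I) \<cdot> \<delta> X Y I I \<cdot> (X \<bullet> ((Y \<odot> dl) \<cdot> inv (r\<^sub>c Y)))"
  proof -
    have "?\<zeta> \<cdot> ?d \<cdot> ?z = (?\<zeta> \<cdot> ?d) \<cdot> ?z" by simp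
    also have "\<dots> = ((X \<odot> I) \<bullet> (Y \<odot> (I \<odot> dl))) \<cdot> \<zeta> X Y I (I \<odot> I) \<cdot> ?z"
      by (subst zeta_nat) simp_all
    also have "\<dots> = ((X \<odot> I) \<bullet> (Y \<odot> (I \<odot> dl))) \<cdot> (inv (r\<^sub>c X) \<bullet> ((Y \<odot> inv (r\<^sub>c I)) \<cdot> inv (r\<^sub>c Y)))"
      by (simp only: z1)
    finally have 1: "?\<zeta> \<cdot> ?d \<cdot> ?z = ((X \<odot> I) \<bullet> (Y \<odot> (I \<odot> dl))) \<cdot> (inv (r\<^sub>c X) \<bullet> ((Y \<odot> inv (r\<^sub>c I)) \<cdot> inv (r\<^sub>c Y)))" .
    have "((X \<odot> I) \<bullet> inv (a\<^sub>c Y I ?ii)) \<cdot> ?\<zeta> \<cdot> ?d \<cdot> ?z =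
      inv (r\<^sub>c X) \<bullet> (inv (a\<^sub>c Y I ?ii) \<cdot> (Y \<odot> (I \<odot> dl)) \<cdot> (Y \<odot> inv (r\<^sub>c I)) \<cdot> inv (r\<^sub>c Y))"
      by (subst 1) simp
    also have "\<dots> = (inv (r\<^sub>c X) \<bullet> (inv (r\<^sub>c Y) \<odot> ?ii)) \<cdot> (X \<bullet> ((Y \<odot> dl) \<cdot> inv (r\<^sub>c Y)))"
      by (subst Y) simp
    finally have 2: "((X \<odot> I) \<bullet> inv (a\<^sub>c Y I ?ii)) \<cdot> ?\<zeta> \<cdot> ?d \<cdot> ?z = (inv (r\<^sub>c X) \<bullet> (inv (r\<^sub>c Y) \<odot> ?ii)) \<cdot> (X \<bullet> ((Y \<odot> dl) \<cdot> inv (r\<^sub>c Y)))" .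
    have "?A \<cdot> ?g \<cdot> ((X \<odot> I) \<bullet> inv (a\<^sub>c Y I ?ii)) \<cdot> ?\<zeta> \<cdot> ?d \<cdot> ?z =
      ?A \<cdot> (?g \<cdot> (inv (r\<^sub>c X) \<bullet> (inv (r\<^sub>c Y) \<odot> ?ii))) \<cdot> (X \<bullet> ((Y \<odot> dl) \<cdot> inv (r\<^sub>c Y)))"
      by (subst 2) simp
    also have "\<dots> = ?A \<cdot> (((inv (r\<^sub>c X) \<odot> I) \<bullet> inv (r\<^sub>c Y)) \<odot> I) \<cdot> \<delta> X Y I I \<cdot> (X \<bullet> ((Y \<odot> dl) \<cdot> inv (r\<^sub>c Y)))"
      using delta_nat[of "inv (r\<^sub>c X)" "inv (r\<^sub>c Y)" I I] by simp
    also have "\<dots> = ((((X \<odot> inv (r\<^sub>c I))) \<bullet> inv (r\<^sub>c Y)) \<odot> I) \<cdot> \<delta> X Y I I \<cdot> (X \<bullet> ((Y \<odot> dl) \<cdot> inv (r\<^sub>c Y)))"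
      by (simp add: a)
    finally show ?thesis .
  qed
  have "?A \<cdot> ?g \<cdot> ((X \<odot> I) \<bullet> inv (a\<^sub>c Y I ?ii)) \<cdot> ?\<zeta> \<cdot> ?d \<cdot> ?z =
     (?A \<cdot> ?g \<cdot> ((X \<odot> I) \<bullet> inv (a\<^sub>c Y I ?ii)) \<cdot> ?\<zeta>) \<cdot> ?d \<cdot> ?z" by simp
  also have "\<dots> = ((\<zeta> X Y (I \<odot> I) I \<odot> I) \<cdot> inv (a\<^sub>c (X \<bullet> Y) ((I \<odot> I) \<bullet> I) I) \<cdot> ((X \<bullet> Y) \<odot> \<delta> I I I I)) \<cdot> ?d \<cdot> ?z"
    by (subst R3) simp_all
  also have "\<dots> = (\<zeta> X Y (I \<odot> I) I \<odot> I) \<cdot> inv (a\<^sub>c (X \<bullet> Y) ((I \<odot> I) \<bullet> I) I) \<cdot> ((X \<bullet> Y) \<odot> (\<delta> I I I I \<cdot> (I \<bullet> (I \<odot> dl)))) \<cdot> ?z"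
    by simp
  also have "\<dots> = (\<zeta> X Y (I \<odot> I) I \<odot> I) \<cdot> inv (a\<^sub>c (X \<bullet> Y) ((I \<odot> I) \<bullet> I) I) \<cdot>
     ((X \<bullet> Y) \<odot> (((inv (r\<^sub>c I) \<bullet> I) \<odot> I) \<cdot> inv (r\<^sub>c (I \<bullet> I)) \<cdot> \<Delta>\<^sub>I)) \<cdot> inv (r\<^sub>c (X \<bullet> Y))"
    by (subst R7') simp
  also have "\<dots> = (\<zeta> X Y (I \<odot> I) I \<odot> I) \<cdot> inv (a\<^sub>c (X \<bullet> Y) ((I \<odot> I) \<bullet> I) I) \<cdot>
     ((X \<bullet> Y) \<odot> ((((inv (r\<^sub>c I) \<bullet> I) \<cdot> \<Delta>\<^sub>I) \<odot> I) \<cdot> inv (r\<^sub>c I))) \<cdot> inv (r\<^sub>c (X \<bullet> Y))"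
    using circ.Inv_runit_nat[of "\<Delta>\<^sub>I" "I \<bullet> I", symmetric] by simp
  also have "\<dots> = (\<zeta> X Y (I \<odot> I) I \<odot> I) \<cdot> (inv (a\<^sub>c (X \<bullet> Y) ((I \<odot> I) \<bullet> I) I) \<cdot>
     ((X \<bullet> Y) \<odot> (((inv (r\<^sub>c I) \<bullet> I) \<cdot> \<Delta>\<^sub>I) \<odot> I))) \<cdot> ((X \<bullet> Y) \<odot> inv (r\<^sub>c I)) \<cdot> inv (r\<^sub>c (X \<bullet> Y))"
    by simp
  also have "\<dots> = (\<zeta> X Y (I \<odot> I) I \<odot> I) \<cdot> (((X \<bullet> Y) \<odot> ((inv (r\<^sub>c I) \<bullet> I) \<cdot> \<Delta>\<^sub>I)) \<odot> I) \<cdot>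
     (inv (a\<^sub>c (X \<bullet> Y) I I) \<cdot> ((X \<bullet> Y) \<odot> inv (r\<^sub>c I))) \<cdot> inv (r\<^sub>c (X \<bullet> Y))"
    by (subst circ.Inv_assoc_nat) simp_all
  also have "\<dots> = (\<zeta> X Y (I \<odot> I) I \<odot> I) \<cdot> (((X \<bullet> Y) \<odot> ((inv (r\<^sub>c I) \<bullet> I) \<cdot> \<Delta>\<^sub>I)) \<odot> I) \<cdot>
     (inv (r\<^sub>c (X \<bullet> Y)) \<odot> I) \<cdot> inv (r\<^sub>c (X \<bullet> Y))"
    using circ.Inv_runit_nat[of "inv (r\<^sub>c (X \<bullet> Y))" "(X \<bullet> Y) \<odot> I"] by (simp add: a')
  also have "\<dots> = ((\<zeta> X Y (I \<odot> I) I \<cdot> ((X \<bullet> Y) \<odot> ((inv (r\<^sub>c I) \<bullet> I) \<cdot> \<Delta>\<^sub>I)) \<cdot> inv (r\<^sub>c (X \<bullet> Y))) \<odot> I) \<cdot> inv (r\<^sub>c (X \<bullet> Y))"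
    by simp
  also have "\<dots> = ((((X \<odot> inv (r\<^sub>c I)) \<cdot> inv (r\<^sub>c X)) \<bullet> inv (r\<^sub>c Y)) \<odot> I) \<cdot> inv (r\<^sub>c (X \<bullet> Y))"
    by (simp only: z2)
  finally have "((((X \<odot> inv (r\<^sub>c I))) \<bullet> inv (r\<^sub>c Y)) \<odot> I) \<cdot> \<delta> X Y I I \<cdot> (X \<bullet> ((Y \<odot> dl) \<cdot> inv (r\<^sub>c Y))) =
    ((((X \<odot> inv (r\<^sub>c I)) \<cdot> inv (r\<^sub>c X)) \<bullet> inv (r\<^sub>c Y)) \<odot> I) \<cdot> inv (r\<^sub>c (X \<bullet> Y))"
    unfolding L .
  then have "(((r\<^sub>c X \<cdot> (X \<odot> r\<^sub>c I)) \<bullet> r\<^sub>c Y) \<odot> I) \<cdot> (((((X \<odot> inv (r\<^sub>c I))) \<bullet> inv (r\<^sub>c Y)) \<odot> I) \<cdot> \<delta> X Y I I \<cdot> (X \<bullet> ((Y \<odot> dl) \<cdot> inv (r\<^sub>c Y)))) \<cdot> (X \<bullet> r\<^sub>c Y) =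
    (((r\<^sub>c X \<cdot> (X \<odot> r\<^sub>c I)) \<bullet> r\<^sub>c Y) \<odot> I) \<cdot> (((((X \<odot> inv (r\<^sub>c I)) \<cdot> inv (r\<^sub>c X)) \<bullet> inv (r\<^sub>c Y)) \<odot> I) \<cdot> inv (r\<^sub>c (X \<bullet> Y))) \<cdot> (X \<bullet> r\<^sub>c Y)"
    by (rule arg_cong)
  then show ?thesis by simp
qed

lemma phi_simps' [simp]:
  assumes "X \<in> Obj D" "Y \<in> Obj D"
  shows "\<phi> X Y \<in> Arr D" "Dom D (\<phi> X Y) = X \<bullet> Y\<^sup>-" "Cod D (\<phi> X Y) = ((X \<odot> Y) \<bullet> I) \<odot> J"
    "\<psi> X Y \<in> Arr D" "Dom D (\<psi> X Y) = X\<^sup>- \<bullet> Y" "Cod D (\<psi> X Y) = J \<odot> (I \<bullet> (X \<odot> Y))"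
  using assms by (simp_all add: \<phi>_def \<psi>_def)

text \<open>Up to unit constraints, \<open>\<phi>\<close> is \<open>\<delta>\<close> with
  \<open>I\<close> in the second and \<open>J\<close> in the last place. \<open>R5\<close>, with
  \<open>I\<close> and \<open>J\<close> inserted, lets \<open>\<gamma>\<close> bring in the general
  last factor \<open>V\<close>. So an equation stated with \<open>\<phi>\<close>, such as the right
  antipode equation, becomes one about \<open>\<delta>\<close>.\<close>

lemma delta_phi:
  assumes [simp]: "X \<in> Obj D" "T \<in> Obj D" "V \<in> Obj D"
  shows "\<delta> X I T V \<cdot> (X \<bullet> inv (l\<^sub>c (T\<^sup>- \<bullet> V))) \<cdot> a\<^sub>b X (T\<^sup>-) V =
    (((X \<odot> T) \<bullet> I) \<odot> (l\<^sub>b V \<cdot> (J \<bullet> l\<^sub>c V))) \<cdot> \<gamma> ((X \<odot> T) \<bullet> I) I J V \<cdot>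
    (((inv (a\<^sub>b (X \<odot> T) I (I\<^sup>-)) \<cdot> ((X \<odot> T) \<bullet> dr)) \<odot> J) \<bullet> V) \<cdot> (\<phi> X T \<bullet> V)"
proof -
  let ?Q = "(X \<odot> T) \<bullet> I" and ?TJ = "T\<^sup>- \<bullet> J"
  define w where "w = (I \<odot> inv (r\<^sub>b (T\<^sup>-))) \<cdot> inv (l\<^sub>c (T\<^sup>-))"
  have w [simp]: "w \<in> Arr D" "Dom D w = T\<^sup>-" "Cod D w = I \<odot> ?TJ"
    unfolding w_def by simp_all
  define x where "x = (J \<bullet> inv (l\<^sub>c V)) \<cdot> inv (l\<^sub>b V)"
  have x [simp]: "x \<in> Arr D" "Dom D x = V" "Cod D x = J \<bullet> (I \<odot> V)"
    unfolding x_def by simp_all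
  let ?y = "((X \<bullet> ((dr \<odot> ?TJ) \<cdot> w)) \<bullet> V)"
  have phi: "\<delta> X I T J \<cdot> (X \<bullet> w) = \<phi> X T"
    unfolding w_def \<phi>_def by simp
  have lw: "l\<^sub>c ?TJ \<cdot> w = inv (r\<^sub>b (T\<^sup>-))"
  proof -
    have "l\<^sub>c ?TJ \<cdot> w = (l\<^sub>c ?TJ \<cdot> (I \<odot> inv (r\<^sub>b (T\<^sup>-)))) \<cdot> inv (l\<^sub>c (T\<^sup>-))" unfolding w_def by simp
    also have "\<dots> = inv (r\<^sub>b (T\<^sup>-))" by (subst circ.lunit_nat) simp_all
    finally show ?thesis .
  qed
  \<comment> \<open>The inner \<open>\<gamma>\<close> of \<open>R5\<close> is met at the
    half-reversed unit \<open>dr\<close>, so \<open>gamma_unit\<close> turns it into unit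
    constraints.\<close>
  have bracket: "(I \<odot> a\<^sub>b (T\<^sup>-) J (I \<odot> V)) \<cdot> (\<gamma> I I ?TJ V \<cdot> ((dr \<odot> ?TJ) \<bullet> V)) \<cdot> (w \<bullet> V) =
    (I \<odot> (T\<^sup>- \<bullet> x)) \<cdot> inv (l\<^sub>c (T\<^sup>- \<bullet> V))"
  proof -
    have "(I \<odot> a\<^sub>b (T\<^sup>-) J (I \<odot> V)) \<cdot> (\<gamma> I I ?TJ V \<cdot> ((dr \<odot> ?TJ) \<bullet> V)) \<cdot> (w \<bullet> V) =
      (I \<odot> (a\<^sub>b (T\<^sup>-) J (I \<odot> V) \<cdot> (?TJ \<bullet> inv (l\<^sub>c V)))) \<cdot> inv (l\<^sub>c (?TJ \<bullet> V)) \<cdot> ((l\<^sub>c ?TJ \<cdot> w) \<bullet> V)"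
      by (subst gamma_unit) simp_all
    also have "\<dots> = (I \<odot> ((T\<^sup>- \<bullet> (J \<bullet> inv (l\<^sub>c V))) \<cdot> a\<^sub>b (T\<^sup>-) J V)) \<cdot> inv (l\<^sub>c (?TJ \<bullet> V)) \<cdot> (inv (r\<^sub>b (T\<^sup>-)) \<bullet> V)"
      using bull.assoc_nat[of "T\<^sup>-" J "inv (l\<^sub>c V)"] by (simp add: lw)
    also have "\<dots> = (I \<odot> ((T\<^sup>- \<bullet> (J \<bullet> inv (l\<^sub>c V))) \<cdot> a\<^sub>b (T\<^sup>-) J V)) \<cdot> (I \<odot> (inv (r\<^sub>b (T\<^sup>-)) \<bullet> V)) \<cdot> inv (l\<^sub>c (T\<^sup>- \<bullet> V))"
      using circ.Inv_lunit_nat[of "inv (r\<^sub>b (T\<^sup>-)) \<bullet> V" "?TJ \<bullet> V"] by simp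
    also have "\<dots> = (I \<odot> ((T\<^sup>- \<bullet> (J \<bullet> inv (l\<^sub>c V))) \<cdot> a\<^sub>b (T\<^sup>-) J V \<cdot> (inv (r\<^sub>b (T\<^sup>-)) \<bullet> V))) \<cdot> inv (l\<^sub>c (T\<^sup>- \<bullet> V))"
      by simp
    also have "\<dots> = (I \<odot> (T\<^sup>- \<bullet> x)) \<cdot> inv (l\<^sub>c (T\<^sup>- \<bullet> V))"
      unfolding x_def by (subst bull.triangle_inv) simp_all
    finally show ?thesis .
  qed
  let ?L = "\<delta> X I T (J \<bullet> (I \<odot> V)) \<cdot> (X \<bullet> (I \<odot> a\<^sub>b (T\<^sup>-) J (I \<odot> V))) \<cdot> (X \<bullet> \<gamma> I I ?TJ V) \<cdot>
      a\<^sub>b X ((I \<bullet> I\<^sup>-) \<odot> ?TJ) V"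
  have "?L \<cdot> ?y = \<delta> X I T (J \<bullet> (I \<odot> V)) \<cdot> (X \<bullet> ((I \<odot> a\<^sub>b (T\<^sup>-) J (I \<odot> V)) \<cdot> \<gamma> I I ?TJ V)) \<cdot>
      (a\<^sub>b X ((I \<bullet> I\<^sup>-) \<odot> ?TJ) V \<cdot> ((X \<bullet> ((dr \<odot> ?TJ) \<cdot> w)) \<bullet> V))"
    by simp
  also have "\<dots> = \<delta> X I T (J \<bullet> (I \<odot> V)) \<cdot> (X \<bullet> ((I \<odot> a\<^sub>b (T\<^sup>-) J (I \<odot> V)) \<cdot> (\<gamma> I I ?TJ V \<cdot> ((dr \<odot> ?TJ) \<bullet> V)) \<cdot> (w \<bullet> V))) \<cdot>
      a\<^sub>b X (T\<^sup>-) V"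
    by (subst bull.assoc_nat) simp_all
  also have "\<dots> = (\<delta> X I T (J \<bullet> (I \<odot> V)) \<cdot> (X \<bullet> (I \<odot> (T\<^sup>- \<bullet> x)))) \<cdot> (X \<bullet> inv (l\<^sub>c (T\<^sup>- \<bullet> V))) \<cdot> a\<^sub>b X (T\<^sup>-) V"
    by (subst bracket) simp
  also have "\<dots> = (?Q \<odot> x) \<cdot> \<delta> X I T V \<cdot> (X \<bullet> inv (l\<^sub>c (T\<^sup>- \<bullet> V))) \<cdot> a\<^sub>b X (T\<^sup>-) V"
    using delta_nat[of X I T x] by simp
  finally have 1: "(?Q \<odot> x) \<cdot> \<delta> X I T V \<cdot> (X \<bullet> inv (l\<^sub>c (T\<^sup>- \<bullet> V))) \<cdot> a\<^sub>b X (T\<^sup>-) V = ?L \<cdot> ?y" ..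
  also have "\<dots> = (\<gamma> ?Q I J V \<cdot> ((inv (a\<^sub>b (X \<odot> T) I (I\<^sup>-)) \<odot> J) \<bullet> V) \<cdot> (\<delta> X (I \<bullet> I\<^sup>-) T J \<bullet> V)) \<cdot> ?y"
    by (subst R5) simp_all
  also have "\<dots> = \<gamma> ?Q I J V \<cdot> ((inv (a\<^sub>b (X \<odot> T) I (I\<^sup>-)) \<odot> J) \<bullet> V) \<cdot>
      ((\<delta> X (I \<bullet> I\<^sup>-) T J \<cdot> (X \<bullet> (dr \<odot> ?TJ))) \<bullet> V) \<cdot> ((X \<bullet> w) \<bullet> V)"
    by simp
  also have "\<dots> = \<gamma> ?Q I J V \<cdot> ((inv (a\<^sub>b (X \<odot> T) I (I\<^sup>-)) \<odot> J) \<bullet> V) \<cdot>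
      (((((X \<odot> T) \<bullet> dr) \<odot> J) \<cdot> \<delta> X I T J) \<bullet> V) \<cdot> ((X \<bullet> w) \<bullet> V)"
    using delta_nat[of X dr T J] by simp
  also have "\<dots> = \<gamma> ?Q I J V \<cdot> ((inv (a\<^sub>b (X \<odot> T) I (I\<^sup>-)) \<odot> J) \<bullet> V) \<cdot> ((((X \<odot> T) \<bullet> dr) \<odot> J) \<bullet> V) \<cdot>
      ((\<delta> X I T J \<cdot> (X \<bullet> w)) \<bullet> V)"
    by simp
  also have "\<dots> = \<gamma> ?Q I J V \<cdot> (((inv (a\<^sub>b (X \<odot> T) I (I\<^sup>-)) \<cdot> ((X \<odot> T) \<bullet> dr)) \<odot> J) \<bullet> V) \<cdot> (\<phi> X T \<bullet> V)"
    by (subst phi) simp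
  finally have "(?Q \<odot> x) \<cdot> \<delta> X I T V \<cdot> (X \<bullet> inv (l\<^sub>c (T\<^sup>- \<bullet> V))) \<cdot> a\<^sub>b X (T\<^sup>-) V =
    \<gamma> ?Q I J V \<cdot> (((inv (a\<^sub>b (X \<odot> T) I (I\<^sup>-)) \<cdot> ((X \<odot> T) \<bullet> dr)) \<odot> J) \<bullet> V) \<cdot> (\<phi> X T \<bullet> V)" .
  then have "(?Q \<odot> (l\<^sub>b V \<cdot> (J \<bullet> l\<^sub>c V))) \<cdot> ((?Q \<odot> x) \<cdot> \<delta> X I T V \<cdot> (X \<bullet> inv (l\<^sub>c (T\<^sup>- \<bullet> V))) \<cdot> a\<^sub>b X (T\<^sup>-) V) =
    (?Q \<odot> (l\<^sub>b V \<cdot> (J \<bullet> l\<^sub>c V))) \<cdot> (\<gamma> ?Q I J V \<cdot> (((inv (a\<^sub>b (X \<odot> T) I (I\<^sup>-)) \<cdot> ((X \<odot> T) \<bullet> dr)) \<odot> J) \<bullet> V) \<cdot> (\<phi> X T \<bullet> V))"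
    by (rule arg_cong)
  moreover have "(l\<^sub>b V \<cdot> (J \<bullet> l\<^sub>c V)) \<cdot> x = V"
    unfolding x_def by simp
  ultimately show ?thesis by simp
qed

text \<open>\<open>R9\<close> at \<open>Z = I\<close>, with \<open>\<phi>\<^sub>c\<^sub>0\<close>
  inserted so that on one side the reversed unit disappears by the unit law of
  \<open>\<phi>\<^sub>c\<close>. It turns the left antipode equation, stated with
  \<open>\<psi>\<close>, into one about \<open>\<delta>\<close>.\<close>

lemma psi_delta:
  assumes [simp]: "X \<in> Obj D" "Y \<in> Obj D" "U \<in> Obj D"
  shows "a\<^sub>c X Y U \<cdot> (r\<^sub>b (X \<odot> Y) \<odot> U) \<cdot> \<delta> X J Y U =
    ((r\<^sub>c X \<cdot> r\<^sub>b (X \<odot> I)) \<odot> (Y \<odot> U)) \<cdot> \<delta> X J I (Y \<odot> U) \<cdot>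
    (X \<bullet> ((m\<^sub>J \<odot> (I\<^sup>- \<bullet> (Y \<odot> U))) \<cdot> inv (a\<^sub>c J J (I\<^sup>- \<bullet> (Y \<odot> U))) \<cdot>
      (J \<odot> ((J \<odot> (\<phi>\<^sub>c\<^sub>0 \<bullet> (Y \<odot> U))) \<cdot> \<psi> Y U))))"
proof -
  define W where "W = Y \<odot> U"
  have W [simp]: "W \<in> Obj D" by (simp add: W_def)
  note [simp] = W_def[symmetric]
  define w where "w = (Y\<^sup>- \<odot> \<phi>\<^sub>c\<^sub>0) \<cdot> inv (r\<^sub>c (Y\<^sup>-))"
  have w [simp]: "w \<in> Arr D" "Dom D w = Y\<^sup>-" "Cod D w = Y\<^sup>- \<odot> I\<^sup>-" unfolding w_def by simp_all
  let ?y = "X \<bullet> (J \<odot> (w \<bullet> U))"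
  \<comment> \<open>\<open>m\<^sub>J\<close> merges the two copies of \<open>J\<close> in
    \<open>R9\<close>; the counit axiom of \<open>\<zeta>\<close> then removes the
    \<open>\<zeta>\<close> on the right side.\<close>
  let ?z = "(r\<^sub>c X \<cdot> r\<^sub>b (X \<odot> I) \<cdot> ((X \<odot> I) \<bullet> m\<^sub>J)) \<odot> W"
  let ?a = "inv (a\<^sub>c J J (I\<^sup>- \<bullet> W))"
  let ?L = "\<delta> X (J \<odot> J) I W \<cdot> (X \<bullet> ?a) \<cdot> (X \<bullet> (J \<odot> \<gamma> J Y (I\<^sup>-) U)) \<cdot> (X \<bullet> (J \<odot> ((inv (l\<^sub>b (Y\<^sup>-)) \<odot> I\<^sup>-) \<bullet> U)))"
  let ?R = "(\<zeta> X J I J \<odot> W) \<cdot> ((inv (r\<^sub>b X) \<odot> inv (r\<^sub>b I)) \<odot> W) \<cdot>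
        a\<^sub>c (X \<odot> I) Y U \<cdot> (inv (a\<^sub>c X I Y) \<odot> U) \<cdot>
        (r\<^sub>b (X \<odot> (I \<odot> Y)) \<odot> U) \<cdot> \<delta> X J (I \<odot> Y) U \<cdot> (X \<bullet> (J \<odot> (\<phi>\<^sub>c Y I \<bullet> U)))"
  have LR: "?L = ?R" using R9[of X Y I U] by simp
  have g: "\<gamma> J Y (I\<^sup>-) U \<cdot> ((inv (l\<^sub>b (Y\<^sup>-)) \<odot> I\<^sup>-) \<bullet> U) \<cdot> (w \<bullet> U) = (J \<odot> (\<phi>\<^sub>c\<^sub>0 \<bullet> W)) \<cdot> \<psi> Y U"
  proof -
    have "\<gamma> J Y (I\<^sup>-) U \<cdot> ((inv (l\<^sub>b (Y\<^sup>-)) \<odot> I\<^sup>-) \<bullet> U) \<cdot> (w \<bullet> U) =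
      (\<gamma> J Y (I\<^sup>-) U \<cdot> (((J \<bullet> Y\<^sup>-) \<odot> \<phi>\<^sub>c\<^sub>0) \<bullet> U)) \<cdot> ((inv (l\<^sub>b (Y\<^sup>-)) \<odot> I) \<bullet> U) \<cdot> (inv (r\<^sub>c (Y\<^sup>-)) \<bullet> U)"
      unfolding w_def by simp
    also have "\<dots> = (J \<odot> (\<phi>\<^sub>c\<^sub>0 \<bullet> W)) \<cdot> \<psi> Y U"
      using gamma_nat[of J Y "\<phi>\<^sub>c\<^sub>0" U] by (simp add: \<psi>_def)
    finally show ?thesis .
  qed
  have "?z \<cdot> ?L \<cdot> ?y = ((r\<^sub>c X \<cdot> r\<^sub>b (X \<odot> I)) \<odot> W) \<cdot> ((((X \<odot> I) \<bullet> m\<^sub>J) \<odot> W) \<cdot> \<delta> X (J \<odot> J) I W) \<cdot>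
      (X \<bullet> (?a \<cdot> (J \<odot> (\<gamma> J Y (I\<^sup>-) U \<cdot> ((inv (l\<^sub>b (Y\<^sup>-)) \<odot> I\<^sup>-) \<bullet> U) \<cdot> (w \<bullet> U)))))"
    by simp
  also have "\<dots> = ((r\<^sub>c X \<cdot> r\<^sub>b (X \<odot> I)) \<odot> W) \<cdot> (\<delta> X J I W \<cdot> (X \<bullet> (m\<^sub>J \<odot> (I\<^sup>- \<bullet> W)))) \<cdot>
      (X \<bullet> (?a \<cdot> (J \<odot> ((J \<odot> (\<phi>\<^sub>c\<^sub>0 \<bullet> W)) \<cdot> \<psi> Y U))))"
    using delta_nat[of X "m\<^sub>J" I W] by (simp only: g) simp
  finally have L: "?z \<cdot> ?L \<cdot> ?y = ((r\<^sub>c X \<cdot> r\<^sub>b (X \<odot> I)) \<odot> W) \<cdot> \<delta> X J I W \<cdot>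
     (X \<bullet> ((m\<^sub>J \<odot> (I\<^sup>- \<bullet> W)) \<cdot> ?a \<cdot> (J \<odot> ((J \<odot> (\<phi>\<^sub>c\<^sub>0 \<bullet> W)) \<cdot> \<psi> Y U))))"
    by simp
  have pw: "\<phi>\<^sub>c Y I \<cdot> w = (inv (l\<^sub>c Y))\<^sup>-"
  proof -
    have "\<phi>\<^sub>c Y I \<cdot> w = (inv (l\<^sub>c Y))\<^sup>- \<cdot> ((l\<^sub>c Y)\<^sup>- \<cdot> \<phi>\<^sub>c Y I \<cdot> (Y\<^sup>- \<odot> \<phi>\<^sub>c\<^sub>0)) \<cdot> inv (r\<^sub>c (Y\<^sup>-))"
      unfolding w_def by simp
    then show ?thesis by (simp add: phi_c_unit_right)
  qed
  have tri: "inv (a\<^sub>c X I Y) \<cdot> (X \<odot> inv (l\<^sub>c Y)) = inv (r\<^sub>c X) \<odot> Y"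
    by (rule circ.triangle_inv') simp_all
  have "?R \<cdot> ?y = (\<zeta> X J I J \<odot> W) \<cdot> ((inv (r\<^sub>b X) \<odot> inv (r\<^sub>b I)) \<odot> W) \<cdot>
        a\<^sub>c (X \<odot> I) Y U \<cdot> ((inv (a\<^sub>c X I Y) \<cdot> r\<^sub>b (X \<odot> (I \<odot> Y))) \<odot> U) \<cdot> (\<delta> X J (I \<odot> Y) U \<cdot> (X \<bullet> (J \<odot> ((inv (l\<^sub>c Y))\<^sup>- \<bullet> U))))"
    by (simp add: pw)
  also have "\<dots> = (\<zeta> X J I J \<odot> W) \<cdot> ((inv (r\<^sub>b X) \<odot> inv (r\<^sub>b I)) \<odot> W) \<cdot>
        a\<^sub>c (X \<odot> I) Y U \<cdot> ((inv (a\<^sub>c X I Y) \<cdot> (r\<^sub>b (X \<odot> (I \<odot> Y)) \<cdot> ((X \<odot> inv (l\<^sub>c Y)) \<bullet> J))) \<odot> U) \<cdot> \<delta> X J Y U"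
    using delta_nat[of X J "inv (l\<^sub>c Y)" U] by simp
  also have "\<dots> = (\<zeta> X J I J \<odot> W) \<cdot> ((inv (r\<^sub>b X) \<odot> inv (r\<^sub>b I)) \<odot> W) \<cdot>
        (a\<^sub>c (X \<odot> I) Y U \<cdot> ((inv (r\<^sub>c X) \<odot> Y) \<odot> U)) \<cdot> (r\<^sub>b (X \<odot> Y) \<odot> U) \<cdot> \<delta> X J Y U"
    by (subst bull.runit_nat) (simp_all add: circ.comp_rewrite[OF tri])
  also have "\<dots> = (\<zeta> X J I J \<odot> W) \<cdot> ((inv (r\<^sub>b X) \<odot> inv (r\<^sub>b I)) \<odot> W) \<cdot>
        (inv (r\<^sub>c X) \<odot> W) \<cdot> a\<^sub>c X Y U \<cdot> (r\<^sub>b (X \<odot> Y) \<odot> U) \<cdot> \<delta> X J Y U"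
    using circ.assoc_nat[of "inv (r\<^sub>c X)" Y U] by simp
  finally have R: "?R \<cdot> ?y = (\<zeta> X J I J \<odot> W) \<cdot> ((inv (r\<^sub>b X) \<odot> inv (r\<^sub>b I)) \<odot> W) \<cdot>
        (inv (r\<^sub>c X) \<odot> W) \<cdot> a\<^sub>c X Y U \<cdot> (r\<^sub>b (X \<odot> Y) \<odot> U) \<cdot> \<delta> X J Y U" .
  have "?z \<cdot> ?R \<cdot> ?y = ((r\<^sub>c X \<cdot> (r\<^sub>b (X \<odot> I) \<cdot> ((X \<odot> I) \<bullet> m\<^sub>J) \<cdot> \<zeta> X J I J) \<cdot> (inv (r\<^sub>b X) \<odot> inv (r\<^sub>b I)) \<cdot> inv (r\<^sub>c X)) \<odot> W) \<cdot>
      a\<^sub>c X Y U \<cdot> (r\<^sub>b (X \<odot> Y) \<odot> U) \<cdot> \<delta> X J Y U"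
    by (subst R) simp
  also have "\<dots> = a\<^sub>c X Y U \<cdot> (r\<^sub>b (X \<odot> Y) \<odot> U) \<cdot> \<delta> X J Y U"
    by (subst zeta_counit_right) simp_all
  finally have zR: "?z \<cdot> ?R \<cdot> ?y = a\<^sub>c X Y U \<cdot> (r\<^sub>b (X \<odot> Y) \<odot> U) \<cdot> \<delta> X J Y U" .
  have "?z \<cdot> ?L \<cdot> ?y = ?z \<cdot> ?R \<cdot> ?y" by (simp only: LR)
  from trans[OF L[symmetric] trans[OF this zR]] show ?thesis
    unfolding W_def[symmetric] by (rule sym)
qed

text \<open>For Hopf algebras this is \<open>x \<otimes> S(h\<^sub>1) h\<^sub>2 = x \<otimes>
  \<epsilon>(h) 1\<close>. \<open>psi_delta\<close> brings in the left antipode equation, and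
  \<open>delta_unit\<close> removes the \<open>\<delta>\<close> that remains.\<close>

lemma delta_antipode_left:
  assumes [simp]: "bimonoid H" and S: "left_antipode H S"
    and [simp]: "X \<in> Obj D"
  shows "(X \<odot> mul H) \<cdot> a\<^sub>c X (ob H) (ob H) \<cdot> (r\<^sub>b (X \<odot> ob H) \<odot> ob H) \<cdot> \<delta> X J (ob H) (ob H) \<cdot>
      (X \<bullet> (J \<odot> ((S \<bullet> ob H) \<cdot> comul H))) =
    (X \<odot> one H) \<cdot> inv (r\<^sub>c X) \<cdot> r\<^sub>b X \<cdot> (X \<bullet> (m\<^sub>J \<cdot> (J \<odot> counit H)))"
proof -
  let ?h = "ob H" let ?W = "ob H \<odot> ob H"
  have [simp]: "S \<in> Arr D" "Dom D S = ?h" "Cod D S = ?h\<^sup>-" using S by (auto simp: left_antipode_def Hom_def)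
  define P where "P = \<psi> ?h ?h \<cdot> (S \<bullet> ?h) \<cdot> comul H"
  have P [simp]: "P \<in> Arr D" "Dom D P = ?h" "Cod D P = J \<odot> (I \<bullet> ?W)" unfolding P_def by simp_all
  define x where "x = r\<^sub>c X \<cdot> r\<^sub>b (X \<odot> I)"
  have x [simp]: "x \<in> Arr D" "Dom D x = (X \<odot> I) \<bullet> J" "Cod D x = X" unfolding x_def by simp_all
  have x_eq: "x = r\<^sub>b X \<cdot> (r\<^sub>c X \<bullet> J)"
    unfolding x_def by (subst bull.runit_nat) simp_all
  have ap': "(J \<odot> (I \<bullet> mul H)) \<cdot> P = (J \<odot> ((I \<bullet> one H) \<cdot> \<Delta>\<^sub>I)) \<cdot> inv (r\<^sub>c J) \<cdot> counit H"
    using S unfolding left_antipode_def P_def by simp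
  \<comment> \<open>The part that \<open>psi_delta\<close> leaves inside \<open>\<delta>\<close>:
    the antipode equation collapses it to the counit, the unit of \<open>H\<close> and a single copy
    of \<open>J\<close>.\<close>
  have br1: "(m\<^sub>J \<odot> (I\<^sup>- \<bullet> mul H)) \<cdot> inv (a\<^sub>c J J (I\<^sup>- \<bullet> ?W)) \<cdot> (J \<odot> ((J \<odot> (\<phi>\<^sub>c\<^sub>0 \<bullet> ?W)) \<cdot> P)) =
    (J \<odot> ((I\<^sup>- \<bullet> one H) \<cdot> dl)) \<cdot> inv (r\<^sub>c J) \<cdot> m\<^sub>J \<cdot> (J \<odot> counit H)"
  proof -
    have "(m\<^sub>J \<odot> (I\<^sup>- \<bullet> mul H)) \<cdot> inv (a\<^sub>c J J (I\<^sup>- \<bullet> ?W)) \<cdot> (J \<odot> ((J \<odot> (\<phi>\<^sub>c\<^sub>0 \<bullet> ?W)) \<cdot> P)) =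
      (m\<^sub>J \<odot> (I\<^sup>- \<bullet> ?h)) \<cdot> (((J \<odot> J) \<odot> (I\<^sup>- \<bullet> mul H)) \<cdot> inv (a\<^sub>c J J (I\<^sup>- \<bullet> ?W))) \<cdot> (J \<odot> ((J \<odot> (\<phi>\<^sub>c\<^sub>0 \<bullet> ?W)) \<cdot> P))"
      by simp
    also have "\<dots> = (m\<^sub>J \<odot> (I\<^sup>- \<bullet> ?h)) \<cdot> (inv (a\<^sub>c J J (I\<^sup>- \<bullet> ?h)) \<cdot> (J \<odot> (J \<odot> (I\<^sup>- \<bullet> mul H)))) \<cdot> (J \<odot> ((J \<odot> (\<phi>\<^sub>c\<^sub>0 \<bullet> ?W)) \<cdot> P))"
      using circ.Inv_assoc_nat[of J J "I\<^sup>- \<bullet> mul H"] by simp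
    also have "\<dots> = (m\<^sub>J \<odot> (I\<^sup>- \<bullet> ?h)) \<cdot> inv (a\<^sub>c J J (I\<^sup>- \<bullet> ?h)) \<cdot> (J \<odot> ((J \<odot> (\<phi>\<^sub>c\<^sub>0 \<bullet> ?h)) \<cdot> (J \<odot> (I \<bullet> mul H)) \<cdot> P))"
      by simp
    also have "\<dots> = (m\<^sub>J \<odot> (I\<^sup>- \<bullet> ?h)) \<cdot> (inv (a\<^sub>c J J (I\<^sup>- \<bullet> ?h)) \<cdot> (J \<odot> (J \<odot> ((I\<^sup>- \<bullet> one H) \<cdot> dl)))) \<cdot> (J \<odot> (inv (r\<^sub>c J) \<cdot> counit H))"
      by (subst ap') (simp add: dl_def)
    also have "\<dots> = (m\<^sub>J \<odot> ((I\<^sup>- \<bullet> one H) \<cdot> dl)) \<cdot> (inv (a\<^sub>c J J I) \<cdot> (J \<odot> inv (r\<^sub>c J))) \<cdot> (J \<odot> counit H)"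
      by (subst circ.Inv_assoc_nat) simp_all
    also have "\<dots> = (J \<odot> ((I\<^sup>- \<bullet> one H) \<cdot> dl)) \<cdot> ((m\<^sub>J \<odot> I) \<cdot> inv (r\<^sub>c (J \<odot> J))) \<cdot> (J \<odot> counit H)"
      by (simp add: circ.runit_ten_inv')
    also have "\<dots> = (J \<odot> ((I\<^sup>- \<bullet> one H) \<cdot> dl)) \<cdot> inv (r\<^sub>c J) \<cdot> m\<^sub>J \<cdot> (J \<odot> counit H)"
      using circ.Inv_runit_nat[of "m\<^sub>J" J] by simp
    finally show ?thesis .
  qed
  have "(X \<odot> mul H) \<cdot> a\<^sub>c X ?h ?h \<cdot> (r\<^sub>b (X \<odot> ?h) \<odot> ?h) \<cdot> \<delta> X J ?h ?h \<cdot> (X \<bullet> (J \<odot> ((S \<bullet> ?h) \<cdot> comul H))) =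
    (X \<odot> mul H) \<cdot> (a\<^sub>c X ?h ?h \<cdot> (r\<^sub>b (X \<odot> ?h) \<odot> ?h) \<cdot> \<delta> X J ?h ?h) \<cdot> (X \<bullet> (J \<odot> ((S \<bullet> ?h) \<cdot> comul H)))"
    by simp
  also have "\<dots> = (X \<odot> mul H) \<cdot> (x \<odot> ?W) \<cdot> \<delta> X J I ?W \<cdot>
    (X \<bullet> ((m\<^sub>J \<odot> (I\<^sup>- \<bullet> ?W)) \<cdot> inv (a\<^sub>c J J (I\<^sup>- \<bullet> ?W)) \<cdot> (J \<odot> ((J \<odot> (\<phi>\<^sub>c\<^sub>0 \<bullet> ?W)) \<cdot> P))))"
    by (subst psi_delta) (simp_all add: x_def P_def)
  also have "\<dots> = (x \<odot> ?h) \<cdot> ((((X \<odot> I) \<bullet> J) \<odot> mul H) \<cdot> \<delta> X J I ?W) \<cdot>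
    (X \<bullet> ((m\<^sub>J \<odot> (I\<^sup>- \<bullet> ?W)) \<cdot> inv (a\<^sub>c J J (I\<^sup>- \<bullet> ?W)) \<cdot> (J \<odot> ((J \<odot> (\<phi>\<^sub>c\<^sub>0 \<bullet> ?W)) \<cdot> P))))"
    by simp
  also have "\<dots> = (x \<odot> ?h) \<cdot> (\<delta> X J I ?h \<cdot> (X \<bullet> (J \<odot> (I\<^sup>- \<bullet> mul H)))) \<cdot>
    (X \<bullet> ((m\<^sub>J \<odot> (I\<^sup>- \<bullet> ?W)) \<cdot> inv (a\<^sub>c J J (I\<^sup>- \<bullet> ?W)) \<cdot> (J \<odot> ((J \<odot> (\<phi>\<^sub>c\<^sub>0 \<bullet> ?W)) \<cdot> P))))"
    using delta_nat[of X J I "mul H"] by simp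
  also have "\<dots> = (x \<odot> ?h) \<cdot> \<delta> X J I ?h \<cdot>
    (X \<bullet> ((m\<^sub>J \<odot> (I\<^sup>- \<bullet> mul H)) \<cdot> inv (a\<^sub>c J J (I\<^sup>- \<bullet> ?W)) \<cdot> (J \<odot> ((J \<odot> (\<phi>\<^sub>c\<^sub>0 \<bullet> ?W)) \<cdot> P))))"
    by simp
  also have "\<dots> = (x \<odot> ?h) \<cdot> (\<delta> X J I ?h \<cdot> (X \<bullet> (J \<odot> (I\<^sup>- \<bullet> one H)))) \<cdot>
    (X \<bullet> ((J \<odot> dl) \<cdot> inv (r\<^sub>c J) \<cdot> m\<^sub>J \<cdot> (J \<odot> counit H)))"
    by (subst br1) simp
  also have "\<dots> = (r\<^sub>b X \<odot> one H) \<cdot> (((r\<^sub>c X \<bullet> J) \<odot> I) \<cdot> \<delta> X J I I \<cdot> (X \<bullet> (J \<odot> dl))) \<cdot>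
    (X \<bullet> (inv (r\<^sub>c J) \<cdot> m\<^sub>J \<cdot> (J \<odot> counit H)))"
    using delta_nat[of X J I "one H"] by (simp add: x_eq)
  also have "\<dots> = (X \<odot> one H) \<cdot> ((r\<^sub>b X \<odot> I) \<cdot> inv (r\<^sub>c (X \<bullet> J))) \<cdot> (X \<bullet> (m\<^sub>J \<cdot> (J \<odot> counit H)))"
    by (subst delta_unit) simp_all
  also have "\<dots> = (X \<odot> one H) \<cdot> inv (r\<^sub>c X) \<cdot> r\<^sub>b X \<cdot> (X \<bullet> (m\<^sub>J \<cdot> (J \<odot> counit H)))"
    using circ.Inv_runit_nat[of "r\<^sub>b X" X] by simp
  finally show ?thesis .
qed

section \<open>Modules, comodules and the Galois maps\<close>

definition left_comodule where
  "left_comodule H W \<kappa> \<longleftrightarrow> W \<in> Obj D \<and> \<kappa> \<in> Hom D W (ob H \<bullet> W) \<and>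
    a\<^sub>b (ob H) (ob H) W \<cdot> (comul H \<bullet> W) \<cdot> \<kappa> = (ob H \<bullet> \<kappa>) \<cdot> \<kappa> \<and> l\<^sub>b W \<cdot> (counit H \<bullet> W) \<cdot> \<kappa> = W"

definition right_module where
  "right_module H N \<mu> \<longleftrightarrow> N \<in> Obj D \<and> \<mu> \<in> Hom D (N \<odot> ob H) N \<and>
    \<mu> \<cdot> (\<mu> \<odot> ob H) = \<mu> \<cdot> (N \<odot> mul H) \<cdot> a\<^sub>c N (ob H) (ob H) \<and> \<mu> \<cdot> (N \<odot> one H) = r\<^sub>c N"

text \<open>For Hopf algebras this is
  \<open>w\<^sub>1 S(w\<^sub>2) \<otimes> w\<^sub>0 = 1 \<otimes> w\<close>. The antipode equation
  is applied inside the iterated coaction of \<open>W\<close>: coassociativity of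
  \<open>\<kappa>\<close> produces the comultiplication of \<open>H\<close> that it asks for,
  \<open>delta_phi\<close> the \<open>\<phi>\<close>.\<close>

lemma delta_antipode_right:
  assumes [simp]: "bimonoid H" and S: "right_antipode H S"
    and W: "left_comodule H W \<kappa>"
  shows "((mul H \<bullet> I) \<odot> W) \<cdot> \<delta> (ob H) I (ob H) W \<cdot> (ob H \<bullet> ((I \<odot> ((S \<bullet> W) \<cdot> \<kappa>)) \<cdot> inv (l\<^sub>c W))) \<cdot> \<kappa> =
    (((one H \<bullet> I) \<cdot> \<Delta>\<^sub>I) \<odot> W) \<cdot> inv (l\<^sub>c W)"
proof -
  let ?h = "ob H"
  have [simp]: "S \<in> Arr D" "Dom D S = ?h" "Cod D S = ?h\<^sup>-" using S by (auto simp: right_antipode_def Hom_def)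
  have [simp]: "W \<in> Obj D" "\<kappa> \<in> Arr D" "Dom D \<kappa> = W" "Cod D \<kappa> = ?h \<bullet> W"
    and co: "a\<^sub>b ?h ?h W \<cdot> (comul H \<bullet> W) \<cdot> \<kappa> = (?h \<bullet> \<kappa>) \<cdot> \<kappa>" and cu: "l\<^sub>b W \<cdot> (counit H \<bullet> W) \<cdot> \<kappa> = W"
    using W unfolding left_comodule_def Hom_def by blast+
  define Q where "Q = (?h \<odot> ?h) \<bullet> I"
  have Q [simp]: "Q \<in> Obj D" unfolding Q_def by simp
  define q where "q = inv (a\<^sub>b (?h \<odot> ?h) I (I\<^sup>-)) \<cdot> ((?h \<odot> ?h) \<bullet> dr)"
  have q [simp]: "q \<in> Arr D" "Dom D q = Q" "Cod D q = Q \<bullet> I\<^sup>-" unfolding q_def Q_def by simp_all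
  define q' where "q' = inv (a\<^sub>b ?h I (I\<^sup>-)) \<cdot> (?h \<bullet> dr)"
  have q' [simp]: "q' \<in> Arr D" "Dom D q' = ?h \<bullet> I" "Cod D q' = (?h \<bullet> I) \<bullet> I\<^sup>-" unfolding q'_def by simp_all
  define v where "v = (one H \<bullet> I) \<cdot> \<Delta>\<^sub>I"
  have v [simp]: "v \<in> Arr D" "Dom D v = I" "Cod D v = ?h \<bullet> I" unfolding v_def by simp_all
  define p where "p = \<phi> ?h ?h \<cdot> (?h \<bullet> S) \<cdot> comul H"
  have p [simp]: "p \<in> Arr D" "Dom D p = ?h" "Cod D p = Q \<odot> J" unfolding p_def Q_def by simp_all
  have [simp]: "(mul H \<bullet> I) \<in> Arr D" "Dom D (mul H \<bullet> I) = Q" unfolding Q_def by simp_all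
  have ap': "((mul H \<bullet> I) \<odot> J) \<cdot> p = (v \<odot> J) \<cdot> inv (l\<^sub>c J) \<cdot> counit H"
    using S unfolding right_antipode_def p_def v_def by simp
  have mq: "((mul H \<bullet> I) \<bullet> I\<^sup>-) \<cdot> q = q' \<cdot> (mul H \<bullet> I)"
  proof -
    have "((mul H \<bullet> I) \<bullet> I\<^sup>-) \<cdot> q = (((mul H \<bullet> I) \<bullet> I\<^sup>-) \<cdot> inv (a\<^sub>b (?h \<odot> ?h) I (I\<^sup>-))) \<cdot> ((?h \<odot> ?h) \<bullet> dr)"
      unfolding q_def by (simp add: Q_def)
    also have "\<dots> = (inv (a\<^sub>b ?h I (I\<^sup>-)) \<cdot> (mul H \<bullet> (I \<bullet> I\<^sup>-))) \<cdot> ((?h \<odot> ?h) \<bullet> dr)"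
      by (subst bull.Inv_assoc_nat) (simp_all add: Q_def)
    also have "\<dots> = q' \<cdot> (mul H \<bullet> I)" unfolding q'_def by (simp add: Q_def)
    finally show ?thesis .
  qed
  \<comment> \<open>Coassociativity of \<open>\<Delta>\<^sub>I\<close>: the reversed unit may be
    split off before or after the unit of \<open>H\<close> is inserted.\<close>
  have qv: "q' \<cdot> v = (v \<bullet> I\<^sup>-) \<cdot> dr"
  proof -
    have "q' \<cdot> v = (inv (a\<^sub>b ?h I (I\<^sup>-)) \<cdot> (one H \<bullet> (I \<bullet> \<phi>\<^sub>c\<^sub>0))) \<cdot> (I \<bullet> \<Delta>\<^sub>I) \<cdot> \<Delta>\<^sub>I"
      unfolding q'_def v_def dr_def by simp
    also have "\<dots> = ((one H \<bullet> I) \<bullet> \<phi>\<^sub>c\<^sub>0) \<cdot> inv (a\<^sub>b I I I) \<cdot> (I \<bullet> \<Delta>\<^sub>I) \<cdot> \<Delta>\<^sub>I"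
      by (subst bull.Inv_assoc_nat) simp_all
    also have "\<dots> = (v \<bullet> I\<^sup>-) \<cdot> dr"
      unfolding v_def dr_def by (simp flip: Delta_I_coassoc)
    finally show ?thesis .
  qed
  define G where "G = \<gamma> (?h \<bullet> I) I J W"
  have G [simp]: "G \<in> Arr D" "Dom D G = (((?h \<bullet> I) \<bullet> I\<^sup>-) \<odot> J) \<bullet> W" "Cod D G = (?h \<bullet> I) \<odot> (J \<bullet> (I \<odot> W))"
    unfolding G_def by simp_all
  define y where "y = l\<^sub>b W \<cdot> (J \<bullet> l\<^sub>c W)"
  have y [simp]: "y \<in> Arr D" "Dom D y = J \<bullet> (I \<odot> W)" "Cod D y = W" unfolding y_def by simp_all
  have step1: "(?h \<bullet> ((I \<odot> ((S \<bullet> W) \<cdot> \<kappa>)) \<cdot> inv (l\<^sub>c W))) \<cdot> \<kappa> =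
    (?h \<bullet> inv (l\<^sub>c (?h\<^sup>- \<bullet> W))) \<cdot> a\<^sub>b ?h (?h\<^sup>-) W \<cdot> (((?h \<bullet> S) \<cdot> comul H) \<bullet> W) \<cdot> \<kappa>"
  proof -
    have "(?h \<bullet> ((I \<odot> ((S \<bullet> W) \<cdot> \<kappa>)) \<cdot> inv (l\<^sub>c W))) \<cdot> \<kappa> = (?h \<bullet> inv (l\<^sub>c (?h\<^sup>- \<bullet> W))) \<cdot> (?h \<bullet> (S \<bullet> W)) \<cdot> (?h \<bullet> \<kappa>) \<cdot> \<kappa>"
      using circ.Inv_lunit_nat[of "(S \<bullet> W) \<cdot> \<kappa>" "?h\<^sup>- \<bullet> W"] by simp
    also have "\<dots> = (?h \<bullet> inv (l\<^sub>c (?h\<^sup>- \<bullet> W))) \<cdot> ((?h \<bullet> (S \<bullet> W)) \<cdot> a\<^sub>b ?h ?h W) \<cdot> (comul H \<bullet> W) \<cdot> \<kappa>"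
      by (subst co[symmetric]) simp
    also have "\<dots> = (?h \<bullet> inv (l\<^sub>c (?h\<^sup>- \<bullet> W))) \<cdot> (a\<^sub>b ?h (?h\<^sup>-) W \<cdot> ((?h \<bullet> S) \<bullet> W)) \<cdot> (comul H \<bullet> W) \<cdot> \<kappa>"
      by (subst bull.assoc_nat) simp_all
    finally show ?thesis by simp
  qed
  have "((mul H \<bullet> I) \<odot> W) \<cdot> \<delta> ?h I ?h W \<cdot> (?h \<bullet> ((I \<odot> ((S \<bullet> W) \<cdot> \<kappa>)) \<cdot> inv (l\<^sub>c W))) \<cdot> \<kappa> =
    ((mul H \<bullet> I) \<odot> W) \<cdot> (\<delta> ?h I ?h W \<cdot> (?h \<bullet> inv (l\<^sub>c (?h\<^sup>- \<bullet> W))) \<cdot> a\<^sub>b ?h (?h\<^sup>-) W) \<cdot> (((?h \<bullet> S) \<cdot> comul H) \<bullet> W) \<cdot> \<kappa>"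
    by (subst step1) (simp add: Q_def)
  also have "\<dots> = ((mul H \<bullet> I) \<odot> W) \<cdot> ((Q \<odot> y) \<cdot> \<gamma> Q I J W \<cdot> ((q \<odot> J) \<bullet> W) \<cdot> (\<phi> ?h ?h \<bullet> W)) \<cdot> (((?h \<bullet> S) \<cdot> comul H) \<bullet> W) \<cdot> \<kappa>"
    by (subst delta_phi) (simp_all add: Q_def q_def y_def)
  also have "\<dots> = ((mul H \<bullet> I) \<odot> W) \<cdot> (Q \<odot> y) \<cdot> \<gamma> Q I J W \<cdot> ((q \<odot> J) \<bullet> W) \<cdot> (p \<bullet> W) \<cdot> \<kappa>"
    unfolding p_def by (simp add: Q_def[symmetric])
  also have "\<dots> = ((?h \<bullet> I) \<odot> y) \<cdot> (((mul H \<bullet> I) \<odot> (J \<bullet> (I \<odot> W))) \<cdot> \<gamma> Q I J W) \<cdot> ((q \<odot> J) \<bullet> W) \<cdot> (p \<bullet> W) \<cdot> \<kappa>"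
    by simp
  also have "\<dots> = ((?h \<bullet> I) \<odot> y) \<cdot> (G \<cdot> ((((mul H \<bullet> I) \<bullet> I\<^sup>-) \<odot> J) \<bullet> W)) \<cdot> ((q \<odot> J) \<bullet> W) \<cdot> (p \<bullet> W) \<cdot> \<kappa>"
    using gamma_nat[of "mul H \<bullet> I" I J W] unfolding G_def by simp
  also have "\<dots> = ((?h \<bullet> I) \<odot> y) \<cdot> G \<cdot> (((((mul H \<bullet> I) \<bullet> I\<^sup>-) \<cdot> q) \<odot> J) \<bullet> W) \<cdot> (p \<bullet> W) \<cdot> \<kappa>"
    by simp
  also have "\<dots> = ((?h \<bullet> I) \<odot> y) \<cdot> G \<cdot> ((q' \<odot> J) \<bullet> W) \<cdot> ((((mul H \<bullet> I) \<odot> J) \<cdot> p) \<bullet> W) \<cdot> \<kappa>"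
    by (subst mq) simp
  also have "\<dots> = ((?h \<bullet> I) \<odot> y) \<cdot> G \<cdot> (((q' \<cdot> v) \<odot> J) \<bullet> W) \<cdot> ((inv (l\<^sub>c J) \<cdot> counit H) \<bullet> W) \<cdot> \<kappa>"
    by (subst ap') simp
  also have "\<dots> = ((?h \<bullet> I) \<odot> y) \<cdot> (G \<cdot> (((v \<bullet> I\<^sup>-) \<odot> J) \<bullet> W)) \<cdot> ((dr \<odot> J) \<bullet> W) \<cdot> ((inv (l\<^sub>c J) \<cdot> counit H) \<bullet> W) \<cdot> \<kappa>"
    by (subst qv) simp
  also have "\<dots> = ((?h \<bullet> I) \<odot> y) \<cdot> ((v \<odot> (J \<bullet> (I \<odot> W))) \<cdot> \<gamma> I I J W) \<cdot> ((dr \<odot> J) \<bullet> W) \<cdot> ((inv (l\<^sub>c J) \<cdot> counit H) \<bullet> W) \<cdot> \<kappa>"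
    using gamma_nat[of v I J W] unfolding G_def by simp
  also have "\<dots> = (v \<odot> y) \<cdot> (\<gamma> I I J W \<cdot> ((dr \<odot> J) \<bullet> W)) \<cdot> ((inv (l\<^sub>c J) \<cdot> counit H) \<bullet> W) \<cdot> \<kappa>"
    by simp
  also have "\<dots> = (v \<odot> (y \<cdot> (J \<bullet> inv (l\<^sub>c W)))) \<cdot> inv (l\<^sub>c (J \<bullet> W)) \<cdot> (counit H \<bullet> W) \<cdot> \<kappa>"
    by (subst gamma_unit) simp_all
  also have "\<dots> = (v \<odot> W) \<cdot> ((I \<odot> l\<^sub>b W) \<cdot> inv (l\<^sub>c (J \<bullet> W))) \<cdot> (counit H \<bullet> W) \<cdot> \<kappa>"
    unfolding y_def by simp
  also have "\<dots> = (v \<odot> W) \<cdot> inv (l\<^sub>c W) \<cdot> l\<^sub>b W \<cdot> (counit H \<bullet> W) \<cdot> \<kappa>"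
    using circ.Inv_lunit_nat[of "l\<^sub>b W" W] by simp
  finally show ?thesis by (simp add: cu v_def)
qed

text \<open>For Hopf algebras these are the maps \<open>n \<otimes> w \<mapsto> n w\<^sub>1 \<otimes> w\<^sub>0\<close> and \<open>n \<otimes> w \<mapsto> n S(w\<^sub>1) \<otimes> w\<^sub>0\<close>, where
  \<open>\<kappa>(w) = w\<^sub>1 \<otimes> w\<^sub>0\<close>.\<close>

definition galois where
  "galois H N \<mu> W \<kappa> = (\<mu> \<bullet> l\<^sub>c W) \<cdot> \<zeta> N I (ob H) W \<cdot> ((N \<bullet> I) \<odot> \<kappa>)"

definition galois_inv where
  "galois_inv H S N \<mu> W \<kappa> = ((\<mu> \<bullet> I) \<odot> W) \<cdot> \<delta> N I (ob H) W \<cdot> (N \<bullet> ((I \<odot> ((S \<bullet> W) \<cdot> \<kappa>)) \<cdot> inv (l\<^sub>c W)))"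

lemma left_comodule_simps:
  assumes "left_comodule H W \<kappa>"
  shows "W \<in> Obj D" "\<kappa> \<in> Arr D" "Dom D \<kappa> = W" "Cod D \<kappa> = ob H \<bullet> W"
    "a\<^sub>b (ob H) (ob H) W \<cdot> (comul H \<bullet> W) \<cdot> \<kappa> = (ob H \<bullet> \<kappa>) \<cdot> \<kappa>" "l\<^sub>b W \<cdot> (counit H \<bullet> W) \<cdot> \<kappa> = W"
  using assms unfolding left_comodule_def Hom_def by blast+

lemma right_module_simps:
  assumes "right_module H N \<mu>"
  shows "N \<in> Obj D" "\<mu> \<in> Arr D" "Dom D \<mu> = N \<odot> ob H" "Cod D \<mu> = N"
    "\<mu> \<cdot> (\<mu> \<odot> ob H) = \<mu> \<cdot> (N \<odot> mul H) \<cdot> a\<^sub>c N (ob H) (ob H)" "\<mu> \<cdot> (N \<odot> one H) = r\<^sub>c N"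
  using assms unfolding right_module_def Hom_def by blast+

lemma galois_simps:
  assumes "bimonoid H" "right_module H N \<mu>" "left_comodule H W \<kappa>"
  shows "galois H N \<mu> W \<kappa> \<in> Arr D" "Dom D (galois H N \<mu> W \<kappa>) = (N \<bullet> I) \<odot> W" "Cod D (galois H N \<mu> W \<kappa>) = N \<bullet> W"
  using assms by (simp_all add: galois_def left_comodule_simps[OF assms(3)] right_module_simps(1-4)[OF assms(2)])

lemma galois_inv_simps:
  assumes "bimonoid H" "right_module H N \<mu>" "left_comodule H W \<kappa>" "S \<in> Hom D (ob H) ((ob H)\<^sup>-)"
  shows "galois_inv H S N \<mu> W \<kappa> \<in> Arr D" "Dom D (galois_inv H S N \<mu> W \<kappa>) = N \<bullet> W"
    "Cod D (galois_inv H S N \<mu> W \<kappa>) = (N \<bullet> I) \<odot> W"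
  using assms by (simp_all add: galois_inv_def left_comodule_simps[OF assms(3)] right_module_simps(1-4)[OF assms(2)] Hom_def)

text \<open>The composite is \<open>n \<otimes> w \<mapsto> n w\<^sub>1 S(w\<^sub>2) \<otimes>
  w\<^sub>0\<close>. \<open>R3\<close> moves \<open>\<delta>\<close> past the \<open>\<zeta>\<close>
  of the Galois map, so that the two actions on \<open>N\<close> merge by associativity and the
  right antipode equation applies inside.\<close>

lemma galois_inv_gal:
  assumes [simp]: "bimonoid H" and S: "right_antipode H S"
    and N: "right_module H N \<mu>" and W: "left_comodule H W \<kappa>"
  shows "galois_inv H S N \<mu> W \<kappa> \<cdot> galois H N \<mu> W \<kappa> = (N \<bullet> I) \<odot> W"
proof -
  let ?h = "ob H" let ?hW = "?h\<^sup>- \<bullet> W" let ?NI = "N \<bullet> I" let ?Nh = "N \<odot> ?h"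
  have [simp]: "S \<in> Arr D" "Dom D S = ?h" "Cod D S = ?h\<^sup>-" using S by (auto simp: right_antipode_def Hom_def)
  note [simp] = left_comodule_simps(1-4)[OF W] right_module_simps(1-4)[OF N]
  note mod = right_module_simps(5,6)[OF N]
  define s where "s = (S \<bullet> W) \<cdot> \<kappa>"
  have s [simp]: "s \<in> Arr D" "Dom D s = W" "Cod D s = ?hW" unfolding s_def by simp_all
  define x where "x = (I \<odot> s) \<cdot> inv (l\<^sub>c W)"
  have x [simp]: "x \<in> Arr D" "Dom D x = W" "Cod D x = I \<odot> ?hW" unfolding x_def by simp_all
  have x_eq: "x = inv (l\<^sub>c ?hW) \<cdot> s"
    using circ.Inv_lunit_nat[of s ?hW] unfolding x_def by simp
  define v where "v = (one H \<bullet> I) \<cdot> \<Delta>\<^sub>I"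
  have v [simp]: "v \<in> Arr D" "Dom D v = I" "Cod D v = ?h \<bullet> I" unfolding v_def by simp_all
  have F: "((mul H \<bullet> I) \<odot> W) \<cdot> \<delta> ?h I ?h W \<cdot> (?h \<bullet> x) \<cdot> \<kappa> = (v \<odot> W) \<cdot> inv (l\<^sub>c W)"
    using delta_antipode_right[OF _ S W] unfolding x_def s_def v_def by simp
  \<comment> \<open>An extra unit factor is inserted next to the antipode so that the left side of
    \<open>R3\<close> appears.\<close>
  have 1: "(l\<^sub>c I \<odot> ?hW) \<cdot> inv (a\<^sub>c I I ?hW) \<cdot> (I \<odot> x) = I \<odot> s"
  proof -
    have "(l\<^sub>c I \<odot> ?hW) \<cdot> inv (a\<^sub>c I I ?hW) = I \<odot> l\<^sub>c ?hW"
      using circ.inv_triangle[of I ?hW] by (simp add: l_I_eq)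
    then show ?thesis by (simp add: circ.comp_rewrite x_eq)
  qed
  have 2: "\<delta> N I ?h W \<cdot> (\<mu> \<bullet> (l\<^sub>c I \<odot> ?hW)) = (((\<mu> \<odot> ?h) \<bullet> l\<^sub>c I) \<odot> W) \<cdot> \<delta> ?Nh (I \<odot> I) ?h W"
    using delta_nat[of \<mu> "l\<^sub>c I" ?h W] by simp
  have 3: "(?Nh \<bullet> (I \<odot> x)) \<cdot> \<zeta> N I ?h W = \<zeta> N I ?h (I \<odot> ?hW) \<cdot> (?NI \<odot> (?h \<bullet> x))"
    using zeta_nat[of N I ?h x] by simp
  have r3: "((a\<^sub>c N ?h ?h \<bullet> (I \<odot> I)) \<odot> W) \<cdot> \<delta> ?Nh (I \<odot> I) ?h W \<cdot> (?Nh \<bullet> inv (a\<^sub>c I I ?hW)) \<cdot> \<zeta> N I ?h (I \<odot> ?hW) =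
    (\<zeta> N I (?h \<odot> ?h) I \<odot> W) \<cdot> inv (a\<^sub>c ?NI ((?h \<odot> ?h) \<bullet> I) W) \<cdot> (?NI \<odot> \<delta> ?h I ?h W)"
    by (rule R3) simp
  let ?mm = "((\<mu> \<cdot> (N \<odot> mul H)) \<bullet> l\<^sub>c I) \<odot> W"
  have "galois_inv H S N \<mu> W \<kappa> \<cdot> galois H N \<mu> W \<kappa> =
    ((\<mu> \<bullet> I) \<odot> W) \<cdot> \<delta> N I ?h W \<cdot> (\<mu> \<bullet> (I \<odot> s)) \<cdot> \<zeta> N I ?h W \<cdot> (?NI \<odot> \<kappa>)"
    unfolding galois_inv_def galois_def s_def by simp
  also have "\<dots> = ((\<mu> \<bullet> I) \<odot> W) \<cdot> (\<delta> N I ?h W \<cdot> (\<mu> \<bullet> (l\<^sub>c I \<odot> ?hW))) \<cdot> (?Nh \<bullet> inv (a\<^sub>c I I ?hW)) \<cdot>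
      ((?Nh \<bullet> (I \<odot> x)) \<cdot> \<zeta> N I ?h W) \<cdot> (?NI \<odot> \<kappa>)"
    by (subst 1[symmetric]) simp
  also have "\<dots> = ((((\<mu> \<cdot> (\<mu> \<odot> ?h)) \<bullet> l\<^sub>c I)) \<odot> W) \<cdot> \<delta> ?Nh (I \<odot> I) ?h W \<cdot> (?Nh \<bullet> inv (a\<^sub>c I I ?hW)) \<cdot>
      \<zeta> N I ?h (I \<odot> ?hW) \<cdot> (?NI \<odot> (?h \<bullet> x)) \<cdot> (?NI \<odot> \<kappa>)"
    by (subst 2, subst 3) simp
  also have "\<dots> = ?mm \<cdot> (((a\<^sub>c N ?h ?h \<bullet> (I \<odot> I)) \<odot> W) \<cdot> \<delta> ?Nh (I \<odot> I) ?h W \<cdot> (?Nh \<bullet> inv (a\<^sub>c I I ?hW)) \<cdot>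
      \<zeta> N I ?h (I \<odot> ?hW)) \<cdot> (?NI \<odot> ((?h \<bullet> x) \<cdot> \<kappa>))"
    by (subst mod(1)) simp
  also have "\<dots> = ?mm \<cdot> ((\<zeta> N I (?h \<odot> ?h) I \<odot> W) \<cdot> inv (a\<^sub>c ?NI ((?h \<odot> ?h) \<bullet> I) W) \<cdot> (?NI \<odot> \<delta> ?h I ?h W)) \<cdot> (?NI \<odot> ((?h \<bullet> x) \<cdot> \<kappa>))"
    by (subst r3) (rule refl)
  also have "\<dots> = ((\<mu> \<bullet> l\<^sub>c I) \<odot> W) \<cdot> ((((N \<odot> mul H) \<bullet> (I \<odot> I)) \<cdot> \<zeta> N I (?h \<odot> ?h) I) \<odot> W) \<cdot>
      inv (a\<^sub>c ?NI ((?h \<odot> ?h) \<bullet> I) W) \<cdot> (?NI \<odot> (\<delta> ?h I ?h W \<cdot> (?h \<bullet> x) \<cdot> \<kappa>))"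
    by simp
  also have "\<dots> = (((\<mu> \<bullet> l\<^sub>c I) \<cdot> \<zeta> N I ?h I) \<odot> W) \<cdot> (((?NI \<odot> (mul H \<bullet> I)) \<odot> W) \<cdot>
      inv (a\<^sub>c ?NI ((?h \<odot> ?h) \<bullet> I) W)) \<cdot> (?NI \<odot> (\<delta> ?h I ?h W \<cdot> (?h \<bullet> x) \<cdot> \<kappa>))"
    using zeta_nat[of N I "mul H" I] by simp
  also have "\<dots> = (((\<mu> \<bullet> l\<^sub>c I) \<cdot> \<zeta> N I ?h I) \<odot> W) \<cdot> (inv (a\<^sub>c ?NI (?h \<bullet> I) W) \<cdot> (?NI \<odot> ((mul H \<bullet> I) \<odot> W))) \<cdot>
      (?NI \<odot> (\<delta> ?h I ?h W \<cdot> (?h \<bullet> x) \<cdot> \<kappa>))"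
    using circ.Inv_assoc_nat[of ?NI "mul H \<bullet> I" W] by simp
  also have "\<dots> = (((\<mu> \<bullet> l\<^sub>c I) \<cdot> \<zeta> N I ?h I) \<odot> W) \<cdot> inv (a\<^sub>c ?NI (?h \<bullet> I) W) \<cdot>
      (?NI \<odot> (((mul H \<bullet> I) \<odot> W) \<cdot> \<delta> ?h I ?h W \<cdot> (?h \<bullet> x) \<cdot> \<kappa>))"
    by simp
  also have "\<dots> = (((\<mu> \<bullet> l\<^sub>c I) \<cdot> \<zeta> N I ?h I) \<odot> W) \<cdot> (inv (a\<^sub>c ?NI (?h \<bullet> I) W) \<cdot> (?NI \<odot> (v \<odot> W))) \<cdot> (?NI \<odot> inv (l\<^sub>c W))"
    by (subst F) simp
  also have "\<dots> = (((\<mu> \<bullet> l\<^sub>c I) \<cdot> (\<zeta> N I ?h I \<cdot> (?NI \<odot> (one H \<bullet> I))) \<cdot> (?NI \<odot> \<Delta>\<^sub>I)) \<odot> W) \<cdot>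
      inv (a\<^sub>c ?NI I W) \<cdot> (?NI \<odot> inv (l\<^sub>c W))"
    by (subst circ.Inv_assoc_nat) (simp_all add: v_def)
  also have "\<dots> = ((((\<mu> \<cdot> (N \<odot> one H)) \<bullet> l\<^sub>c I) \<cdot> \<zeta> N I I I \<cdot> (?NI \<odot> \<Delta>\<^sub>I)) \<odot> W) \<cdot> (inv (r\<^sub>c ?NI) \<odot> W)"
    by (subst zeta_nat) (simp_all add: circ.triangle_inv')
  also have "\<dots> = ((r\<^sub>c ?NI) \<odot> W) \<cdot> (inv (r\<^sub>c ?NI) \<odot> W)"
    by (simp only: mod(2) l_I_eq[symmetric]) (subst zeta_unit_right, simp_all)
  finally show ?thesis by simp
qed

text \<open>\<open>R4\<close> with \<open>J\<close> in place of \<open>Y\<close> and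
  \<open>I\<close> in place of \<open>Z\<close>, the \<open>J\<close> then being absorbed by unit
  constraints. It detaches \<open>V\<close> and leaves a \<open>\<delta>\<close> with second
  argument \<open>J\<close>, the shape in which the left antipode equation is available.\<close>

lemma zeta_delta:
  assumes [simp]: "X \<in> Obj D" "T \<in> Obj D" "U \<in> Obj D" "V \<in> Obj D"
  shows "\<zeta> (X \<odot> T) I U V \<cdot> \<delta> X I T (U \<bullet> V) =
    ((r\<^sub>b (X \<odot> T) \<odot> U) \<bullet> (I \<odot> V)) \<cdot> (\<delta> X J T U \<bullet> (I \<odot> V)) \<cdot> inv (a\<^sub>b X (J \<odot> (T\<^sup>- \<bullet> U)) (I \<odot> V)) \<cdot>
    (X \<bullet> (\<zeta> J I (T\<^sup>- \<bullet> U) V \<cdot> (inv (l\<^sub>b I) \<odot> inv (a\<^sub>b (T\<^sup>-) U V))))"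
proof -
  let ?XT = "X \<odot> T" let ?TUV = "T\<^sup>- \<bullet> (U \<bullet> V)"
  let ?y = "X \<bullet> (inv (l\<^sub>b I) \<odot> ?TUV)"
  let ?a = "inv (a\<^sub>b X (J \<odot> (T\<^sup>- \<bullet> U)) (I \<odot> V))"
  have "((\<delta> X J T U \<bullet> (I \<odot> V)) \<cdot> ?a \<cdot> (X \<bullet> \<zeta> J I (T\<^sup>- \<bullet> U) V) \<cdot> (X \<bullet> ((J \<bullet> I) \<odot> inv (a\<^sub>b (T\<^sup>-) U V)))) \<cdot> ?y =
    (\<zeta> (?XT \<bullet> J) I U V \<cdot> (inv (a\<^sub>b ?XT J I) \<odot> (U \<bullet> V)) \<cdot> \<delta> X (J \<bullet> I) T (U \<bullet> V)) \<cdot> ?y"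
    by (subst R4) simp_all
  also have "\<dots> = \<zeta> (?XT \<bullet> J) I U V \<cdot> (inv (a\<^sub>b ?XT J I) \<odot> (U \<bullet> V)) \<cdot> ((?XT \<bullet> inv (l\<^sub>b I)) \<odot> (U \<bullet> V)) \<cdot> \<delta> X I T (U \<bullet> V)"
    using delta_nat[of X "inv (l\<^sub>b I)" T "U \<bullet> V"] by simp
  also have "\<dots> = (\<zeta> (?XT \<bullet> J) I U V \<cdot> ((inv (r\<^sub>b ?XT) \<bullet> I) \<odot> (U \<bullet> V))) \<cdot> \<delta> X I T (U \<bullet> V)"
    by (simp add: bull.triangle_inv')
  also have "\<dots> = ((inv (r\<^sub>b ?XT) \<odot> U) \<bullet> (I \<odot> V)) \<cdot> \<zeta> ?XT I U V \<cdot> \<delta> X I T (U \<bullet> V)"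
    by (subst zeta_nat) simp_all
  finally have "((r\<^sub>b ?XT \<odot> U) \<bullet> (I \<odot> V)) \<cdot> (((inv (r\<^sub>b ?XT) \<odot> U) \<bullet> (I \<odot> V)) \<cdot> \<zeta> ?XT I U V \<cdot> \<delta> X I T (U \<bullet> V)) =
    ((r\<^sub>b ?XT \<odot> U) \<bullet> (I \<odot> V)) \<cdot> ((\<delta> X J T U \<bullet> (I \<odot> V)) \<cdot> ?a \<cdot> (X \<bullet> \<zeta> J I (T\<^sup>- \<bullet> U) V) \<cdot> (X \<bullet> ((J \<bullet> I) \<odot> inv (a\<^sub>b (T\<^sup>-) U V)))) \<cdot> ?y"
    by simp
  then show ?thesis by simp
qed

text \<open>The composite is \<open>n \<otimes> w \<mapsto> n S(w\<^sub>1) w\<^sub>2 \<otimes>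
  w\<^sub>0\<close>, so this side rests on the left antipode equation, reached through
  \<open>zeta_delta\<close>.\<close>

lemma galois_gal_inv:
  assumes [simp]: "bimonoid H" and S: "left_antipode H S"
    and N: "right_module H N \<mu>" and W: "left_comodule H W \<kappa>"
  shows "galois H N \<mu> W \<kappa> \<cdot> galois_inv H S N \<mu> W \<kappa> = N \<bullet> W"
proof -
  let ?h = "ob H" let ?NI = "N \<bullet> I" let ?Nh = "N \<odot> ?h" let ?IW = "I \<odot> W"
  have [simp]: "S \<in> Arr D" "Dom D S = ?h" "Cod D S = ?h\<^sup>-" using S by (auto simp: left_antipode_def Hom_def)
  note [simp] = left_comodule_simps(1-4)[OF W] right_module_simps(1-4)[OF N]
  note com = left_comodule_simps(5,6)[OF W]
  note mod = right_module_simps(5,6)[OF N]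
  define y where "y = (I \<odot> ((S \<bullet> W) \<cdot> \<kappa>)) \<cdot> inv (l\<^sub>c W)"
  have y [simp]: "y \<in> Arr D" "Dom D y = W" "Cod D y = I \<odot> (?h\<^sup>- \<bullet> W)" unfolding y_def by simp_all
  define E where "E = (S \<bullet> ?h) \<cdot> comul H"
  have E [simp]: "E \<in> Arr D" "Dom D E = ?h" "Cod D E = ?h\<^sup>- \<bullet> ?h" unfolding E_def by simp_all
  \<comment> \<open>What remains of the coaction of \<open>W\<close> once the antipode part
    \<open>E\<close> has been pulled out.\<close>
  define \<omega> where "\<omega> = \<zeta> J I ?h W \<cdot> (inv (l\<^sub>b I) \<odot> \<kappa>) \<cdot> inv (l\<^sub>c W)"
  have \<omega> [simp]: "\<omega> \<in> Arr D" "Dom D \<omega> = W" "Cod D \<omega> = (J \<odot> ?h) \<bullet> ?IW" unfolding \<omega>_def by simp_all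
  define c where "c = m\<^sub>J \<cdot> (J \<odot> counit H)"
  have c [simp]: "c \<in> Arr D" "Dom D c = J \<odot> ?h" "Cod D c = J" unfolding c_def by simp_all
  have 1: "\<zeta> N I ?h W \<cdot> ((\<mu> \<bullet> I) \<odot> (?h \<bullet> W)) = ((\<mu> \<odot> ?h) \<bullet> ?IW) \<cdot> \<zeta> ?Nh I ?h W"
    by (subst zeta_nat) simp_all
  have 2: "((?Nh \<bullet> I) \<odot> \<kappa>) \<cdot> \<delta> N I ?h W = \<delta> N I ?h (?h \<bullet> W) \<cdot> (N \<bullet> (I \<odot> (?h\<^sup>- \<bullet> \<kappa>)))"
    using delta_nat[of N I ?h \<kappa>] by simp
  have 3: "\<zeta> J I (?h\<^sup>- \<bullet> ?h) W \<cdot> (inv (l\<^sub>b I) \<odot> inv (a\<^sub>b (?h\<^sup>-) ?h W)) \<cdot> (I \<odot> (?h\<^sup>- \<bullet> \<kappa>)) \<cdot> y = ((J \<odot> E) \<bullet> ?IW) \<cdot> \<omega>"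
  proof -
    have e: "inv (a\<^sub>b (?h\<^sup>-) ?h W) \<cdot> (?h\<^sup>- \<bullet> \<kappa>) \<cdot> (S \<bullet> W) \<cdot> \<kappa> = (E \<bullet> W) \<cdot> \<kappa>"
    proof -
      have "inv (a\<^sub>b (?h\<^sup>-) ?h W) \<cdot> (?h\<^sup>- \<bullet> \<kappa>) \<cdot> (S \<bullet> W) \<cdot> \<kappa> = (inv (a\<^sub>b (?h\<^sup>-) ?h W) \<cdot> (S \<bullet> (?h \<bullet> W))) \<cdot> (?h \<bullet> \<kappa>) \<cdot> \<kappa>"
        by simp
      also have "\<dots> = ((S \<bullet> ?h) \<bullet> W) \<cdot> inv (a\<^sub>b ?h ?h W) \<cdot> (?h \<bullet> \<kappa>) \<cdot> \<kappa>"
        by (subst bull.Inv_assoc_nat) simp_all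
      also have "\<dots> = (E \<bullet> W) \<cdot> \<kappa>"
        by (simp flip: com(1) add: E_def)
      finally show ?thesis .
    qed
    have "\<zeta> J I (?h\<^sup>- \<bullet> ?h) W \<cdot> (inv (l\<^sub>b I) \<odot> inv (a\<^sub>b (?h\<^sup>-) ?h W)) \<cdot> (I \<odot> (?h\<^sup>- \<bullet> \<kappa>)) \<cdot> y =
      \<zeta> J I (?h\<^sup>- \<bullet> ?h) W \<cdot> (inv (l\<^sub>b I) \<odot> (inv (a\<^sub>b (?h\<^sup>-) ?h W) \<cdot> (?h\<^sup>- \<bullet> \<kappa>) \<cdot> (S \<bullet> W) \<cdot> \<kappa>)) \<cdot> inv (l\<^sub>c W)"
      unfolding y_def by simp
    also have "\<dots> = (\<zeta> J I (?h\<^sup>- \<bullet> ?h) W \<cdot> ((J \<bullet> I) \<odot> (E \<bullet> W))) \<cdot> (inv (l\<^sub>b I) \<odot> \<kappa>) \<cdot> inv (l\<^sub>c W)"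
      by (subst e) simp
    also have "\<dots> = ((J \<odot> E) \<bullet> ?IW) \<cdot> \<omega>"
      by (subst zeta_nat) (simp_all add: \<omega>_def)
    finally show ?thesis .
  qed
  \<comment> \<open>Associativity merges the two actions, and the left antipode equation is used
    with \<open>N\<close> in front.\<close>
  have B: "\<mu> \<cdot> (\<mu> \<odot> ?h) \<cdot> (r\<^sub>b ?Nh \<odot> ?h) \<cdot> \<delta> N J ?h ?h \<cdot> (N \<bullet> (J \<odot> E)) = r\<^sub>b N \<cdot> (N \<bullet> c)"
  proof -
    have "\<mu> \<cdot> (\<mu> \<odot> ?h) \<cdot> (r\<^sub>b ?Nh \<odot> ?h) \<cdot> \<delta> N J ?h ?h \<cdot> (N \<bullet> (J \<odot> E)) =
      (\<mu> \<cdot> (\<mu> \<odot> ?h)) \<cdot> (r\<^sub>b ?Nh \<odot> ?h) \<cdot> \<delta> N J ?h ?h \<cdot> (N \<bullet> (J \<odot> E))" by simp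
    also have "\<dots> = \<mu> \<cdot> ((N \<odot> mul H) \<cdot> a\<^sub>c N ?h ?h \<cdot> (r\<^sub>b ?Nh \<odot> ?h) \<cdot> \<delta> N J ?h ?h \<cdot> (N \<bullet> (J \<odot> E)))"
      by (subst mod(1)) simp
    also have "\<dots> = (\<mu> \<cdot> (N \<odot> one H)) \<cdot> inv (r\<^sub>c N) \<cdot> r\<^sub>b N \<cdot> (N \<bullet> c)"
      using delta_antipode_left[OF _ S, of N] unfolding E_def c_def by simp
    also have "\<dots> = r\<^sub>b N \<cdot> (N \<bullet> c)"
      by (subst mod(2)) simp
    finally show ?thesis .
  qed
  \<comment> \<open>The counit left over by the antipode equation is absorbed by the coaction of
    \<open>W\<close>.\<close>
  have C: "l\<^sub>b W \<cdot> (c \<bullet> l\<^sub>c W) \<cdot> \<omega> = W"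
  proof -
    have "l\<^sub>b W \<cdot> (c \<bullet> l\<^sub>c W) \<cdot> \<omega> =
      (l\<^sub>b W \<cdot> (J \<bullet> l\<^sub>c W)) \<cdot> (m\<^sub>J \<bullet> ?IW) \<cdot> (((J \<odot> counit H) \<bullet> ?IW) \<cdot> \<zeta> J I ?h W) \<cdot> (inv (l\<^sub>b I) \<odot> \<kappa>) \<cdot> inv (l\<^sub>c W)"
      unfolding c_def \<omega>_def by simp
    also have "\<dots> = (l\<^sub>c W \<cdot> l\<^sub>b ?IW) \<cdot> (m\<^sub>J \<bullet> ?IW) \<cdot> (\<zeta> J I J W \<cdot> ((J \<bullet> I) \<odot> (counit H \<bullet> W))) \<cdot> (inv (l\<^sub>b I) \<odot> \<kappa>) \<cdot> inv (l\<^sub>c W)"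
      using zeta_nat[of J I "counit H" W] bull.lunit_nat[of "l\<^sub>c W" W] by simp
    also have "\<dots> = l\<^sub>c W \<cdot> (l\<^sub>b ?IW \<cdot> (m\<^sub>J \<bullet> ?IW) \<cdot> \<zeta> J I J W) \<cdot> (inv (l\<^sub>b I) \<odot> ((counit H \<bullet> W) \<cdot> \<kappa>)) \<cdot> inv (l\<^sub>c W)"
      by simp
    also have "\<dots> = l\<^sub>c W \<cdot> (I \<odot> (l\<^sub>b W \<cdot> (counit H \<bullet> W) \<cdot> \<kappa>)) \<cdot> inv (l\<^sub>c W)"
      by (subst zeta_counit_left) simp_all
    finally show ?thesis by (simp add: com(2))
  qed
  have "galois H N \<mu> W \<kappa> \<cdot> galois_inv H S N \<mu> W \<kappa> =
    (\<mu> \<bullet> l\<^sub>c W) \<cdot> (\<zeta> N I ?h W \<cdot> ((\<mu> \<bullet> I) \<odot> (?h \<bullet> W))) \<cdot> (((?Nh \<bullet> I) \<odot> \<kappa>) \<cdot> \<delta> N I ?h W) \<cdot> (N \<bullet> y)"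
    unfolding galois_def galois_inv_def y_def by simp
  also have "\<dots> = ((\<mu> \<cdot> (\<mu> \<odot> ?h)) \<bullet> l\<^sub>c W) \<cdot> (\<zeta> ?Nh I ?h W \<cdot> \<delta> N I ?h (?h \<bullet> W)) \<cdot> (N \<bullet> ((I \<odot> (?h\<^sup>- \<bullet> \<kappa>)) \<cdot> y))"
    by (subst 1, subst 2) simp
  also have "\<dots> = ((\<mu> \<cdot> (\<mu> \<odot> ?h) \<cdot> (r\<^sub>b ?Nh \<odot> ?h) \<cdot> \<delta> N J ?h ?h) \<bullet> l\<^sub>c W) \<cdot> inv (a\<^sub>b N (J \<odot> (?h\<^sup>- \<bullet> ?h)) ?IW) \<cdot>
    (N \<bullet> (\<zeta> J I (?h\<^sup>- \<bullet> ?h) W \<cdot> (inv (l\<^sub>b I) \<odot> inv (a\<^sub>b (?h\<^sup>-) ?h W)) \<cdot> (I \<odot> (?h\<^sup>- \<bullet> \<kappa>)) \<cdot> y))"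
    by (subst zeta_delta) simp_all
  also have "\<dots> = ((\<mu> \<cdot> (\<mu> \<odot> ?h) \<cdot> (r\<^sub>b ?Nh \<odot> ?h) \<cdot> \<delta> N J ?h ?h) \<bullet> l\<^sub>c W) \<cdot> (inv (a\<^sub>b N (J \<odot> (?h\<^sup>- \<bullet> ?h)) ?IW) \<cdot>
    (N \<bullet> ((J \<odot> E) \<bullet> ?IW))) \<cdot> (N \<bullet> \<omega>)"
    by (subst 3) simp
  also have "\<dots> = ((\<mu> \<cdot> (\<mu> \<odot> ?h) \<cdot> (r\<^sub>b ?Nh \<odot> ?h) \<cdot> \<delta> N J ?h ?h \<cdot> (N \<bullet> (J \<odot> E))) \<bullet> l\<^sub>c W) \<cdot> inv (a\<^sub>b N (J \<odot> ?h) ?IW) \<cdot> (N \<bullet> \<omega>)"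
    by (subst bull.Inv_assoc_nat) simp_all
  also have "\<dots> = (r\<^sub>b N \<bullet> W) \<cdot> (((N \<bullet> c) \<bullet> l\<^sub>c W) \<cdot> inv (a\<^sub>b N (J \<odot> ?h) ?IW)) \<cdot> (N \<bullet> \<omega>)"
    by (subst B) simp
  also have "\<dots> = (r\<^sub>b N \<bullet> W) \<cdot> (inv (a\<^sub>b N J W) \<cdot> (N \<bullet> (c \<bullet> l\<^sub>c W))) \<cdot> (N \<bullet> \<omega>)"
    by (subst bull.Inv_assoc_nat) simp_all
  also have "\<dots> = ((r\<^sub>b N \<bullet> W) \<cdot> inv (a\<^sub>b N J W)) \<cdot> (N \<bullet> ((c \<bullet> l\<^sub>c W) \<cdot> \<omega>))"
    by simp
  also have "\<dots> = N \<bullet> (l\<^sub>b W \<cdot> (c \<bullet> l\<^sub>c W) \<cdot> \<omega>)"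
    by (subst bull.inv_triangle) simp_all
  finally show ?thesis by (simp add: C)
qed

text \<open>The diagonal action. Its associativity combines that of \<open>\<zeta>\<close>, of
  \<open>\<mu>\<close> and of \<open>mul H\<close> with multiplicativity of
  \<open>comul H\<close>.\<close>

lemma right_module_bull:
  assumes [simp]: "bimonoid H" and N: "right_module H N \<mu>"
  shows "right_module H (N \<bullet> ob H) ((\<mu> \<bullet> mul H) \<cdot> \<zeta> N (ob H) (ob H) (ob H) \<cdot> ((N \<bullet> ob H) \<odot> comul H))"
proof -
  let ?h = "ob H" let ?Nh = "N \<bullet> ?h" let ?hh = "?h \<odot> ?h" let ?z = "\<zeta> N ?h ?h ?h"
  note [simp] = right_module_simps(1-4)[OF N]
  note mod = right_module_simps(5,6)[OF N]
  define \<mu>' where "\<mu>' = (\<mu> \<bullet> mul H) \<cdot> ?z \<cdot> (?Nh \<odot> comul H)"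
  have [simp]: "\<mu>' \<in> Arr D" "Dom D \<mu>' = ?Nh \<odot> ?h" "Cod D \<mu>' = ?Nh" unfolding \<mu>'_def by simp_all
  have za: "((a\<^sub>c N ?h ?h \<bullet> a\<^sub>c ?h ?h ?h) \<cdot> \<zeta> (N \<odot> ?h) ?hh ?h ?h \<cdot> (?z \<odot> (?h \<bullet> ?h))) =
    \<zeta> N ?h ?hh ?hh \<cdot> (?Nh \<odot> \<zeta> ?h ?h ?h ?h) \<cdot> a\<^sub>c ?Nh (?h \<bullet> ?h) (?h \<bullet> ?h)"
    by (rule zeta_assoc_circ[symmetric]) simp
  have L: "\<mu>' \<cdot> (\<mu>' \<odot> ?h) = ((\<mu> \<cdot> (N \<odot> mul H)) \<bullet> (mul H \<cdot> (?h \<odot> mul H))) \<cdot>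
      \<zeta> N ?h ?hh ?hh \<cdot> (?Nh \<odot> (\<zeta> ?h ?h ?h ?h \<cdot> (comul H \<odot> comul H))) \<cdot> a\<^sub>c ?Nh ?h ?h"
  proof -
    have "\<mu>' \<cdot> (\<mu>' \<odot> ?h) = (\<mu> \<bullet> mul H) \<cdot> (?z \<cdot> ((\<mu> \<bullet> mul H) \<odot> (?h \<bullet> ?h))) \<cdot> ((?z \<cdot> (?Nh \<odot> comul H)) \<odot> comul H)"
      unfolding \<mu>'_def by simp
    also have "\<dots> = ((\<mu> \<cdot> (\<mu> \<odot> ?h)) \<bullet> (mul H \<cdot> (mul H \<odot> ?h))) \<cdot> \<zeta> (N \<odot> ?h) ?hh ?h ?h \<cdot> ((?z \<cdot> (?Nh \<odot> comul H)) \<odot> comul H)"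
      by (subst zeta_nat) simp_all
    also have "\<dots> = ((\<mu> \<cdot> (N \<odot> mul H)) \<bullet> (mul H \<cdot> (?h \<odot> mul H))) \<cdot>
      ((a\<^sub>c N ?h ?h \<bullet> a\<^sub>c ?h ?h ?h) \<cdot> \<zeta> (N \<odot> ?h) ?hh ?h ?h \<cdot> (?z \<odot> (?h \<bullet> ?h))) \<cdot> ((?Nh \<odot> comul H) \<odot> comul H)"
      by (simp add: mod(1) mul_assoc)
    also have "\<dots> = ((\<mu> \<cdot> (N \<odot> mul H)) \<bullet> (mul H \<cdot> (?h \<odot> mul H))) \<cdot>
      \<zeta> N ?h ?hh ?hh \<cdot> (?Nh \<odot> \<zeta> ?h ?h ?h ?h) \<cdot> (a\<^sub>c ?Nh (?h \<bullet> ?h) (?h \<bullet> ?h) \<cdot> ((?Nh \<odot> comul H) \<odot> comul H))"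
      by (simp only: za) simp
    also have "\<dots> = ((\<mu> \<cdot> (N \<odot> mul H)) \<bullet> (mul H \<cdot> (?h \<odot> mul H))) \<cdot>
      \<zeta> N ?h ?hh ?hh \<cdot> (?Nh \<odot> (\<zeta> ?h ?h ?h ?h \<cdot> (comul H \<odot> comul H))) \<cdot> a\<^sub>c ?Nh ?h ?h"
      by (subst circ.assoc_nat) simp_all
    finally show ?thesis .
  qed
  have R: "\<mu>' \<cdot> (?Nh \<odot> mul H) \<cdot> a\<^sub>c ?Nh ?h ?h = ((\<mu> \<cdot> (N \<odot> mul H)) \<bullet> (mul H \<cdot> (?h \<odot> mul H))) \<cdot>
      \<zeta> N ?h ?hh ?hh \<cdot> (?Nh \<odot> (\<zeta> ?h ?h ?h ?h \<cdot> (comul H \<odot> comul H))) \<cdot> a\<^sub>c ?Nh ?h ?h"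
  proof -
    have "\<mu>' \<cdot> (?Nh \<odot> mul H) \<cdot> a\<^sub>c ?Nh ?h ?h = (\<mu> \<bullet> mul H) \<cdot> (?z \<cdot> (?Nh \<odot> (mul H \<bullet> mul H))) \<cdot>
      (?Nh \<odot> (\<zeta> ?h ?h ?h ?h \<cdot> (comul H \<odot> comul H))) \<cdot> a\<^sub>c ?Nh ?h ?h"
      unfolding \<mu>'_def by (simp add: comul_mul)
    then show ?thesis using zeta_nat[of N ?h "mul H" "mul H"] by simp
  qed
  have U: "\<mu>' \<cdot> (?Nh \<odot> one H) = r\<^sub>c ?Nh"
  proof -
    have "\<mu>' \<cdot> (?Nh \<odot> one H) = (\<mu> \<bullet> mul H) \<cdot> (?z \<cdot> (?Nh \<odot> (one H \<bullet> one H))) \<cdot> (?Nh \<odot> \<Delta>\<^sub>I)"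
      unfolding \<mu>'_def by (simp add: comul_one)
    also have "\<dots> = ((\<mu> \<cdot> (N \<odot> one H)) \<bullet> (mul H \<cdot> (?h \<odot> one H))) \<cdot> \<zeta> N ?h I I \<cdot> (?Nh \<odot> \<Delta>\<^sub>I)"
      using zeta_nat[of N ?h "one H" "one H"] by simp
    finally show ?thesis by (simp add: mod(2) mul_unit_right zeta_unit_right)
  qed
  show ?thesis
    unfolding \<mu>'_def[symmetric] right_module_def using L R U by (simp add: Hom_def)
qed

lemma left_comodule_self: "bimonoid H \<Longrightarrow> left_comodule H (ob H) (comul H)"
  by (simp add: left_comodule_def Hom_def coassoc counit_left)

lemma left_comodule_cofree:
  assumes [simp]: "bimonoid H" "V \<in> Obj D"
  shows "left_comodule H (ob H \<bullet> V) (a\<^sub>b (ob H) (ob H) V \<cdot> (comul H \<bullet> V))"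
proof -
  let ?h = "ob H" let ?W = "?h \<bullet> V"
  have "a\<^sub>b ?h ?h ?W \<cdot> (comul H \<bullet> ?W) \<cdot> a\<^sub>b ?h ?h V \<cdot> (comul H \<bullet> V) =
    a\<^sub>b ?h ?h ?W \<cdot> ((comul H \<bullet> (?h \<bullet> V)) \<cdot> a\<^sub>b ?h ?h V) \<cdot> (comul H \<bullet> V)" by simp
  also have "\<dots> = a\<^sub>b ?h ?h ?W \<cdot> (a\<^sub>b (?h \<bullet> ?h) ?h V \<cdot> ((comul H \<bullet> ?h) \<bullet> V)) \<cdot> (comul H \<bullet> V)"
    by (subst bull.assoc_nat) simp_all
  also have "\<dots> = (a\<^sub>b ?h ?h ?W \<cdot> a\<^sub>b (?h \<bullet> ?h) ?h V) \<cdot> (((comul H \<bullet> ?h) \<cdot> comul H) \<bullet> V)"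
    by simp
  also have "\<dots> = (?h \<bullet> a\<^sub>b ?h ?h V) \<cdot> a\<^sub>b ?h (?h \<bullet> ?h) V \<cdot> ((a\<^sub>b ?h ?h ?h \<cdot> (comul H \<bullet> ?h) \<cdot> comul H) \<bullet> V)"
    by (subst bull.pentagon) simp_all
  also have "\<dots> = (?h \<bullet> a\<^sub>b ?h ?h V) \<cdot> (a\<^sub>b ?h (?h \<bullet> ?h) V \<cdot> ((?h \<bullet> comul H) \<bullet> V)) \<cdot> (comul H \<bullet> V)"
    by (simp add: coassoc)
  also have "\<dots> = (?h \<bullet> (a\<^sub>b ?h ?h V \<cdot> (comul H \<bullet> V))) \<cdot> a\<^sub>b ?h ?h V \<cdot> (comul H \<bullet> V)"
    by (subst bull.assoc_nat) simp_all
  finally have 1: "a\<^sub>b ?h ?h ?W \<cdot> (comul H \<bullet> ?W) \<cdot> a\<^sub>b ?h ?h V \<cdot> (comul H \<bullet> V) =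
    (?h \<bullet> (a\<^sub>b ?h ?h V \<cdot> (comul H \<bullet> V))) \<cdot> a\<^sub>b ?h ?h V \<cdot> (comul H \<bullet> V)" .
  have "l\<^sub>b ?W \<cdot> (counit H \<bullet> ?W) \<cdot> a\<^sub>b ?h ?h V \<cdot> (comul H \<bullet> V) =
    l\<^sub>b ?W \<cdot> ((counit H \<bullet> (?h \<bullet> V)) \<cdot> a\<^sub>b ?h ?h V) \<cdot> (comul H \<bullet> V)" by simp
  also have "\<dots> = l\<^sub>b ?W \<cdot> (a\<^sub>b J ?h V \<cdot> ((counit H \<bullet> ?h) \<bullet> V)) \<cdot> (comul H \<bullet> V)"
    by (subst bull.assoc_nat) simp_all
  also have "\<dots> = (l\<^sub>b ?W \<cdot> a\<^sub>b J ?h V) \<cdot> (((counit H \<bullet> ?h) \<cdot> comul H) \<bullet> V)"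
    by simp
  also have "\<dots> = ?W"
    by (subst bull.lunit_ten) (simp_all add: counit_left)
  finally show ?thesis using 1 by (simp add: left_comodule_def Hom_def)
qed

text \<open>Naturality of \<open>\<delta>\<close> in its first argument together with linearity of
  \<open>f\<close>. It is applied to the coaction of \<open>A\<close>, which is thereby moved across
  the inverse Galois map.\<close>

lemma galois_inv_natural:
  assumes [simp]: "bimonoid H" and S: "S \<in> Hom D (ob H) ((ob H)\<^sup>-)"
    and N: "right_module H N \<mu>" and N': "right_module H N' \<mu>'" and W: "left_comodule H W \<kappa>"
    and f [simp]: "f \<in> Arr D" "Dom D f = N" "Cod D f = N'" and lin: "f \<cdot> \<mu> = \<mu>' \<cdot> (f \<odot> ob H)"
  shows "galois_inv H S N' \<mu>' W \<kappa> \<cdot> (f \<bullet> W) = ((f \<bullet> I) \<odot> W) \<cdot> galois_inv H S N \<mu> W \<kappa>"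
proof -
  have [simp]: "S \<in> Arr D" "Dom D S = ob H" "Cod D S = (ob H)\<^sup>-" using S by (auto simp: Hom_def)
  note [simp] = left_comodule_simps(1-4)[OF W] right_module_simps(1-4)[OF N] right_module_simps(1-4)[OF N']
  let ?y = "(I \<odot> ((S \<bullet> W) \<cdot> \<kappa>)) \<cdot> inv (l\<^sub>c W)"
  have "galois_inv H S N' \<mu>' W \<kappa> \<cdot> (f \<bullet> W) = ((\<mu>' \<bullet> I) \<odot> W) \<cdot> (\<delta> N' I (ob H) W \<cdot> (f \<bullet> (I \<odot> ((ob H)\<^sup>- \<bullet> W)))) \<cdot> (N \<bullet> ?y)"
    unfolding galois_inv_def by simp
  also have "\<dots> = (((\<mu>' \<cdot> (f \<odot> ob H)) \<bullet> I) \<odot> W) \<cdot> \<delta> N I (ob H) W \<cdot> (N \<bullet> ?y)"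
    using delta_nat[of f I "ob H" W] by simp
  also have "\<dots> = ((f \<bullet> I) \<odot> W) \<cdot> galois_inv H S N \<mu> W \<kappa>"
    unfolding galois_inv_def by (simp flip: lin)
  finally show ?thesis .
qed

text \<open>For Hopf algebras: the Galois map of the diagonal module sends
  \<open>(n \<otimes> 1) \<otimes> w\<close> to
  \<open>n w\<^sub>1 \<otimes> w\<^sub>2 \<otimes> w\<^sub>0\<close>, which is also the coaction of
  \<open>W\<close> applied to \<open>n w\<^sub>1 \<otimes> w\<^sub>0\<close>. Coassociativity of
  \<open>\<kappa>\<close> and associativity of \<open>\<zeta>\<close> for \<open>\<bullet>\<close>
  identify the two.\<close>

lemma galois_bull:
  assumes [simp]: "bimonoid H" and N: "right_module H N \<mu>" and W: "left_comodule H W \<kappa>"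
  shows "galois H (N \<bullet> ob H) ((\<mu> \<bullet> mul H) \<cdot> \<zeta> N (ob H) (ob H) (ob H) \<cdot> ((N \<bullet> ob H) \<odot> comul H)) W \<kappa> \<cdot>
      ((inv (a\<^sub>b N (ob H) I) \<cdot> (N \<bullet> ((one H \<bullet> I) \<cdot> \<Delta>\<^sub>I))) \<odot> W) =
    inv (a\<^sub>b N (ob H) W) \<cdot> (N \<bullet> \<kappa>) \<cdot> galois H N \<mu> W \<kappa>"
proof -
  let ?h = "ob H" let ?Nh = "N \<bullet> ?h" let ?hh = "?h \<odot> ?h" let ?z = "\<zeta> N ?h ?h ?h" let ?IW = "I \<odot> W"
  note [simp] = left_comodule_simps(1-4)[OF W] right_module_simps(1-4)[OF N]
  note com = left_comodule_simps(5,6)[OF W]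
  note mod = right_module_simps(5,6)[OF N]
  define v where "v = (one H \<bullet> I) \<cdot> \<Delta>\<^sub>I"
  have v [simp]: "v \<in> Arr D" "Dom D v = I" "Cod D v = ?h \<bullet> I" unfolding v_def by simp_all
  define \<alpha> where "\<alpha> = inv (a\<^sub>b N ?h I) \<cdot> (N \<bullet> v)"
  have \<alpha> [simp]: "\<alpha> \<in> Arr D" "Dom D \<alpha> = N \<bullet> I" "Cod D \<alpha> = ?Nh \<bullet> I" unfolding \<alpha>_def by simp_all
  have za: "a\<^sub>b (N \<odot> ?h) ?hh ?IW \<cdot> (?z \<bullet> ?IW) \<cdot> \<zeta> ?Nh I (?h \<bullet> ?h) W =
    ((N \<odot> ?h) \<bullet> \<zeta> ?h I ?h W) \<cdot> \<zeta> N (?h \<bullet> I) ?h (?h \<bullet> W) \<cdot> (a\<^sub>b N ?h I \<odot> a\<^sub>b ?h ?h W)"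
    by (rule zeta_assoc_bull[symmetric]) simp
  have Z: "(?z \<bullet> ?IW) \<cdot> \<zeta> ?Nh I (?h \<bullet> ?h) W \<cdot> (\<alpha> \<odot> ((comul H \<bullet> W) \<cdot> \<kappa>)) =
    inv (a\<^sub>b (N \<odot> ?h) ?hh ?IW) \<cdot> ((N \<odot> ?h) \<bullet> (\<zeta> ?h I ?h W \<cdot> (v \<odot> \<kappa>))) \<cdot> \<zeta> N I ?h W \<cdot> ((N \<bullet> I) \<odot> \<kappa>)"
  proof (rule circ.iso_shift)
    have "a\<^sub>b (N \<odot> ?h) ?hh ?IW \<cdot> (?z \<bullet> ?IW) \<cdot> \<zeta> ?Nh I (?h \<bullet> ?h) W \<cdot> (\<alpha> \<odot> ((comul H \<bullet> W) \<cdot> \<kappa>)) =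
      (a\<^sub>b (N \<odot> ?h) ?hh ?IW \<cdot> (?z \<bullet> ?IW) \<cdot> \<zeta> ?Nh I (?h \<bullet> ?h) W) \<cdot> (\<alpha> \<odot> ((comul H \<bullet> W) \<cdot> \<kappa>))" by simp
    also have "\<dots> = ((N \<odot> ?h) \<bullet> \<zeta> ?h I ?h W) \<cdot> \<zeta> N (?h \<bullet> I) ?h (?h \<bullet> W) \<cdot> ((a\<^sub>b N ?h I \<cdot> \<alpha>) \<odot> (a\<^sub>b ?h ?h W \<cdot> (comul H \<bullet> W) \<cdot> \<kappa>))"
      by (simp only: za) simp
    also have "\<dots> = ((N \<odot> ?h) \<bullet> \<zeta> ?h I ?h W) \<cdot> (\<zeta> N (?h \<bullet> I) ?h (?h \<bullet> W) \<cdot> ((N \<bullet> v) \<odot> (?h \<bullet> \<kappa>))) \<cdot> ((N \<bullet> I) \<odot> \<kappa>)"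
      by (simp add: com(1) \<alpha>_def)
    also have "\<dots> = ((N \<odot> ?h) \<bullet> (\<zeta> ?h I ?h W \<cdot> (v \<odot> \<kappa>))) \<cdot> \<zeta> N I ?h W \<cdot> ((N \<bullet> I) \<odot> \<kappa>)"
      by (subst zeta_nat) simp_all
    finally show "a\<^sub>b (N \<odot> ?h) ?hh ?IW \<cdot> (?z \<bullet> ?IW) \<cdot> \<zeta> ?Nh I (?h \<bullet> ?h) W \<cdot> (\<alpha> \<odot> ((comul H \<bullet> W) \<cdot> \<kappa>)) =
      ((N \<odot> ?h) \<bullet> (\<zeta> ?h I ?h W \<cdot> (v \<odot> \<kappa>))) \<cdot> \<zeta> N I ?h W \<cdot> ((N \<bullet> I) \<odot> \<kappa>)" .
  qed simp_all
  \<comment> \<open>The inserted unit of \<open>H\<close> is absorbed by the multiplication, leaving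
    the plain coaction.\<close>
  have K: "(mul H \<bullet> l\<^sub>c W) \<cdot> \<zeta> ?h I ?h W \<cdot> (v \<odot> \<kappa>) = \<kappa> \<cdot> l\<^sub>c W"
  proof -
    have "(mul H \<bullet> l\<^sub>c W) \<cdot> \<zeta> ?h I ?h W \<cdot> (v \<odot> \<kappa>) =
      (mul H \<bullet> l\<^sub>c W) \<cdot> (\<zeta> ?h I ?h W \<cdot> ((one H \<bullet> I) \<odot> (?h \<bullet> W))) \<cdot> (\<Delta>\<^sub>I \<odot> (?h \<bullet> W)) \<cdot> (I \<odot> \<kappa>)"
      unfolding v_def by simp
    also have "\<dots> = ((mul H \<cdot> (one H \<odot> ?h)) \<bullet> l\<^sub>c W) \<cdot> \<zeta> I I ?h W \<cdot> (\<Delta>\<^sub>I \<odot> (?h \<bullet> W)) \<cdot> (I \<odot> \<kappa>)"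
      by (subst zeta_nat) simp_all
    also have "\<dots> = ((l\<^sub>c ?h \<bullet> l\<^sub>c W) \<cdot> \<zeta> I I ?h W \<cdot> (\<Delta>\<^sub>I \<odot> (?h \<bullet> W))) \<cdot> (I \<odot> \<kappa>)"
      by (simp add: mul_unit_left)
    also have "\<dots> = \<kappa> \<cdot> l\<^sub>c W"
      by (subst zeta_unit_left) (simp_all add: circ.lunit_nat)
    finally show ?thesis .
  qed
  have "galois H ?Nh ((\<mu> \<bullet> mul H) \<cdot> ?z \<cdot> (?Nh \<odot> comul H)) W \<kappa> \<cdot> (\<alpha> \<odot> W) =
    ((\<mu> \<bullet> mul H) \<bullet> l\<^sub>c W) \<cdot> (?z \<bullet> ?IW) \<cdot> (((?Nh \<odot> comul H) \<bullet> ?IW) \<cdot> \<zeta> ?Nh I ?h W) \<cdot> (\<alpha> \<odot> \<kappa>)"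
    unfolding galois_def by simp
  also have "\<dots> = ((\<mu> \<bullet> mul H) \<bullet> l\<^sub>c W) \<cdot> (?z \<bullet> ?IW) \<cdot> (\<zeta> ?Nh I (?h \<bullet> ?h) W \<cdot> ((?Nh \<bullet> I) \<odot> (comul H \<bullet> W))) \<cdot> (\<alpha> \<odot> \<kappa>)"
    by (subst zeta_nat) simp_all
  also have "\<dots> = ((\<mu> \<bullet> mul H) \<bullet> l\<^sub>c W) \<cdot> (?z \<bullet> ?IW) \<cdot> \<zeta> ?Nh I (?h \<bullet> ?h) W \<cdot> (\<alpha> \<odot> ((comul H \<bullet> W) \<cdot> \<kappa>))"
    by simp
  also have "\<dots> = (((\<mu> \<bullet> mul H) \<bullet> l\<^sub>c W) \<cdot> inv (a\<^sub>b (N \<odot> ?h) ?hh ?IW)) \<cdot>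
      ((N \<odot> ?h) \<bullet> (\<zeta> ?h I ?h W \<cdot> (v \<odot> \<kappa>))) \<cdot> \<zeta> N I ?h W \<cdot> ((N \<bullet> I) \<odot> \<kappa>)"
    by (subst Z) simp
  also have "\<dots> = (inv (a\<^sub>b N ?h W) \<cdot> (\<mu> \<bullet> (mul H \<bullet> l\<^sub>c W))) \<cdot>
      ((N \<odot> ?h) \<bullet> (\<zeta> ?h I ?h W \<cdot> (v \<odot> \<kappa>))) \<cdot> \<zeta> N I ?h W \<cdot> ((N \<bullet> I) \<odot> \<kappa>)"
    by (subst bull.Inv_assoc_nat) simp_all
  also have "\<dots> = inv (a\<^sub>b N ?h W) \<cdot> (\<mu> \<bullet> ((mul H \<bullet> l\<^sub>c W) \<cdot> \<zeta> ?h I ?h W \<cdot> (v \<odot> \<kappa>))) \<cdot> \<zeta> N I ?h W \<cdot> ((N \<bullet> I) \<odot> \<kappa>)"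
    by simp
  also have "\<dots> = inv (a\<^sub>b N ?h W) \<cdot> (N \<bullet> \<kappa>) \<cdot> galois H N \<mu> W \<kappa>"
    by (subst K) (simp add: galois_def)
  finally show ?thesis unfolding \<alpha>_def v_def .
qed

text \<open>For Hopf algebras this is \<open>n h\<^sub>1 \<epsilon>(h\<^sub>2) = n h\<close>: at
  \<open>W = H\<close> the counit recovers the action.\<close>

lemma galois_counit:
  assumes [simp]: "bimonoid H" and N: "right_module H N \<mu>"
  shows "r\<^sub>b N \<cdot> (N \<bullet> counit H) \<cdot> galois H N \<mu> (ob H) (comul H) = \<mu> \<cdot> ((r\<^sub>b N \<cdot> (N \<bullet> \<epsilon>\<^sub>I)) \<odot> ob H)"
proof -
  let ?h = "ob H" let ?Nh = "N \<odot> ?h"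
  note [simp] = right_module_simps(1-4)[OF N]
  have e: "counit H \<cdot> l\<^sub>c ?h = m\<^sub>J \<cdot> (\<epsilon>\<^sub>I \<odot> counit H)"
  proof -
    have "m\<^sub>J \<cdot> (\<epsilon>\<^sub>I \<odot> counit H) = (m\<^sub>J \<cdot> (\<epsilon>\<^sub>I \<odot> J)) \<cdot> (I \<odot> counit H)" by simp
    also have "\<dots> = counit H \<cdot> l\<^sub>c ?h" by (simp add: m_J_unit_left circ.lunit_nat)
    finally show ?thesis ..
  qed
  have "r\<^sub>b N \<cdot> (N \<bullet> counit H) \<cdot> galois H N \<mu> ?h (comul H) =
    r\<^sub>b N \<cdot> (\<mu> \<bullet> (counit H \<cdot> l\<^sub>c ?h)) \<cdot> \<zeta> N I ?h ?h \<cdot> ((N \<bullet> I) \<odot> comul H)"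
    unfolding galois_def by simp
  also have "\<dots> = (r\<^sub>b N \<cdot> (\<mu> \<bullet> J)) \<cdot> (?Nh \<bullet> m\<^sub>J) \<cdot> ((?Nh \<bullet> (\<epsilon>\<^sub>I \<odot> counit H)) \<cdot> \<zeta> N I ?h ?h) \<cdot> ((N \<bullet> I) \<odot> comul H)"
    by (subst e) simp
  also have "\<dots> = (\<mu> \<cdot> r\<^sub>b ?Nh) \<cdot> (?Nh \<bullet> m\<^sub>J) \<cdot> ((?Nh \<bullet> (\<epsilon>\<^sub>I \<odot> counit H)) \<cdot> \<zeta> N I ?h ?h) \<cdot> ((N \<bullet> I) \<odot> comul H)"
    by (subst bull.runit_nat) simp_all
  also have "\<dots> = (\<mu> \<cdot> r\<^sub>b ?Nh) \<cdot> (?Nh \<bullet> m\<^sub>J) \<cdot> (\<zeta> N J ?h J \<cdot> ((N \<bullet> \<epsilon>\<^sub>I) \<odot> (?h \<bullet> counit H))) \<cdot> ((N \<bullet> I) \<odot> comul H)"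
    by (subst zeta_nat) simp_all
  also have "\<dots> = \<mu> \<cdot> (r\<^sub>b ?Nh \<cdot> (?Nh \<bullet> m\<^sub>J) \<cdot> \<zeta> N J ?h J) \<cdot> ((N \<bullet> \<epsilon>\<^sub>I) \<odot> ((?h \<bullet> counit H) \<cdot> comul H))"
    by simp
  also have "\<dots> = \<mu> \<cdot> ((r\<^sub>b N \<cdot> (N \<bullet> \<epsilon>\<^sub>I)) \<odot> (r\<^sub>b ?h \<cdot> (?h \<bullet> counit H) \<cdot> comul H))"
    by (subst zeta_counit_right) simp_all
  finally show ?thesis by (simp add: counit_right)
qed

text \<open>A coinvariant \<open>w\<close> contributes just the unit of \<open>H\<close> to the
  action, so the Galois map does nothing beyond unit constraints.\<close>

lemma galois_coinvariant:
  assumes [simp]: "bimonoid H" and N: "right_module H N \<mu>" and W: "left_comodule H W \<kappa>"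
    and [simp]: "w \<in> Arr D" "Dom D w = I" "Cod D w = W" and w: "\<kappa> \<cdot> w = (one H \<bullet> w) \<cdot> \<Delta>\<^sub>I"
  shows "galois H N \<mu> W \<kappa> \<cdot> ((N \<bullet> I) \<odot> w) = (N \<bullet> w) \<cdot> r\<^sub>c (N \<bullet> I)"
proof -
  note [simp] = left_comodule_simps(1-4)[OF W] right_module_simps(1-4)[OF N]
  have "galois H N \<mu> W \<kappa> \<cdot> ((N \<bullet> I) \<odot> w) = (\<mu> \<bullet> l\<^sub>c W) \<cdot> (\<zeta> N I (ob H) W \<cdot> ((N \<bullet> I) \<odot> (one H \<bullet> w))) \<cdot> ((N \<bullet> I) \<odot> \<Delta>\<^sub>I)"
    unfolding galois_def by (simp add: w)
  also have "\<dots> = ((\<mu> \<cdot> (N \<odot> one H)) \<bullet> (l\<^sub>c W \<cdot> (I \<odot> w))) \<cdot> \<zeta> N I I I \<cdot> ((N \<bullet> I) \<odot> \<Delta>\<^sub>I)"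
    using zeta_nat[of N I "one H" w] by simp
  also have "\<dots> = (N \<bullet> w) \<cdot> (r\<^sub>c N \<bullet> r\<^sub>c I) \<cdot> \<zeta> N I I I \<cdot> ((N \<bullet> I) \<odot> \<Delta>\<^sub>I)"
    by (simp add: right_module_simps(6)[OF N] circ.lunit_nat l_I_eq)
  finally show ?thesis by (simp add: zeta_unit_right)
qed

end

section \<open>The splitting\<close>

text \<open>Based on \<open>semi_reversion\<close>, so that it can be interpreted a second time
  after both tensor products have been reversed.\<close>

locale hopf_split_kernel = split_kernel D s A H K \<pi> \<sigma> k e + semi_reversion D R
  for D :: "('a, 'b) duoidal_scheme" and s A H K \<pi> \<sigma> k e and R :: "'a reversion_data" +
  fixes S :: 'a
  assumes S_antipode: "is_antipode H S"

context split_kernel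
begin

lemma kernel_mor_simps [simp]:
  "\<pi> \<in> Arr D" "Dom D \<pi> = ob A" "Cod D \<pi> = ob H" "\<sigma> \<in> Arr D" "Dom D \<sigma> = ob H" "Cod D \<sigma> = ob A"
  "k \<in> Arr D" "Dom D k = ob K" "Cod D k = ob A" "e \<in> Arr D" "Dom D e = ob K" "Cod D e = I"
  using comonoid_mor_simps[OF bimonoid_mor_comonoid_mor[OF pi_mor]]
    comonoid_mor_simps[OF bimonoid_mor_comonoid_mor[OF sigma_mor]]
    comonoid_mor_simps[OF bimonoid_mor_comonoid_mor[OF k_mor]]
    comonoid_mor_simps[OF bimonoid_mor_comonoid_mor[OF e_mor]] by simp_all

lemmas comul_pi = comul_mor[OF bimonoid_mor_comonoid_mor[OF pi_mor]]
lemmas comul_sigma = comul_mor[OF bimonoid_mor_comonoid_mor[OF sigma_mor]]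
lemmas comul_k = comul_mor[OF bimonoid_mor_comonoid_mor[OF k_mor]]
lemmas comul_e = comul_mor[OF bimonoid_mor_comonoid_mor[OF e_mor], simplified]
lemmas counit_pi = counit_mor[OF bimonoid_mor_comonoid_mor[OF pi_mor]]
lemmas counit_k = counit_mor[OF bimonoid_mor_comonoid_mor[OF k_mor]]
lemmas counit_e = counit_mor[OF bimonoid_mor_comonoid_mor[OF e_mor], simplified]

text \<open>\<open>A\<close> is a right \<open>H\<close>-module through \<open>\<sigma>\<close> and,
  by \<open>coact\<close>, a right \<open>H\<close>-comodule through \<open>\<pi>\<close>; the
  latter is the morphism \<open>\<theta>\<close> of the overview.\<close>

definition act where "act = mul A \<cdot> (ob A \<odot> \<sigma>)"
definition coact where "coact = (ob A \<bullet> \<pi>) \<cdot> comul A"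
text \<open>Replaces the element \<open>1\<close> of a Hopf algebra, and \<open>triv_coact\<close>
  replaces \<open>a \<mapsto> a \<otimes> 1\<close>. Since the unit of \<open>\<bullet>\<close> is
  \<open>J\<close>, a copy of \<open>I\<close> has to be kept as an additional leg.\<close>

definition unit_pair where "unit_pair = (one H \<bullet> I) \<cdot> \<Delta>\<^sub>I"
definition triv_coact where "triv_coact = inv (a\<^sub>b (ob A) (ob H) I) \<cdot> (ob A \<bullet> unit_pair)"
text \<open>The morphism through which \<open>coact \<cdot> k\<close> factors over
  \<open>A \<bullet> one H\<close>. It is the one that will be retracted.\<close>

definition leg where "leg = (k \<bullet> e) \<cdot> comul K"
definition proj where "proj = r\<^sub>b (ob A) \<cdot> (ob A \<bullet> \<epsilon>\<^sub>I)"

lemma kernel_def_simps [simp]: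
  "act \<in> Arr D" "Dom D act = ob A \<odot> ob H" "Cod D act = ob A"
  "coact \<in> Arr D" "Dom D coact = ob A" "Cod D coact = ob A \<bullet> ob H"
  "unit_pair \<in> Arr D" "Dom D unit_pair = I" "Cod D unit_pair = ob H \<bullet> I"
  "triv_coact \<in> Arr D" "Dom D triv_coact = ob A \<bullet> I" "Cod D triv_coact = (ob A \<bullet> ob H) \<bullet> I"
  "leg \<in> Arr D" "Dom D leg = ob K" "Cod D leg = ob A \<bullet> I"
  "proj \<in> Arr D" "Dom D proj = ob A \<bullet> I" "Cod D proj = ob A"
  by (simp_all add: act_def coact_def unit_pair_def triv_coact_def leg_def proj_def)

lemma coact_k: "coact \<cdot> k = (ob A \<bullet> one H) \<cdot> leg"
proof -
  have "coact \<cdot> k = (k \<bullet> (\<pi> \<cdot> k)) \<cdot> comul K"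
    unfolding coact_def by (simp add: comul_k)
  then show ?thesis unfolding leg_def by (simp add: pi_k)
qed

lemma coact_coassoc: "a\<^sub>b (ob A) (ob H) (ob H) \<cdot> (coact \<bullet> ob H) \<cdot> coact = (ob A \<bullet> comul H) \<cdot> coact"
proof -
  have "a\<^sub>b (ob A) (ob H) (ob H) \<cdot> (coact \<bullet> ob H) \<cdot> coact =
    (a\<^sub>b (ob A) (ob H) (ob H) \<cdot> ((ob A \<bullet> \<pi>) \<bullet> \<pi>)) \<cdot> (comul A \<bullet> ob A) \<cdot> comul A"
    unfolding coact_def by simp
  also have "\<dots> = (ob A \<bullet> (\<pi> \<bullet> \<pi>)) \<cdot> a\<^sub>b (ob A) (ob A) (ob A) \<cdot> (comul A \<bullet> ob A) \<cdot> comul A"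
    by (simp add: bull.assoc_nat)
  also have "\<dots> = (ob A \<bullet> comul H) \<cdot> coact"
    unfolding coact_def by (simp add: coassoc comul_pi)
  finally show ?thesis .
qed

text \<open>\<open>K\<close> consists of coinvariants. Coassociativity of \<open>K\<close> moves the
  second coaction onto the \<open>e\<close>-leg, where \<open>e\<close> is comultiplicative.\<close>

lemma coact_leg: "(coact \<bullet> I) \<cdot> leg = triv_coact \<cdot> leg"
proof -
  have "(coact \<bullet> I) \<cdot> leg = ((coact \<cdot> k) \<bullet> e) \<cdot> comul K" unfolding leg_def by simp
  also have "\<dots> = ((k \<bullet> (one H \<cdot> e)) \<bullet> e) \<cdot> inv (a\<^sub>b (ob K) (ob K) (ob K)) \<cdot> (ob K \<bullet> comul K) \<cdot> comul K"
    unfolding coact_k leg_def by (simp flip: coassoc)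
  also have "\<dots> = (((k \<bullet> (one H \<cdot> e)) \<bullet> e) \<cdot> inv (a\<^sub>b (ob K) (ob K) (ob K))) \<cdot> (ob K \<bullet> comul K) \<cdot> comul K"
    by simp
  also have "\<dots> = (inv (a\<^sub>b (ob A) (ob H) I) \<cdot> (k \<bullet> ((one H \<cdot> e) \<bullet> e))) \<cdot> (ob K \<bullet> comul K) \<cdot> comul K"
    by (subst bull.Inv_assoc_nat) simp_all
  also have "\<dots> = inv (a\<^sub>b (ob A) (ob H) I) \<cdot> (k \<bullet> ((one H \<bullet> I) \<cdot> (e \<bullet> e) \<cdot> comul K)) \<cdot> comul K"
    by simp
  also have "\<dots> = triv_coact \<cdot> leg"
    unfolding triv_coact_def leg_def unit_pair_def by (simp flip: comul_e)
  finally show ?thesis .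
qed

lemma proj_leg: "proj \<cdot> leg = k"
proof -
  have "proj \<cdot> leg = (r\<^sub>b (ob A) \<cdot> (k \<bullet> J)) \<cdot> (ob K \<bullet> counit K) \<cdot> comul K"
    unfolding proj_def leg_def by (simp add: counit_e)
  also have "\<dots> = k \<cdot> r\<^sub>b (ob K) \<cdot> (ob K \<bullet> counit K) \<cdot> comul K"
    by (subst bull.runit_nat) simp_all
  finally show ?thesis by (simp add: counit_right)
qed

end

context hopf_split_kernel
begin

lemma S_simps [simp]: "S \<in> Arr D" "Dom D S = ob H" "Cod D S = (ob H)\<^sup>-"
  using S_antipode unfolding is_antipode_def Hom_def by blast+

lemma S_Hom: "S \<in> Hom D (ob H) ((ob H)\<^sup>-)"
  by (simp add: Hom_def)

lemma S_left: "left_antipode H S" and S_right: "right_antipode H S"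
  using S_antipode unfolding is_antipode_iff by blast+

lemma act_module: "right_module H (ob A) act"
proof -
  let ?A = "ob A" let ?h = "ob H"
  have "act \<cdot> (act \<odot> ?h) = mul A \<cdot> (mul A \<odot> ?A) \<cdot> ((?A \<odot> \<sigma>) \<odot> \<sigma>)"
    unfolding act_def by simp
  also have "\<dots> = mul A \<cdot> (?A \<odot> mul A) \<cdot> (a\<^sub>c ?A ?A ?A \<cdot> ((?A \<odot> \<sigma>) \<odot> \<sigma>))"
    by (subst circ.comp_rewrite[OF mul_assoc]) simp_all
  also have "\<dots> = mul A \<cdot> (?A \<odot> (mul A \<cdot> (\<sigma> \<odot> \<sigma>))) \<cdot> a\<^sub>c ?A ?h ?h"
    by (subst circ.assoc_nat) simp_all
  also have "\<dots> = act \<cdot> (?A \<odot> mul H) \<cdot> a\<^sub>c ?A ?h ?h"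
    unfolding act_def by (simp flip: mul_mor[OF sigma_mor])
  finally have "act \<cdot> (act \<odot> ?h) = act \<cdot> (?A \<odot> mul H) \<cdot> a\<^sub>c ?A ?h ?h" .
  moreover have "act \<cdot> (?A \<odot> one H) = r\<^sub>c ?A"
    unfolding act_def by (simp add: one_mor[OF sigma_mor] mul_unit_right)
  ultimately show ?thesis by (simp add: right_module_def Hom_def)
qed

definition act_bull where
  "act_bull = (act \<bullet> mul H) \<cdot> \<zeta> (ob A) (ob H) (ob H) (ob H) \<cdot> ((ob A \<bullet> ob H) \<odot> comul H)"

lemma act_bull_simps [simp]: "act_bull \<in> Arr D" "Dom D act_bull = (ob A \<bullet> ob H) \<odot> ob H" "Cod D act_bull = ob A \<bullet> ob H"
  by (simp_all add: act_bull_def)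

lemma act_bull_module: "right_module H (ob A \<bullet> ob H) act_bull"
  unfolding act_bull_def by (rule right_module_bull[OF bimonoid_H act_module])

text \<open>\<open>A\<close> is a Hopf module over \<open>H\<close>: multiplicativity of
  \<open>comul A\<close> and of \<open>\<pi>\<close> gives the formula with
  \<open>\<pi> \<cdot> \<sigma>\<close> on the second leg, and this is the identity of
  \<open>H\<close>.\<close>

lemma coact_act: "coact \<cdot> act = act_bull \<cdot> (coact \<odot> ob H)"
proof -
  let ?A = "ob A" let ?h = "ob H"
  have "coact \<cdot> act = (?A \<bullet> \<pi>) \<cdot> (mul A \<bullet> mul A) \<cdot> \<zeta> ?A ?A ?A ?A \<cdot> (comul A \<odot> (comul A \<cdot> \<sigma>))"
    unfolding coact_def act_def by (simp add: circ.comp_rewrite[OF comul_mul])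
  also have "\<dots> = (mul A \<bullet> (mul H \<cdot> (\<pi> \<odot> \<pi>))) \<cdot> (\<zeta> ?A ?A ?A ?A \<cdot> ((?A \<bullet> ?A) \<odot> (\<sigma> \<bullet> \<sigma>))) \<cdot> (comul A \<odot> comul H)"
    by (simp add: comul_sigma mul_mor[OF pi_mor])
  also have "\<dots> = (act \<bullet> mul H) \<cdot> ((?A \<odot> ?h) \<bullet> (\<pi> \<odot> (\<pi> \<cdot> \<sigma>))) \<cdot> \<zeta> ?A ?A ?h ?h \<cdot> (comul A \<odot> comul H)"
    by (subst zeta_nat) (simp_all add: act_def)
  also have "\<dots> = (act \<bullet> mul H) \<cdot> (((?A \<odot> ?h) \<bullet> (\<pi> \<odot> ?h)) \<cdot> \<zeta> ?A ?A ?h ?h) \<cdot> (comul A \<odot> comul H)"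
    by (simp add: pi_sigma)
  also have "\<dots> = (act \<bullet> mul H) \<cdot> (\<zeta> ?A ?h ?h ?h \<cdot> ((?A \<bullet> \<pi>) \<odot> (?h \<bullet> ?h))) \<cdot> (comul A \<odot> comul H)"
    by (subst zeta_nat) simp_all
  also have "\<dots> = act_bull \<cdot> (coact \<odot> ?h)"
    unfolding act_bull_def coact_def by simp
  finally show ?thesis .
qed

abbreviation gA where "gA \<equiv> galois H (ob A) act"
abbreviation gA' where "gA' \<equiv> galois_inv H S (ob A) act"

lemmas gA_simps = galois_simps[OF bimonoid_H act_module] galois_inv_simps[OF bimonoid_H act_module _ S_Hom]
lemmas gA_bull_simps = galois_simps[OF bimonoid_H act_bull_module] galois_inv_simps[OF bimonoid_H act_bull_module _ S_Hom]
lemmas gA_inverse = galois_inv_gal[OF bimonoid_H S_right act_module] galois_gal_inv[OF bimonoid_H S_left act_module]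
lemmas gA_bull_inverse = galois_inv_gal[OF bimonoid_H S_right act_bull_module]

text \<open>The hypothesis says that \<open>f\<close> takes values in the cotensor product of
  \<open>A\<close> and \<open>W\<close> over \<open>H\<close>; the conclusion, that the inverse
  Galois map sends these to coinvariants of \<open>A\<close>. Naturality moves the coaction past the
  inverse, the hypothesis replaces it by the coaction of \<open>W\<close>, and
  \<open>galois_bull\<close> recognises the trivial coaction.\<close>

lemma equalizing:
  assumes W: "left_comodule H W \<kappa>" and [simp]: "f \<in> Arr D" "Cod D f = ob A \<bullet> W"
    and f: "a\<^sub>b (ob A) (ob H) W \<cdot> (coact \<bullet> W) \<cdot> f = (ob A \<bullet> \<kappa>) \<cdot> f"
  shows "((coact \<bullet> I) \<odot> W) \<cdot> gA' W \<kappa> \<cdot> f = (triv_coact \<odot> W) \<cdot> gA' W \<kappa> \<cdot> f"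
proof -
  let ?A = "ob A" let ?h = "ob H" let ?g2 = "galois_inv H S (?A \<bullet> ?h) act_bull W \<kappa>"
  note [simp] = left_comodule_simps(1-4)[OF W] gA_simps[OF W] gA_bull_simps[OF W]
  have "((coact \<bullet> I) \<odot> W) \<cdot> gA' W \<kappa> \<cdot> f = (((coact \<bullet> I) \<odot> W) \<cdot> gA' W \<kappa>) \<cdot> f" by simp
  also have "\<dots> = (?g2 \<cdot> (coact \<bullet> W)) \<cdot> f"
    by (subst galois_inv_natural[OF bimonoid_H S_Hom act_module act_bull_module W _ _ _ coact_act]) simp_all
  also have "\<dots> = ?g2 \<cdot> inv (a\<^sub>b ?A ?h W) \<cdot> a\<^sub>b ?A ?h W \<cdot> (coact \<bullet> W) \<cdot> f" by simp
  \<comment> \<open>The identity \<open>gA W \<kappa> \<cdot> gA' W \<kappa>\<close> is inserted in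
    front of \<open>f\<close> to create the expression that \<open>galois_bull\<close>
    rewrites.\<close>
  also have "\<dots> = ?g2 \<cdot> inv (a\<^sub>b ?A ?h W) \<cdot> (?A \<bullet> \<kappa>) \<cdot> (gA W \<kappa> \<cdot> gA' W \<kappa>) \<cdot> f"
    by (subst f) (simp add: gA_inverse(2)[OF W])
  also have "\<dots> = ?g2 \<cdot> (inv (a\<^sub>b ?A ?h W) \<cdot> (?A \<bullet> \<kappa>) \<cdot> gA W \<kappa>) \<cdot> gA' W \<kappa> \<cdot> f" by simp
  also have "\<dots> = ?g2 \<cdot> (galois H (?A \<bullet> ?h) act_bull W \<kappa> \<cdot> (triv_coact \<odot> W)) \<cdot> gA' W \<kappa> \<cdot> f"
    by (simp only: act_bull_def triv_coact_def unit_pair_def galois_bull[OF bimonoid_H act_module W])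
  also have "\<dots> = (?g2 \<cdot> galois H (?A \<bullet> ?h) act_bull W \<kappa>) \<cdot> (triv_coact \<odot> W) \<cdot> gA' W \<kappa> \<cdot> f" by simp
  also have "\<dots> = (triv_coact \<odot> W) \<cdot> gA' W \<kappa> \<cdot> f"
    by (simp add: gA_bull_inverse[OF W])
  finally show ?thesis .
qed

text \<open>The cofree comodule on \<open>I\<close> stands in for \<open>H\<close> as a comodule
  over itself. The counit of \<open>H\<close> alone would end in \<open>J\<close>, which
  \<open>\<odot>\<close> cannot absorb; with the extra leg the counit ends in \<open>I\<close>, and
  \<open>r\<^sub>c\<close> removes it.\<close>

definition HI where "HI = ob H \<bullet> I"
definition HI_coact where "HI_coact = a\<^sub>b (ob H) (ob H) I \<cdot> (comul H \<bullet> I)"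
definition HI_counit where "HI_counit = l\<^sub>b I \<cdot> (counit H \<bullet> I)"
definition coactI where "coactI = a\<^sub>b (ob A) (ob H) I \<cdot> (coact \<bullet> I)"

lemma HI: "left_comodule H HI HI_coact"
  unfolding HI_def HI_coact_def by (rule left_comodule_cofree) simp_all

lemma HI_simps [simp]: "ob H \<bullet> I = HI" "HI \<in> Obj D"
  "HI_coact \<in> Arr D" "Dom D HI_coact = HI" "Cod D HI_coact = ob H \<bullet> HI"
  "HI_counit \<in> Arr D" "Dom D HI_counit = HI" "Cod D HI_counit = I"
  "coactI \<in> Arr D" "Dom D coactI = ob A \<bullet> I" "Cod D coactI = ob A \<bullet> HI"
  by (simp_all add: HI_def HI_coact_def HI_counit_def coactI_def)

text \<open>Provides the hypothesis of \<open>equalizing\<close> for \<open>coactI\<close> and the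
  cofree comodule.\<close>

lemma coactI_coassoc: "a\<^sub>b (ob A) (ob H) HI \<cdot> (coact \<bullet> HI) \<cdot> coactI = (ob A \<bullet> HI_coact) \<cdot> coactI"
proof -
  let ?A = "ob A" let ?h = "ob H" let ?Ah = "ob A \<bullet> ob H" let ?W = "?h \<bullet> I"
  have "a\<^sub>b ?A ?h ?W \<cdot> (coact \<bullet> ?W) \<cdot> a\<^sub>b ?A ?h I \<cdot> (coact \<bullet> I) =
    a\<^sub>b ?A ?h ?W \<cdot> ((coact \<bullet> (?h \<bullet> I)) \<cdot> a\<^sub>b ?A ?h I) \<cdot> (coact \<bullet> I)" by (simp del: HI_simps(1))
  also have "\<dots> = a\<^sub>b ?A ?h ?W \<cdot> (a\<^sub>b ?Ah ?h I \<cdot> ((coact \<bullet> ?h) \<bullet> I)) \<cdot> (coact \<bullet> I)"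
    by (subst bull.assoc_nat) (simp_all del: HI_simps(1))
  also have "\<dots> = (a\<^sub>b ?A ?h ?W \<cdot> a\<^sub>b ?Ah ?h I) \<cdot> (((coact \<bullet> ?h) \<cdot> coact) \<bullet> I)"
    by (simp del: HI_simps(1))
  also have "\<dots> = (?A \<bullet> a\<^sub>b ?h ?h I) \<cdot> a\<^sub>b ?A (?h \<bullet> ?h) I \<cdot> ((a\<^sub>b ?A ?h ?h \<cdot> (coact \<bullet> ?h) \<cdot> coact) \<bullet> I)"
    by (subst bull.pentagon) (simp_all del: HI_simps(1))
  also have "\<dots> = (?A \<bullet> a\<^sub>b ?h ?h I) \<cdot> (a\<^sub>b ?A (?h \<bullet> ?h) I \<cdot> ((?A \<bullet> comul H) \<bullet> I)) \<cdot> (coact \<bullet> I)"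
    by (simp add: coact_coassoc del: HI_simps(1))
  also have "\<dots> = (?A \<bullet> (a\<^sub>b ?h ?h I \<cdot> (comul H \<bullet> I))) \<cdot> a\<^sub>b ?A ?h I \<cdot> (coact \<bullet> I)"
    by (subst bull.assoc_nat) (simp_all del: HI_simps(1))
  finally show ?thesis unfolding coactI_def HI_coact_def HI_def .
qed

lemma proj_triv_coact: "r\<^sub>b (ob A \<bullet> ob H) \<cdot> ((ob A \<bullet> ob H) \<bullet> \<epsilon>\<^sub>I) \<cdot> triv_coact = ob A \<bullet> one H"
proof -
  let ?A = "ob A" let ?h = "ob H"
  have "r\<^sub>b (?A \<bullet> ?h) \<cdot> ((?A \<bullet> ?h) \<bullet> \<epsilon>\<^sub>I) \<cdot> triv_coact = r\<^sub>b (?A \<bullet> ?h) \<cdot> (((?A \<bullet> ?h) \<bullet> \<epsilon>\<^sub>I) \<cdot> inv (a\<^sub>b ?A ?h I)) \<cdot> (?A \<bullet> unit_pair)"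
    unfolding triv_coact_def by simp
  also have "\<dots> = r\<^sub>b (?A \<bullet> ?h) \<cdot> (inv (a\<^sub>b ?A ?h J) \<cdot> (?A \<bullet> (?h \<bullet> \<epsilon>\<^sub>I))) \<cdot> (?A \<bullet> unit_pair)"
    by (subst bull.Inv_assoc_nat) (simp_all del: HI_simps(1))
  also have "\<dots> = (r\<^sub>b (?A \<bullet> ?h) \<cdot> inv (a\<^sub>b ?A ?h J)) \<cdot> (?A \<bullet> (?h \<bullet> \<epsilon>\<^sub>I)) \<cdot> (?A \<bullet> unit_pair)" by (simp del: HI_simps(1))
  also have "\<dots> = ?A \<bullet> (r\<^sub>b ?h \<cdot> (?h \<bullet> \<epsilon>\<^sub>I) \<cdot> unit_pair)"
    by (subst bull.inv_runit_ten) (simp_all del: HI_simps(1))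
  also have "r\<^sub>b ?h \<cdot> (?h \<bullet> \<epsilon>\<^sub>I) \<cdot> unit_pair = (r\<^sub>b ?h \<cdot> (one H \<bullet> J)) \<cdot> (I \<bullet> \<epsilon>\<^sub>I) \<cdot> \<Delta>\<^sub>I"
    unfolding unit_pair_def by (simp del: HI_simps(1))
  also have "\<dots> = one H \<cdot> r\<^sub>b I \<cdot> (I \<bullet> \<epsilon>\<^sub>I) \<cdot> \<Delta>\<^sub>I"
    by (subst bull.runit_nat) simp_all
  finally show ?thesis by (simp add: Delta_I_counit_right)
qed

text \<open>For Hopf algebras \<open>retr\<close> is \<open>a \<mapsto> a\<^sub>1 \<sigma>(S(\<pi>(a\<^sub>2)))\<close>.\<close>

definition retr_bull where "retr_bull = r\<^sub>c (ob A) \<cdot> (proj \<odot> HI_counit) \<cdot> gA' HI HI_coact \<cdot> a\<^sub>b (ob A) (ob H) I"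
definition retr where "retr = retr_bull \<cdot> (coact \<bullet> I)"

lemmas [simp] = gA_simps[OF HI]

lemma retr_simps [simp]: "retr_bull \<in> Arr D" "Dom D retr_bull = (ob A \<bullet> ob H) \<bullet> I" "Cod D retr_bull = ob A"
    "retr \<in> Arr D" "Dom D retr = ob A \<bullet> I" "Cod D retr = ob A"
  by (simp_all add: retr_bull_def retr_def)

lemma retr_eq: "retr = r\<^sub>c (ob A) \<cdot> (proj \<odot> HI_counit) \<cdot> gA' HI HI_coact \<cdot> coactI"
  unfolding retr_def retr_bull_def coactI_def by simp

text \<open>\<open>unit_pair\<close> is coinvariant in the cofree comodule, so the Galois map, and
  hence its inverse, leaves it in place: on \<open>a \<otimes> 1\<close> the classical formula
  returns \<open>a\<close>.\<close>

lemma retr_bull_triv_coact: "retr_bull \<cdot> triv_coact = proj"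
proof -
  let ?A = "ob A"
  have kv: "HI_coact \<cdot> unit_pair = (one H \<bullet> unit_pair) \<cdot> \<Delta>\<^sub>I"
  proof -
    have "HI_coact \<cdot> unit_pair = a\<^sub>b (ob H) (ob H) I \<cdot> (((one H \<bullet> one H) \<cdot> \<Delta>\<^sub>I) \<bullet> I) \<cdot> \<Delta>\<^sub>I"
      unfolding HI_coact_def unit_pair_def by (simp add: comul_one del: HI_simps(1))
    also have "\<dots> = (a\<^sub>b (ob H) (ob H) I \<cdot> ((one H \<bullet> one H) \<bullet> I)) \<cdot> (\<Delta>\<^sub>I \<bullet> I) \<cdot> \<Delta>\<^sub>I"
      by (simp del: HI_simps(1))
    also have "\<dots> = (one H \<bullet> (one H \<bullet> I)) \<cdot> a\<^sub>b I I I \<cdot> (\<Delta>\<^sub>I \<bullet> I) \<cdot> \<Delta>\<^sub>I"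
      by (subst bull.assoc_nat) simp_all
    also have "\<dots> = (one H \<bullet> unit_pair) \<cdot> \<Delta>\<^sub>I"
      by (simp add: Delta_I_coassoc unit_pair_def)
    finally show ?thesis .
  qed
  have ov: "HI_counit \<cdot> unit_pair = I"
    unfolding HI_counit_def unit_pair_def by (simp add: counit_one Delta_I_counit_left del: HI_simps(1))
  have g: "gA' HI HI_coact \<cdot> (?A \<bullet> unit_pair) = ((?A \<bullet> I) \<odot> unit_pair) \<cdot> inv (r\<^sub>c (?A \<bullet> I))"
  proof -
    have "gA' HI HI_coact \<cdot> (?A \<bullet> unit_pair) = gA' HI HI_coact \<cdot> ((?A \<bullet> unit_pair) \<cdot> r\<^sub>c (?A \<bullet> I)) \<cdot> inv (r\<^sub>c (?A \<bullet> I))" by simp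
    also have "\<dots> = gA' HI HI_coact \<cdot> (gA HI HI_coact \<cdot> ((?A \<bullet> I) \<odot> unit_pair)) \<cdot> inv (r\<^sub>c (?A \<bullet> I))"
      using galois_coinvariant[OF bimonoid_H act_module HI _ _ _ kv] by simp
    also have "\<dots> = (gA' HI HI_coact \<cdot> gA HI HI_coact) \<cdot> ((?A \<bullet> I) \<odot> unit_pair) \<cdot> inv (r\<^sub>c (?A \<bullet> I))" by simp
    finally show ?thesis by (simp add: gA_inverse(1)[OF HI])
  qed
  have "retr_bull \<cdot> triv_coact = r\<^sub>c ?A \<cdot> (proj \<odot> HI_counit) \<cdot> gA' HI HI_coact \<cdot> (?A \<bullet> unit_pair)"
    unfolding retr_bull_def triv_coact_def by simp
  also have "\<dots> = r\<^sub>c ?A \<cdot> (proj \<odot> I) \<cdot> inv (r\<^sub>c (?A \<bullet> I))"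
    by (subst g) (simp add: ov)
  also have "\<dots> = proj"
    using circ.Inv_runit_nat[of proj ?A] by simp
  finally show ?thesis .
qed

text \<open>By \<open>equalizing\<close> the coaction on \<open>retr\<close> is the trivial one, so
  it factors through \<open>A \<bullet> one H\<close>. The factor is given explicitly because the
  criterion \<open>factor\<close> asks for it.\<close>

lemma coact_retr: "coact \<cdot> retr = (ob A \<bullet> one H) \<cdot> r\<^sub>c (ob A \<bullet> I) \<cdot> ((ob A \<bullet> I) \<odot> HI_counit) \<cdot> gA' HI HI_coact \<cdot> coactI"
proof -
  let ?A = "ob A" let ?Ah = "ob A \<bullet> ob H" let ?x = "gA' HI HI_coact \<cdot> coactI"
  have tq: "coact \<cdot> proj = r\<^sub>b ?Ah \<cdot> (?Ah \<bullet> \<epsilon>\<^sub>I) \<cdot> (coact \<bullet> I)"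
  proof -
    have "r\<^sub>b ?Ah \<cdot> (?Ah \<bullet> \<epsilon>\<^sub>I) \<cdot> (coact \<bullet> I) = (r\<^sub>b ?Ah \<cdot> (coact \<bullet> J)) \<cdot> (?A \<bullet> \<epsilon>\<^sub>I)" by simp
    also have "\<dots> = coact \<cdot> proj" by (subst bull.runit_nat) (simp_all add: proj_def)
    finally show ?thesis ..
  qed
  have "coact \<cdot> retr = (coact \<cdot> r\<^sub>c ?A) \<cdot> (proj \<odot> HI_counit) \<cdot> ?x" unfolding retr_eq by simp
  also have "\<dots> = (r\<^sub>c ?Ah \<cdot> (coact \<odot> I)) \<cdot> (proj \<odot> HI_counit) \<cdot> ?x"
    by (subst circ.runit_nat) simp_all
  also have "\<dots> = r\<^sub>c ?Ah \<cdot> ((coact \<cdot> proj) \<odot> HI_counit) \<cdot> ?x" by simp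
  also have "\<dots> = r\<^sub>c ?Ah \<cdot> ((r\<^sub>b ?Ah \<cdot> (?Ah \<bullet> \<epsilon>\<^sub>I)) \<odot> HI_counit) \<cdot> ((coact \<bullet> I) \<odot> HI) \<cdot> ?x"
    by (subst tq) simp
  also have "\<dots> = r\<^sub>c ?Ah \<cdot> ((r\<^sub>b ?Ah \<cdot> (?Ah \<bullet> \<epsilon>\<^sub>I)) \<odot> HI_counit) \<cdot> (triv_coact \<odot> HI) \<cdot> ?x"
    by (subst equalizing[OF HI]) (simp_all add: coactI_coassoc)
  also have "\<dots> = r\<^sub>c ?Ah \<cdot> ((r\<^sub>b ?Ah \<cdot> (?Ah \<bullet> \<epsilon>\<^sub>I) \<cdot> triv_coact) \<odot> HI_counit) \<cdot> ?x" by simp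
  also have "\<dots> = (r\<^sub>c ?Ah \<cdot> ((?A \<bullet> one H) \<odot> I)) \<cdot> ((?A \<bullet> I) \<odot> HI_counit) \<cdot> ?x"
    by (subst proj_triv_coact) simp
  also have "\<dots> = (?A \<bullet> one H) \<cdot> r\<^sub>c (?A \<bullet> I) \<cdot> ((?A \<bullet> I) \<odot> HI_counit) \<cdot> ?x"
    by (subst circ.runit_nat) simp_all
  finally show ?thesis .
qed

text \<open>The corestriction of \<open>retr\<close> to \<open>K\<close>. The choice is harmless,
  \<open>k\<close> being a monomorphism.\<close>

definition \<rho> where "\<rho> = (SOME h. h \<in> Hom D (ob A \<bullet> I) (ob K) \<and> k \<cdot> h = retr)"

lemma rho: "\<rho> \<in> Hom D (ob A \<bullet> I) (ob K) \<and> k \<cdot> \<rho> = retr"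
  unfolding \<rho>_def
proof (rule someI_ex)
  have "\<exists>h \<in> Hom D (ob A \<bullet> I) (ob K). k \<cdot> h = retr"
  proof (rule factor)
    show "(ob A \<bullet> \<pi>) \<cdot> comul A \<cdot> retr = (ob A \<bullet> one H) \<cdot> r\<^sub>c (ob A \<bullet> I) \<cdot> ((ob A \<bullet> I) \<odot> HI_counit) \<cdot> gA' HI HI_coact \<cdot> coactI"
      using coact_retr unfolding coact_def by simp
  qed (simp_all add: Hom_def)
  then show "\<exists>h. h \<in> Hom D (ob A \<bullet> I) (ob K) \<and> k \<cdot> h = retr" by blast
qed

lemma rho_simps [simp]: "\<rho> \<in> Arr D" "Dom D \<rho> = ob A \<bullet> I" "Cod D \<rho> = ob K" and k_rho: "k \<cdot> \<rho> = retr"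
  using rho by (auto simp: Hom_def)

text \<open>On \<open>leg\<close> the coaction is trivial, there \<open>retr_bull\<close> is the
  projection, and the projection of \<open>leg\<close> is \<open>k\<close>; cancel
  \<open>k\<close>.\<close>

lemma rho_leg: "\<rho> \<cdot> leg = ob K"
proof (rule circ.monicD[OF k_monic, rotated -1])
  have "k \<cdot> \<rho> \<cdot> leg = retr_bull \<cdot> (coact \<bullet> I) \<cdot> leg"
    by (simp add: circ.comp_rewrite[OF k_rho] retr_def)
  also have "\<dots> = k \<cdot> ob K"
    by (simp add: coact_leg circ.comp_rewrite[OF retr_bull_triv_coact] proj_leg)
  finally show "k \<cdot> \<rho> \<cdot> leg = k \<cdot> ob K" .
qed simp_all

text \<open>For Hopf algebras the inverse is \<open>a \<mapsto> a\<^sub>1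
  \<sigma>(S(\<pi>(a\<^sub>2))) \<otimes> \<pi>(a\<^sub>3)\<close>: the inverse Galois map for
  \<open>W = H\<close> applied to the coaction, with \<open>\<rho>\<close> moving the first factor
  into \<open>K\<close>.\<close>

lemma split_iso: "is_iso D (mul A \<cdot> (k \<odot> \<sigma>))"
proof -
  let ?A = "ob A" let ?h = "ob H"
  note W = left_comodule_self[OF bimonoid_H]
  note [simp] = gA_simps[OF W]
  let ?g = "gA ?h (comul H)" and ?g' = "gA' ?h (comul H)"
  let ?f = "mul A \<cdot> (k \<odot> \<sigma>)" and ?f' = "(\<rho> \<odot> ?h) \<cdot> ?g' \<cdot> coact"
  have f: "?f = act \<cdot> (k \<odot> ?h)" unfolding act_def by simp
  \<comment> \<open>\<open>\<pi> \<cdot> k\<close> factors through the unit, so the coaction of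
    \<open>k(x) \<sigma>(h)\<close> involves the comultiplication of \<open>h\<close> and no more:
    it is the Galois map on \<open>leg\<close>.\<close>
  have coact_f: "coact \<cdot> ?f = ?g \<cdot> (leg \<odot> ?h)"
  proof -
    have "coact \<cdot> ?f = act_bull \<cdot> ((coact \<cdot> k) \<odot> ?h)"
      unfolding f by (simp add: circ.comp_rewrite[OF coact_act])
    also have "\<dots> = (act \<bullet> mul H) \<cdot> (\<zeta> ?A ?h ?h ?h \<cdot> ((?A \<bullet> one H) \<odot> (?h \<bullet> ?h))) \<cdot> (leg \<odot> comul H)"
      unfolding act_bull_def coact_k by simp
    also have "\<dots> = (act \<bullet> (mul H \<cdot> (one H \<odot> ?h))) \<cdot> \<zeta> ?A I ?h ?h \<cdot> (leg \<odot> comul H)"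
      by (subst zeta_nat) simp_all
    also have "\<dots> = ?g \<cdot> (leg \<odot> ?h)"
      by (simp add: mul_unit_left galois_def)
    finally show ?thesis .
  qed
  have "?f' \<cdot> ?f = (\<rho> \<odot> ?h) \<cdot> ?g' \<cdot> coact \<cdot> ?f" by simp
  also have "\<dots> = (\<rho> \<odot> ?h) \<cdot> (?g' \<cdot> ?g) \<cdot> (leg \<odot> ?h)" by (simp only: coact_f) simp
  also have "\<dots> = ob K \<odot> ?h" by (simp add: gA_inverse(1)[OF W] rho_leg)
  finally have 1: "?f' \<cdot> ?f = ob K \<odot> ?h" .
  have "?f \<cdot> ?f' = act \<cdot> ((k \<cdot> \<rho>) \<odot> ?h) \<cdot> ?g' \<cdot> coact" unfolding f by simp
  also have "\<dots> = act \<cdot> (retr_bull \<odot> ?h) \<cdot> ((coact \<bullet> I) \<odot> ?h) \<cdot> ?g' \<cdot> coact" by (simp add: k_rho retr_def)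
  \<comment> \<open>The first factor produced by the inverse Galois map is coinvariant, so
    \<open>retr\<close> acts on it as the projection.\<close>
  also have "\<dots> = act \<cdot> (retr_bull \<odot> ?h) \<cdot> (triv_coact \<odot> ?h) \<cdot> ?g' \<cdot> coact"
    by (subst equalizing[OF W]) (simp_all add: coact_coassoc)
  also have "\<dots> = (act \<cdot> ((r\<^sub>b ?A \<cdot> (?A \<bullet> \<epsilon>\<^sub>I)) \<odot> ?h)) \<cdot> ?g' \<cdot> coact"
    by (simp add: retr_bull_triv_coact flip: proj_def)
  \<comment> \<open>Projecting and then acting is the Galois map followed by the counit of
    \<open>H\<close>, so the two Galois maps meet and cancel.\<close>
  also have "\<dots> = r\<^sub>b ?A \<cdot> (?A \<bullet> counit H) \<cdot> (?g \<cdot> ?g') \<cdot> coact"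
    by (subst galois_counit[OF bimonoid_H act_module, symmetric]) simp
  also have "\<dots> = r\<^sub>b ?A \<cdot> (?A \<bullet> counit H) \<cdot> coact"
    by (simp add: gA_inverse(2)[OF W])
  also have "\<dots> = ?A"
    unfolding coact_def by (simp add: counit_pi counit_right)
  finally have 2: "?f \<cdot> ?f' = ?A" .
  show ?thesis
    by (rule circ.isoI(1)[OF _ _ 1 2]) (simp_all add: Hom_def)
qed

section \<open>A right antipode of the kernel\<close>

text \<open>\<open>K\<close> acts on \<open>A\<close> by multiplication through \<open>k\<close>,
  and by \<open>K_act_bull\<close> on \<open>A \<bullet> Y\<close> with the trivial action, through
  \<open>e\<close>, on \<open>Y\<close>. The ingredients of \<open>retr\<close> are shown one by one
  to be linear for these actions.\<close>

definition K_act where "K_act = mul A \<cdot> (k \<odot> ob A)"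
definition K_coact where "K_coact = (ob K \<bullet> e) \<cdot> comul K"
definition K_act_bull where "K_act_bull Y = (K_act \<bullet> l\<^sub>c Y) \<cdot> \<zeta> (ob K) I (ob A) Y \<cdot> (K_coact \<odot> (ob A \<bullet> Y))"

lemma K_act_simps [simp]: "K_act \<in> Arr D" "Dom D K_act = ob K \<odot> ob A" "Cod D K_act = ob A"
    "K_coact \<in> Arr D" "Dom D K_coact = ob K" "Cod D K_coact = ob K \<bullet> I"
  by (simp_all add: K_act_def K_coact_def)

lemma K_act_bull_simps [simp]:
  assumes "Y \<in> Obj D"
  shows "K_act_bull Y \<in> Arr D" "Dom D (K_act_bull Y) = ob K \<odot> (ob A \<bullet> Y)" "Cod D (K_act_bull Y) = ob A \<bullet> Y"
  using assms by (simp_all add: K_act_bull_def)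

lemma leg_eq: "leg = (k \<bullet> I) \<cdot> K_coact"
  by (simp add: leg_def K_coact_def)

lemma K_coact_coassoc: "a\<^sub>b (ob K) I I \<cdot> (K_coact \<bullet> I) \<cdot> K_coact = (ob K \<bullet> \<Delta>\<^sub>I) \<cdot> K_coact"
proof -
  let ?K = "ob K"
  have "a\<^sub>b ?K I I \<cdot> (K_coact \<bullet> I) \<cdot> K_coact = (a\<^sub>b ?K I I \<cdot> ((?K \<bullet> e) \<bullet> e)) \<cdot> (comul K \<bullet> ?K) \<cdot> comul K"
    unfolding K_coact_def by simp
  also have "\<dots> = (?K \<bullet> (e \<bullet> e)) \<cdot> a\<^sub>b ?K ?K ?K \<cdot> (comul K \<bullet> ?K) \<cdot> comul K"
    by (subst bull.assoc_nat) simp_all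
  also have "\<dots> = (?K \<bullet> \<Delta>\<^sub>I) \<cdot> K_coact"
    by (simp add: coassoc K_coact_def comul_e)
  finally show ?thesis .
qed

lemma K_coact_counit: "r\<^sub>b (ob K) \<cdot> (ob K \<bullet> \<epsilon>\<^sub>I) \<cdot> K_coact = ob K"
  by (simp add: K_coact_def counit_e counit_right)

text \<open>\<open>\<pi> \<cdot> k\<close> factors through the unit of \<open>H\<close>, so the
  action of \<open>K\<close> is felt on the left leg of the coaction and is trivial on the right
  one.\<close>

lemma coact_K_act: "coact \<cdot> K_act = K_act_bull (ob H) \<cdot> (ob K \<odot> coact)"
proof -
  let ?A = "ob A" let ?h = "ob H"
  have "coact \<cdot> K_act = (?A \<bullet> \<pi>) \<cdot> (mul A \<bullet> mul A) \<cdot> \<zeta> ?A ?A ?A ?A \<cdot> ((comul A \<cdot> k) \<odot> comul A)"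
    unfolding coact_def K_act_def by (simp add: circ.comp_rewrite[OF comul_mul])
  also have "\<dots> = (mul A \<bullet> mul H) \<cdot> (((?A \<odot> ?A) \<bullet> (\<pi> \<odot> \<pi>)) \<cdot> \<zeta> ?A ?A ?A ?A) \<cdot> ((comul A \<cdot> k) \<odot> comul A)"
    by (simp add: mul_mor[OF pi_mor])
  also have "\<dots> = (mul A \<bullet> mul H) \<cdot> (\<zeta> ?A ?h ?A ?h \<cdot> ((?A \<bullet> \<pi>) \<odot> (?A \<bullet> \<pi>))) \<cdot> ((comul A \<cdot> k) \<odot> comul A)"
    by (subst zeta_nat) simp_all
  also have "\<dots> = (mul A \<bullet> mul H) \<cdot> \<zeta> ?A ?h ?A ?h \<cdot> ((coact \<cdot> k) \<odot> coact)"
    by (simp add: coact_def)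
  also have "\<dots> = (mul A \<bullet> mul H) \<cdot> (\<zeta> ?A ?h ?A ?h \<cdot> ((k \<bullet> one H) \<odot> (?A \<bullet> ?h))) \<cdot> (K_coact \<odot> coact)"
    by (simp add: coact_k leg_eq)
  also have "\<dots> = (K_act \<bullet> (mul H \<cdot> (one H \<odot> ?h))) \<cdot> \<zeta> (ob K) I ?A ?h \<cdot> (K_coact \<odot> coact)"
    by (subst zeta_nat) (simp_all add: K_act_def)
  also have "\<dots> = K_act_bull ?h \<cdot> (ob K \<odot> coact)"
    by (simp add: mul_unit_left K_act_bull_def)
  finally show ?thesis .
qed

text \<open>The previous statement with a further \<open>I\<close> on the right. Coassociativity of
  \<open>K_coact\<close> and associativity of \<open>\<zeta>\<close> merge the trivial actions on
  \<open>H\<close> and on \<open>I\<close> into one on \<open>H \<bullet> I\<close>.\<close>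

lemma coactI_K_act_bull: "coactI \<cdot> K_act_bull I = K_act_bull HI \<cdot> (ob K \<odot> coactI)"
proof -
  let ?A = "ob A" let ?h = "ob H" let ?K = "ob K" let ?KA = "ob K \<odot> ob A" let ?W = "ob H \<bullet> I"
  note [simp del] = HI_simps(1,11)
  have thI_W [simp]: "Cod D coactI = ?A \<bullet> ?W" by (simp add: coactI_def)
  have za: "a\<^sub>b ?KA (I \<odot> ?h) (I \<odot> I) \<cdot> (\<zeta> ?K I ?A ?h \<bullet> (I \<odot> I)) \<cdot> \<zeta> (?K \<bullet> I) I (?A \<bullet> ?h) I =
    (?KA \<bullet> \<zeta> I I ?h I) \<cdot> \<zeta> ?K (I \<bullet> I) ?A ?W \<cdot> (a\<^sub>b ?K I I \<odot> a\<^sub>b ?A ?h I)"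
    by (rule zeta_assoc_bull[symmetric]) simp
  have "(coact \<bullet> I) \<cdot> K_act_bull I = ((coact \<cdot> K_act) \<bullet> l\<^sub>c I) \<cdot> \<zeta> ?K I ?A I \<cdot> (K_coact \<odot> (?A \<bullet> I))"
    unfolding K_act_bull_def by simp
  also have "\<dots> = ((K_act \<bullet> l\<^sub>c ?h) \<bullet> l\<^sub>c I) \<cdot> (\<zeta> ?K I ?A ?h \<bullet> (I \<odot> I)) \<cdot> (((K_coact \<odot> coact) \<bullet> (I \<odot> I)) \<cdot> \<zeta> ?K I ?A I) \<cdot> (K_coact \<odot> (?A \<bullet> I))"
    by (subst coact_K_act) (simp add: K_act_bull_def)
  also have "\<dots> = ((K_act \<bullet> l\<^sub>c ?h) \<bullet> l\<^sub>c I) \<cdot> (\<zeta> ?K I ?A ?h \<bullet> (I \<odot> I)) \<cdot> (\<zeta> (?K \<bullet> I) I (?A \<bullet> ?h) I \<cdot> ((K_coact \<bullet> I) \<odot> (coact \<bullet> I))) \<cdot> (K_coact \<odot> (?A \<bullet> I))"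
    by (subst zeta_nat) simp_all
  finally have 1: "(coact \<bullet> I) \<cdot> K_act_bull I = ((K_act \<bullet> l\<^sub>c ?h) \<bullet> l\<^sub>c I) \<cdot> (\<zeta> ?K I ?A ?h \<bullet> (I \<odot> I)) \<cdot> (\<zeta> (?K \<bullet> I) I (?A \<bullet> ?h) I \<cdot> ((K_coact \<bullet> I) \<odot> (coact \<bullet> I))) \<cdot> (K_coact \<odot> (?A \<bullet> I))" .
  have "coactI \<cdot> K_act_bull I = a\<^sub>b ?A ?h I \<cdot> (coact \<bullet> I) \<cdot> K_act_bull I"
    unfolding coactI_def by simp
  also have "\<dots> = (a\<^sub>b ?A ?h I \<cdot> ((K_act \<bullet> l\<^sub>c ?h) \<bullet> l\<^sub>c I)) \<cdot> (\<zeta> ?K I ?A ?h \<bullet> (I \<odot> I)) \<cdot> \<zeta> (?K \<bullet> I) I (?A \<bullet> ?h) I \<cdot> (((K_coact \<bullet> I) \<cdot> K_coact) \<odot> (coact \<bullet> I))"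
    by (subst 1) simp
  also have "\<dots> = (K_act \<bullet> (l\<^sub>c ?h \<bullet> l\<^sub>c I)) \<cdot> (a\<^sub>b ?KA (I \<odot> ?h) (I \<odot> I) \<cdot> (\<zeta> ?K I ?A ?h \<bullet> (I \<odot> I)) \<cdot> \<zeta> (?K \<bullet> I) I (?A \<bullet> ?h) I) \<cdot> (((K_coact \<bullet> I) \<cdot> K_coact) \<odot> (coact \<bullet> I))"
    by (subst bull.assoc_nat) simp_all
  also have "\<dots> = (K_act \<bullet> (l\<^sub>c ?h \<bullet> l\<^sub>c I)) \<cdot> (?KA \<bullet> \<zeta> I I ?h I) \<cdot> \<zeta> ?K (I \<bullet> I) ?A ?W \<cdot> ((a\<^sub>b ?K I I \<cdot> (K_coact \<bullet> I) \<cdot> K_coact) \<odot> coactI)"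
    by (simp only: za) (simp add: coactI_def)
  also have "\<dots> = (K_act \<bullet> (l\<^sub>c ?h \<bullet> l\<^sub>c I)) \<cdot> (?KA \<bullet> \<zeta> I I ?h I) \<cdot> (\<zeta> ?K (I \<bullet> I) ?A ?W \<cdot> ((?K \<bullet> \<Delta>\<^sub>I) \<odot> (?A \<bullet> ?W))) \<cdot> (K_coact \<odot> coactI)"
    by (simp add: K_coact_coassoc)
  also have "\<dots> = (K_act \<bullet> ((l\<^sub>c ?h \<bullet> l\<^sub>c I) \<cdot> \<zeta> I I ?h I \<cdot> (\<Delta>\<^sub>I \<odot> ?W))) \<cdot> \<zeta> ?K I ?A ?W \<cdot> (K_coact \<odot> coactI)"
    by (subst zeta_nat) simp_all
  also have "\<dots> = K_act_bull ?W \<cdot> (ob K \<odot> coactI)"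
    by (subst zeta_unit_left) (simp_all add: K_act_bull_def)
  finally show ?thesis by (simp add: HI_def)
qed

text \<open>Left multiplication by \<open>K\<close> commutes with the right action of
  \<open>H\<close> by associativity of \<open>A\<close>, while \<open>W\<close> carries the trivial
  action on both sides.\<close>

lemma galois_K_act_bull:
  assumes W: "left_comodule H W \<kappa>"
  shows "gA W \<kappa> \<cdot> (K_act_bull I \<odot> W) = K_act_bull W \<cdot> (ob K \<odot> gA W \<kappa>) \<cdot> a\<^sub>c (ob K) (ob A \<bullet> I) W"
proof -
  let ?A = "ob A" let ?h = "ob H" let ?K = "ob K" let ?KA = "ob K \<odot> ob A" let ?AI = "ob A \<bullet> I"
  note [simp] = left_comodule_simps(1-4)[OF W]
  have za: "(a\<^sub>c ?K ?A ?h \<bullet> a\<^sub>c I I W) \<cdot> \<zeta> ?KA (I \<odot> I) ?h W \<cdot> (\<zeta> ?K I ?A I \<odot> (?h \<bullet> W)) =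
    \<zeta> ?K I (?A \<odot> ?h) (I \<odot> W) \<cdot> ((?K \<bullet> I) \<odot> \<zeta> ?A I ?h W) \<cdot> a\<^sub>c (?K \<bullet> I) ?AI (?h \<bullet> W)"
    by (rule zeta_assoc_circ[symmetric]) simp
  have ak: "act \<cdot> (K_act \<odot> ?h) = K_act \<cdot> (?K \<odot> act) \<cdot> a\<^sub>c ?K ?A ?h"
  proof -
    have "act \<cdot> (K_act \<odot> ?h) = mul A \<cdot> (mul A \<odot> ?A) \<cdot> ((k \<odot> ?A) \<odot> \<sigma>)"
      unfolding act_def K_act_def by simp
    also have "\<dots> = mul A \<cdot> (?A \<odot> mul A) \<cdot> (a\<^sub>c ?A ?A ?A \<cdot> ((k \<odot> ?A) \<odot> \<sigma>))"
      by (subst circ.comp_rewrite[OF mul_assoc]) simp_all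
    also have "\<dots> = K_act \<cdot> (?K \<odot> act) \<cdot> a\<^sub>c ?K ?A ?h"
      by (subst circ.assoc_nat) (simp_all add: act_def K_act_def)
    finally show ?thesis .
  qed
  have ll: "l\<^sub>c W \<cdot> (l\<^sub>c I \<odot> W) = l\<^sub>c W \<cdot> (I \<odot> l\<^sub>c W) \<cdot> a\<^sub>c I I W"
    using circ.triangle'[of I W] by (simp add: l_I_eq)
  have "gA W \<kappa> \<cdot> (K_act_bull I \<odot> W) = (act \<bullet> l\<^sub>c W) \<cdot> (\<zeta> ?A I ?h W \<cdot> ((K_act \<bullet> l\<^sub>c I) \<odot> (?h \<bullet> W))) \<cdot>
      ((\<zeta> ?K I ?A I \<cdot> (K_coact \<odot> ?AI)) \<odot> \<kappa>)"
    unfolding galois_def K_act_bull_def by simp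
  also have "\<dots> = ((act \<cdot> (K_act \<odot> ?h)) \<bullet> (l\<^sub>c W \<cdot> (l\<^sub>c I \<odot> W))) \<cdot> \<zeta> ?KA (I \<odot> I) ?h W \<cdot> ((\<zeta> ?K I ?A I \<cdot> (K_coact \<odot> ?AI)) \<odot> \<kappa>)"
    by (subst zeta_nat) simp_all
  also have "\<dots> = ((K_act \<cdot> (?K \<odot> act)) \<bullet> (l\<^sub>c W \<cdot> (I \<odot> l\<^sub>c W))) \<cdot>
      ((a\<^sub>c ?K ?A ?h \<bullet> a\<^sub>c I I W) \<cdot> \<zeta> ?KA (I \<odot> I) ?h W \<cdot> (\<zeta> ?K I ?A I \<odot> (?h \<bullet> W))) \<cdot> ((K_coact \<odot> ?AI) \<odot> \<kappa>)"
    by (simp add: ak ll)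
  also have "\<dots> = (K_act \<bullet> l\<^sub>c W) \<cdot> (((?K \<odot> act) \<bullet> (I \<odot> l\<^sub>c W)) \<cdot> \<zeta> ?K I (?A \<odot> ?h) (I \<odot> W)) \<cdot> ((?K \<bullet> I) \<odot> \<zeta> ?A I ?h W) \<cdot>
      (a\<^sub>c (?K \<bullet> I) ?AI (?h \<bullet> W) \<cdot> ((K_coact \<odot> ?AI) \<odot> \<kappa>))"
    by (simp only: za) simp
  also have "\<dots> = (K_act \<bullet> l\<^sub>c W) \<cdot> (\<zeta> ?K I ?A W \<cdot> ((?K \<bullet> I) \<odot> (act \<bullet> l\<^sub>c W))) \<cdot> ((?K \<bullet> I) \<odot> \<zeta> ?A I ?h W) \<cdot>
      (a\<^sub>c (?K \<bullet> I) ?AI (?h \<bullet> W) \<cdot> ((K_coact \<odot> ?AI) \<odot> \<kappa>))"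
    by (subst zeta_nat) simp_all
  also have "\<dots> = K_act_bull W \<cdot> (ob K \<odot> gA W \<kappa>) \<cdot> a\<^sub>c (ob K) (ob A \<bullet> I) W"
    by (subst circ.assoc_nat) (simp_all add: K_act_bull_def galois_def)
  finally show ?thesis .
qed

lemma galois_inv_K_act_bull:
  assumes W: "left_comodule H W \<kappa>"
  shows "gA' W \<kappa> \<cdot> K_act_bull W = (K_act_bull I \<odot> W) \<cdot> inv (a\<^sub>c (ob K) (ob A \<bullet> I) W) \<cdot> (ob K \<odot> gA' W \<kappa>)"
proof -
  note [simp] = left_comodule_simps(1-4)[OF W] gA_simps[OF W]
  let ?a = "a\<^sub>c (ob K) (ob A \<bullet> I) W"
  have "gA' W \<kappa> \<cdot> K_act_bull W = gA' W \<kappa> \<cdot> (K_act_bull W \<cdot> (ob K \<odot> gA W \<kappa>) \<cdot> ?a) \<cdot> inv ?a \<cdot> (ob K \<odot> gA' W \<kappa>)"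
    by (simp add: gA_inverse[OF W])
  also have "\<dots> = (gA' W \<kappa> \<cdot> gA W \<kappa>) \<cdot> (K_act_bull I \<odot> W) \<cdot> inv ?a \<cdot> (ob K \<odot> gA' W \<kappa>)"
    by (subst galois_K_act_bull[OF W, symmetric]) simp
  finally show ?thesis by (simp add: gA_inverse(1)[OF W])
qed

text \<open>Multiplicativity of \<open>\<epsilon>\<^sub>I\<close> and the counit axiom of
  \<open>\<zeta>\<close> remove the leg on which \<open>K\<close> acts trivially.\<close>

lemma proj_K_act_bull: "proj \<cdot> K_act_bull I = K_act \<cdot> (ob K \<odot> proj)"
proof -
  let ?A = "ob A" let ?K = "ob K" let ?KA = "ob K \<odot> ob A"
  have e: "\<epsilon>\<^sub>I \<cdot> l\<^sub>c I = m\<^sub>J \<cdot> (\<epsilon>\<^sub>I \<odot> \<epsilon>\<^sub>I)"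
    using counit_mul[OF unit_bimonoid] by simp
  have "proj \<cdot> K_act_bull I = r\<^sub>b ?A \<cdot> (K_act \<bullet> (\<epsilon>\<^sub>I \<cdot> l\<^sub>c I)) \<cdot> \<zeta> ?K I ?A I \<cdot> (K_coact \<odot> (?A \<bullet> I))"
    unfolding proj_def K_act_bull_def by simp
  also have "\<dots> = (r\<^sub>b ?A \<cdot> (K_act \<bullet> J)) \<cdot> (?KA \<bullet> m\<^sub>J) \<cdot> ((?KA \<bullet> (\<epsilon>\<^sub>I \<odot> \<epsilon>\<^sub>I)) \<cdot> \<zeta> ?K I ?A I) \<cdot> (K_coact \<odot> (?A \<bullet> I))"
    by (subst e) simp
  also have "\<dots> = (K_act \<cdot> r\<^sub>b ?KA) \<cdot> (?KA \<bullet> m\<^sub>J) \<cdot> ((?KA \<bullet> (\<epsilon>\<^sub>I \<odot> \<epsilon>\<^sub>I)) \<cdot> \<zeta> ?K I ?A I) \<cdot> (K_coact \<odot> (?A \<bullet> I))"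
    by (subst bull.runit_nat) simp_all
  also have "\<dots> = (K_act \<cdot> r\<^sub>b ?KA) \<cdot> (?KA \<bullet> m\<^sub>J) \<cdot> (\<zeta> ?K J ?A J \<cdot> ((?K \<bullet> \<epsilon>\<^sub>I) \<odot> (?A \<bullet> \<epsilon>\<^sub>I))) \<cdot> (K_coact \<odot> (?A \<bullet> I))"
    by (subst zeta_nat) simp_all
  also have "\<dots> = K_act \<cdot> (r\<^sub>b ?KA \<cdot> (?KA \<bullet> m\<^sub>J) \<cdot> \<zeta> ?K J ?A J) \<cdot> (((?K \<bullet> \<epsilon>\<^sub>I) \<cdot> K_coact) \<odot> (?A \<bullet> \<epsilon>\<^sub>I))"
    by simp
  also have "\<dots> = K_act \<cdot> ((r\<^sub>b ?K \<cdot> (?K \<bullet> \<epsilon>\<^sub>I) \<cdot> K_coact) \<odot> proj)"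
    by (subst zeta_counit_right) (simp_all add: proj_def)
  finally show ?thesis by (simp add: K_coact_counit)
qed

lemma retr_K_act_bull: "retr \<cdot> K_act_bull I = K_act \<cdot> (ob K \<odot> retr)"
proof -
  let ?A = "ob A" let ?K = "ob K" let ?KA = "ob K \<odot> ob A"
  have "retr \<cdot> K_act_bull I = r\<^sub>c ?A \<cdot> (proj \<odot> HI_counit) \<cdot> gA' HI HI_coact \<cdot> coactI \<cdot> K_act_bull I"
    unfolding retr_eq by simp
  also have "\<dots> = r\<^sub>c ?A \<cdot> (proj \<odot> HI_counit) \<cdot> (gA' HI HI_coact \<cdot> K_act_bull HI) \<cdot> (?K \<odot> coactI)"
    by (subst coactI_K_act_bull) simp
  also have "\<dots> = r\<^sub>c ?A \<cdot> ((proj \<cdot> K_act_bull I) \<odot> HI_counit) \<cdot> inv (a\<^sub>c ?K (?A \<bullet> I) HI) \<cdot> (?K \<odot> (gA' HI HI_coact \<cdot> coactI))"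
    by (subst galois_inv_K_act_bull[OF HI]) simp
  also have "\<dots> = r\<^sub>c ?A \<cdot> (K_act \<odot> I) \<cdot> (((?K \<odot> proj) \<odot> HI_counit) \<cdot> inv (a\<^sub>c ?K (?A \<bullet> I) HI)) \<cdot> (?K \<odot> (gA' HI HI_coact \<cdot> coactI))"
    by (subst proj_K_act_bull) simp
  also have "\<dots> = r\<^sub>c ?A \<cdot> (K_act \<odot> I) \<cdot> (inv (a\<^sub>c ?K ?A I) \<cdot> (?K \<odot> (proj \<odot> HI_counit))) \<cdot> (?K \<odot> (gA' HI HI_coact \<cdot> coactI))"
    by (subst circ.Inv_assoc_nat) simp_all
  also have "\<dots> = (r\<^sub>c ?A \<cdot> (K_act \<odot> I)) \<cdot> inv (a\<^sub>c ?K ?A I) \<cdot> (?K \<odot> ((proj \<odot> HI_counit) \<cdot> gA' HI HI_coact \<cdot> coactI))"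
    by simp
  also have "\<dots> = K_act \<cdot> (r\<^sub>c ?KA \<cdot> inv (a\<^sub>c ?K ?A I)) \<cdot> (?K \<odot> ((proj \<odot> HI_counit) \<cdot> gA' HI HI_coact \<cdot> coactI))"
    by (subst circ.runit_nat) simp_all
  also have "\<dots> = K_act \<cdot> (?K \<odot> retr)"
    by (subst circ.inv_runit_ten) (simp_all add: retr_eq)
  finally show ?thesis .
qed

lemma rho_linear: "mul K \<cdot> (ob K \<odot> \<rho>) = \<rho> \<cdot> K_act_bull I"
proof (rule circ.monicD[OF k_monic, rotated -1])
  have "k \<cdot> mul K \<cdot> (ob K \<odot> \<rho>) = K_act \<cdot> (ob K \<odot> (k \<cdot> \<rho>))"
    by (simp add: circ.comp_rewrite[OF mul_mor[OF k_mor]] K_act_def)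
  then show "k \<cdot> mul K \<cdot> (ob K \<odot> \<rho>) = k \<cdot> \<rho> \<cdot> K_act_bull I"
    by (simp add: circ.comp_rewrite[OF k_rho] k_rho retr_K_act_bull)
qed simp_all

lemma s_simps [simp]:
  assumes "X \<in> Obj D" "Y \<in> Obj D"
  shows "s X Y \<in> Arr D" "Dom D (s X Y) = X \<bullet> Y" "Cod D (s X Y) = Y \<bullet> X"
  using s_Hom[OF assms] by (auto simp: Hom_def)

lemma s_nat:
  assumes "f \<in> Arr D" "g \<in> Arr D" "Cod D f = X" "Cod D g = Y"
  shows "s X Y \<cdot> (f \<bullet> g) = (g \<bullet> f) \<cdot> s (Dom D f) (Dom D g)"
  by (rule s_natural) (use assms in \<open>auto simp: Hom_def\<close>)

text \<open>\<open>\<phi>\<^sub>b\<close> reverses the order: from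
  \<open>A\<^sup>- \<bullet> I\<^sup>-\<close> it leads to the reversion of
  \<open>I \<bullet> A\<close>. So the retraction is needed with the unit on the left.\<close>

definition \<rho>t where "\<rho>t = \<rho> \<cdot> s I (ob A)"

lemma rhot_simps [simp]: "\<rho>t \<in> Arr D" "Dom D \<rho>t = I \<bullet> ob A" "Cod D \<rho>t = ob K"
  by (simp_all add: \<rho>t_def)

text \<open>\<open>s_zeta\<close> carries the symmetry through the action, and cocommutativity of
  \<open>K\<close> allows \<open>e\<close> to sit on either leg of \<open>comul K\<close>.\<close>

lemma rhot_linear:
  "mul K \<cdot> (ob K \<odot> \<rho>t) = \<rho>t \<cdot> (l\<^sub>c I \<bullet> K_act) \<cdot> \<zeta> I (ob K) I (ob A) \<cdot> (((e \<bullet> ob K) \<cdot> comul K) \<odot> (I \<bullet> ob A))"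
proof -
  let ?A = "ob A" let ?K = "ob K" let ?c = "(e \<bullet> ob K) \<cdot> comul K"
  have K_coact: "s I ?K \<cdot> ?c = K_coact"
  proof -
    have "s I ?K \<cdot> ?c = (s I ?K \<cdot> (e \<bullet> ?K)) \<cdot> comul K" by simp
    also have "\<dots> = (?K \<bullet> e) \<cdot> s ?K ?K \<cdot> comul K" by (subst s_nat) simp_all
    finally show ?thesis by (simp add: cocommutative_K K_coact_def)
  qed
  have "\<rho>t \<cdot> (l\<^sub>c I \<bullet> K_act) \<cdot> \<zeta> I ?K I ?A \<cdot> (?c \<odot> (I \<bullet> ?A)) =
    \<rho> \<cdot> (s I ?A \<cdot> (l\<^sub>c I \<bullet> K_act)) \<cdot> \<zeta> I ?K I ?A \<cdot> (?c \<odot> (I \<bullet> ?A))"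
    unfolding \<rho>t_def by simp
  also have "\<dots> = \<rho> \<cdot> (K_act \<bullet> l\<^sub>c I) \<cdot> (s (I \<odot> I) (?K \<odot> ?A) \<cdot> \<zeta> I ?K I ?A) \<cdot> (?c \<odot> (I \<bullet> ?A))"
    by (subst s_nat) simp_all
  also have "\<dots> = \<rho> \<cdot> (K_act \<bullet> l\<^sub>c I) \<cdot> \<zeta> ?K I ?A I \<cdot> ((s I ?K \<cdot> ?c) \<odot> s I ?A)"
    by (subst s_zeta) simp_all
  also have "\<dots> = (\<rho> \<cdot> K_act_bull I) \<cdot> (?K \<odot> s I ?A)"
    by (subst K_coact) (simp add: K_act_bull_def)
  also have "\<dots> = mul K \<cdot> (?K \<odot> \<rho>t)"
    by (subst rho_linear[symmetric]) (simp add: \<rho>t_def)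
  finally show ?thesis ..
qed

lemma rhot_unit: "\<rho>t \<cdot> (I \<bullet> one A) \<cdot> \<Delta>\<^sub>I = one K"
proof -
  have pu: "leg \<cdot> one K = (one A \<bullet> I) \<cdot> \<Delta>\<^sub>I"
    using one_mor[OF k_mor] one_mor[OF e_mor] by (simp add: leg_def comul_one)
  have "\<rho>t \<cdot> (I \<bullet> one A) \<cdot> \<Delta>\<^sub>I = \<rho> \<cdot> (s I (ob A) \<cdot> (I \<bullet> one A)) \<cdot> \<Delta>\<^sub>I"
    unfolding \<rho>t_def by simp
  also have "\<dots> = \<rho> \<cdot> (one A \<bullet> I) \<cdot> s I I \<cdot> \<Delta>\<^sub>I"
    by (subst s_nat) simp_all
  also have "\<dots> = \<rho> \<cdot> leg \<cdot> one K"
    by (simp add: s_Delta_I pu)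
  also have "\<dots> = one K"
    by (simp add: circ.comp_rewrite[OF rho_leg])
  finally show ?thesis .
qed

text \<open>Makes \<open>K\<close> a comodule over \<open>A\<close>, the coefficient comodule for
  which the right antipode equation of \<open>A\<close> is used, in the form
  \<open>delta_antipode_right\<close>.\<close>

lemma left_comodule_k: "left_comodule A (ob K) ((k \<bullet> ob K) \<cdot> comul K)"
proof -
  let ?A = "ob A" let ?K = "ob K" let ?l = "(k \<bullet> ob K) \<cdot> comul K"
  have "a\<^sub>b ?A ?A ?K \<cdot> (comul A \<bullet> ?K) \<cdot> ?l = (a\<^sub>b ?A ?A ?K \<cdot> ((k \<bullet> k) \<bullet> ?K)) \<cdot> (comul K \<bullet> ?K) \<cdot> comul K"
    by (simp add: comul_k)
  also have "\<dots> = (k \<bullet> (k \<bullet> ?K)) \<cdot> a\<^sub>b ?K ?K ?K \<cdot> (comul K \<bullet> ?K) \<cdot> comul K"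
    by (subst bull.assoc_nat) simp_all
  also have "\<dots> = (?A \<bullet> ?l) \<cdot> ?l"
    by (simp add: coassoc)
  finally show ?thesis
    by (simp add: left_comodule_def Hom_def counit_k counit_left)
qed

text \<open>The candidate \<open>Sg\<close> is the antipode of \<open>A\<close> on \<open>k\<close>,
  paired with the trivial leg \<open>e\<close> and pushed into \<open>(ob K)\<^sup>-\<close> by
  applying the functor to \<open>\<rho>t\<close>. In the antipode equation, linearity brings
  \<open>\<rho>t\<close> to the outside; what stays inside is
  \<open>k(x\<^sub>1) S(k(x\<^sub>2))\<close>, computed in \<open>A\<close>, and \<open>R14\<close>
  separates it from the auxiliary unit.\<close>

lemma kernel_right_antipode:
  assumes SA: "right_antipode A SA"
  shows "\<exists>T. right_antipode K T"
proof -
  let ?A = "ob A" let ?K = "ob K" let ?KA = "?K \<odot> ?A" let ?Z = "?A\<^sup>- \<bullet> I\<^sup>-" let ?AI = "?A \<bullet> I"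
  have SA_simps [simp]: "SA \<in> Arr D" "Dom D SA = ?A" "Cod D SA = ?A\<^sup>-"
    using SA unfolding right_antipode_def Hom_def by blast+
  define ct where "ct = (e \<bullet> ?K) \<cdot> comul K"
  have ct [simp]: "ct \<in> Arr D" "Dom D ct = ?K" "Cod D ct = I \<bullet> ?K" unfolding ct_def by simp_all
  \<comment> \<open>For Hopf algebras
    \<open>x \<mapsto> S(k(x\<^sub>1)) \<otimes> e(x\<^sub>2)\<close>; the second leg supplies the
    reversed unit that \<open>\<phi>\<^sub>b\<close> expects.\<close>
  define s' where "s' = ((SA \<cdot> k) \<bullet> (\<phi>\<^sub>c\<^sub>0 \<cdot> e)) \<cdot> comul K"
  have s' [simp]: "s' \<in> Arr D" "Dom D s' = ?K" "Cod D s' = ?Z" unfolding s'_def by simp_all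
  define Sg where "Sg = (\<rho>t\<^sup>-) \<cdot> \<phi>\<^sub>b ?A I \<cdot> s'"
  have Sg [simp]: "Sg \<in> Arr D" "Dom D Sg = ?K" "Cod D Sg = ?K\<^sup>-" unfolding Sg_def by simp_all
  define w where "w = (I \<odot> inv (r\<^sub>b ?Z)) \<cdot> inv (l\<^sub>c ?Z) \<cdot> s'"
  have w [simp]: "w \<in> Arr D" "Dom D w = ?K" "Cod D w = I \<odot> (?Z \<bullet> J)" unfolding w_def by simp_all
  define n where "n = (I\<^sup>- \<bullet> \<epsilon>\<^sub>I) \<cdot> dl"
  have n [simp]: "n \<in> Arr D" "Dom D n = I" "Cod D n = I\<^sup>- \<bullet> J" unfolding n_def by simp_all
  define vA where "vA = (one A \<bullet> I) \<cdot> \<Delta>\<^sub>I"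
  have vA [simp]: "vA \<in> Arr D" "Dom D vA = I" "Cod D vA = ?AI" unfolding vA_def by simp_all
  define vK where "vK = (one K \<bullet> I) \<cdot> \<Delta>\<^sub>I"
  have vK [simp]: "vK \<in> Arr D" "Dom D vK = I" "Cod D vK = ?K \<bullet> I" unfolding vK_def by simp_all
  define l where "l = (k \<bullet> ?K) \<cdot> comul K"
  have l [simp]: "l \<in> Arr D" "Dom D l = ?K" "Cod D l = ?A \<bullet> ?K" unfolding l_def by simp_all
  define y where "y = (I \<odot> ((SA \<bullet> ?K) \<cdot> l)) \<cdot> inv (l\<^sub>c ?K)"
  have y [simp]: "y \<in> Arr D" "Dom D y = ?K" "Cod D y = I \<odot> (?A\<^sup>- \<bullet> ?K)" unfolding y_def by simp_all
  define w' where "w' = (I \<odot> (?A\<^sup>- \<bullet> (n \<cdot> e))) \<cdot> y"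
  have w' [simp]: "w' \<in> Arr D" "Dom D w' = ?K" "Cod D w' = I \<odot> (?A\<^sup>- \<bullet> (I\<^sup>- \<bullet> J))" unfolding w'_def by simp_all
  define E where "E = \<delta> ?K I ?A (I\<^sup>- \<bullet> J)"
  have E [simp]: "E \<in> Arr D" "Dom D E = ?K \<bullet> (I \<odot> (?A\<^sup>- \<bullet> (I\<^sup>- \<bullet> J)))" "Cod D E = (?KA \<bullet> I) \<odot> (I\<^sup>- \<bullet> J)"
    unfolding E_def by simp_all
  \<comment> \<open>The unit constraints inside \<open>\<phi>\<close> are natural, so
    \<open>\<rho>t\<close> and \<open>\<phi>\<^sub>b\<close> can be placed in the arguments of
    \<open>\<delta>\<close>, within reach of its naturality and of \<open>R14\<close>.\<close>
  have phi_Sg: "\<phi> ?K ?K \<cdot> (?K \<bullet> Sg) = \<delta> ?K I ?K J \<cdot> (?K \<bullet> (I \<odot> (\<rho>t\<^sup>- \<bullet> J))) \<cdot> (?K \<bullet> (I \<odot> (\<phi>\<^sub>b ?A I \<bullet> J))) \<cdot> (?K \<bullet> w)"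
  proof -
    let ?f = "(\<rho>t\<^sup>-) \<cdot> \<phi>\<^sub>b ?A I"
    have "(I \<odot> inv (r\<^sub>b (?K\<^sup>-))) \<cdot> inv (l\<^sub>c (?K\<^sup>-)) \<cdot> Sg = (I \<odot> inv (r\<^sub>b (?K\<^sup>-))) \<cdot> (inv (l\<^sub>c (?K\<^sup>-)) \<cdot> ?f) \<cdot> s'"
      unfolding Sg_def by simp
    also have "\<dots> = (I \<odot> (inv (r\<^sub>b (?K\<^sup>-)) \<cdot> ?f)) \<cdot> inv (l\<^sub>c ?Z) \<cdot> s'"
      using circ.Inv_lunit_nat[of ?f "?K\<^sup>-", symmetric] by simp
    also have "\<dots> = (I \<odot> (?f \<bullet> J)) \<cdot> w"
      using bull.Inv_runit_nat[of ?f "?K\<^sup>-", symmetric] unfolding w_def by simp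
    finally show ?thesis unfolding \<phi>_def by simp
  qed
  \<comment> \<open>After reassociation, the reversed unit leg together with the inserted
    \<open>J\<close> is \<open>n \<cdot> e\<close>.\<close>
  have aw: "(I \<odot> a\<^sub>b (?A\<^sup>-) (I\<^sup>-) J) \<cdot> w = w'"
  proof -
    have rI: "inv (r\<^sub>b I) = (I \<bullet> \<epsilon>\<^sub>I) \<cdot> \<Delta>\<^sub>I"
      using circ.iso_shift[of "r\<^sub>b I" "(I \<bullet> \<epsilon>\<^sub>I) \<cdot> \<Delta>\<^sub>I" I] Delta_I_counit_right by simp
    have rn: "inv (r\<^sub>b (I\<^sup>-)) \<cdot> \<phi>\<^sub>c\<^sub>0 = n"
    proof -
      have "inv (r\<^sub>b (I\<^sup>-)) \<cdot> \<phi>\<^sub>c\<^sub>0 = (\<phi>\<^sub>c\<^sub>0 \<bullet> J) \<cdot> inv (r\<^sub>b I)"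
        using bull.Inv_runit_nat[of "\<phi>\<^sub>c\<^sub>0" "I\<^sup>-"] by simp
      then show ?thesis unfolding rI n_def dl_def by simp
    qed
    have "(I \<odot> a\<^sub>b (?A\<^sup>-) (I\<^sup>-) J) \<cdot> w = (I \<odot> (a\<^sub>b (?A\<^sup>-) (I\<^sup>-) J \<cdot> inv (r\<^sub>b ?Z))) \<cdot> inv (l\<^sub>c ?Z) \<cdot> s'"
      unfolding w_def by simp
    also have "\<dots> = (I \<odot> (?A\<^sup>- \<bullet> inv (r\<^sub>b (I\<^sup>-)))) \<cdot> (I \<odot> s') \<cdot> inv (l\<^sub>c ?K)"
      using circ.Inv_lunit_nat[of s' ?Z] by (simp add: bull.runit_ten_inv)
    also have "\<dots> = (I \<odot> (((SA \<cdot> k) \<bullet> ((inv (r\<^sub>b (I\<^sup>-)) \<cdot> \<phi>\<^sub>c\<^sub>0) \<cdot> e)) \<cdot> comul K)) \<cdot> inv (l\<^sub>c ?K)"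
      unfolding s'_def by simp
    also have "\<dots> = w'"
      unfolding rn w'_def y_def l_def by simp
    finally show ?thesis .
  qed
  \<comment> \<open>\<open>R14\<close> splits the \<open>\<delta>\<close> whose reversed argument is
    \<open>I \<bullet> A\<close> into one for \<open>A\<close>, which is \<open>E\<close>, and one
    for the unit.\<close>
  have r14: "((\<zeta> I ?K I ?A \<bullet> I) \<odot> J) \<cdot> \<delta> (I \<bullet> ?K) I (I \<bullet> ?A) J \<cdot> ((I \<bullet> ?K) \<bullet> (I \<odot> (\<phi>\<^sub>b ?A I \<bullet> J))) =
    (inv (a\<^sub>b (I \<odot> I) ?KA I) \<odot> J) \<cdot> \<delta> I (?KA \<bullet> I) I J \<cdot> (I \<bullet> E) \<cdot> a\<^sub>b I ?K (I \<odot> (?A\<^sup>- \<bullet> (I\<^sup>- \<bullet> J))) \<cdot>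
      ((I \<bullet> ?K) \<bullet> (I \<odot> a\<^sub>b (?A\<^sup>-) (I\<^sup>-) J))"
  proof -
    have "(inv (a\<^sub>b (I \<odot> I) ?KA I) \<odot> J) \<cdot> (\<delta> I (?KA \<bullet> I) I J \<cdot> (I \<bullet> E)) \<cdot> a\<^sub>b I ?K (I \<odot> (?A\<^sup>- \<bullet> (I\<^sup>- \<bullet> J))) \<cdot>
      ((I \<bullet> ?K) \<bullet> (I \<odot> a\<^sub>b (?A\<^sup>-) (I\<^sup>-) J)) =
      ((\<zeta> I ?K I ?A \<bullet> I) \<odot> J) \<cdot> \<delta> (I \<bullet> ?K) I (I \<bullet> ?A) J \<cdot> ((I \<bullet> ?K) \<bullet> (I \<odot> (\<phi>\<^sub>b ?A I \<bullet> J)))"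
      unfolding E_def by (subst R14) simp_all
    then show ?thesis by simp
  qed
  have aD: "a\<^sub>b I ?K (I \<odot> (?A\<^sup>- \<bullet> (I\<^sup>- \<bullet> J))) \<cdot> (ct \<bullet> w') \<cdot> comul K = (e \<bullet> ((?K \<bullet> w') \<cdot> comul K)) \<cdot> comul K"
  proof -
    have "a\<^sub>b I ?K (I \<odot> (?A\<^sup>- \<bullet> (I\<^sup>- \<bullet> J))) \<cdot> (ct \<bullet> w') \<cdot> comul K =
      (a\<^sub>b I ?K (I \<odot> (?A\<^sup>- \<bullet> (I\<^sup>- \<bullet> J))) \<cdot> ((e \<bullet> ?K) \<bullet> w')) \<cdot> (comul K \<bullet> ?K) \<cdot> comul K"
      unfolding ct_def by simp
    also have "\<dots> = (e \<bullet> (?K \<bullet> w')) \<cdot> a\<^sub>b ?K ?K ?K \<cdot> (comul K \<bullet> ?K) \<cdot> comul K"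
      by (subst bull.assoc_nat) simp_all
    finally show ?thesis by (simp add: coassoc)
  qed
  \<comment> \<open>The antipode of \<open>A\<close> cancels here, with \<open>K\<close> as
    coefficient comodule.\<close>
  have G: "((K_act \<bullet> I) \<odot> (I\<^sup>- \<bullet> J)) \<cdot> E \<cdot> (?K \<bullet> w') \<cdot> comul K = (vA \<odot> (n \<cdot> e)) \<cdot> inv (l\<^sub>c ?K)"
  proof -
    have "((K_act \<bullet> I) \<odot> (I\<^sup>- \<bullet> J)) \<cdot> E \<cdot> (?K \<bullet> w') \<cdot> comul K =
      ((K_act \<bullet> I) \<odot> (I\<^sup>- \<bullet> J)) \<cdot> (E \<cdot> (?K \<bullet> (I \<odot> (?A\<^sup>- \<bullet> (n \<cdot> e))))) \<cdot> (?K \<bullet> y) \<cdot> comul K"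
      unfolding w'_def by simp
    also have "\<dots> = (?AI \<odot> (n \<cdot> e)) \<cdot> ((mul A \<bullet> I) \<odot> ?K) \<cdot> ((((k \<odot> ?A) \<bullet> I) \<odot> ?K) \<cdot> \<delta> ?K I ?A ?K) \<cdot> (?K \<bullet> y) \<cdot> comul K"
      using delta_nat[of ?K I ?A "n \<cdot> e"] unfolding E_def K_act_def by simp
    also have "\<dots> = (?AI \<odot> (n \<cdot> e)) \<cdot> ((mul A \<bullet> I) \<odot> ?K) \<cdot> (\<delta> ?A I ?A ?K \<cdot> (k \<bullet> (I \<odot> (?A\<^sup>- \<bullet> ?K)))) \<cdot> (?K \<bullet> y) \<cdot> comul K"
      using delta_nat[of k I ?A ?K] by simp
    also have "\<dots> = (?AI \<odot> (n \<cdot> e)) \<cdot> (((mul A \<bullet> I) \<odot> ?K) \<cdot> \<delta> ?A I ?A ?K \<cdot> (?A \<bullet> y) \<cdot> l)"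
      unfolding l_def by simp
    also have "\<dots> = (vA \<odot> (n \<cdot> e)) \<cdot> inv (l\<^sub>c ?K)"
      using delta_antipode_right[OF bimonoid_A SA left_comodule_k] unfolding y_def l_def vA_def by simp
    finally show ?thesis .
  qed
  have z: "(\<rho>t \<bullet> I) \<cdot> inv (a\<^sub>b I ?A I) \<cdot> (I \<bullet> vA) \<cdot> \<Delta>\<^sub>I = vK"
  proof -
    have "(\<rho>t \<bullet> I) \<cdot> inv (a\<^sub>b I ?A I) \<cdot> (I \<bullet> vA) \<cdot> \<Delta>\<^sub>I = (\<rho>t \<bullet> I) \<cdot> (inv (a\<^sub>b I ?A I) \<cdot> (I \<bullet> (one A \<bullet> I))) \<cdot> (I \<bullet> \<Delta>\<^sub>I) \<cdot> \<Delta>\<^sub>I"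
      unfolding vA_def by simp
    also have "\<dots> = ((\<rho>t \<cdot> (I \<bullet> one A)) \<bullet> I) \<cdot> inv (a\<^sub>b I I I) \<cdot> (I \<bullet> \<Delta>\<^sub>I) \<cdot> \<Delta>\<^sub>I"
      by (subst bull.Inv_assoc_nat) simp_all
    also have "\<dots> = ((\<rho>t \<cdot> (I \<bullet> one A) \<cdot> \<Delta>\<^sub>I) \<bullet> I) \<cdot> \<Delta>\<^sub>I"
      by (simp flip: Delta_I_coassoc)
    finally show ?thesis by (simp add: rhot_unit vK_def)
  qed
  let ?B = "I \<bullet> ?AI"
  let ?P = "(((\<rho>t \<bullet> I) \<cdot> inv (a\<^sub>b I ?A I)) \<odot> J)"
  \<comment> \<open>The second \<open>\<delta>\<close> coming from \<open>R14\<close> has the unit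
    in its reversed argument and is removed by \<open>delta_unit\<close>.\<close>
  have du: "((l\<^sub>c I \<bullet> ?AI) \<odot> J) \<cdot> \<delta> I ?AI I J \<cdot> (I \<bullet> (?AI \<odot> n)) = (?B \<odot> \<epsilon>\<^sub>I) \<cdot> inv (r\<^sub>c ?B) \<cdot> (I \<bullet> r\<^sub>c ?AI)"
  proof -
    have "((l\<^sub>c I \<bullet> ?AI) \<odot> J) \<cdot> \<delta> I ?AI I J \<cdot> (I \<bullet> (?AI \<odot> n)) =
      ((l\<^sub>c I \<bullet> ?AI) \<odot> J) \<cdot> (\<delta> I ?AI I J \<cdot> (I \<bullet> (?AI \<odot> (I\<^sup>- \<bullet> \<epsilon>\<^sub>I)))) \<cdot> (I \<bullet> (?AI \<odot> dl))"
      unfolding n_def by simp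
    also have "\<dots> = (?B \<odot> \<epsilon>\<^sub>I) \<cdot> ((r\<^sub>c I \<bullet> ?AI) \<odot> I) \<cdot> \<delta> I ?AI I I \<cdot> (I \<bullet> (?AI \<odot> dl))"
      using delta_nat[of I ?AI I "\<epsilon>\<^sub>I"] by (simp add: l_I_eq)
    also have "\<dots> = (?B \<odot> \<epsilon>\<^sub>I) \<cdot> inv (r\<^sub>c ?B) \<cdot> (I \<bullet> r\<^sub>c ?AI)"
      by (subst delta_unit) simp_all
    finally show ?thesis .
  qed
  have tail: "(I \<bullet> r\<^sub>c ?AI) \<cdot> (e \<bullet> ((vA \<odot> e) \<cdot> inv (l\<^sub>c ?K))) \<cdot> comul K = (I \<bullet> vA) \<cdot> \<Delta>\<^sub>I \<cdot> e"
  proof -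
    have "r\<^sub>c ?AI \<cdot> (vA \<odot> e) \<cdot> inv (l\<^sub>c ?K) = (r\<^sub>c ?AI \<cdot> (vA \<odot> I)) \<cdot> (I \<odot> e) \<cdot> inv (l\<^sub>c ?K)" by simp
    also have "\<dots> = (vA \<cdot> r\<^sub>c I) \<cdot> inv (l\<^sub>c I) \<cdot> e"
      using circ.Inv_lunit_nat[of e I] by (subst circ.runit_nat) simp_all
    finally have "r\<^sub>c ?AI \<cdot> (vA \<odot> e) \<cdot> inv (l\<^sub>c ?K) = vA \<cdot> e" by (simp add: l_I_eq)
    then show ?thesis by (simp add: comul_e)
  qed
  have "((mul K \<bullet> I) \<odot> J) \<cdot> \<phi> ?K ?K \<cdot> (?K \<bullet> Sg) \<cdot> comul K = ((mul K \<bullet> I) \<odot> J) \<cdot> (\<phi> ?K ?K \<cdot> (?K \<bullet> Sg)) \<cdot> comul K"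
    by simp
  also have "\<dots> = ((mul K \<bullet> I) \<odot> J) \<cdot> (\<delta> ?K I ?K J \<cdot> (?K \<bullet> (I \<odot> (\<rho>t\<^sup>- \<bullet> J)))) \<cdot> (?K \<bullet> (I \<odot> (\<phi>\<^sub>b ?A I \<bullet> J))) \<cdot> (?K \<bullet> w) \<cdot> comul K"
    by (subst phi_Sg) simp
  also have "\<dots> = (((mul K \<cdot> (?K \<odot> \<rho>t)) \<bullet> I) \<odot> J) \<cdot> \<delta> ?K I (I \<bullet> ?A) J \<cdot> (?K \<bullet> (I \<odot> (\<phi>\<^sub>b ?A I \<bullet> J))) \<cdot> (?K \<bullet> w) \<cdot> comul K"
    using delta_nat[of ?K I \<rho>t J] by simp
  \<comment> \<open>Linearity takes \<open>\<rho>t\<close> out of the product and exchanges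
    multiplication in \<open>K\<close> for the action on \<open>A\<close>.\<close>
  also have "\<dots> = (((\<rho>t \<cdot> (l\<^sub>c I \<bullet> K_act)) \<bullet> I) \<odot> J) \<cdot> ((\<zeta> I ?K I ?A \<bullet> I) \<odot> J) \<cdot> ((((ct \<odot> (I \<bullet> ?A)) \<bullet> I) \<odot> J) \<cdot> \<delta> ?K I (I \<bullet> ?A) J) \<cdot>
      (?K \<bullet> (I \<odot> (\<phi>\<^sub>b ?A I \<bullet> J))) \<cdot> (?K \<bullet> w) \<cdot> comul K"
    by (subst rhot_linear) (simp add: ct_def)
  also have "\<dots> = (((\<rho>t \<cdot> (l\<^sub>c I \<bullet> K_act)) \<bullet> I) \<odot> J) \<cdot> ((\<zeta> I ?K I ?A \<bullet> I) \<odot> J) \<cdot> (\<delta> (I \<bullet> ?K) I (I \<bullet> ?A) J \<cdot> (ct \<bullet> (I \<odot> ((I \<bullet> ?A)\<^sup>- \<bullet> J)))) \<cdot>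
      (?K \<bullet> (I \<odot> (\<phi>\<^sub>b ?A I \<bullet> J))) \<cdot> (?K \<bullet> w) \<cdot> comul K"
    using delta_nat[of ct I "I \<bullet> ?A" J] by simp
  also have "\<dots> = (((\<rho>t \<cdot> (l\<^sub>c I \<bullet> K_act)) \<bullet> I) \<odot> J) \<cdot> (((\<zeta> I ?K I ?A \<bullet> I) \<odot> J) \<cdot> \<delta> (I \<bullet> ?K) I (I \<bullet> ?A) J \<cdot>
      ((I \<bullet> ?K) \<bullet> (I \<odot> (\<phi>\<^sub>b ?A I \<bullet> J)))) \<cdot> (ct \<bullet> w) \<cdot> comul K"
    by simp
  also have "\<dots> = ((\<rho>t \<bullet> I) \<odot> J) \<cdot> ((((l\<^sub>c I \<bullet> K_act) \<bullet> I) \<cdot> inv (a\<^sub>b (I \<odot> I) ?KA I)) \<odot> J) \<cdot> \<delta> I (?KA \<bullet> I) I J \<cdot> (I \<bullet> E) \<cdot>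
      a\<^sub>b I ?K (I \<odot> (?A\<^sup>- \<bullet> (I\<^sup>- \<bullet> J))) \<cdot> (ct \<bullet> ((I \<odot> a\<^sub>b (?A\<^sup>-) (I\<^sup>-) J) \<cdot> w)) \<cdot> comul K"
    by (subst r14) simp
  also have "\<dots> = ((\<rho>t \<bullet> I) \<odot> J) \<cdot> ((((l\<^sub>c I \<bullet> K_act) \<bullet> I) \<cdot> inv (a\<^sub>b (I \<odot> I) ?KA I)) \<odot> J) \<cdot> \<delta> I (?KA \<bullet> I) I J \<cdot> (I \<bullet> E) \<cdot>
      (e \<bullet> ((?K \<bullet> w') \<cdot> comul K)) \<cdot> comul K"
    by (subst aw, subst aD) (rule refl)
  also have "\<dots> = ((\<rho>t \<bullet> I) \<odot> J) \<cdot> ((inv (a\<^sub>b I ?A I) \<cdot> (l\<^sub>c I \<bullet> (K_act \<bullet> I))) \<odot> J) \<cdot> \<delta> I (?KA \<bullet> I) I J \<cdot> (I \<bullet> E) \<cdot>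
      (e \<bullet> ((?K \<bullet> w') \<cdot> comul K)) \<cdot> comul K"
    by (subst bull.Inv_assoc_nat) simp_all
  also have "\<dots> = ?P \<cdot> ((l\<^sub>c I \<bullet> ?AI) \<odot> J) \<cdot> ((((I \<odot> I) \<bullet> (K_act \<bullet> I)) \<odot> J) \<cdot> \<delta> I (?KA \<bullet> I) I J) \<cdot> (e \<bullet> (E \<cdot> (?K \<bullet> w') \<cdot> comul K)) \<cdot> comul K"
    by simp
  also have "\<dots> = ?P \<cdot> ((l\<^sub>c I \<bullet> ?AI) \<odot> J) \<cdot> (\<delta> I ?AI I J \<cdot> (I \<bullet> ((K_act \<bullet> I) \<odot> (I\<^sup>- \<bullet> J)))) \<cdot> (e \<bullet> (E \<cdot> (?K \<bullet> w') \<cdot> comul K)) \<cdot> comul K"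
    using delta_nat[of I "K_act \<bullet> I" I J] by simp
  also have "\<dots> = ?P \<cdot> ((l\<^sub>c I \<bullet> ?AI) \<odot> J) \<cdot> \<delta> I ?AI I J \<cdot> (e \<bullet> (((K_act \<bullet> I) \<odot> (I\<^sup>- \<bullet> J)) \<cdot> E \<cdot> (?K \<bullet> w') \<cdot> comul K)) \<cdot> comul K"
    by simp
  also have "\<dots> = ?P \<cdot> (((l\<^sub>c I \<bullet> ?AI) \<odot> J) \<cdot> \<delta> I ?AI I J \<cdot> (I \<bullet> (?AI \<odot> n))) \<cdot> (e \<bullet> ((vA \<odot> e) \<cdot> inv (l\<^sub>c ?K))) \<cdot> comul K"
    by (subst G) simp
  also have "\<dots> = ?P \<cdot> (?B \<odot> \<epsilon>\<^sub>I) \<cdot> inv (r\<^sub>c ?B) \<cdot> (I \<bullet> r\<^sub>c ?AI) \<cdot> (e \<bullet> ((vA \<odot> e) \<cdot> inv (l\<^sub>c ?K))) \<cdot> comul K"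
    by (subst du) simp
  also have "\<dots> = (((\<rho>t \<bullet> I) \<cdot> inv (a\<^sub>b I ?A I)) \<odot> \<epsilon>\<^sub>I) \<cdot> (inv (r\<^sub>c ?B) \<cdot> ((I \<bullet> vA) \<cdot> \<Delta>\<^sub>I)) \<cdot> e"
    by (subst tail) simp
  also have "\<dots> = (((\<rho>t \<bullet> I) \<cdot> inv (a\<^sub>b I ?A I)) \<odot> \<epsilon>\<^sub>I) \<cdot> ((((I \<bullet> vA) \<cdot> \<Delta>\<^sub>I) \<odot> I) \<cdot> inv (r\<^sub>c I)) \<cdot> e"
    using circ.Inv_runit_nat[of "(I \<bullet> vA) \<cdot> \<Delta>\<^sub>I" ?B] by simp
  also have "\<dots> = (((\<rho>t \<bullet> I) \<cdot> inv (a\<^sub>b I ?A I) \<cdot> (I \<bullet> vA) \<cdot> \<Delta>\<^sub>I) \<odot> \<epsilon>\<^sub>I) \<cdot> inv (r\<^sub>c I) \<cdot> e"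
    by simp
  also have "\<dots> = (vK \<odot> J) \<cdot> ((I \<odot> \<epsilon>\<^sub>I) \<cdot> inv (l\<^sub>c I)) \<cdot> e"
    by (subst z) (simp add: l_I_eq)
  also have "\<dots> = (vK \<odot> J) \<cdot> inv (l\<^sub>c J) \<cdot> counit K"
    using circ.Inv_lunit_nat[of "\<epsilon>\<^sub>I" J] by (simp add: counit_e)
  finally have "((mul K \<bullet> I) \<odot> J) \<cdot> \<phi> ?K ?K \<cdot> (?K \<bullet> Sg) \<cdot> comul K = ((one K \<bullet> I) \<odot> J) \<cdot> (\<Delta>\<^sub>I \<odot> J) \<cdot> inv (l\<^sub>c J) \<cdot> counit K"
    unfolding vK_def by simp
  moreover have "Sg \<in> Hom D ?K (?K\<^sup>-)" by (simp add: Hom_def)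
  ultimately show ?thesis unfolding right_antipode_def by blast
qed

end

section \<open>Reversing both tensor products\<close>

text \<open>Category and unit morphisms stay the same, so a statement about \<open>mirror D\<close>
  concerns the same arrows; reversing both tensor products reverses all four arguments of
  \<open>\<zeta>\<close>.\<close>

definition mirror :: "('a, 'b) duoidal_scheme \<Rightarrow> ('a, 'b) duoidal_scheme" where
  "mirror D = D\<lparr>circ := rev_tensor D (circ D), bull := rev_tensor D (bull D), zeta := \<lambda>A B C E. zeta D E C B A\<rparr>"

text \<open>With the arguments in opposite order, \<open>\<delta>\<close> has the typing of
  \<open>\<gamma>\<close> for the reversed tensor products, and conversely.\<close>

definition mirror_rev :: "'a reversion_data \<Rightarrow> 'a reversion_data" where
  "mirror_rev R = R\<lparr>phi_circ := \<lambda>X Y. phi_circ R Y X, phi_bull := \<lambda>X Y. phi_bull R Y X,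
     gam := \<lambda>X Y Z T. del R T Z Y X, del := \<lambda>X Y Z T. gam R T Z Y X\<rparr>"

lemma mirror_cat: "Arr (mirror D) = Arr D" "Dom (mirror D) = Dom D" "Cod (mirror D) = Cod D" "Comp (mirror D) = Comp D"
  by (simp_all add: mirror_def)

lemma mirror_simps:
  "Arr (mirror D) = Arr D" "Dom (mirror D) = Dom D" "Cod (mirror D) = Cod D" "Comp (mirror D) = Comp D"
  "Obj (mirror D) = Obj D" "Hom (mirror D) = Hom D" "inverse_of (mirror D) = inverse_of D"
  "is_iso (mirror D) = is_iso D" "Inv (mirror D) = Inv D" "monic (mirror D) = monic D"
  "ten (circ (mirror D)) X Y = ten (circ D) Y X" "ten (bull (mirror D)) X Y = ten (bull D) Y X"
  "unit_ob (circ (mirror D)) = unit_ob (circ D)" "unit_ob (bull (mirror D)) = unit_ob (bull D)"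
  "assoc (circ (mirror D)) X Y Z = Inv D (assoc (circ D) Z Y X)"
  "assoc (bull (mirror D)) X Y Z = Inv D (assoc (bull D) Z Y X)"
  "lunit (circ (mirror D)) = runit (circ D)" "runit (circ (mirror D)) = lunit (circ D)"
  "lunit (bull (mirror D)) = runit (bull D)" "runit (bull (mirror D)) = lunit (bull D)"
  "zeta (mirror D) X Y Z W = zeta D W Z Y X"
  "Delta_I (mirror D) = Delta_I D" "m_J (mirror D) = m_J D" "eps_I (mirror D) = eps_I D"
  by (simp_all add: mirror_def rev_tensor_def Obj_def Hom_def inverse_of_def is_iso_def Inv_def monic_def fun_eq_iff)

lemma mirror_rev_simps:
  "rv (mirror_rev R) = rv R" "phi_circ (mirror_rev R) X Y = phi_circ R Y X" "phi_circ0 (mirror_rev R) = phi_circ0 R"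
  "phi_bull (mirror_rev R) X Y = phi_bull R Y X" "phi_bull0 (mirror_rev R) = phi_bull0 R"
  "gam (mirror_rev R) X Y Z T = del R T Z Y X" "del (mirror_rev R) X Y Z T = gam R T Z Y X"
  by (simp_all add: mirror_rev_def)

lemma (in category) Inv_comp:
  assumes "is_iso C f" "is_iso C g" "Dom C g = Cod C f"
  shows "is_iso C (Comp C g f)" "Inv C (Comp C g f) = Comp C (Inv C f) (Inv C g)"
proof -
  have A: "f \<in> Arr C" "g \<in> Arr C" using assms by (auto simp: is_iso_def)
  then have 1: "Comp C g f \<in> Hom C (Dom C f) (Cod C g)" "Comp C (Inv C f) (Inv C g) \<in> Hom C (Cod C g) (Dom C f)"
    using assms by (auto simp: Hom_def)
  show "is_iso C (Comp C g f)" "Inv C (Comp C g f) = Comp C (Inv C f) (Inv C g)"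
    using isoI[OF 1] A assms by auto
qed

text \<open>Stated for any \<open>C'\<close> with the same categorical part, because
  \<open>mirror D\<close> is a different record from \<open>D\<close>. The two unit constraints
  trade places, and the pentagon is inverted.\<close>

lemma (in monoidal_category) monoidal_rev:
  assumes C': "Arr C' = Arr C" "Dom C' = Dom C" "Cod C' = Cod C" "Comp C' = Comp C"
  shows "monoidal_category C' (rev_tensor C T)"
proof -
  have e1: "Obj C' = Obj C" unfolding Obj_def C' ..
  have e2: "Hom C' = Hom C" by (intro ext) (unfold Hom_def C', rule refl)
  have e3: "is_iso C' = is_iso C" by (intro ext) (unfold is_iso_def inverse_of_def e2 C', rule refl)
  note e = e1 e2 e3
  have t: "ten (rev_tensor C T) X Y = ten T Y X" "unit_ob (rev_tensor C T) = unit_ob T"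
    "assoc (rev_tensor C T) X Y Z = Inv C (assoc T Z Y X)" "lunit (rev_tensor C T) = runit T"
    "runit (rev_tensor C T) = lunit T" for X Y Z
    unfolding rev_tensor_def by simp_all
  show ?thesis
    apply (unfold_locales; unfold C' e t)
    subgoal by simp
    subgoal by simp
    subgoal by simp
    subgoal by (rule Comp_Hom)
    subgoal by (rule Comp_Dom)
    subgoal by (rule Comp_Cod)
    subgoal by (rule Comp_assoc)
    subgoal by simp
    subgoal by (rule ten_Hom)
    subgoal by (rule interchange)
    subgoal by (simp add: Hom_def)
    subgoal by simp
    subgoal for f X X' g Y Y' h Z Z'
      using Inv_assoc_nat[of h g f Z' Y' X'] by (auto simp: Hom_def)
    subgoal by (rule runit_Hom)
    subgoal by (rule runit_iso)
    subgoal by (rule runit_natural)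
    subgoal by (rule lunit_Hom)
    subgoal by (rule lunit_iso)
    subgoal by (rule lunit_natural)
    subgoal premises prems for X Y Z W
    proof -
      have [simp]: "X \<in> Obj C" "Y \<in> Obj C" "Z \<in> Obj C" "W \<in> Obj C" using prems by auto
      have "Inv C (Comp C (assoc T W Z (ten T Y X)) (assoc T (ten T W Z) Y X)) =
        Inv C (Comp C (ten T W (assoc T Z Y X)) (Comp C (assoc T W (ten T Z Y) X) (ten T (assoc T W Z Y) X)))"
        by (subst pentagon) simp_all
      then show ?thesis by (simp add: Inv_comp del: ten_comp ten_comp')
    qed
    subgoal by (simp add: inv_triangle)
    done
qed

lemma (in monoidal_category) monoid_rev:
  assumes "is_monoid C T X m u" "Obj C' = Obj C" "Hom C' = Hom C" "Comp C' = Comp C"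
  shows "is_monoid C' (rev_tensor C T) X m u"
proof -
  have [simp]: "X \<in> Obj C" "m \<in> Arr C" "Dom C m = ten T X X" "Cod C m = X" and
    a: "Comp C m (ten T m X) = Comp C m (Comp C (ten T X m) (assoc T X X X))"
    using assms(1) unfolding is_monoid_def Hom_def by blast+
  have "Comp C m (Comp C (ten T m X) (Inv C (assoc T X X X))) = Comp C m (ten T X m)"
    by (simp add: comp_rewrite[OF a])
  then show ?thesis
    using assms unfolding is_monoid_def rev_tensor_def by simp
qed

lemma (in monoidal_category) comonoid_rev:
  assumes "is_comonoid C T X d e" "Obj C' = Obj C" "Hom C' = Hom C" "Comp C' = Comp C"
  shows "is_comonoid C' (rev_tensor C T) X d e"
proof -
  have [simp]: "X \<in> Obj C" "d \<in> Arr C" "Dom C d = X" "Cod C d = ten T X X" and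
    a: "Comp C (assoc T X X X) (Comp C (ten T d X) d) = Comp C (ten T X d) d"
    using assms(1) unfolding is_comonoid_def Hom_def by blast+
  have "Comp C (Inv C (assoc T X X X)) (Comp C (ten T X d) d) = Comp C (ten T d X) d"
    by (simp flip: a)
  then show ?thesis
    using assms unfolding is_comonoid_def rev_tensor_def by simp
qed

lemma mirror_tensors: "circ (mirror D) = rev_tensor D (circ D)" "bull (mirror D) = rev_tensor D (bull D)"
  by (simp_all add: mirror_def)

context duoidal_category
begin

text \<open>Each unit axiom of \<open>\<zeta>\<close> becomes its left or right partner. The two
  associativity axioms are their own mirror images once the associators have been moved to the
  opposite sides.\<close>

lemma duoidal_mirror: "duoidal_category (mirror D)"
proof -
  have mc: "monoidal_category (mirror D) (circ (mirror D))" "monoidal_category (mirror D) (bull (mirror D))"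
    unfolding mirror_tensors by (intro circ.monoidal_rev bull.monoidal_rev mirror_cat)+
  have mJ: "is_monoid (mirror D) (circ (mirror D)) J m\<^sub>J \<epsilon>\<^sub>I"
    unfolding mirror_tensors by (rule circ.monoid_rev[OF J_monoid]) (simp_all add: mirror_simps)
  have cI: "is_comonoid (mirror D) (bull (mirror D)) I \<Delta>\<^sub>I \<epsilon>\<^sub>I"
    unfolding mirror_tensors by (rule bull.comonoid_rev[OF I_comonoid]) (simp_all add: mirror_simps)
  show ?thesis
    apply (rule duoidal_category.intro[OF mc])
    apply (unfold_locales)
    subgoal using zeta_Hom unfolding mirror_simps by auto
    subgoal unfolding mirror_simps by (rule zeta_natural)
    subgoal using mJ unfolding mirror_simps(13,14,22-24) .
    subgoal using cI unfolding mirror_simps(13,14,22-24) .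
    subgoal premises prems for A B C E F G
    proof -
      have o: "A \<in> Obj D" "B \<in> Obj D" "C \<in> Obj D" "E \<in> Obj D" "F \<in> Obj D" "G \<in> Obj D"
        using prems by (auto simp: mirror_simps)
      note [simp] = o
      let ?a = "a\<^sub>c (G \<bullet> F) (E \<bullet> C) (B \<bullet> A)" and ?b = "a\<^sub>c G E B \<bullet> a\<^sub>c F C A"
      have "inv ?b \<cdot> (\<zeta> G F (E \<odot> B) (C \<odot> A) \<cdot> ((G \<bullet> F) \<odot> \<zeta> E C B A) \<cdot> ?a) \<cdot> inv ?a =
        inv ?b \<cdot> (?b \<cdot> \<zeta> (G \<odot> E) (F \<odot> C) B A \<cdot> (\<zeta> G F E C \<odot> (B \<bullet> A))) \<cdot> inv ?a"
        by (subst zeta_assoc_circ) simp_all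
      then show ?thesis unfolding mirror_simps by simp
    qed
    subgoal premises prems for A B C E F G
    proof -
      have o: "A \<in> Obj D" "B \<in> Obj D" "C \<in> Obj D" "E \<in> Obj D" "F \<in> Obj D" "G \<in> Obj D"
        using prems by (auto simp: mirror_simps)
      note [simp] = o
      let ?a = "a\<^sub>b G F E \<odot> a\<^sub>b C B A" and ?b = "a\<^sub>b (G \<odot> C) (F \<odot> B) (E \<odot> A)"
      have "inv ?b \<cdot> (((G \<odot> C) \<bullet> \<zeta> F E B A) \<cdot> \<zeta> G (F \<bullet> E) C (B \<bullet> A) \<cdot> ?a) \<cdot> inv ?a =
        inv ?b \<cdot> (?b \<cdot> (\<zeta> G F C B \<bullet> (E \<odot> A)) \<cdot> \<zeta> (G \<bullet> F) E (C \<bullet> B) A) \<cdot> inv ?a"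
        by (subst zeta_assoc_bull) simp_all
      then show ?thesis unfolding mirror_simps by simp
    qed
    subgoal using zeta_runit_circ unfolding mirror_simps by auto
    subgoal using zeta_lunit_circ unfolding mirror_simps by auto
    subgoal using zeta_runit_bull unfolding mirror_simps by auto
    subgoal using zeta_lunit_bull unfolding mirror_simps by auto
    done
qed

end

context semi_reversion
begin

text \<open>The pairs exchanged are \<open>R1\<close> and \<open>R3\<close>, \<open>R2\<close> and
  \<open>R4\<close>, \<open>R6\<close> and \<open>R7\<close>, \<open>R8\<close> and
  \<open>R9\<close>, \<open>R13\<close> and \<open>R14\<close>; \<open>R5\<close> is its own mirror
  image. Where an associator falls on the wrong side, both sides are composed with an inverse
  associator.\<close>

lemma semi_reversion_mirror: "semi_reversion (mirror D) (mirror_rev R)"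
proof -
  interpret m: duoidal_category "mirror D" by (rule duoidal_mirror)
  show ?thesis
    apply unfold_locales
    apply (unfold mirror_simps mirror_rev_simps)
    subgoal using rv_endofunctor unfolding is_endofunctor_def mirror_simps .
    subgoal by (rule phi_c0_Hom)
    subgoal by (rule phi_c_Hom)
    subgoal by (rule phi_b_Hom)
    subgoal by (rule phi_c_unit_right)
    subgoal by (rule phi_c_unit_left)
    subgoal by (rule delta_Hom) auto
    subgoal by (rule delta_natural)
    subgoal by (rule gamma_Hom) auto
    subgoal by (rule gamma_natural)
    subgoal premises prems for X Y Z T U V
    proof -
      have [simp]: "X \<in> Obj D" "Y \<in> Obj D" "Z \<in> Obj D" "T \<in> Obj D" "U \<in> Obj D" "V \<in> Obj D" using prems by auto
      let ?P = "(inv (a\<^sub>c V T Y) \<bullet> (U \<odot> Z)) \<odot> X"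
      show ?thesis using arg_cong[OF R3[of V U T Z Y X], of "\<lambda>z. ?P \<cdot> z"] by simp
    qed
    subgoal premises prems for X Y Z T U V
    proof -
      have [simp]: "X \<in> Obj D" "Y \<in> Obj D" "Z \<in> Obj D" "T \<in> Obj D" "U \<in> Obj D" "V \<in> Obj D" using prems by auto
      show ?thesis by (rule R4) simp
    qed
    subgoal premises prems for X Y Z T U V
    proof -
      have [simp]: "X \<in> Obj D" "Y \<in> Obj D" "Z \<in> Obj D" "T \<in> Obj D" "U \<in> Obj D" "V \<in> Obj D" using prems by auto
      let ?P = "V \<odot> ((T \<odot> Y) \<bullet> inv (a\<^sub>c U Z X))"
      show ?thesis using arg_cong[OF R1[of V U T Z Y X], of "\<lambda>z. ?P \<cdot> z"] by simp
    qed
    subgoal premises prems for X Y Z T U V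
    proof -
      have [simp]: "X \<in> Obj D" "Y \<in> Obj D" "Z \<in> Obj D" "T \<in> Obj D" "U \<in> Obj D" "V \<in> Obj D" using prems by auto
      show ?thesis using R2[of V U T Z Y X] by simp
    qed
    subgoal premises prems for X Y Z T U V
    proof -
      have [simp]: "X \<in> Obj D" "Y \<in> Obj D" "Z \<in> Obj D" "T \<in> Obj D" "U \<in> Obj D" "V \<in> Obj D" using prems by auto
      let ?P = "inv (a\<^sub>b V ((U \<bullet> T\<^sup>-) \<odot> (Z\<^sup>- \<bullet> Y)) X)"
      show ?thesis using arg_cong[OF R5[of V U T Z Y X], of "\<lambda>z. z \<cdot> ?P"] by simp
    qed
    subgoal by (rule R7)
    subgoal by (rule R6)
    subgoal premises prems for X Y Z U
    proof -
      have [simp]: "X \<in> Obj D" "Y \<in> Obj D" "Z \<in> Obj D" "U \<in> Obj D" using prems by auto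
      show ?thesis using R9[of U Z Y X] by simp
    qed
    subgoal premises prems for X Y Z U
    proof -
      have [simp]: "X \<in> Obj D" "Y \<in> Obj D" "Z \<in> Obj D" "U \<in> Obj D" using prems by auto
      show ?thesis using R8[of U Z Y X] by simp
    qed
    subgoal premises prems for X Y Z T U V
    proof -
      have [simp]: "X \<in> Obj D" "Y \<in> Obj D" "Z \<in> Obj D" "T \<in> Obj D" "U \<in> Obj D" "V \<in> Obj D" using prems by auto
      let ?P = "inv (a\<^sub>b (V \<odot> Y) (U \<odot> Z) T) \<odot> X"
      show ?thesis using arg_cong[OF R14[of V U T Z Y X], of "\<lambda>z. ?P \<cdot> z"] by simp
    qed
    subgoal premises prems for X Y Z T U V
    proof -
      have [simp]: "X \<in> Obj D" "Y \<in> Obj D" "Z \<in> Obj D" "T \<in> Obj D" "U \<in> Obj D" "V \<in> Obj D" using prems by auto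
      let ?P = "V \<odot> inv (a\<^sub>b Z (T \<odot> Y) (U \<odot> X))"
      show ?thesis using arg_cong[OF R13[of V U T Z Y X], of "\<lambda>z. ?P \<cdot> z"] by simp
    qed
    done
qed

end

text \<open>\<open>\<phi>\<close> and \<open>\<psi>\<close> are mirror images by definition, so
  unfolding suffices.\<close>

lemma right_antipode_mirror:
  "reversion_syntax.right_antipode (mirror D) (mirror_rev R) H S \<longleftrightarrow> reversion_syntax.left_antipode D R H S"
  unfolding reversion_syntax.right_antipode_def reversion_syntax.left_antipode_def
    reversion_syntax.\<phi>_def reversion_syntax.\<psi>_def mirror_simps mirror_rev_simps ..

lemma left_antipode_mirror:
  "reversion_syntax.left_antipode (mirror D) (mirror_rev R) H S \<longleftrightarrow> reversion_syntax.right_antipode D R H S"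
  unfolding reversion_syntax.right_antipode_def reversion_syntax.left_antipode_def
    reversion_syntax.\<phi>_def reversion_syntax.\<psi>_def mirror_simps mirror_rev_simps ..

lemma is_antipode_mirror:
  "reversion_syntax.is_antipode (mirror D) (mirror_rev R) H S \<longleftrightarrow> reversion_syntax.is_antipode D R H S"
  unfolding reversion_syntax.is_antipode_iff right_antipode_mirror left_antipode_mirror by blast

context duoidal_category
begin

lemma comonoid_mirror: "comonoid X \<Longrightarrow> duoidal_syntax.comonoid (mirror D) X"
  unfolding duoidal_syntax.comonoid_def mirror_tensors
  by (rule bull.comonoid_rev) (simp_all add: mirror_simps)

lemma comonoid_mor_mirror: "duoidal_syntax.comonoid_mor (mirror D) X Y f \<longleftrightarrow> comonoid_mor X Y f"
  unfolding duoidal_syntax.comonoid_mor_def mirror_simps ..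

lemma bimonoid_mirror:
  assumes "bimonoid H"
  shows "duoidal_syntax.bimonoid (mirror D) H"
proof -
  have "is_monoid D (circ D) (ob H) (mul H) (one H)"
    using assms unfolding bimonoid_def by blast
  then have "is_monoid (mirror D) (circ (mirror D)) (ob H) (mul H) (one H)"
    unfolding mirror_tensors by (rule circ.monoid_rev) (simp_all add: mirror_simps)
  then show ?thesis
    using comonoid_mirror[OF bimonoid_comonoid[OF assms]] comul_mul[OF assms] counit_mul[OF assms]
      comul_one[OF assms] counit_one[OF assms]
    unfolding duoidal_syntax.bimonoid_def mirror_simps by blast
qed

lemma bimonoid_mor_mirror: "duoidal_syntax.bimonoid_mor (mirror D) X Y f \<longleftrightarrow> bimonoid_mor X Y f"
  unfolding duoidal_syntax.bimonoid_mor_def comonoid_mor_mirror mirror_simps ..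

text \<open>The multiplication \<open>l\<^sub>c I\<close> becomes \<open>r\<^sub>c I\<close>, which
  is the same morphism.\<close>

lemma unit_bimonoid_mirror: "duoidal_syntax.unit_bimonoid (mirror D) = unit_bimonoid"
  unfolding duoidal_syntax.unit_bimonoid_def mirror_simps l_I_eq ..

end

text \<open>In the mirror image, \<open>factor\<close> has \<open>\<pi>\<close> on the left leg;
  cocommutativity of \<open>A\<close> and naturality of \<open>s\<close> bring it back to the right.
  The conditions on \<open>s\<close> are naturality and compatibility with \<open>\<zeta>\<close>,
  with \<open>\<Delta>\<^sub>I\<close> and with the comultiplications of \<open>A\<close> and
  \<open>K\<close>; interchanging the arguments of \<open>s\<close> respects all of them.\<close>

lemma (in split_kernel) split_kernel_mirror:
  "split_kernel (mirror D) (\<lambda>X Y. s Y X) A H K \<pi> \<sigma> k e"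
proof -
  interpret m: duoidal_category "mirror D" by (rule duoidal_mirror)
  have s [simp]: "s X Y \<in> Arr D" "Dom D (s X Y) = X \<bullet> Y" "Cod D (s X Y) = Y \<bullet> X"
    if "X \<in> Obj D" "Y \<in> Obj D" for X Y
    using s_Hom[OF that] by (simp_all add: Hom_def)
  show ?thesis
  proof (unfold_locales, unfold mirror_simps bimonoid_mor_mirror unit_bimonoid_mirror)
    fix f X t
    assume f: "f \<in> Hom D X (ob A)" and t: "t \<in> Hom D X (I \<bullet> ob A)"
      and eq: "(\<pi> \<bullet> ob A) \<cdot> comul A \<cdot> f = (one H \<bullet> ob A) \<cdot> t"
    have [simp]: "f \<in> Arr D" "Dom D f = X" "Cod D f = ob A" "t \<in> Arr D" "Dom D t = X" "Cod D t = I \<bullet> ob A"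
      using f t by (simp_all add: Hom_def)
    have sp: "s (ob H) (ob A) \<cdot> (\<pi> \<bullet> ob A) = (ob A \<bullet> \<pi>) \<cdot> s (ob A) (ob A)"
      "s (ob H) (ob A) \<cdot> (one H \<bullet> ob A) = (ob A \<bullet> one H) \<cdot> s I (ob A)"
      by (rule s_natural; simp add: Hom_def)+
    have "(ob A \<bullet> \<pi>) \<cdot> comul A \<cdot> f = (ob A \<bullet> \<pi>) \<cdot> (s (ob A) (ob A) \<cdot> comul A) \<cdot> f"
      by (simp only: cocommutative_A)
    also have "\<dots> = (s (ob H) (ob A) \<cdot> (\<pi> \<bullet> ob A)) \<cdot> comul A \<cdot> f"
      by (subst sp) simp
    also have "\<dots> = (s (ob H) (ob A) \<cdot> (one H \<bullet> ob A)) \<cdot> t"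
      using eq by simp
    also have "\<dots> = (ob A \<bullet> one H) \<cdot> s I (ob A) \<cdot> t"
      by (subst sp) simp
    finally show "\<exists>h\<in>Hom D X (ob K). k \<cdot> h = f"
      by (rule factor[OF f, rotated]) (simp add: Hom_def)
  next
    fix X Y Z W
    assume "{X, Y, Z, W} \<subseteq> Obj D"
    then show "s (W \<odot> Y) (Z \<odot> X) \<cdot> \<zeta> W Z Y X = \<zeta> Z W X Y \<cdot> (s W Z \<odot> s Y X)"
      by (intro s_zeta) auto
  qed (auto intro: s_natural bimonoid_mirror s_Hom s_Delta_I pi_mor sigma_mor k_mor e_mor pi_sigma pi_k k_monic kk_monic one_monic
      cocommutative_A cocommutative_K)
qed

section \<open>Antipodes of split quotients and of the unit bimonoid\<close>

context semi_reversion
begin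

lemma phi_nat:
  assumes [simp]: "f \<in> Arr D" "g \<in> Arr D" "Cod D f = X" "Cod D g = Y"
  shows "\<phi> X Y \<cdot> (f \<bullet> g\<^sup>-) = (((f \<odot> g) \<bullet> I) \<odot> J) \<cdot> \<phi> (Dom D f) (Dom D g)"
proof -
  have [simp]: "X \<in> Obj D" "Y \<in> Obj D" using assms circ.Cod_Obj by blast+
  have "(I \<odot> inv (r\<^sub>b (Y\<^sup>-))) \<cdot> inv (l\<^sub>c (Y\<^sup>-)) \<cdot> g\<^sup>- =
    (I \<odot> (inv (r\<^sub>b (Y\<^sup>-)) \<cdot> g\<^sup>-)) \<cdot> inv (l\<^sub>c ((Dom D g)\<^sup>-))"
    using circ.Inv_lunit_nat[of "g\<^sup>-" "Y\<^sup>-", symmetric] by simp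
  also have "\<dots> = (I \<odot> (g\<^sup>- \<bullet> J)) \<cdot> (I \<odot> inv (r\<^sub>b ((Dom D g)\<^sup>-))) \<cdot> inv (l\<^sub>c ((Dom D g)\<^sup>-))"
    using bull.Inv_runit_nat[of "g\<^sup>-" "Y\<^sup>-", symmetric] by simp
  finally have "\<phi> X Y \<cdot> (f \<bullet> g\<^sup>-) = \<delta> X I Y J \<cdot> (f \<bullet> ((I \<odot> (g\<^sup>- \<bullet> J)) \<cdot> (I \<odot> inv (r\<^sub>b ((Dom D g)\<^sup>-))) \<cdot> inv (l\<^sub>c ((Dom D g)\<^sup>-))))"
    unfolding \<phi>_def by simp
  also have "\<dots> = (\<delta> X I Y J \<cdot> (f \<bullet> (I \<odot> (g\<^sup>- \<bullet> J)))) \<cdot> (Dom D f \<bullet> ((I \<odot> inv (r\<^sub>b ((Dom D g)\<^sup>-))) \<cdot> inv (l\<^sub>c ((Dom D g)\<^sup>-))))"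
    by simp
  also have "\<dots> = (((f \<odot> g) \<bullet> I) \<odot> J) \<cdot> \<phi> (Dom D f) (Dom D g)"
    by (subst delta_nat) (simp_all add: \<phi>_def)
  finally show ?thesis .
qed

text \<open>Insert \<open>\<pi> \<cdot> \<sigma>\<close> for the identity of \<open>H\<close>, move
  \<open>\<sigma>\<close> through the comultiplication and \<open>\<pi>\<close> through the
  multiplication: the equation for \<open>A\<close> appears in between. So \<open>H\<close> is a
  Hopf monoid as soon as \<open>A\<close> is.\<close>

lemma right_antipode_retract:
  assumes [simp]: "bimonoid A" "bimonoid H" and pi: "bimonoid_mor A H \<pi>" and sigma: "bimonoid_mor H A \<sigma>"
    and ps: "\<pi> \<cdot> \<sigma> = ob H" and S: "right_antipode A S"
  shows "right_antipode H (\<pi>\<^sup>- \<cdot> S \<cdot> \<sigma>)"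
proof -
  note cp = bimonoid_mor_comonoid_mor[OF pi] and cs = bimonoid_mor_comonoid_mor[OF sigma]
  note [simp] = comonoid_mor_simps[OF cp] comonoid_mor_simps[OF cs]
  have S' [simp]: "S \<in> Arr D" "Dom D S = ob A" "Cod D S = (ob A)\<^sup>-"
    and eq: "((mul A \<bullet> I) \<odot> J) \<cdot> \<phi> (ob A) (ob A) \<cdot> (ob A \<bullet> S) \<cdot> comul A =
       ((one A \<bullet> I) \<odot> J) \<cdot> (\<Delta>\<^sub>I \<odot> J) \<cdot> inv (l\<^sub>c J) \<cdot> counit A"
    using S unfolding right_antipode_def Hom_def by blast+
  have "((mul H \<bullet> I) \<odot> J) \<cdot> \<phi> (ob H) (ob H) \<cdot> (ob H \<bullet> (\<pi>\<^sup>- \<cdot> S \<cdot> \<sigma>)) \<cdot> comul H =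
    ((mul H \<bullet> I) \<odot> J) \<cdot> \<phi> (ob H) (ob H) \<cdot> ((\<pi> \<cdot> \<sigma>) \<bullet> (\<pi>\<^sup>- \<cdot> S \<cdot> \<sigma>)) \<cdot> comul H"
    unfolding ps ..
  also have "\<dots> = ((mul H \<bullet> I) \<odot> J) \<cdot> (\<phi> (ob H) (ob H) \<cdot> (\<pi> \<bullet> \<pi>\<^sup>-)) \<cdot> (ob A \<bullet> S) \<cdot> (\<sigma> \<bullet> \<sigma>) \<cdot> comul H"
    by simp
  also have "\<dots> = (((mul H \<cdot> (\<pi> \<odot> \<pi>)) \<bullet> I) \<odot> J) \<cdot> \<phi> (ob A) (ob A) \<cdot> (ob A \<bullet> S) \<cdot> comul A \<cdot> \<sigma>"
    by (subst phi_nat) (simp_all add: comul_mor[OF cs])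
  also have "\<dots> = ((\<pi> \<bullet> I) \<odot> J) \<cdot> (((mul A \<bullet> I) \<odot> J) \<cdot> \<phi> (ob A) (ob A) \<cdot> (ob A \<bullet> S) \<cdot> comul A) \<cdot> \<sigma>"
    by (simp flip: mul_mor[OF pi])
  also have "\<dots> = (((\<pi> \<cdot> one A) \<bullet> I) \<odot> J) \<cdot> (\<Delta>\<^sub>I \<odot> J) \<cdot> inv (l\<^sub>c J) \<cdot> counit A \<cdot> \<sigma>"
    by (subst eq) simp
  finally show ?thesis
    by (simp add: right_antipode_def Hom_def one_mor[OF pi] counit_mor[OF cs])
qed

text \<open>\<open>I\<close> has to be a Hopf monoid to serve as the initial object among
  cocommutative Hopf monoids. The equation comes from \<open>delta_unit\<close> at
  \<open>X = Y = I\<close>.\<close>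

lemma right_antipode_unit: "right_antipode unit_bimonoid \<phi>\<^sub>c\<^sub>0"
proof -
  have rI: "inv (r\<^sub>b I) = (I \<bullet> \<epsilon>\<^sub>I) \<cdot> \<Delta>\<^sub>I"
    using circ.iso_shift[of "r\<^sub>b I" "(I \<bullet> \<epsilon>\<^sub>I) \<cdot> \<Delta>\<^sub>I" I] Delta_I_counit_right by simp
  have rn: "inv (r\<^sub>b (I\<^sup>-)) \<cdot> \<phi>\<^sub>c\<^sub>0 = (I\<^sup>- \<bullet> \<epsilon>\<^sub>I) \<cdot> dl"
    using bull.Inv_runit_nat[of "\<phi>\<^sub>c\<^sub>0" "I\<^sup>-"] by (simp add: rI dl_def)
  have "(I \<odot> inv (r\<^sub>b (I\<^sup>-))) \<cdot> inv (l\<^sub>c (I\<^sup>-)) \<cdot> \<phi>\<^sub>c\<^sub>0 = (I \<odot> ((I\<^sup>- \<bullet> \<epsilon>\<^sub>I) \<cdot> dl)) \<cdot> inv (l\<^sub>c I)"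
    using circ.Inv_lunit_nat[of "\<phi>\<^sub>c\<^sub>0" "I\<^sup>-", symmetric] by (simp add: rn)
  then have "((l\<^sub>c I \<bullet> I) \<odot> J) \<cdot> \<phi> I I \<cdot> (I \<bullet> \<phi>\<^sub>c\<^sub>0) \<cdot> \<Delta>\<^sub>I =
    ((r\<^sub>c I \<bullet> I) \<odot> J) \<cdot> (\<delta> I I I J \<cdot> (I \<bullet> (I \<odot> (I\<^sup>- \<bullet> \<epsilon>\<^sub>I)))) \<cdot> (I \<bullet> (I \<odot> dl)) \<cdot> (I \<bullet> inv (l\<^sub>c I)) \<cdot> \<Delta>\<^sub>I"
    unfolding \<phi>_def by (simp add: l_I_eq)
  also have "\<dots> = ((I \<bullet> I) \<odot> \<epsilon>\<^sub>I) \<cdot> (((r\<^sub>c I \<bullet> I) \<odot> I) \<cdot> \<delta> I I I I \<cdot> (I \<bullet> (I \<odot> dl))) \<cdot> (I \<bullet> inv (l\<^sub>c I)) \<cdot> \<Delta>\<^sub>I"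
    using delta_nat[of I I I "\<epsilon>\<^sub>I"] by simp
  also have "\<dots> = ((I \<bullet> I) \<odot> \<epsilon>\<^sub>I) \<cdot> (inv (r\<^sub>c (I \<bullet> I)) \<cdot> \<Delta>\<^sub>I)"
    by (subst delta_unit) (simp_all add: l_I_eq)
  also have "\<dots> = ((I \<bullet> I) \<odot> \<epsilon>\<^sub>I) \<cdot> ((\<Delta>\<^sub>I \<odot> I) \<cdot> inv (r\<^sub>c I))"
    using circ.Inv_runit_nat[of "\<Delta>\<^sub>I" "I \<bullet> I"] by simp
  also have "\<dots> = (\<Delta>\<^sub>I \<odot> J) \<cdot> ((I \<odot> \<epsilon>\<^sub>I) \<cdot> inv (l\<^sub>c I))"
    by (simp add: l_I_eq)
  also have "\<dots> = (\<Delta>\<^sub>I \<odot> J) \<cdot> inv (l\<^sub>c J) \<cdot> \<epsilon>\<^sub>I"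
    using circ.Inv_lunit_nat[of "\<epsilon>\<^sub>I" J] by simp
  finally show ?thesis
    unfolding right_antipode_def by (simp add: Hom_def)
qed

lemma antipode_retract:
  assumes b: "bimonoid A" "bimonoid H" and m: "bimonoid_mor A H \<pi>" "bimonoid_mor H A \<sigma>"
    and ps: "\<pi> \<cdot> \<sigma> = ob H" and S: "is_antipode A S"
  shows "is_antipode H (\<pi>\<^sup>- \<cdot> S \<cdot> \<sigma>)"
proof -
  interpret m: semi_reversion "mirror D" "mirror_rev R" by (rule semi_reversion_mirror)
  have "reversion_syntax.right_antipode (mirror D) (mirror_rev R) H
    (Comp (mirror D) (rv (mirror_rev R) \<pi>) (Comp (mirror D) S \<sigma>))"
    by (rule m.right_antipode_retract[of A])
      (use assms in \<open>simp_all add: bimonoid_mirror bimonoid_mor_mirror right_antipode_mirror is_antipode_iff mirror_simps\<close>)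
  then show ?thesis
    using right_antipode_retract[OF b m ps] S
    by (simp add: right_antipode_mirror is_antipode_iff mirror_simps mirror_rev_simps)
qed

lemma antipode_unit: "is_antipode unit_bimonoid \<phi>\<^sub>c\<^sub>0"
proof -
  interpret m: semi_reversion "mirror D" "mirror_rev R" by (rule semi_reversion_mirror)
  show ?thesis
    using m.right_antipode_unit right_antipode_unit
    by (simp add: right_antipode_mirror is_antipode_iff mirror_rev_simps unit_bimonoid_mirror)
qed

end

section \<open>Antipodes\<close>

sublocale reversion \<subseteq> semi_reversion
  by (rule semi_reversion)

context reversion
begin

lemma
  assumes "X \<in> Obj D" "Y \<in> Obj D"
  shows psi_t_simps [simp]: "\<psi>\<^sub>t X Y \<in> Arr D" "Dom D (\<psi>\<^sub>t X Y) = X\<^sup>- \<bullet> ((Y \<bullet> I) \<odot> J)" "Cod D (\<psi>\<^sub>t X Y) = (X \<odot> Y)\<^sup>-"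
    and phi_t_simps [simp]: "\<phi>\<^sub>t X Y \<in> Arr D" "Dom D (\<phi>\<^sub>t X Y) = (J \<odot> (I \<bullet> X)) \<bullet> Y\<^sup>-" "Cod D (\<phi>\<^sub>t X Y) = (X \<odot> Y)\<^sup>-"
proof -
  have [simp]: "\<gamma>\<^sub>t X Y I J \<in> Arr D" "Dom D (\<gamma>\<^sub>t X Y I J) = X\<^sup>- \<bullet> ((Y \<bullet> I) \<odot> J)"
    "Cod D (\<gamma>\<^sub>t X Y I J) = I \<odot> ((X \<odot> Y)\<^sup>- \<bullet> J)"
    "\<delta>\<^sub>t J I X Y \<in> Arr D" "Dom D (\<delta>\<^sub>t J I X Y) = (J \<odot> (I \<bullet> X)) \<bullet> Y\<^sup>-"
    "Cod D (\<delta>\<^sub>t J I X Y) = (J \<bullet> (X \<odot> Y)\<^sup>-) \<odot> I"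
    using gamma_t_Hom[of X Y I J] delta_t_Hom[of J I X Y] assms by (simp_all add: Hom_def)
  show "\<psi>\<^sub>t X Y \<in> Arr D" "Dom D (\<psi>\<^sub>t X Y) = X\<^sup>- \<bullet> ((Y \<bullet> I) \<odot> J)" "Cod D (\<psi>\<^sub>t X Y) = (X \<odot> Y)\<^sup>-"
    "\<phi>\<^sub>t X Y \<in> Arr D" "Dom D (\<phi>\<^sub>t X Y) = (J \<odot> (I \<bullet> X)) \<bullet> Y\<^sup>-" "Cod D (\<phi>\<^sub>t X Y) = (X \<odot> Y)\<^sup>-"
    using assms by (simp_all add: \<psi>\<^sub>t_def \<phi>\<^sub>t_def)
qed

lemma psi_t_nat:
  assumes [simp]: "Y \<in> Obj D" "f \<in> Arr D" "Cod D f = Z"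
  shows "\<psi>\<^sub>t Y Z \<cdot> (Y\<^sup>- \<bullet> ((f \<bullet> I) \<odot> J)) = (Y \<odot> f)\<^sup>- \<cdot> \<psi>\<^sub>t Y (Dom D f)"
proof -
  have [simp]: "Z \<in> Obj D" using assms circ.Cod_Obj by blast
  let ?g = "(Y \<odot> f)\<^sup>-" let ?W = "(Y \<odot> Dom D f)\<^sup>-"
  have [simp]: "\<gamma>\<^sub>t Y X I J \<in> Arr D" "Dom D (\<gamma>\<^sub>t Y X I J) = Y\<^sup>- \<bullet> ((X \<bullet> I) \<odot> J)"
    "Cod D (\<gamma>\<^sub>t Y X I J) = I \<odot> ((Y \<odot> X)\<^sup>- \<bullet> J)" if "X \<in> Obj D" for X
    using gamma_t_Hom[of Y X I J] that by (simp_all add: Hom_def)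
  have "\<psi>\<^sub>t Y Z \<cdot> (Y\<^sup>- \<bullet> ((f \<bullet> I) \<odot> J)) = l\<^sub>c ((Y \<odot> Z)\<^sup>-) \<cdot> (I \<odot> r\<^sub>b ((Y \<odot> Z)\<^sup>-)) \<cdot> (\<gamma>\<^sub>t Y Z I J \<cdot> (Y\<^sup>- \<bullet> ((f \<bullet> I) \<odot> J)))"
    unfolding \<psi>\<^sub>t_def by simp
  also have "\<dots> = l\<^sub>c ((Y \<odot> Z)\<^sup>-) \<cdot> (I \<odot> (r\<^sub>b ((Y \<odot> Z)\<^sup>-) \<cdot> (?g \<bullet> J))) \<cdot> \<gamma>\<^sub>t Y (Dom D f) I J"
    by (subst gamma_t_natural[of Y Y Y f "Dom D f" Z I I I J J J]) (simp_all add: Hom_def)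
  also have "\<dots> = (l\<^sub>c ((Y \<odot> Z)\<^sup>-) \<cdot> (I \<odot> ?g)) \<cdot> (I \<odot> r\<^sub>b ?W) \<cdot> \<gamma>\<^sub>t Y (Dom D f) I J"
    by (subst bull.runit_nat) simp_all
  also have "\<dots> = ?g \<cdot> \<psi>\<^sub>t Y (Dom D f)"
    by (subst circ.lunit_nat) (simp_all add: \<psi>\<^sub>t_def)
  finally show ?thesis .
qed

lemma phi_t_nat:
  assumes [simp]: "Y \<in> Obj D" "f \<in> Arr D" "Cod D f = Z"
  shows "\<phi>\<^sub>t Z Y \<cdot> ((J \<odot> (I \<bullet> f)) \<bullet> Y\<^sup>-) = (f \<odot> Y)\<^sup>- \<cdot> \<phi>\<^sub>t (Dom D f) Y"
proof -
  have [simp]: "Z \<in> Obj D" using assms circ.Cod_Obj by blast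
  let ?g = "(f \<odot> Y)\<^sup>-" let ?W = "(Dom D f \<odot> Y)\<^sup>-"
  have [simp]: "\<delta>\<^sub>t J I X Y \<in> Arr D" "Dom D (\<delta>\<^sub>t J I X Y) = (J \<odot> (I \<bullet> X)) \<bullet> Y\<^sup>-"
    "Cod D (\<delta>\<^sub>t J I X Y) = (J \<bullet> (X \<odot> Y)\<^sup>-) \<odot> I" if "X \<in> Obj D" for X
    using delta_t_Hom[of J I X Y] that by (simp_all add: Hom_def)
  have "\<phi>\<^sub>t Z Y \<cdot> ((J \<odot> (I \<bullet> f)) \<bullet> Y\<^sup>-) = r\<^sub>c ((Z \<odot> Y)\<^sup>-) \<cdot> (l\<^sub>b ((Z \<odot> Y)\<^sup>-) \<odot> I) \<cdot> (\<delta>\<^sub>t J I Z Y \<cdot> ((J \<odot> (I \<bullet> f)) \<bullet> Y\<^sup>-))"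
    unfolding \<phi>\<^sub>t_def by simp
  also have "\<dots> = r\<^sub>c ((Z \<odot> Y)\<^sup>-) \<cdot> ((l\<^sub>b ((Z \<odot> Y)\<^sup>-) \<cdot> (J \<bullet> ?g)) \<odot> I) \<cdot> \<delta>\<^sub>t J I (Dom D f) Y"
    by (subst delta_t_natural[of J J J I I I f "Dom D f" Z Y Y Y]) (simp_all add: Hom_def)
  also have "\<dots> = (r\<^sub>c ((Z \<odot> Y)\<^sup>-) \<cdot> (?g \<odot> I)) \<cdot> (l\<^sub>b ?W \<odot> I) \<cdot> \<delta>\<^sub>t J I (Dom D f) Y"
    by (subst bull.lunit_nat) simp_all
  also have "\<dots> = ?g \<cdot> \<phi>\<^sub>t (Dom D f) Y"
    by (subst circ.runit_nat) (simp_all add: \<phi>\<^sub>t_def)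
  finally show ?thesis .
qed

text \<open>The argument that a left and a right inverse for convolution agree. The triple product
  of \<open>S\<close>, the identity and \<open>T\<close> is written out in both bracketings;
  \<open>R10\<close> plays the role of associativity, \<open>R11\<close> and \<open>R12\<close> that
  of the unit laws.\<close>

lemma left_right_antipode_unique:
  assumes [simp]: "bimonoid H" and L: "left_antipode H S" and R: "right_antipode H T"
  shows "S = T"
proof -
  let ?A = "ob H" let ?B = "?A\<^sup>-" let ?m = "mul H" let ?u = "one H" let ?D = "comul H" let ?e = "counit H"
  have [simp]: "S \<in> Arr D" "Dom D S = ?A" "Cod D S = ?B"
    and Leq: "(J \<odot> (I \<bullet> ?m)) \<cdot> \<psi> ?A ?A \<cdot> (S \<bullet> ?A) \<cdot> ?D = (J \<odot> (I \<bullet> ?u)) \<cdot> (J \<odot> \<Delta>\<^sub>I) \<cdot> inv (r\<^sub>c J) \<cdot> ?e"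
    using L unfolding left_antipode_def Hom_def by blast+
  have [simp]: "T \<in> Arr D" "Dom D T = ?A" "Cod D T = ?B"
    and Req: "((?m \<bullet> I) \<odot> J) \<cdot> \<phi> ?A ?A \<cdot> (?A \<bullet> T) \<cdot> ?D = ((?u \<bullet> I) \<odot> J) \<cdot> (\<Delta>\<^sub>I \<odot> J) \<cdot> inv (l\<^sub>c J) \<cdot> ?e"
    using R unfolding right_antipode_def Hom_def by blast+
  have R12': "(l\<^sub>c ?A)\<^sup>- \<cdot> \<phi>\<^sub>t I ?A \<cdot> ((J \<odot> \<Delta>\<^sub>I) \<bullet> ?B) = l\<^sub>b ?B \<cdot> (r\<^sub>c J \<bullet> ?B)"
    using R12[of ?A] delta_t_Hom[of J I I ?A] by (simp add: \<phi>\<^sub>t_def Hom_def)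
  have R11': "(r\<^sub>c ?A)\<^sup>- \<cdot> \<psi>\<^sub>t ?A I \<cdot> (?B \<bullet> (\<Delta>\<^sub>I \<odot> J)) = r\<^sub>b ?B \<cdot> (?B \<bullet> l\<^sub>c J)"
    using R11[of ?A] gamma_t_Hom[of ?A I I J] by (simp add: \<psi>\<^sub>t_def Hom_def)
  \<comment> \<open>Product with \<open>S\<close> first: the left antipode equation and
    \<open>R12\<close> leave \<open>T\<close>.\<close>
  have "?m\<^sup>- \<cdot> \<phi>\<^sub>t ?A ?A \<cdot> (((J \<odot> (I \<bullet> ?m)) \<cdot> \<psi> ?A ?A \<cdot> (S \<bullet> ?A) \<cdot> ?D) \<bullet> T) \<cdot> ?D =
    ?m\<^sup>- \<cdot> (\<phi>\<^sub>t ?A ?A \<cdot> ((J \<odot> (I \<bullet> ?u)) \<bullet> ?B)) \<cdot> (((J \<odot> \<Delta>\<^sub>I) \<cdot> inv (r\<^sub>c J) \<cdot> ?e) \<bullet> T) \<cdot> ?D"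
    unfolding Leq by simp
  also have "\<dots> = ((l\<^sub>c ?A)\<^sup>- \<cdot> \<phi>\<^sub>t I ?A \<cdot> ((J \<odot> \<Delta>\<^sub>I) \<bullet> ?B)) \<cdot> ((inv (r\<^sub>c J) \<cdot> ?e) \<bullet> T) \<cdot> ?D"
    by (subst phi_t_nat) (simp_all add: mul_unit_left)
  also have "\<dots> = (l\<^sub>b ?B \<cdot> (J \<bullet> T)) \<cdot> (?e \<bullet> ?A) \<cdot> ?D"
    by (subst R12') simp
  also have "\<dots> = T"
    by (subst bull.lunit_nat) (simp_all add: counit_left)
  finally have 1: "?m\<^sup>- \<cdot> \<phi>\<^sub>t ?A ?A \<cdot> (((J \<odot> (I \<bullet> ?m)) \<cdot> \<psi> ?A ?A \<cdot> (S \<bullet> ?A) \<cdot> ?D) \<bullet> T) \<cdot> ?D = T" .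
  \<comment> \<open>Product with \<open>T\<close> first: the right antipode equation and
    \<open>R11\<close> leave \<open>S\<close>.\<close>
  have "?m\<^sup>- \<cdot> \<psi>\<^sub>t ?A ?A \<cdot> (S \<bullet> (((?m \<bullet> I) \<odot> J) \<cdot> \<phi> ?A ?A \<cdot> (?A \<bullet> T) \<cdot> ?D)) \<cdot> ?D =
    ?m\<^sup>- \<cdot> (\<psi>\<^sub>t ?A ?A \<cdot> (?B \<bullet> ((?u \<bullet> I) \<odot> J))) \<cdot> (S \<bullet> ((\<Delta>\<^sub>I \<odot> J) \<cdot> inv (l\<^sub>c J) \<cdot> ?e)) \<cdot> ?D"
    unfolding Req by simp
  also have "\<dots> = ((r\<^sub>c ?A)\<^sup>- \<cdot> \<psi>\<^sub>t ?A I \<cdot> (?B \<bullet> (\<Delta>\<^sub>I \<odot> J))) \<cdot> (S \<bullet> (inv (l\<^sub>c J) \<cdot> ?e)) \<cdot> ?D"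
    by (subst psi_t_nat) (simp_all add: mul_unit_right)
  also have "\<dots> = (r\<^sub>b ?B \<cdot> (S \<bullet> J)) \<cdot> (?A \<bullet> ?e) \<cdot> ?D"
    by (subst R11') simp
  also have "\<dots> = S"
    by (subst bull.runit_nat) (simp_all add: counit_right)
  finally have 2: "?m\<^sup>- \<cdot> \<psi>\<^sub>t ?A ?A \<cdot> (S \<bullet> (((?m \<bullet> I) \<odot> J) \<cdot> \<phi> ?A ?A \<cdot> (?A \<bullet> T) \<cdot> ?D)) \<cdot> ?D = S" .
  \<comment> \<open>The two bracketings agree by associativity of \<open>mul H\<close>,
    \<open>R10\<close> and coassociativity.\<close>
  have "?m\<^sup>- \<cdot> \<phi>\<^sub>t ?A ?A \<cdot> (((J \<odot> (I \<bullet> ?m)) \<cdot> \<psi> ?A ?A \<cdot> (S \<bullet> ?A) \<cdot> ?D) \<bullet> T) \<cdot> ?D =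
    ?m\<^sup>- \<cdot> (\<phi>\<^sub>t ?A ?A \<cdot> ((J \<odot> (I \<bullet> ?m)) \<bullet> ?B)) \<cdot> (\<psi> ?A ?A \<bullet> ?B) \<cdot> ((S \<bullet> ?A) \<bullet> T) \<cdot> (?D \<bullet> ?A) \<cdot> ?D"
    by simp
  also have "\<dots> = (?m \<cdot> (?m \<odot> ?A))\<^sup>- \<cdot> \<phi>\<^sub>t (?A \<odot> ?A) ?A \<cdot> (\<psi> ?A ?A \<bullet> ?B) \<cdot> ((S \<bullet> ?A) \<bullet> T) \<cdot> (?D \<bullet> ?A) \<cdot> ?D"
    by (subst phi_t_nat) simp_all
  also have "\<dots> = (?m \<cdot> (?A \<odot> ?m))\<^sup>- \<cdot> ((a\<^sub>c ?A ?A ?A)\<^sup>- \<cdot> \<phi>\<^sub>t (?A \<odot> ?A) ?A \<cdot> (\<psi> ?A ?A \<bullet> ?B)) \<cdot> ((S \<bullet> ?A) \<bullet> T) \<cdot> (?D \<bullet> ?A) \<cdot> ?D"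
    by (subst mul_assoc) simp_all
  also have "\<dots> = (?m \<cdot> (?A \<odot> ?m))\<^sup>- \<cdot> \<psi>\<^sub>t ?A (?A \<odot> ?A) \<cdot> (?B \<bullet> \<phi> ?A ?A) \<cdot> (a\<^sub>b ?B ?A ?B \<cdot> ((S \<bullet> ?A) \<bullet> T)) \<cdot> (?D \<bullet> ?A) \<cdot> ?D"
    by (subst R10) simp_all
  also have "\<dots> = (?m \<cdot> (?A \<odot> ?m))\<^sup>- \<cdot> \<psi>\<^sub>t ?A (?A \<odot> ?A) \<cdot> (?B \<bullet> \<phi> ?A ?A) \<cdot> (S \<bullet> (?A \<bullet> T)) \<cdot> (a\<^sub>b ?A ?A ?A \<cdot> (?D \<bullet> ?A) \<cdot> ?D)"
    by (subst bull.assoc_nat) simp_all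
  also have "\<dots> = ?m\<^sup>- \<cdot> ((?A \<odot> ?m)\<^sup>- \<cdot> \<psi>\<^sub>t ?A (?A \<odot> ?A)) \<cdot> (?B \<bullet> \<phi> ?A ?A) \<cdot> (S \<bullet> (?A \<bullet> T)) \<cdot> (?A \<bullet> ?D) \<cdot> ?D"
    by (subst coassoc) simp_all
  also have "\<dots> = ?m\<^sup>- \<cdot> (\<psi>\<^sub>t ?A ?A \<cdot> (?B \<bullet> ((?m \<bullet> I) \<odot> J))) \<cdot> (?B \<bullet> \<phi> ?A ?A) \<cdot> (S \<bullet> (?A \<bullet> T)) \<cdot> (?A \<bullet> ?D) \<cdot> ?D"
    by (subst psi_t_nat) simp_all
  also have "\<dots> = ?m\<^sup>- \<cdot> \<psi>\<^sub>t ?A ?A \<cdot> (S \<bullet> (((?m \<bullet> I) \<odot> J) \<cdot> \<phi> ?A ?A \<cdot> (?A \<bullet> T) \<cdot> ?D)) \<cdot> ?D"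
    by simp
  finally show ?thesis unfolding 1 2 ..
qed

lemma kernel_antipode:
  assumes sk: "split_kernel D s A H K \<pi> \<sigma> k e" and SA: "is_antipode A SA"
  shows "\<exists>S. is_antipode K S"
proof -
  interpret split_kernel D s A H K \<pi> \<sigma> k e by (rule sk)
  \<comment> \<open>The Galois maps need an antipode of \<open>H\<close>; it is inherited from
    \<open>A\<close> along the splitting.\<close>
  have SH: "is_antipode H (\<pi>\<^sup>- \<cdot> SA \<cdot> \<sigma>)"
    by (rule antipode_retract[OF bimonoid_A bimonoid_H pi_mor sigma_mor pi_sigma SA])
  interpret h: hopf_split_kernel D s A H K \<pi> \<sigma> k e R "\<pi>\<^sup>- \<cdot> SA \<cdot> \<sigma>"
    by unfold_locales (rule SH)
  interpret m: split_kernel "mirror D" "\<lambda>X Y. s Y X" A H K \<pi> \<sigma> k e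
    by (rule split_kernel_mirror)
  interpret m: semi_reversion "mirror D" "mirror_rev R" by (rule semi_reversion_mirror)
  interpret m: hopf_split_kernel "mirror D" "\<lambda>X Y. s Y X" A H K \<pi> \<sigma> k e "mirror_rev R" "\<pi>\<^sup>- \<cdot> SA \<cdot> \<sigma>"
    by unfold_locales (simp add: is_antipode_mirror SH)
  obtain T where T: "right_antipode K T"
    using h.kernel_right_antipode SA unfolding is_antipode_iff by blast
  obtain S where "reversion_syntax.right_antipode (mirror D) (mirror_rev R) K S"
    using m.kernel_right_antipode SA unfolding is_antipode_iff right_antipode_mirror by blast
  then have S: "left_antipode K S" by (simp add: right_antipode_mirror)
  have "S = T" by (rule left_right_antipode_unique[OF bimonoid_K S T])
  then show ?thesis using S T by (auto simp: is_antipode_iff)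
qed

end

section \<open>Categories of comonoids and bimonoids\<close>

lemma structure_cat_simps:
  "Arr (structure_cat C U M) = M" "Dom (structure_cat C U M) (X, f, Y) = (X, U X, X)"
  "Cod (structure_cat C U M) (X, f, Y) = (Y, U Y, Y)"
  "Comp (structure_cat C U M) (Y', g, Z) (X, f, Y) = (X, Comp C g f, Z)"
  by (simp_all add: structure_cat_def)

lemma structure_cat_Hom:
  "t \<in> Hom (structure_cat C U M) T (Y, y, Y') \<longleftrightarrow>
    (\<exists>X f. t = (X, f, Y) \<and> T = (X, U X, X) \<and> (X, f, Y) \<in> M \<and> y = U Y \<and> Y' = Y)"
  by (cases t) (auto simp: Hom_def structure_cat_simps)

text \<open>Strips the source and target tags from the arrows, so that the universal property has to
  be checked for underlying morphisms.\<close>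

lemma structure_cat_pullback:
  assumes "(A, f, Z) \<in> M" "(B, g, Z) \<in> M" "(P, p, A) \<in> M" "(P, q, B) \<in> M" "Comp C f p = Comp C g q"
    and "\<And>X p' q'. (X, p', A) \<in> M \<Longrightarrow> (X, q', B) \<in> M \<Longrightarrow> Comp C f p' = Comp C g q' \<Longrightarrow>
      \<exists>!h. (X, h, P) \<in> M \<and> Comp C p h = p' \<and> Comp C q h = q'"
  shows "is_pullback (structure_cat C U M) (P, p, A) (P, q, B) (A, f, Z) (B, g, Z)"
proof -
  have "\<exists>!h. h \<in> Hom (structure_cat C U M) X (P, U P, P) \<and>
      Comp (structure_cat C U M) (P, p, A) h = p' \<and> Comp (structure_cat C U M) (P, q, B) h = q'"
    if p': "p' \<in> Hom (structure_cat C U M) X (A, U A, A)" and q': "q' \<in> Hom (structure_cat C U M) X (B, U B, B)"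
      and eq: "Comp (structure_cat C U M) (A, f, Z) p' = Comp (structure_cat C U M) (B, g, Z) q'" for X p' q'
  proof -
    obtain Y x y where [simp]: "p' = (Y, x, A)" "q' = (Y, y, B)" "X = (Y, U Y, Y)" and m: "(Y, x, A) \<in> M" "(Y, y, B) \<in> M"
      using p' q' by (auto simp: structure_cat_Hom)
    have "\<exists>!h. (Y, h, P) \<in> M \<and> Comp C p h = x \<and> Comp C q h = y"
      using assms(6)[OF m] eq by (simp add: structure_cat_simps)
    then obtain h where h: "(Y, h, P) \<in> M" "Comp C p h = x" "Comp C q h = y"
      and u: "\<And>h'. (Y, h', P) \<in> M \<Longrightarrow> Comp C p h' = x \<Longrightarrow> Comp C q h' = y \<Longrightarrow> h' = h"
      by blast
    show ?thesis
    proof (rule ex1I[of _ "(Y, h, P)"])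
      show "h' = (Y, h, P)" if "h' \<in> Hom (structure_cat C U M) X (P, U P, P) \<and>
        Comp (structure_cat C U M) (P, p, A) h' = p' \<and> Comp (structure_cat C U M) (P, q, B) h' = q'" for h'
        using that u by (auto simp: structure_cat_Hom structure_cat_simps)
    qed (use h in \<open>auto simp: structure_cat_Hom structure_cat_simps\<close>)
  qed
  then show ?thesis
    using assms(1-5) by (auto simp: is_pullback_def structure_cat_Hom structure_cat_simps)
qed

lemma structure_cat_initial:
  assumes "(Z, U Z, Z) \<in> M" and "\<And>X. (X, U X, X) \<in> M \<Longrightarrow> \<exists>!f. (Z, f, X) \<in> M"
  shows "is_initial (structure_cat C U M) (Z, U Z, Z)"
  unfolding is_initial_def
proof (intro conjI ballI)
  show "(Z, U Z, Z) \<in> Obj (structure_cat C U M)"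
    using assms(1) by (simp add: Obj_def structure_cat_simps)
  fix T assume "T \<in> Obj (structure_cat C U M)"
  then obtain X where X: "T = (X, U X, X)" "(X, U X, X) \<in> M"
    by (cases T) (auto simp: Obj_def structure_cat_simps)
  then obtain f where f: "(Z, f, X) \<in> M" and u: "\<And>f'. (Z, f', X) \<in> M \<Longrightarrow> f' = f"
    using assms(2) by blast
  show "\<exists>!t. t \<in> Hom (structure_cat C U M) (Z, U Z, Z) T"
    unfolding X
  proof (rule ex1I)
    show "(Z, f, X) \<in> Hom (structure_cat C U M) (Z, U Z, Z) (X, U X, X)"
      using f by (simp add: structure_cat_Hom)
    fix t assume "t \<in> Hom (structure_cat C U M) (Z, U Z, Z) (X, U X, X)"
    then obtain f' where "t = (Z, f', X)" "(Z, f', X) \<in> M"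
      by (auto simp: structure_cat_Hom)
    then show "t = (Z, f, X)" using u by blast
  qed
qed

lemma full_subcat_Hom:
  "f \<in> Hom (full_subcat C S) X Y \<longleftrightarrow> f \<in> Hom C X Y \<and> X \<in> S \<and> Y \<in> S"
  by (auto simp: Hom_def full_subcat_def)

lemma full_subcat_pullback:
  assumes P: "is_pullback C p q f g" and S: "Dom C p \<in> S" "Dom C f \<in> S" "Dom C g \<in> S" "Cod C f \<in> S"
  shows "is_pullback (full_subcat C S) p q f g"
proof -
  have s: "Dom (full_subcat C S) = Dom C" "Cod (full_subcat C S) = Cod C" "Comp (full_subcat C S) = Comp C"
    by (simp_all add: full_subcat_def)
  have "f \<in> Arr (full_subcat C S)" "g \<in> Arr (full_subcat C S)"
    using P S by (auto simp: is_pullback_def full_subcat_def)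
  moreover have "\<exists>!h. h \<in> Hom (full_subcat C S) X (Dom C p) \<and> Comp C p h = p' \<and> Comp C q h = q'"
    if p': "p' \<in> Hom (full_subcat C S) X (Dom C f)" and q': "q' \<in> Hom (full_subcat C S) X (Dom C g)"
      and eq: "Comp C f p' = Comp C g q'" for X p' q'
  proof -
    have h: "h \<in> Hom (full_subcat C S) X (Dom C p) \<longleftrightarrow> h \<in> Hom C X (Dom C p)" for h
      using p' S(1) by (simp add: full_subcat_Hom)
    show ?thesis
      unfolding h using P p' q' eq unfolding is_pullback_def full_subcat_Hom by blast
  qed
  ultimately show ?thesis
    using P S unfolding is_pullback_def s by (auto simp: full_subcat_Hom)
qed

lemma full_subcat_initial:
  assumes "is_initial C Z" "Z \<in> S" "Cod C Z = Z"
  shows "is_initial (full_subcat C S) Z"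
proof -
  have "X \<in> Obj (full_subcat C S) \<Longrightarrow> X \<in> Obj C \<and> X \<in> S" for X
    by (auto simp: Obj_def full_subcat_def)
  moreover have "Z \<in> Obj (full_subcat C S)"
    using assms by (auto simp: is_initial_def Obj_def full_subcat_def)
  ultimately show ?thesis
    using assms unfolding is_initial_def full_subcat_Hom by auto
qed

text \<open>Objects of \<open>Comon\<close> are plain comonoid records, so bimonoids enter it
  through \<open>comonoid.truncate\<close>.\<close>

lemma truncate_comonoid [simp]:
  "ob (comonoid.truncate X) = ob X" "comul (comonoid.truncate X) = comul X" "counit (comonoid.truncate X) = counit X"
  by (simp_all add: comonoid.defs)

context duoidal_syntax
begin

lemma comonoid_truncate [simp]: "comonoid (comonoid.truncate X) \<longleftrightarrow> comonoid X"
  by (simp add: comonoid_def)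

lemma comonoid_mor_truncate: "comonoid_mor (comonoid.truncate X) (comonoid.truncate Y) f \<longleftrightarrow> comonoid_mor X Y f"
  by (simp add: comonoid_mor_def)

end

context duoidal_category
begin

lemma bimonoid_mor_id: "bimonoid X \<Longrightarrow> bimonoid_mor X X (ob X)"
  by (simp add: bimonoid_mor_def comonoid_mor_def Hom_def)

text \<open>Preservation of the unit forces a morphism out of \<open>I\<close> to be
  \<open>one X\<close>, since the unit of \<open>unit_bimonoid\<close> is the identity.\<close>

lemma unit_bimonoid_initial: "is_initial Bimon (unit_bimonoid, I, unit_bimonoid)"
  unfolding Bimon_def ob_unit_bimonoid(1)[symmetric]
proof (rule structure_cat_initial; clarify)
  fix X assume X: "bimonoid X"
  show "\<exists>!f. (unit_bimonoid, f, X) \<in> {(X, f, Y). bimonoid X \<and> bimonoid Y \<and> bimonoid_mor X Y f}"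
  proof (rule ex1I[of _ "one X"])
    fix f assume "(unit_bimonoid, f, X) \<in> {(X, f, Y). bimonoid X \<and> bimonoid Y \<and> bimonoid_mor X Y f}"
    then have f: "bimonoid_mor unit_bimonoid X f" by simp
    show "f = one X"
      using one_mor[OF f] comonoid_mor_simps[OF bimonoid_mor_comonoid_mor[OF f]] by simp
  qed (simp add: X unit_bimonoid unit_bimonoid_mor)
qed (use unit_bimonoid bimonoid_mor_id[OF unit_bimonoid] in auto)

end

section \<open>Universal properties of the kernel\<close>

context split_kernel
begin

text \<open>Common core of the universal properties for comonoids and bimonoids. The lift exists by
  \<open>factor\<close>; its compatibility with \<open>e\<close> and with the comultiplications
  follows by cancelling the monomorphisms \<open>one H\<close> and \<open>k \<bullet> k\<close>. The
  source is an object with a morphism \<open>d\<close>, which covers comonoids and bimonoids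
  although their records have different types.\<close>

lemma kernel_factor:
  assumes "f \<in> Hom D X (ob A)" "g \<in> Hom D X I" "d \<in> Hom D X (X \<bullet> X)"
    and d: "comul A \<cdot> f = (f \<bullet> f) \<cdot> d" and eq: "\<pi> \<cdot> f = one H \<cdot> g"
  obtains h where "h \<in> Hom D X (ob K)" "k \<cdot> h = f" "e \<cdot> h = g" "comul K \<cdot> h = (h \<bullet> h) \<cdot> d" "counit K \<cdot> h = counit A \<cdot> f"
proof -
  have [simp]: "f \<in> Arr D" "Dom D f = X" "Cod D f = ob A" "g \<in> Arr D" "Dom D g = X" "Cod D g = I"
    "d \<in> Arr D" "Dom D d = X" "Cod D d = X \<bullet> X"
    using assms by (simp_all add: Hom_def)
  have [simp]: "X \<in> Obj D" using circ.Dom_Obj[of f] by simp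
  have "(ob A \<bullet> \<pi>) \<cdot> comul A \<cdot> f = (ob A \<bullet> one H) \<cdot> (f \<bullet> g) \<cdot> d"
    by (simp add: d eq)
  then obtain h where h: "h \<in> Hom D X (ob K)" and kh: "k \<cdot> h = f"
    using factor[of f X "(f \<bullet> g) \<cdot> d"] assms(1) by (auto simp: Hom_def)
  have [simp]: "h \<in> Arr D" "Dom D h = X" "Cod D h = ob K"
    using h by (simp_all add: Hom_def)
  have "one H \<cdot> e \<cdot> h = one H \<cdot> g"
    by (simp add: circ.comp_rewrite[OF pi_k[symmetric]] kh eq)
  then have "e \<cdot> h = g"
    by (rule circ.monicD[OF one_monic, rotated -1]) simp_all
  moreover have "(k \<bullet> k) \<cdot> comul K \<cdot> h = (k \<bullet> k) \<cdot> (h \<bullet> h) \<cdot> d"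
    by (simp add: circ.comp_rewrite[OF comul_k[symmetric]] kh d)
  then have "comul K \<cdot> h = (h \<bullet> h) \<cdot> d"
    by (rule circ.monicD[OF kk_monic, rotated -1]) simp_all
  moreover have "counit K \<cdot> h = counit A \<cdot> f"
    by (simp flip: kh add: circ.comp_rewrite[OF counit_k])
  ultimately show ?thesis using that h kh by blast
qed

lemma kernel_unique:
  assumes "comonoid_mor X K h" "comonoid_mor X K h'" "k \<cdot> h = k \<cdot> h'"
  shows "h = h'"
  by (rule circ.monicD[OF k_monic, rotated -1])
    (use comonoid_mor_simps[OF assms(1)] comonoid_mor_simps[OF assms(2)] assms(3) in simp_all)

lemma kernel_comonoid_factor:
  assumes X: "comonoid X" and f: "comonoid_mor X A f" and g: "comonoid_mor X unit_bimonoid g"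
    and eq: "\<pi> \<cdot> f = one H \<cdot> g"
  obtains h where "comonoid_mor X K h" "k \<cdot> h = f" "e \<cdot> h = g"
proof -
  obtain h where "h \<in> Hom D (ob X) (ob K)" "k \<cdot> h = f" "e \<cdot> h = g" "comul K \<cdot> h = (h \<bullet> h) \<cdot> comul X"
      "counit K \<cdot> h = counit A \<cdot> f"
  proof (rule kernel_factor[of f "ob X" g "comul X"])
    show "comul A \<cdot> f = (f \<bullet> f) \<cdot> comul X" by (rule comul_mor[OF f])
    show "\<pi> \<cdot> f = one H \<cdot> g" by (rule eq)
  qed (use comonoid_mor_simps[OF f] comonoid_mor_simps[OF g] X in \<open>simp_all add: Hom_def\<close>)
  then show ?thesis
    by (intro that) (simp_all add: comonoid_mor_def counit_mor[OF f])
qed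

lemma kernel_bimonoid_factor:
  assumes [simp]: "bimonoid X" and f: "bimonoid_mor X A f" and g: "bimonoid_mor X unit_bimonoid g"
    and eq: "\<pi> \<cdot> f = one H \<cdot> g"
  obtains h where "bimonoid_mor X K h" "k \<cdot> h = f" "e \<cdot> h = g"
proof -
  obtain h where h: "comonoid_mor X K h" and kh: "k \<cdot> h = f" and eh: "e \<cdot> h = g"
    by (rule kernel_comonoid_factor[of X f g])
      (use f g eq bimonoid_mor_comonoid_mor in auto)
  note [simp] = comonoid_mor_simps[OF h]
  have "k \<cdot> h \<cdot> mul X = f \<cdot> mul X" by (simp add: circ.comp_rewrite[OF kh])
  also have "\<dots> = mul A \<cdot> (k \<odot> k) \<cdot> (h \<odot> h)" by (simp add: mul_mor[OF f] kh)
  also have "\<dots> = k \<cdot> mul K \<cdot> (h \<odot> h)" by (simp add: circ.comp_rewrite[OF mul_mor[OF k_mor]])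
  finally have "h \<cdot> mul X = mul K \<cdot> (h \<odot> h)"
    by (rule circ.monicD[OF k_monic, rotated -1]) simp_all
  moreover have "k \<cdot> h \<cdot> one X = k \<cdot> one K"
    by (simp add: circ.comp_rewrite[OF kh] one_mor[OF f] one_mor[OF k_mor])
  then have "h \<cdot> one X = one K"
    by (rule circ.monicD[OF k_monic, rotated -1]) simp_all
  ultimately show ?thesis using that h kh eh by (auto simp: bimonoid_mor_def)
qed

lemma kernel_pullback_Bimon:
  "is_pullback Bimon (K, k, A) (K, e, unit_bimonoid) (A, \<pi>, H) (unit_bimonoid, one H, H)"
  unfolding Bimon_def
proof (rule structure_cat_pullback)
  fix X f g
  assume "(X, f, A) \<in> {(X, f, Y). bimonoid X \<and> bimonoid Y \<and> bimonoid_mor X Y f}"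
    and "(X, g, unit_bimonoid) \<in> {(X, f, Y). bimonoid X \<and> bimonoid Y \<and> bimonoid_mor X Y f}"
    and "\<pi> \<cdot> f = one H \<cdot> g"
  then obtain h where X: "bimonoid X" and h: "bimonoid_mor X K h" "k \<cdot> h = f" "e \<cdot> h = g"
    using kernel_bimonoid_factor[of X f g] by auto
  show "\<exists>!h. (X, h, K) \<in> {(X, f, Y). bimonoid X \<and> bimonoid Y \<and> bimonoid_mor X Y f} \<and> k \<cdot> h = f \<and> e \<cdot> h = g"
  proof (rule ex1I[of _ h])
    fix h' assume "(X, h', K) \<in> {(X, f, Y). bimonoid X \<and> bimonoid Y \<and> bimonoid_mor X Y f} \<and> k \<cdot> h' = f \<and> e \<cdot> h' = g"
    then show "h' = h"
      using h kernel_unique[of X h' h] bimonoid_mor_comonoid_mor by auto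
  qed (use X h in simp)
qed (use pi_mor k_mor e_mor unit_bimonoid unit_bimonoid_mor pi_k in auto)

lemma kernel_pullback_Comon:
  defines "tr \<equiv> comonoid.truncate"
  shows "is_pullback Comon (tr K, k, tr A) (tr K, e, tr unit_bimonoid) (tr A, \<pi>, tr H) (tr unit_bimonoid, one H, tr H)"
  unfolding Comon_def
proof (rule structure_cat_pullback)
  let ?M = "{(X, f, Y). comonoid X \<and> comonoid Y \<and> comonoid_mor X Y f} :: ('a comonoid \<times> 'a \<times> 'a comonoid) set"
  \<comment> \<open>\<open>comonoid_mor\<close> compares records of one type. Here \<open>X\<close>
    is a plain comonoid and the targets are truncated bimonoids, so the conditions are spelled out
    on the untruncated structure.\<close>
  have t: "comonoid_mor X (tr Y) f \<longleftrightarrow> f \<in> Hom D (ob X) (ob Y) \<and> comul Y \<cdot> f = (f \<bullet> f) \<cdot> comul X \<and> counit Y \<cdot> f = counit X"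
    for X and Y :: "'a bimonoid" and f
    unfolding comonoid_mor_def tr_def by simp
  fix X f g
  assume "(X, f, tr A) \<in> ?M" and "(X, g, tr unit_bimonoid) \<in> ?M" and eq: "\<pi> \<cdot> f = one H \<cdot> g"
  then have X: "comonoid X" and f: "comonoid_mor X (tr A) f" and g: "comonoid_mor X (tr unit_bimonoid) g"
    by auto
  have d: "comul X \<in> Hom D (ob X) (ob X \<bullet> ob X)" using X by (simp add: Hom_def)
  have f': "f \<in> Hom D (ob X) (ob A)" "comul A \<cdot> f = (f \<bullet> f) \<cdot> comul X" "counit A \<cdot> f = counit X"
    using f unfolding t by blast+
  have g': "g \<in> Hom D (ob X) I" using g unfolding t by simp
  obtain h where h: "h \<in> Hom D (ob X) (ob K)" "k \<cdot> h = f" "e \<cdot> h = g" "comul K \<cdot> h = (h \<bullet> h) \<cdot> comul X"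
      "counit K \<cdot> h = counit A \<cdot> f"
    by (rule kernel_factor[OF f'(1) g' d f'(2) eq])
  show "\<exists>!h. (X, h, tr K) \<in> ?M \<and> k \<cdot> h = f \<and> e \<cdot> h = g"
  proof (rule ex1I[of _ h])
    fix h' assume h': "(X, h', tr K) \<in> ?M \<and> k \<cdot> h' = f \<and> e \<cdot> h' = g"
    then have "h' \<in> Hom D (ob X) (ob K)" by (auto simp: t)
    show "h' = h"
      by (rule circ.monicD[OF k_monic, rotated -1])
        (use \<open>h' \<in> Hom D (ob X) (ob K)\<close> h h' in \<open>simp_all add: Hom_def\<close>)
  qed (use X h f' t in \<open>auto simp: tr_def\<close>)
qed (use pi_mor k_mor e_mor unit_bimonoid unit_bimonoid_mor pi_k bimonoid_mor_comonoid_mor in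
    \<open>auto simp: tr_def comonoid_mor_truncate\<close>)

text \<open>A full subcategory containing the four corners of the square inherits the pullback and
  the initial object. One lemma thus serves all bimonoids, the cocommutative ones and the
  cocommutative Hopf monoids.\<close>

lemma kernel_full_subcat:
  assumes "\<And>X. X \<in> {A, H, K, unit_bimonoid} \<Longrightarrow> (X, ob X, X) \<in> S"
  shows "is_pullback (full_subcat Bimon S) (K, k, A) (K, e, unit_bimonoid) (A, \<pi>, H) (unit_bimonoid, one H, H)"
    and "is_kernel (full_subcat Bimon S) (A, \<pi>, H) (K, k, A)"
proof -
  have s: "Dom Bimon (X, f, Y) = (X, ob X, X)" "Cod Bimon (X, f, Y) = (Y, ob Y, Y)" for X f Y
    by (simp_all add: Bimon_def structure_cat_simps)
  show P: "is_pullback (full_subcat Bimon S) (K, k, A) (K, e, unit_bimonoid) (A, \<pi>, H) (unit_bimonoid, one H, H)"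
    by (rule full_subcat_pullback[OF kernel_pullback_Bimon]; unfold s; rule assms; simp)
  have "is_initial (full_subcat Bimon S) (unit_bimonoid, I, unit_bimonoid)"
    by (rule full_subcat_initial[OF unit_bimonoid_initial]) (use assms[of unit_bimonoid] in \<open>simp_all add: s\<close>)
  moreover have "(unit_bimonoid, one H, H) \<in> Hom (full_subcat Bimon S) (unit_bimonoid, I, unit_bimonoid)
      (Cod (full_subcat Bimon S) (A, \<pi>, H))"
    using assms[of H] assms[of unit_bimonoid] unit_bimonoid unit_bimonoid_mor
    by (simp add: Hom_def full_subcat_def Bimon_def structure_cat_simps)
  ultimately show "is_kernel (full_subcat Bimon S) (A, \<pi>, H) (K, k, A)"
    using P unfolding is_kernel_def by blast
qed

lemma kernel_Bimon: "is_kernel Bimon (A, \<pi>, H) (K, k, A)"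
proof -
  have "full_subcat Bimon UNIV = Bimon" by (simp add: full_subcat_def)
  then show ?thesis using kernel_full_subcat(2)[of UNIV] by simp
qed

end

text \<open>Because of the splitting, \<open>comul H\<close> equals
  \<open>(\<pi> \<bullet> \<pi>) \<cdot> comul A \<cdot> \<sigma>\<close>, and the braiding is
  natural.\<close>

lemma (in bull_braided_duoidal_category) cocommutative_split_quotient:
  assumes "bimonoid A" "bimonoid H" and pi: "bimonoid_mor A H \<pi>" and sigma: "bimonoid_mor H A \<sigma>"
    and ps: "\<pi> \<cdot> \<sigma> = ob H" and c: "cocommutative D A"
  shows "cocommutative D H"
proof -
  note cp = bimonoid_mor_comonoid_mor[OF pi] and cs = bimonoid_mor_comonoid_mor[OF sigma]
  note [simp] = comonoid_mor_simps[OF cp] comonoid_mor_simps[OF cs] assms(1,2)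
  have *: "comul H = (\<pi> \<bullet> \<pi>) \<cdot> comul A \<cdot> \<sigma>"
    using circ.comp_rewrite[OF comul_mor[OF cp, symmetric], of \<sigma>] by (simp add: ps)
  have "braid D (ob H) (ob H) \<cdot> comul H = (braid D (ob H) (ob H) \<cdot> (\<pi> \<bullet> \<pi>)) \<cdot> comul A \<cdot> \<sigma>"
    unfolding * by simp
  also have "\<dots> = (\<pi> \<bullet> \<pi>) \<cdot> (braid D (ob A) (ob A) \<cdot> comul A) \<cdot> \<sigma>"
    by (subst braid_nat) simp_all
  also have "\<dots> = comul H"
    using c unfolding cocommutative_def by (simp only: *)
  finally show ?thesis unfolding cocommutative_def .
qed

theorem theorem3p5:
  fixes D :: "'a braided_duoidal"
    and A H :: "'a bimonoid"
    and \<pi> \<sigma> :: 'a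
  assumes "bull_braided_duoidal_category D"
    and "has_binary_intersections D"
    and "bull_preserves_binary_intersections D"
    and "(A, \<pi>, H) \<in> Arr (duoidal_syntax.Bimon D)"
    and "(H, \<sigma>, A) \<in> Arr (duoidal_syntax.Bimon D)"
    and "Comp D \<pi> \<sigma> = ob H"
    and "monic D (one H)"
    and "cocommutative D A"
  shows "\<exists>K k e.
    (let Bim = duoidal_syntax.Bimon D; Com = duoidal_syntax.Comon D;
         E = duoidal_syntax.unit_bimonoid D; tr = comonoid.truncate
     in is_kernel Bim (A, \<pi>, H) (K, k, A) \<and>
        is_pullback Bim (K, k, A) (K, e, E) (A, \<pi>, H) (E, one H, H) \<and>
        is_kernel (Bimon_coc D) (A, \<pi>, H) (K, k, A) \<and>
        is_pullback (Bimon_coc D) (K, k, A) (K, e, E) (A, \<pi>, H) (E, one H, H) \<and>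
        is_pullback Com (tr K, k, tr A) (tr K, e, tr E) (tr A, \<pi>, tr H) (tr E, one H, tr H)) \<and>
    (\<forall>R. reversion D R \<longrightarrow>
       (reversion_syntax.hopf_monoid D R H \<longrightarrow>
          is_iso D (Comp D (mul A) (ten (circ D) k \<sigma>))) \<and>
       (reversion_syntax.hopf_monoid D R A \<longrightarrow>
          reversion_syntax.hopf_monoid D R K \<and>
          is_kernel (Hopf_coc D R) (A, \<pi>, H) (K, k, A)))"
proof -
  interpret bull_braided_duoidal_category D by fact
  have b: "bimonoid A" "bimonoid H" and m: "bimonoid_mor A H \<pi>" "bimonoid_mor H A \<sigma>"
    using assms(4,5) by (simp_all add: Bimon_def structure_cat_simps)
  obtain K k e where sk: "split_kernel D (braid D) A H K \<pi> \<sigma> k e"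
    by (rule split_kernel_exists[OF assms(2,3) b m assms(6,7,8)])
  interpret split_kernel D "braid D" A H K \<pi> \<sigma> k e by (rule sk)
  have bim: "bimonoid X" if "X \<in> {A, H, K, unit_bimonoid}" for X
    using that unit_bimonoid by auto
  \<comment> \<open>All four corners are cocommutative: \<open>H\<close> as a split quotient of
    \<open>A\<close>, \<open>K\<close> by construction, and \<open>I\<close> by compatibility of the
    braiding with \<open>\<Delta>\<^sub>I\<close>.\<close>
  have coc: "cocommutative D X" if "X \<in> {A, H, K, unit_bimonoid}" for X
    using that assms(8) cocommutative_split_quotient[OF b m assms(6,8)] cocommutative_K braid_Delta_I
    by (auto simp: cocommutative_def)
  note coc_kernel = kernel_full_subcat[of "{(H, ob H, H) |H. bimonoid H \<and> cocommutative D H}", folded Bimon_coc_def]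
  have "is_pullback (Bimon_coc D) (K, k, A) (K, e, unit_bimonoid) (A, \<pi>, H) (unit_bimonoid, one H, H)"
    and "is_kernel (Bimon_coc D) (A, \<pi>, H) (K, k, A)"
    by (rule coc_kernel; use bim coc in blast)+
  moreover have "(reversion_syntax.hopf_monoid D R H \<longrightarrow> is_iso D (mul A \<cdot> (k \<odot> \<sigma>))) \<and>
       (reversion_syntax.hopf_monoid D R A \<longrightarrow>
          reversion_syntax.hopf_monoid D R K \<and> is_kernel (Hopf_coc D R) (A, \<pi>, H) (K, k, A))"
    if R: "reversion D R" for R
  proof (intro conjI impI)
    interpret reversion D R by (rule R)
    show "is_iso D (mul A \<cdot> (k \<odot> \<sigma>))" if H: "hopf_monoid H"
    proof -
      obtain S where "is_antipode H S" using H unfolding hopf_monoid_def by blast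
      then interpret hopf_split_kernel D "braid D" A H K \<pi> \<sigma> k e R S by unfold_locales
      show ?thesis by (rule split_iso)
    qed
    assume A: "hopf_monoid A"
    then obtain S where S: "is_antipode A S" unfolding hopf_monoid_def by blast
    \<comment> \<open>All four corners are Hopf monoids, with antipodes from
      \<open>antipode_retract\<close> for \<open>H\<close>, \<open>kernel_antipode\<close> for
      \<open>K\<close> and \<open>antipode_unit\<close> for \<open>I\<close>.\<close>
    have hopf: "hopf_monoid X" if "X \<in> {A, H, K, unit_bimonoid}" for X
      using that A b antipode_retract[OF b m assms(6) S] kernel_antipode[OF sk S] antipode_unit unit_bimonoid by (auto simp: hopf_monoid_def)
    then show "hopf_monoid K" by blast
    show "is_kernel (Hopf_coc D R) (A, \<pi>, H) (K, k, A)"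
      unfolding Hopf_coc_def by (rule kernel_full_subcat; use hopf coc in blast)
  qed
  ultimately show ?thesis
    unfolding Let_def using kernel_Bimon kernel_pullback_Bimon kernel_pullback_Comon by blast
qed

end
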